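(* Let $\varphi$ be an anisotropic quasilinear $p$-form over $F$ of dimension $\geq 2$, let $j$ be an integer with $1 \le j \le \mathfrak{i}_1(\varphi)$, and let $\psi \subset \varphi$ be a subform of codimension $\mathfrak{i}_1(\varphi) - j$. Then $\mathfrak{i}_1(\psi) = j$.
   Context: $p$ is a prime and $F$ is a non-perfect field of characteristic $p$. A quasilinear $p$-form over a field $E$ of characteristic $p$ is a map $\varphi\colon V_\varphi \to E$ on a finite-dimensional $E$-vector space $V_\varphi$ with $\varphi(\lambda v)=\lambda^p\varphi(v)$ and $\varphi(v+w)=\varphi(v)+\varphi(w)$ for all $\lambda\in E$, $v,w\in V_\varphi$ (in coordinates, $a_1x_1^p+\dots+a_nx_n^p$). Its dimension is $\dim V_\varphi$, and $\varphi_L$ denotes its scalar extension to a field $L\supset E$. It is isotropic if $\varphi(v)=0$ for some $v\ne 0$, and anisotropic otherwise. The isotropic vectors form a subspace of $V_\varphi$, whose dimension is the defect index $\mathfrak{i}_0(\varphi)$. A subform $\psi\subset\varphi$ is the restriction of $\varphi$ to a subspace $V_\psi\subset V_\varphi$; its codimension is $\dim(\varphi)-\dim(\psi)$. For an anisotropic quasilinear $p$-form $\varphi$ over $F$ of dimension $\ge 2$, the projective hypersurface $X_\varphi=\{\varphi=0\}\subset\mathbb{P}(V_\varphi)$ is integral, $F(\varphi)$ denotes its function field, and $\mathfrak{i}_1(\varphi):=\mathfrak{i}_0(\varphi_{F(\varphi)})$. *)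

theory Defs
  imports
    "HOL-Computational_Algebra.Primes"
    "HOL-Algebra.Indexed_Polynomials"
    "Jordan_Normal_Form.Missing_VectorSpace"
begin

section \<open>Quasilinear forms\<close>

definition has_characteristic :: "('a, 'm) ring_scheme \<Rightarrow> nat \<Rightarrow> bool" where
  "has_characteristic R p \<longleftrightarrow> (\<forall>n::nat. [n] \<cdot>\<^bsub>R\<^esub> \<one>\<^bsub>R\<^esub> = \<zero>\<^bsub>R\<^esub> \<longleftrightarrow> p dvd n)"

text \<open>Intended for fields of prime characteristic \<open>p\<close>.\<close>

definition perfect_in_char :: "('a, 'm) ring_scheme \<Rightarrow> nat \<Rightarrow> bool" where
  "perfect_in_char R p \<longleftrightarrow> (\<forall>a \<in> carrier R. \<exists>b \<in> carrier R. b [^]\<^bsub>R\<^esub> p = a)"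

locale quasilinear_form = vectorspace E V
  for p :: nat
    and E :: "('a, 'm) ring_scheme"
    and V :: "('a, 'v, 'n) module_scheme"
    and \<phi> :: "'v \<Rightarrow> 'a" +
  assumes prime_char: "Factorial_Ring.prime p" "has_characteristic E p"
    and finite_dimensional: "fin_dim"
    and form_closed: "v \<in> carrier V \<Longrightarrow> \<phi> v \<in> carrier E"
    and form_smult: "\<lbrakk> c \<in> carrier E; v \<in> carrier V \<rbrakk>
           \<Longrightarrow> \<phi> (c \<odot>\<^bsub>V\<^esub> v) = c [^]\<^bsub>E\<^esub> p \<otimes>\<^bsub>E\<^esub> \<phi> v"
    and form_add: "\<lbrakk> v \<in> carrier V; w \<in> carrier V \<rbrakk>
           \<Longrightarrow> \<phi> (v \<oplus>\<^bsub>V\<^esub> w) = \<phi> v \<oplus>\<^bsub>E\<^esub> \<phi> w"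

definition isotropic ::
  "('a, 'm) ring_scheme \<Rightarrow> ('a, 'v, 'n) module_scheme \<Rightarrow> ('v \<Rightarrow> 'a) \<Rightarrow> bool" where
  "isotropic E V \<phi> \<longleftrightarrow> (\<exists>v \<in> carrier V. v \<noteq> \<zero>\<^bsub>V\<^esub> \<and> \<phi> v = \<zero>\<^bsub>E\<^esub>)"

abbreviation anisotropic ::
  "('a, 'm) ring_scheme \<Rightarrow> ('a, 'v, 'n) module_scheme \<Rightarrow> ('v \<Rightarrow> 'a) \<Rightarrow> bool" where
  "anisotropic E V \<phi> \<equiv> \<not> isotropic E V \<phi>"

definition defect_index ::
  "('a, 'm) ring_scheme \<Rightarrow> ('a, 'v, 'n) module_scheme \<Rightarrow> ('v \<Rightarrow> 'a) \<Rightarrow> nat" where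
  "defect_index E V \<phi> =
     vectorspace.dim E (V\<lparr>carrier := {v \<in> carrier V. \<phi> v = \<zero>\<^bsub>E\<^esub>}\<rparr>)"

definition is_subform ::
  "('a, 'm) ring_scheme \<Rightarrow> ('a, 'v, 'n) module_scheme \<Rightarrow> ('v \<Rightarrow> 'a)
     \<Rightarrow> ('a, 'v, 'n) module_scheme \<Rightarrow> ('v \<Rightarrow> 'a) \<Rightarrow> bool" where
  "is_subform E W \<psi> V \<phi> \<longleftrightarrow>
     VectorSpace.subspace E (carrier W) V \<and> W = V\<lparr>carrier := carrier W\<rparr> \<and>
     (\<forall>w \<in> carrier W. \<psi> w = \<phi> w)"

section \<open>Coordinates and scalar extension\<close>

text \<open>
  Scalar extensions and coordinate rings are taken with respect to a chosen basis \<open>B\<close> of the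
  underlying space; a different basis gives isomorphic objects.  The basis vectors themselves
  serve as indices for the coordinates.
\<close>

definition coord_basis :: "('a, 'm) ring_scheme \<Rightarrow> ('a, 'v, 'n) module_scheme \<Rightarrow> 'v set" where
  "coord_basis E V = (SOME B. finite B \<and> vectorspace.basis E V B)"

text \<open>
  The extension of \<open>\<phi>\<close> along a homomorphism \<open>\<iota>\<close> from \<open>E\<close> to \<open>L\<close>.
  The extended space \<open>L \<otimes> V\<close> is identified with the space of functions from \<open>B\<close> to \<open>L\<close>
  (the tensor \<open>1 \<otimes> b\<close> is the indicator function of \<open>b\<close>), and the extended form is
  \<open>\<Sum>\<^sub>b \<phi>(b) x\<^sub>b\<^sup>p\<close>.
\<close>

definition ext_space ::
  "('a, 'm) ring_scheme \<Rightarrow> ('a, 'v, 'n) module_scheme \<Rightarrow> ('l, 'k) ring_scheme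
     \<Rightarrow> ('l, 'v \<Rightarrow> 'l) module" where
  "ext_space E V L = ring.func_space L (coord_basis E V)"

definition ext_form ::
  "nat \<Rightarrow> ('a, 'm) ring_scheme \<Rightarrow> ('a, 'v, 'n) module_scheme \<Rightarrow> ('v \<Rightarrow> 'a)
     \<Rightarrow> ('l, 'k) ring_scheme \<Rightarrow> ('a \<Rightarrow> 'l) \<Rightarrow> ('v \<Rightarrow> 'l) \<Rightarrow> 'l" where
  "ext_form p E V \<phi> L \<iota> x =
     (\<Oplus>\<^bsub>L\<^esub> b \<in> coord_basis E V. \<iota> (\<phi> b) \<otimes>\<^bsub>L\<^esub> x b [^]\<^bsub>L\<^esub> p)"

section \<open>The function field of the hypersurface defined by a form\<close>

subsection \<open>Polynomial rings in a set of variables\<close>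

text \<open>
  \<open>HOL-Algebra.Indexed_Polynomials\<close> provides the set of polynomials in the variables \<open>I\<close>
  (coefficient functions on monomials, which are multisets of variables), addition, constants and
  variables; only the product of two polynomials is missing there.
\<close>

definition mpoly_ring :: "('a, 'm) ring_scheme \<Rightarrow> 'c set \<Rightarrow> ('c multiset \<Rightarrow> 'a) ring" where
  "mpoly_ring R I =
     \<lparr> carrier = ring.indexed_pset R I (carrier R),
       mult = (\<lambda>f g m. \<Oplus>\<^bsub>R\<^esub> k \<in> {k. k \<subseteq># m}. f k \<otimes>\<^bsub>R\<^esub> g (m - k)),
       one = ring.indexed_const R \<one>\<^bsub>R\<^esub>,
       zero = ring.indexed_const R \<zero>\<^bsub>R\<^esub>,
       add = ring.indexed_padd R \<rparr>"

definition homogeneous_mpolys ::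
  "('a, 'm) ring_scheme \<Rightarrow> 'c set \<Rightarrow> nat \<Rightarrow> ('c multiset \<Rightarrow> 'a) set" where
  "homogeneous_mpolys R I d =
     {f \<in> carrier (mpoly_ring R I). \<forall>m. f m \<noteq> \<zero>\<^bsub>R\<^esub> \<longrightarrow> size m = d}"

subsection \<open>Homogeneous fractions of degree zero\<close>

text \<open>
  For a graded domain \<open>S\<close> with graded pieces \<open>G d\<close>: the field of fractions \<open>s/t\<close> with
  \<open>s, t\<close> homogeneous of the same degree and \<open>t \<noteq> 0\<close>.
\<close>

definition hfrac_pairs :: "('s, 'k) ring_scheme \<Rightarrow> (nat \<Rightarrow> 's set) \<Rightarrow> ('s \<times> 's) set" where
  "hfrac_pairs S G = {(s, t). \<exists>d. s \<in> G d \<and> t \<in> G d \<and> t \<noteq> \<zero>\<^bsub>S\<^esub>}"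

definition hfrac_rel ::
  "('s, 'k) ring_scheme \<Rightarrow> (nat \<Rightarrow> 's set) \<Rightarrow> (('s \<times> 's) \<times> ('s \<times> 's)) set" where
  "hfrac_rel S G =
     {((s, t), (s', t')). (s, t) \<in> hfrac_pairs S G \<and> (s', t') \<in> hfrac_pairs S G \<and>
        s \<otimes>\<^bsub>S\<^esub> t' = s' \<otimes>\<^bsub>S\<^esub> t}"

definition hfrac :: "('s, 'k) ring_scheme \<Rightarrow> (nat \<Rightarrow> 's set) \<Rightarrow> 's \<Rightarrow> 's \<Rightarrow> ('s \<times> 's) set" where
  "hfrac S G s t = hfrac_rel S G `` {(s, t)}"

definition hfrac_field ::
  "('s, 'k) ring_scheme \<Rightarrow> (nat \<Rightarrow> 's set) \<Rightarrow> ('s \<times> 's) set ring" where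
  "hfrac_field S G =
     \<lparr> carrier = hfrac_pairs S G // hfrac_rel S G,
       mult = (\<lambda>A C. \<Union>(s, t) \<in> A. \<Union>(s', t') \<in> C. hfrac S G (s \<otimes>\<^bsub>S\<^esub> s') (t \<otimes>\<^bsub>S\<^esub> t')),
       one = hfrac S G \<one>\<^bsub>S\<^esub> \<one>\<^bsub>S\<^esub>,
       zero = hfrac S G \<zero>\<^bsub>S\<^esub> \<one>\<^bsub>S\<^esub>,
       add = (\<lambda>A C. \<Union>(s, t) \<in> A. \<Union>(s', t') \<in> C.
                hfrac S G (s \<otimes>\<^bsub>S\<^esub> t' \<oplus>\<^bsub>S\<^esub> s' \<otimes>\<^bsub>S\<^esub> t) (t \<otimes>\<^bsub>S\<^esub> t')) \<rparr>"

subsection \<open>The function field and the first defect index\<close>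

definition form_mpoly ::
  "nat \<Rightarrow> ('a, 'm) ring_scheme \<Rightarrow> ('a, 'v, 'n) module_scheme \<Rightarrow> ('v \<Rightarrow> 'a)
     \<Rightarrow> 'v multiset \<Rightarrow> 'a" where
  "form_mpoly p F V \<phi> =
     (let B = coord_basis F V; P = mpoly_ring F B in
       \<Oplus>\<^bsub>P\<^esub> b \<in> B. ring.indexed_const F (\<phi> b) \<otimes>\<^bsub>P\<^esub> ring.indexed_var F b [^]\<^bsub>P\<^esub> p)"

definition form_ideal ::
  "nat \<Rightarrow> ('a, 'm) ring_scheme \<Rightarrow> ('a, 'v, 'n) module_scheme \<Rightarrow> ('v \<Rightarrow> 'a)
     \<Rightarrow> ('v multiset \<Rightarrow> 'a) set" where
  "form_ideal p F V \<phi> = PIdl\<^bsub>mpoly_ring F (coord_basis F V)\<^esub> (form_mpoly p F V \<phi>)"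

text \<open>The homogeneous coordinate ring of the hypersurface \<open>\<phi> = 0\<close> in the projective space of \<open>V\<close>.\<close>

definition coord_ring ::
  "nat \<Rightarrow> ('a, 'm) ring_scheme \<Rightarrow> ('a, 'v, 'n) module_scheme \<Rightarrow> ('v \<Rightarrow> 'a)
     \<Rightarrow> ('v multiset \<Rightarrow> 'a) set ring" where
  "coord_ring p F V \<phi> = mpoly_ring F (coord_basis F V) Quot form_ideal p F V \<phi>"

definition coord_class ::
  "nat \<Rightarrow> ('a, 'm) ring_scheme \<Rightarrow> ('a, 'v, 'n) module_scheme \<Rightarrow> ('v \<Rightarrow> 'a)
     \<Rightarrow> ('v multiset \<Rightarrow> 'a) \<Rightarrow> ('v multiset \<Rightarrow> 'a) set" where
  "coord_class p F V \<phi> f = form_ideal p F V \<phi> +>\<^bsub>mpoly_ring F (coord_basis F V)\<^esub> f"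

definition coord_piece ::
  "nat \<Rightarrow> ('a, 'm) ring_scheme \<Rightarrow> ('a, 'v, 'n) module_scheme \<Rightarrow> ('v \<Rightarrow> 'a)
     \<Rightarrow> nat \<Rightarrow> ('v multiset \<Rightarrow> 'a) set set" where
  "coord_piece p F V \<phi> d =
     coord_class p F V \<phi> ` homogeneous_mpolys F (coord_basis F V) d"

type_synonym ('a, 'v) function_field_elem =
  "(('v multiset \<Rightarrow> 'a) set \<times> ('v multiset \<Rightarrow> 'a) set) set"

text \<open>Only meaningful if \<open>\<phi>\<close> is anisotropic of dimension at least 2, so that the coordinate
  ring is a domain.\<close>

definition function_field ::
  "nat \<Rightarrow> ('a, 'm) ring_scheme \<Rightarrow> ('a, 'v, 'n) module_scheme \<Rightarrow> ('v \<Rightarrow> 'a)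
     \<Rightarrow> ('a, 'v) function_field_elem ring" where
  "function_field p F V \<phi> = hfrac_field (coord_ring p F V \<phi>) (coord_piece p F V \<phi>)"

definition function_field_emb ::
  "nat \<Rightarrow> ('a, 'm) ring_scheme \<Rightarrow> ('a, 'v, 'n) module_scheme \<Rightarrow> ('v \<Rightarrow> 'a)
     \<Rightarrow> 'a \<Rightarrow> ('a, 'v) function_field_elem" where
  "function_field_emb p F V \<phi> a =
     hfrac (coord_ring p F V \<phi>) (coord_piece p F V \<phi>)
       (coord_class p F V \<phi> (ring.indexed_const F a)) \<one>\<^bsub>coord_ring p F V \<phi>\<^esub>"

definition first_defect_index ::
  "nat \<Rightarrow> ('a, 'm) ring_scheme \<Rightarrow> ('a, 'v, 'n) module_scheme \<Rightarrow> ('v \<Rightarrow> 'a) \<Rightarrow> nat" where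
  "first_defect_index p F V \<phi> =
     (let K = function_field p F V \<phi> in
       defect_index K (ext_space F V K)
         (ext_form p F V \<phi> K (function_field_emb p F V \<phi>)))"

end

theory Submission
  imports Defs "HOL-Algebra.Finite_Extensions" "HOL-Algebra.Generated_Fields"
begin

text \<open>
  Let \<open>L\<close> be a rational function field over (a copy of) \<open>F\<close> and \<open>k = F\<^sup>p \<subseteq> L\<close>.  Raising coefficients to the
  \<open>p\<close>-th power embeds \<open>F\<close> into \<open>k\<close> and turns the equation \<open>\<Sum> \<phi>(b) x\<^sub>b\<^sup>p = 0\<close> into the \<^emph>\<open>linear\<close>
  equation \<open>\<Sum> \<phi>(b) z\<^sub>b = 0\<close>, in which the \<open>\<phi>(b)\<close> are linearly independent over \<open>k\<close>.  If \<open>z\<close> is a generic solution,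
  the function field of \<open>\<phi>\<close> becomes \<open>N = k(z)\<close>, and the first defect index is \<open>dim \<phi>\<close> minus the rank \<open>r\<close>
  of the \<open>\<phi>(b)\<close> over \<open>N\<close>.

  Take a basis of \<open>V\<close> extending a basis of \<open>W\<close>, a basis \<open>T\<^sub>W\<close> over \<open>N\<close> of the span of the values on \<open>W\<close>, and extend
  it to a basis \<open>T\<close> for the values on \<open>V\<close>.  As \<open>dim W = r + j > r\<close>, solving the equation of \<open>W\<close> for the
  coordinates in \<open>T\<^sub>W\<close> gives a nonzero solution; it generates a field \<open>N\<^sub>1 \<subseteq> N\<close>.  Since \<open>N\<close> has degree \<open>p\<close> over a purely
  transcendental extension of \<open>k\<close>, going up from \<open>k\<close> to \<open>N\<close> costs at most one factor \<open>p\<close> in degrees,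
  and this factor is already lost at \<open>N\<^sub>1\<close>, where the values on \<open>W\<close> are dependent.  Hence independence over \<open>N\<^sub>1\<close>
  persists over \<open>N\<close>, \<open>T\<close> is a basis over \<open>N\<^sub>1\<close> too, and \<open>N\<close> is generated over \<open>N\<^sub>1\<close> by the coordinates outside \<open>W\<close> and \<open>T\<close>.
  Counting monomials with exponents below \<open>q = p\<^sup>t\<close> that are independent over a field containing
  \<open>N\<^sup>q\<close> (a substitute for transcendence degree), one finds that \<open>T \<subseteq> W\<close> and that the solution for \<open>W\<close> is
  generic.  So the first defect index of \<open>\<psi>\<close> is \<open>dim W - r = j\<close>.
\<close>

section \<open>Families over a subfield\<close>

text \<open>All fields involved sit inside one field \<open>L\<close>, so that they can be compared
  by inclusion. Scalars are taken from the copy \<open>k\<close> of the p-th powers, while the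
  values of the form stay in the larger copy of \<open>F\<close>; this avoids extracting p-th roots.
  Anisotropy says that the values on a basis are independent over \<open>k\<close>. In particular
  the ratio of two of them is not in \<open>k\<close>, and for this reason the eliminated coordinate
  of the generic solution is a p-th root outside the rational function field over \<open>k\<close>:
  the origin of the degree \<open>p\<close>. The coordinate ring is not shown to be a domain by
  factoring. Its homogeneous elements are mapped to \<open>L\<close>, and division by the form
  identifies the kernel. The count compares two numbers over a field containing the q-th powers of
  \<open>N\<close>. With n basis vectors, \<open>N\<close> contains p q^(n-2) independent elements;
  if \<open>N\<close> is generated over \<open>k\<close> by s coordinates, one equal to 1 and one
  bound by the relation, it is spanned by at most p q^(s-2) monomials. So s is at least n, and if s
  = n the monomials are independent: no further relation holds, which is genericity for all
  polynomials of degree below q.\<close>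

declare Pi_iff [simp]

text \<open>Indexed families instead of sets: the values of the form are indexed by basis vectors,
  and that different indices give different values is only known once they are independent
  (\<open>fam_indep_inj\<close>). The coefficient set \<open>N\<close> is arbitrary, so that
  independence can first be shown over a subring and then over its fractions.\<close>

definition (in ring) fam_indep :: "'a set \<Rightarrow> 'i set \<Rightarrow> ('i \<Rightarrow> 'a) \<Rightarrow> bool" where
  "fam_indep N I g \<longleftrightarrow> (\<forall>f \<in> I \<rightarrow> N. (\<Oplus>i\<in>I. f i \<otimes> g i) = \<zero> \<longrightarrow> (\<forall>i\<in>I. f i = \<zero>))"

definition (in ring) fam_span :: "'a set \<Rightarrow> 'i set \<Rightarrow> ('i \<Rightarrow> 'a) \<Rightarrow> 'a set" where
  "fam_span N I g = {x. \<exists>f \<in> I \<rightarrow> N. x = (\<Oplus>i\<in>I. f i \<otimes> g i)}"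

section \<open>Subfields and homogeneous linear systems\<close>

context field
begin

lemma subfield_closed:
  assumes "subfield N R"
  shows "N \<subseteq> carrier R" "\<zero> \<in> N" "\<one> \<in> N"
    "\<And>x y. x \<in> N \<Longrightarrow> y \<in> N \<Longrightarrow> x \<oplus> y \<in> N" "\<And>x y. x \<in> N \<Longrightarrow> y \<in> N \<Longrightarrow> x \<otimes> y \<in> N"
    "\<And>x. x \<in> N \<Longrightarrow> \<ominus> x \<in> N" "\<And>x. x \<in> N \<Longrightarrow> x \<noteq> \<zero> \<Longrightarrow> inv x \<in> N"
    "\<And>x. x \<in> N \<Longrightarrow> x \<in> carrier R"
proof -
  have sr: "subring N R" using assms by (rule subfieldE(1))
  show "N \<subseteq> carrier R" using sr by (rule subringE(1))
  then show "\<And>x. x \<in> N \<Longrightarrow> x \<in> carrier R" by auto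
  show "\<zero> \<in> N" "\<one> \<in> N" using sr by (auto intro: subringE(2) subringE(3))
  show "\<And>x y. x \<in> N \<Longrightarrow> y \<in> N \<Longrightarrow> x \<oplus> y \<in> N" using sr by (rule subringE(7))
  show "\<And>x y. x \<in> N \<Longrightarrow> y \<in> N \<Longrightarrow> x \<otimes> y \<in> N" using sr by (rule subringE(6))
  show "\<And>x. x \<in> N \<Longrightarrow> \<ominus> x \<in> N" using sr by (rule subringE(5))
  show "\<And>x. x \<in> N \<Longrightarrow> x \<noteq> \<zero> \<Longrightarrow> inv x \<in> N" using subfield_m_inv(1)[OF assms] by auto
qed

lemma subfield_finsum_closed:
  assumes "subfield N R" "f \<in> I \<rightarrow> N"
  shows "(\<Oplus>i\<in>I. f i) \<in> N"
proof (cases "finite I")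
  case True
  then show ?thesis using assms(2)
  proof (induction I)
    case empty
    then show ?case by (simp add: subfield_closed[OF assms(1)])
  next
    case (insert i I)
    then show ?case by (subst finsum_insert) (auto simp: subfield_closed[OF assms(1)])
  qed
next
  case False
  then show ?thesis by (simp add: subfield_closed[OF assms(1)] finsum_infinite)
qed

lemma subfield_pow_closed:
  assumes "subfield N R" "x \<in> N"
  shows "x [^] (n::nat) \<in> N"
  using assms(2) by (induction n) (auto simp: subfield_closed[OF assms(1)])

lemma subfield_finprod_closed:
  assumes "subfield N R" "f \<in> I \<rightarrow> N"
  shows "(\<Otimes>i\<in>I. f i) \<in> N"
proof (cases "finite I")
  case True
  then show ?thesis using assms(2)
  proof (induction I)
    case empty
    then show ?case by (simp add: subfield_closed[OF assms(1)])
  next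
    case (insert i I)
    then show ?case by (subst finprod_insert) (auto simp: subfield_closed[OF assms(1)])
  qed
next
  case False
  then show ?thesis by (simp add: subfield_closed[OF assms(1)] finprod_infinite)
qed

text \<open>Elimination, one equation at a time: a nonzero coefficient in equation \<open>i0\<close>
  expresses the unknown \<open>j0\<close> by the others, and one equation and one unknown disappear.
  The exchange inequality \<open>fam_indep_card_le\<close> rests on this.\<close>

lemma homogeneous_system:
  assumes N: "subfield N R" and "finite I" "finite J" "card I < card J"
    and "\<And>j i. j \<in> J \<Longrightarrow> i \<in> I \<Longrightarrow> c j i \<in> N"
  shows "\<exists>f \<in> J \<rightarrow> N. (\<exists>j\<in>J. f j \<noteq> \<zero>) \<and> (\<forall>i\<in>I. (\<Oplus>j\<in>J. f j \<otimes> c j i) = \<zero>)"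
  using assms(2-5)
proof (induction I arbitrary: J c rule: finite_induct)
  case empty
  then obtain j where "j \<in> J" by fastforce
  then show ?case by (intro bexI[of _ "\<lambda>_. \<one>"]) (auto simp: subfield_closed[OF N])
next
  case (insert i0 I)
  note sf [simp] = subfield_closed[OF N]
  show ?case
  proof (cases "\<forall>j\<in>J. c j i0 = \<zero>")
    case True
    have "card I < card J" using insert by auto
    then obtain f where f: "f \<in> J \<rightarrow> N" "\<exists>j\<in>J. f j \<noteq> \<zero>"
        "\<forall>i\<in>I. (\<Oplus>j\<in>J. f j \<otimes> c j i) = \<zero>"
      using insert.IH[of J c] insert.prems by auto
    have "(\<Oplus>j\<in>J. f j \<otimes> c j i0) = (\<Oplus>j\<in>J. \<zero>)"
      using True f(1)  by (intro finsum_cong') (auto simp: Pi_iff)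
    then show ?thesis using f by (intro bexI[of _ f]) auto
  next
    case False
    then obtain j0 where j0: "j0 \<in> J" "c j0 i0 \<noteq> \<zero>" by auto
    define J' where "J' = J - {j0}"
    have J': "finite J'" "j0 \<notin> J'" "J = insert j0 J'" "card I < card J'"
      using j0 insert.prems insert.hyps unfolding J'_def by (auto simp: card_Diff_singleton)
    define r where "r j = c j i0 \<otimes> inv (c j0 i0)" for j
    have inv: "inv (c j0 i0) \<in> N" using sf(7)[OF _ j0(2)] insert.prems(3) j0 by auto
    have rN: "r j \<in> N" if "j \<in> J'" for j
      using that J' insert.prems(3) inv  unfolding r_def by auto
    have cN: "c j i \<in> N" if "j \<in> J" "i \<in> insert i0 I" for i j using insert.prems(3) that by auto
    define c' where "c' j i = c j i \<ominus> r j \<otimes> c j0 i" for j i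
    have c'N: "c' j i \<in> N" if "j \<in> J'" "i \<in> insert i0 I" for j i
      unfolding c'_def a_minus_def using that J' rN cN  j0 by auto
    have "\<And>j i. j \<in> J' \<Longrightarrow> i \<in> I \<Longrightarrow> c' j i \<in> N" using c'N by auto
    then obtain f where f: "f \<in> J' \<rightarrow> N" "\<exists>j\<in>J'. f j \<noteq> \<zero>"
        "\<forall>i\<in>I. (\<Oplus>j\<in>J'. f j \<otimes> c' j i) = \<zero>"
      using insert.IH[of J' c'] J' by auto
    define s where "s = (\<Oplus>j\<in>J'. f j \<otimes> r j)"
    have sN: "s \<in> N" unfolding s_def using f rN  by (intro subfield_finsum_closed[OF N]) auto
    \<comment> \<open>The value \<open>\<ominus> s\<close> of the eliminated unknown solves equation
      \<open>i0\<close> whatever the other unknowns are; \<open>c'\<close> is the coefficient matrix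
      after this substitution.\<close>
    define F where "F j = (if j = j0 then \<ominus> s else f j)" for j
    have F: "F \<in> J \<rightarrow> N" using f sN  J' by (auto simp: F_def)
    have key: "(\<Oplus>j\<in>J. F j \<otimes> c j i) = (\<Oplus>j\<in>J'. f j \<otimes> c' j i)" if i: "i \<in> insert i0 I" for i
    proof -
      have C: "c j i \<in> carrier R" if "j \<in> J" for j using cN[OF that i]  by auto
      have fC: "f j \<in> carrier R" "r j \<in> carrier R" if "j \<in> J'" for j using f(1) that rN  by auto
      have "(\<Oplus>j\<in>J. F j \<otimes> c j i) = F j0 \<otimes> c j0 i \<oplus> (\<Oplus>j\<in>J'. F j \<otimes> c j i)"
        unfolding J'(3) using J' C  F by (intro finsum_insert) auto
      also have "(\<Oplus>j\<in>J'. F j \<otimes> c j i) = (\<Oplus>j\<in>J'. f j \<otimes> c j i)"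
        using J' fC C by (intro finsum_cong') (auto simp: F_def)
      also have "F j0 \<otimes> c j0 i = (\<Oplus>j\<in>J'. f j \<otimes> r j \<otimes> (\<ominus> c j0 i))"
      proof -
        have "F j0 \<otimes> c j0 i = s \<otimes> (\<ominus> c j0 i)" using sN  C j0
          by (simp add: F_def l_minus r_minus)
        also have "\<dots> = (\<Oplus>j\<in>J'. f j \<otimes> r j \<otimes> (\<ominus> c j0 i))"
          unfolding s_def using fC C j0 J' by (intro finsum_ldistr) auto
        finally show ?thesis .
      qed
      also have "(\<Oplus>j\<in>J'. f j \<otimes> r j \<otimes> (\<ominus> c j0 i)) \<oplus> (\<Oplus>j\<in>J'. f j \<otimes> c j i)
          = (\<Oplus>j\<in>J'. f j \<otimes> r j \<otimes> (\<ominus> c j0 i) \<oplus> f j \<otimes> c j i)"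
        using fC C j0 J' by (intro finsum_addf[symmetric]) auto
      also have "\<dots> = (\<Oplus>j\<in>J'. f j \<otimes> c' j i)"
      proof (intro finsum_cong')
        fix j assume j: "j \<in> J'"
        show "f j \<otimes> r j \<otimes> (\<ominus> c j0 i) \<oplus> f j \<otimes> c j i = f j \<otimes> c' j i"
          unfolding c'_def a_minus_def using fC[OF j] C[of j] C[of j0] j j0 J'
          by (simp add: r_distr r_minus l_minus m_assoc a_comm)
      qed (use fC c'N i  in auto)
      finally show ?thesis .
    qed
    have c'0: "c' j i0 = \<zero>" if "j \<in> J'" for j
    proof -
      have "c j0 i0 \<in> Units R" using j0 cN[of j0 i0]  by (auto simp: field_Units)
      moreover have "c j i0 \<in> carrier R" using cN[of j i0] that J'  by auto
      ultimately show ?thesis unfolding c'_def r_def by (simp add: m_assoc Units_closed a_minus_def r_neg)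
    qed
    have "(\<Oplus>j\<in>J'. f j \<otimes> c' j i0) = (\<Oplus>j\<in>J'. \<zero>)"
      using c'0 f(1)  by (intro finsum_cong') (auto simp: Pi_iff)
    then have "\<forall>i\<in>insert i0 I. (\<Oplus>j\<in>J. F j \<otimes> c j i) = \<zero>"
      using f(3) key by auto
    moreover have "\<exists>j\<in>J. F j \<noteq> \<zero>" using f(2) J' by (auto simp: F_def)
    ultimately show ?thesis using F by auto
  qed
qed

section \<open>Spans, independence and bases of finite families over a fixed subfield\<close>

context
  fixes N assumes N: "subfield N R"
begin

declare subfield_closed[OF N, simp]

lemma fam_spanI: "f \<in> I \<rightarrow> N \<Longrightarrow> x = (\<Oplus>i\<in>I. f i \<otimes> g i) \<Longrightarrow> x \<in> fam_span N I g"
  unfolding fam_span_def by auto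

lemma fam_span_carrier: "g \<in> I \<rightarrow> carrier R \<Longrightarrow> fam_span N I g \<subseteq> carrier R"
  unfolding fam_span_def by (auto intro!: finsum_closed)

lemma fam_span_zero: "g \<in> I \<rightarrow> carrier R \<Longrightarrow> \<zero> \<in> fam_span N I g"
proof (rule fam_spanI[of "\<lambda>_. \<zero>"])
  assume "g \<in> I \<rightarrow> carrier R"
  then have "(\<Oplus>i\<in>I. \<zero> \<otimes> g i) = (\<Oplus>i\<in>I. \<zero>)" by (intro finsum_cong') auto
  then show "\<zero> = (\<Oplus>i\<in>I. \<zero> \<otimes> g i)" by simp
qed auto

lemma fam_span_add:
  assumes g: "g \<in> I \<rightarrow> carrier R" and "x \<in> fam_span N I g" "y \<in> fam_span N I g"
  shows "x \<oplus> y \<in> fam_span N I g"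
proof -
  obtain f1 f2 where f: "f1 \<in> I \<rightarrow> N" "f2 \<in> I \<rightarrow> N"
      "x = (\<Oplus>i\<in>I. f1 i \<otimes> g i)" "y = (\<Oplus>i\<in>I. f2 i \<otimes> g i)"
    using assms unfolding fam_span_def by auto
  have C: "f1 i \<in> carrier R" "f2 i \<in> carrier R" "g i \<in> carrier R" if "i \<in> I" for i
    using f  g that by auto
  have "x \<oplus> y = (\<Oplus>i\<in>I. f1 i \<otimes> g i \<oplus> f2 i \<otimes> g i)"
    unfolding f using C by (intro finsum_addf[symmetric]) auto
  also have "\<dots> = (\<Oplus>i\<in>I. (f1 i \<oplus> f2 i) \<otimes> g i)"
    using C by (intro finsum_cong') (auto simp: l_distr)
  finally show ?thesis using f  by (intro fam_spanI[of "\<lambda>i. f1 i \<oplus> f2 i"]) auto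
qed

lemma fam_span_smult:
  assumes g: "g \<in> I \<rightarrow> carrier R" and I: "finite I" and "x \<in> fam_span N I g" "c \<in> N"
  shows "c \<otimes> x \<in> fam_span N I g"
proof -
  obtain f1 where f: "f1 \<in> I \<rightarrow> N" "x = (\<Oplus>i\<in>I. f1 i \<otimes> g i)"
    using assms unfolding fam_span_def by auto
  have C: "f1 i \<in> carrier R" "g i \<in> carrier R" if "i \<in> I" for i
    using f  g that by auto
  have c: "c \<in> carrier R" using assms  by auto
  have "c \<otimes> x = (\<Oplus>i\<in>I. c \<otimes> (f1 i \<otimes> g i))"
    unfolding f using C c I by (intro finsum_rdistr) auto
  also have "\<dots> = (\<Oplus>i\<in>I. (c \<otimes> f1 i) \<otimes> g i)"
    using C c by (intro finsum_cong') (auto simp: m_assoc)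
  finally show ?thesis using f  assms by (intro fam_spanI[of "\<lambda>i. c \<otimes> f1 i"]) auto
qed

lemma fam_span_minimal:
  assumes I: "finite I" and S: "\<zero> \<in> S" "S \<subseteq> carrier R" "\<And>x y. x \<in> S \<Longrightarrow> y \<in> S \<Longrightarrow> x \<oplus> y \<in> S"
    "\<And>c x. c \<in> N \<Longrightarrow> x \<in> S \<Longrightarrow> c \<otimes> x \<in> S" and g: "g \<in> I \<rightarrow> S"
  shows "fam_span N I g \<subseteq> S"
proof
  fix x assume "x \<in> fam_span N I g"
  then obtain f where f: "f \<in> I \<rightarrow> N" "x = (\<Oplus>i\<in>I. f i \<otimes> g i)" unfolding fam_span_def by auto
  have "(\<Oplus>i\<in>I. f i \<otimes> g i) \<in> S" using I f(1) g
  proof (induction I)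
    case empty then show ?case using S by simp
  next
    case (insert i I)
    then have "(\<Oplus>j\<in>insert i I. f j \<otimes> g j) = f i \<otimes> g i \<oplus> (\<Oplus>j\<in>I. f j \<otimes> g j)"
      using S(2) subfield_closed(8)[OF N] by (intro finsum_insert) (auto intro!: m_closed)
    then show ?case using insert S by auto
  qed
  then show "x \<in> S" using f by simp
qed

lemma fam_span_mem:
  assumes I: "finite I" and g: "g \<in> I \<rightarrow> carrier R" and i: "i \<in> I"
  shows "g i \<in> fam_span N I g"
proof (rule fam_spanI[of "\<lambda>j. if i = j then \<one> else \<zero>"])
  show "(\<lambda>j. if i = j then \<one> else \<zero>) \<in> I \<rightarrow> N" by auto
  have "(\<Oplus>j\<in>I. (if i = j then \<one> else \<zero>) \<otimes> g j) = (\<Oplus>j\<in>I. if i = j then g j else \<zero>)"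
    using g by (intro finsum_cong') auto
  also have "\<dots> = g i" using finsum_singleton[OF i I g] by simp
  finally show "g i = (\<Oplus>j\<in>I. (if i = j then \<one> else \<zero>) \<otimes> g j)" by simp
qed

lemma fam_span_subset:
  assumes "finite I" "finite J" "g \<in> I \<rightarrow> carrier R" "h \<in> J \<rightarrow> fam_span N I g"
  shows "fam_span N J h \<subseteq> fam_span N I g"
  using assms by (intro fam_span_minimal fam_span_zero fam_span_carrier fam_span_add fam_span_smult) auto

lemma fam_span_mono:
  assumes "finite I" "J \<subseteq> I" "g \<in> I \<rightarrow> carrier R"
  shows "fam_span N J g \<subseteq> fam_span N I g"
  using assms finite_subset[OF assms(2)] by (intro fam_span_subset) (auto intro!: fam_span_mem)

lemma fam_indepD:
  assumes "fam_indep N I g" "f \<in> I \<rightarrow> N" "(\<Oplus>i\<in>I. f i \<otimes> g i) = \<zero>" "i \<in> I"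
  shows "f i = \<zero>"
  using assms unfolding fam_indep_def by auto

lemma fam_indep_subset:
  assumes "fam_indep N I g" "J \<subseteq> I" "finite I" "g \<in> I \<rightarrow> carrier R"
  shows "fam_indep N J g"
  unfolding fam_indep_def
proof (intro ballI impI)
  fix f i assume f: "f \<in> J \<rightarrow> N" "(\<Oplus>i\<in>J. f i \<otimes> g i) = \<zero>" "i \<in> J"
  have C: "f i \<in> carrier R" "g i \<in> carrier R" if "i \<in> J" for i
    using f(1) assms(2,4) that by auto
  define F where "F i = (if i \<in> J then f i else \<zero>)" for i
  have gC: "g i \<in> carrier R" if "i \<in> I" for i using assms(4) that by auto
  have FN: "F i \<in> N" for i using f(1) by (simp add: F_def)
  have "(\<Oplus>i\<in>I. F i \<otimes> g i) = (\<Oplus>i\<in>J. f i \<otimes> g i)"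
  proof (rule add.finprod_mono_neutral_cong_right)
    show "F i \<otimes> g i = \<zero>" if "i \<in> I - J" for i using that gC by (simp add: F_def)
    show "F i \<otimes> g i = f i \<otimes> g i" if "i \<in> J" for i using that by (simp add: F_def)
    show "(\<lambda>i. F i \<otimes> g i) \<in> I \<rightarrow> carrier R" using gC FN by simp
  qed (use assms in auto)
  then have "F i = \<zero>"
    using f(2,3) assms(2) FN by (intro fam_indepD[OF assms(1), of F]) auto
  then show "f i = \<zero>" using f(3) by (simp add: F_def)
qed

lemma fam_indep_subfield:
  assumes "fam_indep N I g" "N' \<subseteq> N"
  shows "fam_indep N' I g"
  using assms unfolding fam_indep_def by (auto simp: Pi_iff subset_iff)

text \<open>With more vectors \<open>h j\<close> than spanning vectors, their coefficients form a
  homogeneous system with more unknowns than equations, and a nonzero solution is a linear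
  dependence.\<close>

lemma fam_indep_card_le:
  assumes "finite I" "finite J" and g: "g \<in> I \<rightarrow> carrier R"
    and h: "h \<in> J \<rightarrow> fam_span N I g" "fam_indep N J h"
  shows "card J \<le> card I"
proof (rule ccontr)
  assume "\<not> card J \<le> card I"
  then have lt: "card I < card J" by simp
  have "\<forall>j\<in>J. \<exists>f. f \<in> I \<rightarrow> N \<and> h j = (\<Oplus>i\<in>I. f i \<otimes> g i)"
    using h(1) unfolding fam_span_def by fastforce
  from bchoice[OF this] obtain c where c: "\<And>j. j \<in> J \<Longrightarrow> c j \<in> I \<rightarrow> N"
      "\<And>j. j \<in> J \<Longrightarrow> h j = (\<Oplus>i\<in>I. c j i \<otimes> g i)" by blast
  have cN: "c j i \<in> N" if "j \<in> J" "i \<in> I" for i j using c(1) that by auto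
  have "\<exists>f \<in> J \<rightarrow> N. (\<exists>j\<in>J. f j \<noteq> \<zero>) \<and> (\<forall>i\<in>I. (\<Oplus>j\<in>J. f j \<otimes> c j i) = \<zero>)"
    by (rule homogeneous_system[OF N assms(1,2) lt]) (rule cN)
  then obtain f where f: "f \<in> J \<rightarrow> N" "\<exists>j\<in>J. f j \<noteq> \<zero>"
      "\<forall>i\<in>I. (\<Oplus>j\<in>J. f j \<otimes> c j i) = \<zero>" by blast
  have gC: "g i \<in> carrier R" if "i \<in> I" for i using g that by auto
  have fC: "f j \<in> carrier R" if "j \<in> J" for j using f(1) that by auto
  have cC: "c j i \<in> carrier R" if "j \<in> J" "i \<in> I" for i j using cN[OF that] by simp
  note C = gC fC cC
  have "(\<Oplus>j\<in>J. f j \<otimes> h j) = (\<Oplus>j\<in>J. \<Oplus>i\<in>I. f j \<otimes> (c j i \<otimes> g i))"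
  proof (intro finsum_cong')
    fix j assume j: "j \<in> J"
    show "f j \<otimes> h j = (\<Oplus>i\<in>I. f j \<otimes> (c j i \<otimes> g i))"
      unfolding c(2)[OF j] by (rule finsum_rdistr) (use C j assms(1) in auto)
  qed (use C in simp_all)
  also have "\<dots> = (\<Oplus>i\<in>I. \<Oplus>j\<in>J. f j \<otimes> (c j i \<otimes> g i))"
    using C assms(1,2) by (intro finsum_finsum_swap) auto
  also have "\<dots> = (\<Oplus>i\<in>I. \<zero>)"
  proof (intro finsum_cong')
    fix i assume i: "i \<in> I"
    have "(\<Oplus>j\<in>J. f j \<otimes> (c j i \<otimes> g i)) = (\<Oplus>j\<in>J. f j \<otimes> c j i \<otimes> g i)"
      using C i by (intro finsum_cong') (auto simp: m_assoc)
    also have "\<dots> = (\<Oplus>j\<in>J. f j \<otimes> c j i) \<otimes> g i"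
      using C i assms(2) by (intro finsum_ldistr[symmetric]) auto
    finally show "(\<Oplus>j\<in>J. f j \<otimes> (c j i \<otimes> g i)) = \<zero>" using f(3) i gC by simp
  qed auto
  finally have "(\<Oplus>j\<in>J. f j \<otimes> h j) = \<zero>" by simp
  then show False using fam_indepD[OF h(2) f(1)] f(2) by blast
qed

lemma fam_indep_insert:
  assumes "finite I" "i0 \<notin> I" "g \<in> insert i0 I \<rightarrow> carrier R" "fam_indep N I g" "g i0 \<notin> fam_span N I g"
  shows "fam_indep N (insert i0 I) g"
  unfolding fam_indep_def
proof (intro ballI impI)
  fix f i assume f: "f \<in> insert i0 I \<rightarrow> N" "(\<Oplus>i\<in>insert i0 I. f i \<otimes> g i) = \<zero>" "i \<in> insert i0 I"
  have C: "f i \<in> carrier R" "g i \<in> carrier R" "f i \<in> N" if "i \<in> insert i0 I" for i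
    using f  assms that by auto
  have eq: "f i0 \<otimes> g i0 \<oplus> (\<Oplus>i\<in>I. f i \<otimes> g i) = \<zero>"
    using f(2) assms C by (subst (asm) finsum_insert) auto
  have SC: "(\<Oplus>i\<in>I. f i \<otimes> g i) \<in> carrier R" using C by (intro finsum_closed) auto
  have "f i0 = \<zero>"
  proof (rule ccontr)
    assume nz: "f i0 \<noteq> \<zero>"
    then have U: "f i0 \<in> Units R" using C by (auto simp: field_Units)
    have i: "inv (f i0) \<in> N" using nz C  by auto
    have "g i0 = inv (f i0) \<otimes> (f i0 \<otimes> g i0)" using U C by (simp add: m_assoc[symmetric])
    also have "f i0 \<otimes> g i0 = \<ominus> (\<Oplus>i\<in>I. f i \<otimes> g i)"
      using eq SC C by (simp add: minus_equality minus_minus)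
    also have "inv (f i0) \<otimes> (\<ominus> (\<Oplus>i\<in>I. f i \<otimes> g i)) = (\<ominus> (inv (f i0))) \<otimes> (\<Oplus>i\<in>I. f i \<otimes> g i)"
      using SC U by (simp add: l_minus r_minus)
    also have "\<dots> \<in> fam_span N I g"
      using assms i  f by (intro fam_span_smult fam_spanI[of f]) auto
    finally show False using assms by simp
  qed
  moreover from this have "\<And>i. i \<in> I \<Longrightarrow> f i = \<zero>"
    using eq SC C assms f by (intro fam_indepD[OF assms(4), of f]) auto
  ultimately show "f i = \<zero>" using f by auto
qed

text \<open>An independent subset of largest cardinality among those containing \<open>T0\<close>
  must span, since otherwise \<open>fam_indep_insert\<close> would enlarge it.\<close>

lemma fam_basis_extend:
  assumes "finite I" "g \<in> I \<rightarrow> carrier R" "T0 \<subseteq> I" "fam_indep N T0 g"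
  obtains T where "T0 \<subseteq> T" "T \<subseteq> I" "fam_indep N T g" "g \<in> I \<rightarrow> fam_span N T g"
proof -
  define P where "P T \<longleftrightarrow> T0 \<subseteq> T \<and> T \<subseteq> I \<and> fam_indep N T g" for T
  have "P T0" using assms unfolding P_def by auto
  moreover have bd: "\<And>T. P T \<Longrightarrow> card T < Suc (card I)"
    using assms(1) unfolding P_def by (auto simp: less_Suc_eq_le intro: card_mono)
  ultimately obtain T where T: "P T" and max: "\<And>T'. P T' \<Longrightarrow> card T' \<le> card T"
    using ex_has_greatest_nat[of P T0 card "Suc (card I)"] by (metis less_imp_le)
  have finT: "finite T" using T assms finite_subset unfolding P_def by auto
  have TI: "T0 \<subseteq> T" "T \<subseteq> I" "fam_indep N T g" using T unfolding P_def by auto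
  have "g i \<in> fam_span N T g" if i: "i \<in> I" for i
  proof (cases "i \<in> T")
    case True then show ?thesis using TI assms finT by (intro fam_span_mem) auto
  next
    case False
    show ?thesis
    proof (rule ccontr)
      assume "g i \<notin> fam_span N T g"
      then have "fam_indep N (insert i T) g"
        using finT False assms TI i by (intro fam_indep_insert) auto
      then have "P (insert i T)" using TI i unfolding P_def by auto
      then show False using max[of "insert i T"] finT False by auto
    qed
  qed
  then show ?thesis using that TI by auto
qed

lemma fam_indep_empty: "fam_indep N {} g"
  unfolding fam_indep_def by auto

text \<open>Equality case of the exchange inequality: a basis extracted from \<open>g\<close>
  already has at least \<open>card J\<close> elements, so nothing was discarded. This is how a count
  of elements becomes a statement of independence.\<close>

lemma fam_span_card_imp_indep:
  assumes "finite I" "finite J" and g: "g \<in> I \<rightarrow> carrier R"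
    and h: "h \<in> J \<rightarrow> fam_span N I g" "fam_indep N J h" and "card I \<le> card J"
  shows "fam_indep N I g"
proof -
  obtain T where T: "T \<subseteq> I" "fam_indep N T g" "g \<in> I \<rightarrow> fam_span N T g"
    using fam_basis_extend[OF assms(1) g, of "{}"] fam_indep_empty by auto
  have "finite T" "g \<in> T \<rightarrow> carrier R" using T assms finite_subset by auto
  moreover have "fam_span N I g \<subseteq> fam_span N T g"
    using T assms calculation by (intro fam_span_subset) auto
  ultimately have "card J \<le> card T" using h assms by (intro fam_indep_card_le[of T J g h]) auto
  then have "T = I" using assms(1,6) T(1) by (metis card_subset_eq card_mono le_antisym le_trans)
  then show ?thesis using T by simp
qed

end

end

section \<open>Frobenius\<close>

text \<open>Pascal's rule: the product with \<open>x\<close> raises the exponent of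
  \<open>x\<close>, the product with \<open>y\<close> does not, and after aligning the indices the
  two binomial coefficients add up.\<close>

lemma (in cring) binomial_finsum:
  assumes x: "x \<in> carrier R" and y: "y \<in> carrier R"
  shows "(x \<oplus> y) [^] n = (\<Oplus>k\<in>{..n}. [(n choose k)] \<cdot> (x [^] k \<otimes> y [^] (n - k)))"
proof (induction n)
  case 0
  show ?case using x y by (simp add: add.nat_pow_Suc)
next
  case (Suc n)
  define B where "B k = [(n choose k)] \<cdot> (x [^] k \<otimes> y [^] (n - k))" for k
  define T where "T k = x [^] Suc k \<otimes> y [^] (n - k)" for k
  have BC: "B \<in> UNIV \<rightarrow> carrier R" using x y by (simp add: B_def)
  have TC: "T k \<in> carrier R" for k using x y by (simp add: T_def)
  have 1: "(\<Oplus>k\<in>{..n}. B k) \<otimes> x = (\<Oplus>k\<in>{..n}. [(n choose k)] \<cdot> T k)"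
  proof -
    have "(\<Oplus>k\<in>{..n}. B k) \<otimes> x = (\<Oplus>k\<in>{..n}. B k \<otimes> x)"
      using x BC by (intro finsum_ldistr) auto
    also have "\<dots> = (\<Oplus>k\<in>{..n}. [(n choose k)] \<cdot> T k)"
    proof (intro finsum_cong')
      fix k
      have "B k \<otimes> x = [(n choose k)] \<cdot> ((x [^] k \<otimes> y [^] (n - k)) \<otimes> x)"
        unfolding B_def using x y by (intro add_pow_ldistr) auto
      also have "(x [^] k \<otimes> y [^] (n - k)) \<otimes> x = T k"
        unfolding T_def using x y by (simp add: m_ac)
      finally show "B k \<otimes> x = [(n choose k)] \<cdot> T k" .
    qed (use TC in auto)
    finally show ?thesis .
  qed
  have 2: "(\<Oplus>k\<in>{..n}. B k) \<otimes> y = (\<Oplus>k\<in>{..Suc n}. [(n choose k)] \<cdot> (x [^] k \<otimes> y [^] (Suc n - k)))"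
  proof -
    have "(\<Oplus>k\<in>{..n}. B k) \<otimes> y = (\<Oplus>k\<in>{..n}. B k \<otimes> y)"
      using y BC by (intro finsum_ldistr) auto
    also have "\<dots> = (\<Oplus>k\<in>{..n}. [(n choose k)] \<cdot> (x [^] k \<otimes> y [^] (Suc n - k)))"
    proof (intro finsum_cong')
      fix k assume k: "k \<in> {..n}"
      have "B k \<otimes> y = [(n choose k)] \<cdot> ((x [^] k \<otimes> y [^] (n - k)) \<otimes> y)"
        unfolding B_def using x y by (intro add_pow_ldistr) auto
      also have "(x [^] k \<otimes> y [^] (n - k)) \<otimes> y = x [^] k \<otimes> y [^] (Suc n - k)"
        using x y k by (simp add: m_assoc Suc_diff_le)
      finally show "B k \<otimes> y = [(n choose k)] \<cdot> (x [^] k \<otimes> y [^] (Suc n - k))" .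
    qed (use x y in auto)
    \<comment> \<open>The extra summand at \<open>Suc n\<close> has binomial coefficient zero; it is
      added so that the first summand can be split off afterwards and the rest shifted by
      one.\<close>
    also have "\<dots> = (\<Oplus>k\<in>{..Suc n}. [(n choose k)] \<cdot> (x [^] k \<otimes> y [^] (Suc n - k)))"
      using x y by (subst finsum_Suc) (auto simp: binomial_eq_0 add.nat_pow_0)
    finally show ?thesis .
  qed
  have 3: "(\<Oplus>k\<in>{..Suc n}. [(n choose k)] \<cdot> (x [^] k \<otimes> y [^] (Suc n - k)))
      = (\<Oplus>k\<in>{..n}. [(n choose Suc k)] \<cdot> T k) \<oplus> y [^] Suc n"
    using x y by (subst finsum_Suc2) (auto simp: T_def)
  have "(x \<oplus> y) [^] Suc n = (\<Oplus>k\<in>{..n}. B k) \<otimes> (x \<oplus> y)"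
    using Suc by (simp add: B_def)
  also have "\<dots> = (\<Oplus>k\<in>{..n}. B k) \<otimes> x \<oplus> (\<Oplus>k\<in>{..n}. B k) \<otimes> y"
    using x y BC by (intro r_distr) (auto intro!: finsum_closed)
  also have "\<dots> = ((\<Oplus>k\<in>{..n}. [(n choose k)] \<cdot> T k) \<oplus> (\<Oplus>k\<in>{..n}. [(n choose Suc k)] \<cdot> T k)) \<oplus> y [^] Suc n"
    unfolding 1 2 3 using TC y by (intro a_assoc[symmetric]) (auto intro!: finsum_closed)
  also have "(\<Oplus>k\<in>{..n}. [(n choose k)] \<cdot> T k) \<oplus> (\<Oplus>k\<in>{..n}. [(n choose Suc k)] \<cdot> T k)
      = (\<Oplus>k\<in>{..n}. [(n choose k)] \<cdot> T k \<oplus> [(n choose Suc k)] \<cdot> T k)"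
    using TC by (intro finsum_addf[symmetric]) auto
  also have "\<dots> = (\<Oplus>k\<in>{..n}. [(Suc n choose Suc k)] \<cdot> T k)"
    using TC by (intro finsum_cong') (auto simp: add.nat_pow_mult)
  also have "\<dots> \<oplus> y [^] Suc n = (\<Oplus>k\<in>{..Suc n}. [(Suc n choose k)] \<cdot> (x [^] k \<otimes> y [^] (Suc n - k)))"
    using x y by (subst finsum_Suc2) (auto simp: T_def)
  finally show ?case .
qed

text \<open>A commutative ring instead of a field, because Frobenius is also used in a univariate
  polynomial ring, to see that X^p - c^p is the p-th power of X - c.\<close>

locale char_ring = cring R for R (structure) +
  fixes p :: nat
  assumes p_prime: "Factorial_Ring.prime p" and p_zero: "[p] \<cdot> \<one> = \<zero>"
begin

lemma p_pos: "0 < p" using p_prime by (simp add: prime_gt_0_nat)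

lemma add_pow_dvd:
  assumes "p dvd n" "x \<in> carrier R"
  shows "[n] \<cdot> x = \<zero>"
proof -
  obtain m where n: "n = p * m" using assms(1) by auto
  have "[n] \<cdot> x = [n] \<cdot> (\<one> \<otimes> x)" using assms by simp
  also have "\<dots> = ([n] \<cdot> \<one>) \<otimes> x" using assms by (intro add_pow_ldistr[symmetric]) auto
  also have "[n] \<cdot> \<one> = [m] \<cdot> ([p] \<cdot> \<one>)" unfolding n by (simp add: add.nat_pow_pow mult.commute)
  finally show ?thesis using assms by (simp add: p_zero)
qed

text \<open>The prime \<open>p\<close> divides every binomial coefficient strictly between the two
  ends.\<close>

lemma frobenius_add:
  assumes "x \<in> carrier R" "y \<in> carrier R"
  shows "(x \<oplus> y) [^] p = x [^] p \<oplus> y [^] p"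
proof -
  \<comment> \<open>As \<open>p\<close> is at least two, the first and the last summand are
    different and can both be split off.\<close>
  obtain m where "p = 2 + m" using prime_ge_2_nat[OF p_prime] le_Suc_ex by blast
  then have m: "p = Suc (Suc m)" by simp
  define f where "f k = [(p choose k)] \<cdot> (x [^] k \<otimes> y [^] (p - k))" for k
  have fC: "f k \<in> carrier R" for k using assms by (simp add: f_def)
  have z: "f k = \<zero>" if "0 < k" "k < p" for k
    unfolding f_def using assms that p_prime
    by (intro add_pow_dvd dvd_choose_prime) auto
  have "(x \<oplus> y) [^] p = (\<Oplus>k\<in>{..p}. f k)"
    unfolding f_def by (rule binomial_finsum[OF assms])
  also have "\<dots> = (\<Oplus>k\<in>{..Suc (Suc m)}. f k)" by (simp only: m)
  also have "\<dots> = f (Suc (Suc m)) \<oplus> ((\<Oplus>k\<in>{..m}. f (Suc k)) \<oplus> f 0)"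
    using fC by (subst finsum_Suc, simp, subst finsum_Suc2, simp_all)
  also have "(\<Oplus>k\<in>{..m}. f (Suc k)) = (\<Oplus>k\<in>{..m}. \<zero>)"
    using z m by (intro finsum_cong') auto
  also have "f (Suc (Suc m)) = x [^] p" unfolding m[symmetric] f_def using assms by simp
  also have "f 0 = y [^] p" unfolding f_def using assms by simp
  finally show ?thesis using assms by simp
qed

lemma frobenius_pow_add:
  assumes "x \<in> carrier R" "y \<in> carrier R"
  shows "(x \<oplus> y) [^] (p ^ t) = x [^] (p ^ t) \<oplus> y [^] (p ^ t)"
proof (induction t)
  case (Suc t)
  have "(x \<oplus> y) [^] (p ^ Suc t) = ((x \<oplus> y) [^] (p ^ t)) [^] p"
    using assms by (simp add: nat_pow_pow mult.commute)
  also have "\<dots> = (x [^] (p ^ t)) [^] p \<oplus> (y [^] (p ^ t)) [^] p"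
    unfolding Suc using assms by (intro frobenius_add) auto
  finally show ?case using assms by (simp add: nat_pow_pow mult.commute)
qed (use assms in simp)

lemma frobenius_finsum:
  assumes "f \<in> I \<rightarrow> carrier R"
  shows "(\<Oplus>i\<in>I. f i) [^] (p ^ t) = (\<Oplus>i\<in>I. f i [^] (p ^ t))"
proof (cases "finite I")
  case True
  then show ?thesis using assms
  proof (induction I)
    case empty
    then show ?case using p_pos by (simp add: nat_pow_zero)
  next
    case (insert i I)
    then have "(\<Oplus>j\<in>insert i I. f j) = f i \<oplus> (\<Oplus>j\<in>I. f j)" by (intro finsum_insert) auto
    moreover have "(\<Oplus>j\<in>insert i I. f j [^] (p ^ t)) = f i [^] (p ^ t) \<oplus> (\<Oplus>j\<in>I. f j [^] (p ^ t))"
      using insert by (intro finsum_insert) auto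
    ultimately show ?case using insert by (simp add: frobenius_pow_add Pi_iff)
  qed
next
  case False
  then show ?thesis using p_pos by (simp add: nat_pow_zero)
qed

lemma frobenius_uminus:
  assumes "x \<in> carrier R"
  shows "(\<ominus> x) [^] (p ^ t) = \<ominus> (x [^] (p ^ t))"
proof -
  have "x [^] (p ^ t) \<oplus> (\<ominus> x) [^] (p ^ t) = (x \<oplus> \<ominus> x) [^] (p ^ t)"
    using assms by (intro frobenius_pow_add[symmetric]) auto
  also have "\<dots> = \<zero>" using assms p_pos by (simp add: r_neg nat_pow_zero)
  finally show ?thesis using assms by (metis a_inv_closed minus_equality a_comm nat_pow_closed)
qed

end

locale char_field = field R + char_ring R p for R (structure) and p
begin

lemma pow_eq_zero_iff:
  assumes "x \<in> carrier R" "0 < (n::nat)"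
  shows "x [^] n = \<zero> \<longleftrightarrow> x = \<zero>"
proof
  assume "x [^] n = \<zero>"
  then show "x = \<zero>"
  proof (induction n)
    case (Suc n)
    then have "x [^] n = \<zero> \<or> x = \<zero>" using assms(1) by (intro integral) auto
    then show ?case using Suc.IH by blast
  qed simp
qed (use assms in \<open>simp add: nat_pow_zero\<close>)

lemma pow_inv:
  assumes "x \<in> carrier R" "x \<noteq> \<zero>"
  shows "(inv x) [^] (n::nat) = inv (x [^] n)"
proof -
  have U: "x \<in> Units R" using assms by (simp add: field_Units)
  have "inv x [^] n \<otimes> x [^] n = \<one>"
    using U assms by (simp add: nat_pow_distrib[symmetric] Units_closed)
  moreover have "x [^] n \<in> Units R" using U by (rule Units_pow_closed)
  ultimately show ?thesis using U assms
    by (intro comm_inv_char[symmetric]) (auto simp: m_comm)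
qed

text \<open>Since the elements whose q-th power lies in \<open>M\<close> form a field, it suffices
  to test generators in order to place all q-th powers of a generated field, or of a span, in
  \<open>M\<close>.\<close>

lemma frobenius_preimage_subfield:
  assumes M: "subfield M R"
  shows "subfield {w \<in> carrier R. w [^] (p ^ t) \<in> M} R"
proof (rule subfieldI')
  note [simp] = subfield_closed[OF M]
  show "subring {w \<in> carrier R. w [^] (p ^ t) \<in> M} R"
  proof (rule subringI)
    show "\<And>h1 h2. h1 \<in> {w \<in> carrier R. w [^] (p ^ t) \<in> M} \<Longrightarrow> h2 \<in> {w \<in> carrier R. w [^] (p ^ t) \<in> M}
        \<Longrightarrow> h1 \<otimes> h2 \<in> {w \<in> carrier R. w [^] (p ^ t) \<in> M}"
      by (simp add: nat_pow_distrib)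
  qed (auto simp: frobenius_uminus frobenius_pow_add)
  show "\<And>k. k \<in> {w \<in> carrier R. w [^] (p ^ t) \<in> M} - {\<zero>} \<Longrightarrow> inv k \<in> {w \<in> carrier R. w [^] (p ^ t) \<in> M}"
    by (auto simp: pow_inv pow_eq_zero_iff p_pos field_Units intro!: Units_inv_closed)
qed

text \<open>By Bezout, \<open>x\<close> is the quotient of a power of \<open>x [^] i\<close> by a
  power of \<open>x [^] j\<close>.\<close>

lemma coprime_powers_mem:
  assumes G: "subfield G R" and x: "x \<in> carrier R" and "x [^] (i::nat) \<in> G" "x [^] (j::nat) \<in> G"
    and "coprime i j" "0 < i"
  shows "x \<in> G"
proof (cases "x = \<zero>")
  case True
  then show ?thesis using subfield_closed(2)[OF G] by simp
next
  case False
  obtain u v where uv: "i * u = j * v + 1"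
    using bezout_nat[of i j] assms(5,6) by auto
  have C: "x [^] (j * v) \<in> carrier R" using x by simp
  have nz: "x [^] (j * v) \<noteq> \<zero>"
  proof
    assume "x [^] (j * v) = \<zero>"
    moreover have "0 < j * v" using calculation one_not_zero by (cases "j * v = 0") auto
    ultimately show False using False x pow_eq_zero_iff by blast
  qed
  have U: "x [^] (j * v) \<in> Units R" using nz C by (simp add: field_Units)
  have "x [^] (j * v) \<otimes> x = x [^] (i * u)" unfolding uv using x by simp
  then have "inv (x [^] (j * v)) \<otimes> x [^] (i * u) = inv (x [^] (j * v)) \<otimes> (x [^] (j * v) \<otimes> x)" by simp
  also have "\<dots> = x" using U x C by (simp add: m_assoc[symmetric])
  finally have "x = inv (x [^] (j * v)) \<otimes> x [^] (i * u)" by simp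
  moreover have "x [^] (i * u) \<in> G" "x [^] (j * v) \<in> G"
    using subfield_pow_closed[OF G assms(3), of u] subfield_pow_closed[OF G assms(4), of v] x
    by (simp_all add: nat_pow_pow)
  ultimately show ?thesis using nz subfield_closed(5,7)[OF G] by metis
qed

end

section \<open>The minimal polynomial of a p-th root\<close>

lemma (in ring_hom_cring) hom_pow:
  "x \<in> carrier R \<Longrightarrow> h (x [^] (n::nat)) = h x [^]\<^bsub>S\<^esub> n"
  by (induction n) auto

text \<open>Unique factorisation for a single prime element, valid in any domain: \<open>D\<close>
  divides one of the two factors and can be cancelled, which lowers the exponent.\<close>

lemma (in domain) prime_power_factor:
  assumes D: "D \<in> carrier R" "D \<noteq> \<zero>" "Divisibility.prime R D"
  shows "a \<in> carrier R \<Longrightarrow> b \<in> carrier R \<Longrightarrow> a \<otimes> b = D [^] (n::nat)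
    \<Longrightarrow> \<exists>u\<in>Units R. \<exists>i\<le>n. a = u \<otimes> D [^] i"
proof (induction n arbitrary: a b)
  case 0
  then have "a \<in> Units R" using m_comm[of a b] unfolding Units_def by auto
  then show ?case using 0 by (intro bexI[of _ a]) auto
next
  case (Suc n)
  have "D divides (a \<otimes> b)" using Suc.prems D by (auto simp: factor_def m_comm intro!: bexI[of _ "D [^] n"])
  then have "D divides a \<or> D divides b" using D Suc.prems unfolding Divisibility.prime_def by blast
  then show ?case
  proof
    assume "D divides a"
    then obtain c where c: "c \<in> carrier R" "a = D \<otimes> c" by (auto simp: factor_def)
    have "D \<otimes> (c \<otimes> b) = D \<otimes> D [^] n" using Suc.prems(3) m_comm[of D "D [^] n"] D(1) unfolding c(2) m_assoc[OF D(1) c(1) Suc.prems(2)] by simp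
    then have "c \<otimes> b = D [^] n" using c D Suc.prems by (simp add: m_lcancel)
    then obtain u i where ui: "u \<in> Units R" "i \<le> n" "c = u \<otimes> D [^] i" using Suc.IH c Suc.prems by blast
    have "a = u \<otimes> D [^] Suc i" unfolding c(2) ui(3) using ui(1) D by (simp add: m_ac Units_closed)
    then show ?thesis using ui(1,2) by (intro bexI[of _ u] exI[of _ "Suc i"]) auto
  next
    assume "D divides b"
    then obtain c where c: "c \<in> carrier R" "b = D \<otimes> c" by (auto simp: factor_def)
    have "D \<otimes> (a \<otimes> c) = D \<otimes> D [^] n" using Suc.prems(1,3) m_comm[of D "D [^] n"] D(1) c by (simp add: m_lcomm)
    then have "a \<otimes> c = D [^] n" using c D Suc.prems by (simp add: m_lcancel)
    then obtain u i where ui: "u \<in> Units R" "i \<le> n" "a = u \<otimes> D [^] i" using Suc.IH c Suc.prems by blast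
    then show ?thesis by (intro bexI[of _ u] exI[of _ i]) auto
  qed
qed

text \<open>Translation between coefficient lists, whose powers descend, and sums over
  \<open>{..<n}\<close>; this explains the reversal.\<close>

lemma (in ring) combine_exp_base:
  assumes x: "x \<in> carrier R"
  shows "f \<in> {..<n} \<rightarrow> carrier R
    \<Longrightarrow> combine (map f (rev [0..<n])) (exp_base x n) = (\<Oplus>i\<in>{..<n}. f i \<otimes> x [^] i)"
proof (induction n)
  case (Suc n)
  have "(\<Oplus>i\<in>{..<Suc n}. f i \<otimes> x [^] i) = f n \<otimes> x [^] n \<oplus> (\<Oplus>i\<in>{..<n}. f i \<otimes> x [^] i)"
    unfolding lessThan_Suc using Suc.prems x by (intro finsum_insert) auto
  then show ?case using Suc by (simp add: exp_base_def)
qed (simp add: exp_base_def)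

lemma (in field) eval_subfield:
  assumes G: "subfield G R" and "set P \<subseteq> G" "x \<in> G"
  shows "eval P x \<in> G"
  using assms(2)
  by (induction P) (auto simp: subfield_closed[OF G] subfield_pow_closed[OF G] assms(3))

context char_field
begin

text \<open>Over the large field X^p - c^p is (X - c)^p, so the minimal polynomial of
  \<open>c\<close> over \<open>G\<close> is (X - c)^i with i positive and at most \<open>p\<close>.
  Its value at zero is \<open>(\<ominus> c) [^] i\<close>, an element of \<open>G\<close>; for i
  below \<open>p\<close> the exponents are coprime and \<open>coprime_powers_mem\<close> would put
  \<open>c\<close> into \<open>G\<close>.\<close>

lemma minimal_polynomial_of_pth_root:
  assumes G: "subfield G R" and c: "c \<in> carrier R" "c [^] p \<in> G" "c \<notin> G"
  shows "(algebraic over G) c" "degree (Irr G c) = p"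
proof -
  \<comment> \<open>The factor X - c exists only over the full field. The ring over \<open>G\<close>
    lies inside \<open>U\<close> and shares its operations, so the factorisation of the minimal
    polynomial can be carried out in \<open>U\<close>.\<close>
  define U where "U = (carrier R)[X]"
  note sG = subfieldE(1)[OF G]
  have car: "subring (carrier R) R" "subfield (carrier R) R" by (rule carrier_is_subring, rule carrier_is_subfield)
  interpret U: domain U unfolding U_def by (rule univ_poly_is_domain[OF car(1)])
  interpret GX: domain "G[X]" by (rule univ_poly_is_domain[OF sG])
  have GU: "carrier (G[X]) \<subseteq> carrier U" unfolding U_def by (simp add: carrier_polynomial_shell[OF sG] subsetI)
  have pow_eq: "a [^]\<^bsub>G[X]\<^esub> (n::nat) = a [^]\<^bsub>U\<^esub> n" for a n
    unfolding U_def by (simp add: nat_pow_def univ_poly_def)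
  have add_eq: "a \<oplus>\<^bsub>G[X]\<^esub> b = a \<oplus>\<^bsub>U\<^esub> b" for a b unfolding U_def by (simp add: univ_poly_def)
  have homU: "poly_of_const \<in> ring_hom R U"
    using canonical_embedding_is_hom[OF car(1)] unfolding U_def by simp
  have homG: "poly_of_const \<in> ring_hom (R \<lparr>carrier := G\<rparr>) (G[X])"
    by (rule canonical_embedding_is_hom[OF sG])
  interpret hU: ring_hom_cring R U poly_of_const by (unfold_locales) (rule homU)
  have XU: "X \<in> carrier U" and XG: "X \<in> carrier (G[X])"
    using var_closed(1)[OF car(1)] var_closed(1)[OF sG] unfolding U_def by auto
  have chU: "[p] \<cdot>\<^bsub>U\<^esub> \<one>\<^bsub>U\<^esub> = \<zero>\<^bsub>U\<^esub>"
  proof -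
    have "poly_of_const ([n] \<cdot> \<one>) = [n] \<cdot>\<^bsub>U\<^esub> \<one>\<^bsub>U\<^esub>" for n :: nat
      by (induction n) (simp_all add: add.nat_pow_Suc U.add.nat_pow_Suc)
    from this[of p] show ?thesis by (simp add: p_zero)
  qed
  interpret U: char_ring U p by unfold_locales (rule p_prime, rule chU)
  define D where "D = X \<oplus>\<^bsub>U\<^esub> poly_of_const (\<ominus> c)"
  have DC: "D \<in> carrier U" unfolding D_def using XU c by simp
  \<comment> \<open>Writing the constant term as \<open>(\<ominus> c) [^] p\<close> makes
    \<open>q\<close> the p-th power of \<open>D\<close> without a discussion of signs.\<close>
  define q where "q = X [^]\<^bsub>G[X]\<^esub> p \<oplus>\<^bsub>G[X]\<^esub> poly_of_const ((\<ominus> c) [^] p)"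
  have cp: "(\<ominus> c) [^] p \<in> G" using frobenius_uminus[OF c(1), of 1] c(2) subfield_closed(6)[OF G] by simp
  have qG: "q \<in> carrier (G[X])" unfolding q_def using XG ring_hom_closed[OF homG, of "(\<ominus> c) [^] p"] cp by simp
  have qD: "q = D [^]\<^bsub>U\<^esub> p"
    unfolding q_def D_def pow_eq add_eq using XU c by (simp add: U.frobenius_add hU.hom_pow)
  have evU: "ring_hom_cring U R (\<lambda>P. eval P a)" if "a \<in> carrier R" for a
    unfolding U_def by (rule eval_cring_hom[OF car(1) that])
  have ev_const: "eval (poly_of_const k) a = k" if "k \<in> carrier R" "a \<in> carrier R" for k a
    using that by (simp add: poly_of_const_def)
  have evD: "eval D a = a \<ominus> c" if a: "a \<in> carrier R" for a
  proof -
    interpret e: ring_hom_cring U R "\<lambda>P. eval P a" by (rule evU[OF a])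
    show ?thesis unfolding D_def using XU c a by (simp add: eval_var ev_const a_minus_def)
  qed
  have Dlist: "D = [\<one>, \<ominus> c]"
    unfolding D_def U_def univ_poly_def var_def poly_of_const_def using c by simp
  have Dnz: "D \<noteq> \<zero>\<^bsub>U\<^esub>" unfolding Dlist by (simp add: U_def univ_poly_zero)
  have qnz: "q \<noteq> []"
  proof -
    have "D [^]\<^bsub>U\<^esub> n \<noteq> \<zero>\<^bsub>U\<^esub>" for n :: nat by (induction n) (use DC Dnz U.integral in \<open>auto\<close>)
    then show ?thesis unfolding qD by (simp add: U_def univ_poly_zero)
  qed
  have evq: "eval q c = \<zero>"
  proof -
    interpret e: ring_hom_cring U R "\<lambda>P. eval P c" by (rule evU[OF c(1)])
    show ?thesis unfolding qD using DC c p_pos by (simp add: e.hom_pow evD r_neg a_minus_def nat_pow_zero)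
  qed
  show alg: "(algebraic over G) c" by (rule algebraicI[OF qG qnz evq])
  define P where "P = Irr G c"
  have P: "P \<in> carrier (G[X])" "pirreducible G P" "lead_coeff P = \<one>" "eval P c = \<zero>"
    using IrrE[OF G c(1) alg] unfolding P_def by auto
  have "P pdivides q" unfolding P_def by (rule Irr_minimal[OF G c(1) alg qG evq])
  then obtain r where r: "r \<in> carrier U" "P \<otimes>\<^bsub>U\<^esub> r = D [^]\<^bsub>U\<^esub> p"
    unfolding pdivides_def U_def[symmetric] qD factor_def by auto
  have "pirreducible (carrier R) D"
    unfolding Dlist by (rule degree_one_imp_pirreducible[OF car(2)])
      (use DC Dlist U_def in auto)
  then have "Divisibility.prime U D"
    using pprime_iff_pirreducible[OF car(2), of D] DC unfolding U_def ring_prime_def by simp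
  then obtain u i where u: "u \<in> Units U" "i \<le> p" "P = u \<otimes>\<^bsub>U\<^esub> D [^]\<^bsub>U\<^esub> i"
    using U.prime_power_factor[OF DC Dnz _ _ r(1) r(2)] P(1) GU by auto
  obtain k where k: "k \<in> carrier R" "k \<noteq> \<zero>" "u = [k]"
    using u(1) univ_poly_carrier_units unfolding U_def by auto
  \<comment> \<open>The powers of \<open>D\<close> are monic of the expected degree. Comparison with
    the monic \<open>P\<close> forces the unit \<open>k\<close> to be one, and the degree of
    \<open>P\<close> is then the exponent.\<close>
  have Dpow: "D [^]\<^bsub>U\<^esub> n \<noteq> [] \<and> lead_coeff (D [^]\<^bsub>U\<^esub> n) = \<one> \<and> degree (D [^]\<^bsub>U\<^esub> n) = n" for n :: nat
  proof (induction n)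
    case 0 show ?case by (simp add: U_def univ_poly_one)
  next
    case (Suc n)
    have pol: "polynomial (carrier R) (D [^]\<^bsub>U\<^esub> n)" "polynomial (carrier R) D"
      using DC U.nat_pow_closed[OF DC, of n] unfolding U_def univ_poly_carrier by auto
    have m: "D [^]\<^bsub>U\<^esub> Suc n = poly_mult (D [^]\<^bsub>U\<^esub> n) D" by (simp add: U_def univ_poly_mult)
    have dl: "D \<noteq> []" "lead_coeff D = \<one>" "degree D = 1" unfolding Dlist by auto
    have deg: "degree (D [^]\<^bsub>U\<^esub> Suc n) = Suc n"
      unfolding m using poly_mult_degree_eq[OF car(1) pol] Suc dl by simp
    moreover have "lead_coeff (D [^]\<^bsub>U\<^esub> Suc n) = \<one>"
      unfolding m using poly_mult_lead_coeff[OF car(1) pol] Suc dl by simp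
    ultimately show ?case by auto
  qed
  have kp: "polynomial (carrier R) [k]" "polynomial (carrier R) (D [^]\<^bsub>U\<^esub> i)"
    using k U.nat_pow_closed[OF DC, of i] unfolding U_def univ_poly_carrier[symmetric] by (auto simp: polynomial_def)
  have Pm: "P = poly_mult [k] (D [^]\<^bsub>U\<^esub> i)" using u(3) k(3) by (simp add: U_def univ_poly_mult)
  have "k = \<one>" using poly_mult_lead_coeff[OF car(1) kp] Dpow[of i] P(3) k(1) unfolding Pm by simp
  then have "u = \<one>\<^bsub>U\<^esub>" using k(3) by (simp add: U_def univ_poly_one)
  then have PD: "P = D [^]\<^bsub>U\<^esub> i" using u(3) DC by simp
  have degP: "degree P = i" unfolding PD using Dpow by blast
  have "i \<noteq> 0"
  proof
    assume "i = 0"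
    then have "P = [\<one>]" using PD by (simp add: U_def univ_poly_one)
    then show False using P(4) c(1) by simp
  qed
  moreover have "i = p"
  proof (rule ccontr)
    assume "i \<noteq> p"
    then have "i < p" "0 < i" using u(2) \<open>i \<noteq> 0\<close> by auto
    then have "\<not> p dvd i" by (auto dest: dvd_imp_le)
    then have ip: "coprime i p" "0 < i"
      using prime_imp_coprime[OF p_prime] \<open>0 < i\<close> by (auto simp: coprime_commute)
    have "set P \<subseteq> G" using P(1) unfolding univ_poly_carrier[symmetric] polynomial_def by auto
    then have "eval P \<zero> \<in> G" by (intro eval_subfield[OF G] subfield_closed(2)[OF G])
    moreover have "eval P \<zero> = (\<ominus> c) [^] i"
    proof -
      interpret e: ring_hom_cring U R "\<lambda>P. eval P \<zero>" by (rule evU) simp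
      show ?thesis unfolding PD using DC c by (simp add: e.hom_pow evD a_minus_def)
    qed
    ultimately have "\<ominus> c \<in> G" using coprime_powers_mem[OF G _ _ cp ip] c by auto
    then have "\<ominus> (\<ominus> c) \<in> G" by (rule subfield_closed(6)[OF G])
    then show False using c by simp
  qed
  ultimately show "degree (Irr G c) = p" using degP unfolding P_def by simp
qed

lemma pth_root_independent:
  assumes G: "subfield G R" and c: "c \<in> carrier R" "c [^] p \<in> G" "c \<notin> G"
  shows "fam_indep G {..<p} (\<lambda>i. c [^] i)"
  unfolding fam_indep_def
proof (intro ballI impI)
  fix f i assume f: "f \<in> {..<p} \<rightarrow> G" "(\<Oplus>i\<in>{..<p}. f i \<otimes> c [^] i) = \<zero>" and i: "i \<in> {..<p}"
  note mp = minimal_polynomial_of_pth_root[OF assms]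
  have ind: "independent G (exp_base c p)" using exp_base_independent[OF G c(1) mp(1)] mp(2) by simp
  have fC: "f \<in> {..<p} \<rightarrow> carrier R" using f(1) subfield_closed(1)[OF G] by auto
  have s: "set (map f (rev [0..<p])) \<subseteq> G" using f(1) by (auto simp: Pi_iff)
  have z: "combine (map f (rev [0..<p])) (exp_base c p) = \<zero>"
    using combine_exp_base[OF c(1) fC] f(2) by simp
  have "set (take (length (exp_base c p)) (map f (rev [0..<p]))) \<subseteq> {\<zero>}"
    by (rule independent_imp_trivial_combine[OF G ind s z])
  then have "set (map f (rev [0..<p])) \<subseteq> {\<zero>}" by (simp add: exp_base_def)
  then show "f i = \<zero>" using i by (simp add: image_subset_iff)
qed

end

section \<open>Towers and \<open>p\<close>-th roots\<close>

context field
begin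

lemma finsum_product_family:
  assumes "finite I" "finite J" and f: "\<And>i j. i \<in> I \<Longrightarrow> j \<in> J \<Longrightarrow> f (i, j) \<in> carrier R"
    and g: "g \<in> I \<rightarrow> carrier R" and h: "h \<in> J \<rightarrow> carrier R"
  shows "(\<Oplus>k\<in>I \<times> J. f k \<otimes> (g (fst k) \<otimes> h (snd k))) = (\<Oplus>j\<in>J. (\<Oplus>i\<in>I. f (i, j) \<otimes> g i) \<otimes> h j)"
proof -
  have gC: "g i \<in> carrier R" if "i \<in> I" for i using g that by simp
  have hC: "h j \<in> carrier R" if "j \<in> J" for j using h that by simp
  have "(\<Oplus>k\<in>I \<times> J. f k \<otimes> (g (fst k) \<otimes> h (snd k))) = finsum R (\<lambda>(i, j). f (i, j) \<otimes> (g i \<otimes> h j)) (I \<times> J)"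
    by (simp add: split_def)
  also have "\<dots> = (\<Oplus>i\<in>I. \<Oplus>j\<in>J. f (i, j) \<otimes> (g i \<otimes> h j))"
    by (rule add.finprod_finprod[symmetric]) (use assms(1,2) f gC hC in simp_all)
  also have "\<dots> = (\<Oplus>j\<in>J. \<Oplus>i\<in>I. f (i, j) \<otimes> (g i \<otimes> h j))"
    by (rule finsum_finsum_swap) (use assms(1,2) f gC hC in simp_all)
  also have "\<dots> = (\<Oplus>j\<in>J. (\<Oplus>i\<in>I. f (i, j) \<otimes> g i) \<otimes> h j)"
  proof (rule finsum_cong')
    fix j assume j: "j \<in> J"
    have "(\<Oplus>i\<in>I. f (i, j) \<otimes> g i) \<otimes> h j = (\<Oplus>i\<in>I. (f (i, j) \<otimes> g i) \<otimes> h j)"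
      by (rule finsum_ldistr) (use assms(1) f gC hC j in simp_all)
    also have "\<dots> = (\<Oplus>i\<in>I. f (i, j) \<otimes> (g i \<otimes> h j))"
      by (rule finsum_cong') (use f gC hC j in \<open>simp_all add: m_assoc\<close>)
    finally show "(\<Oplus>i\<in>I. f (i, j) \<otimes> (g i \<otimes> h j)) = (\<Oplus>i\<in>I. f (i, j) \<otimes> g i) \<otimes> h j" by simp
  qed (use f gC hC in simp_all)
  finally show ?thesis .
qed

text \<open>Tower law: in a relation the coefficients of each \<open>h j\<close> are collected into
  one element of \<open>G\<close>. These vanish by independence over \<open>G\<close>, and then
  their own coefficients vanish by independence over \<open>M\<close>.\<close>

lemma fam_indep_product:
  assumes M: "subfield M R" and G: "subfield G R" and MG: "M \<subseteq> G"
    and fin: "finite I" "finite J" and g: "g \<in> I \<rightarrow> G" and h: "h \<in> J \<rightarrow> carrier R"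
    and ind: "fam_indep M I g" "fam_indep G J h"
  shows "fam_indep M (I \<times> J) (\<lambda>k. g (fst k) \<otimes> h (snd k))"
  unfolding fam_indep_def
proof (intro ballI impI)
  fix f k assume f: "f \<in> I \<times> J \<rightarrow> M"
    and z: "(\<Oplus>k\<in>I \<times> J. f k \<otimes> (g (fst k) \<otimes> h (snd k))) = \<zero>" and k: "k \<in> I \<times> J"
  have fM: "f (i, j) \<in> M" if "i \<in> I" "j \<in> J" for i j using f that by simp
  have gG: "g i \<in> G" if "i \<in> I" for i using g that by simp
  note sc = subfield_closed(8)[OF G] subfield_closed(8)[OF M] subfield_closed(5)[OF G]
  define s where "s j = (\<Oplus>i\<in>I. f (i, j) \<otimes> g i)" for j
  have sG: "s j \<in> G" if "j \<in> J" for j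
    unfolding s_def using fM gG that MG sc(3) by (intro subfield_finsum_closed[OF G]) (auto simp: subset_iff)
  have "(\<Oplus>j\<in>J. s j \<otimes> h j) = \<zero>"
    unfolding s_def z[symmetric]
    by (rule finsum_product_family[symmetric]) (use fin fM gG h sc in simp_all)
  then have s0: "s j = \<zero>" if "j \<in> J" for j
    using fam_indepD[OF G ind(2), of s j] sG that by simp
  obtain i j where ij: "k = (i, j)" "i \<in> I" "j \<in> J" using k by auto
  show "f k = \<zero>"
    using fam_indepD[OF M ind(1), of "\<lambda>i. f (i, j)" i] s0[OF ij(3)] fM ij unfolding s_def by simp
qed

lemma fam_span_product:
  assumes M: "subfield M R" and G: "subfield G R" and MG: "M \<subseteq> G"
    and fin: "finite I" "finite J" and g: "g \<in> I \<rightarrow> carrier R" and h: "h \<in> J \<rightarrow> carrier R"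
    and span: "G \<subseteq> fam_span M I g"
  shows "fam_span G J h \<subseteq> fam_span M (I \<times> J) (\<lambda>k. g (fst k) \<otimes> h (snd k))"
proof
  fix x assume "x \<in> fam_span G J h"
  then obtain c where c: "c \<in> J \<rightarrow> G" "x = (\<Oplus>j\<in>J. c j \<otimes> h j)" unfolding fam_span_def by auto
  have "\<forall>j\<in>J. \<exists>f. f \<in> I \<rightarrow> M \<and> c j = (\<Oplus>i\<in>I. f i \<otimes> g i)"
    using c(1) span unfolding fam_span_def by fastforce
  from bchoice[OF this] obtain f where f: "\<And>j. j \<in> J \<Longrightarrow> f j \<in> I \<rightarrow> M"
      "\<And>j. j \<in> J \<Longrightarrow> c j = (\<Oplus>i\<in>I. f j i \<otimes> g i)" by blast
  have fM: "f j i \<in> M" if "i \<in> I" "j \<in> J" for i j using f(1)[OF that(2)] that by simp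
  note sc = subfield_closed(8)[OF G] subfield_closed(8)[OF M]
  have "x = (\<Oplus>j\<in>J. (\<Oplus>i\<in>I. f j i \<otimes> g i) \<otimes> h j)"
    unfolding c(2) by (rule finsum_cong') (use f(2) c(1) h sc in simp_all)
  also have "\<dots> = (\<Oplus>k\<in>I \<times> J. f (snd k) (fst k) \<otimes> (g (fst k) \<otimes> h (snd k)))"
    using finsum_product_family[of I J "\<lambda>k. f (snd k) (fst k)" g h] fin fM g h sc by simp
  finally show "x \<in> fam_span M (I \<times> J) (\<lambda>k. g (fst k) \<otimes> h (snd k))"
    using fM by (intro fam_spanI[OF M, of "\<lambda>k. f (snd k) (fst k)"]) auto
qed

text \<open>Coefficients 1 and -1 at two indices with the same value would be a dependence. This
  allows passing from families to sets of values, as the tower argument does.\<close>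

lemma fam_indep_inj:
  assumes M: "subfield M R" and I: "finite I" and g: "g \<in> I \<rightarrow> carrier R" and ind: "fam_indep M I g"
  shows "inj_on g I"
proof (rule inj_onI)
  fix i j assume ij: "i \<in> I" "j \<in> I" "g i = g j"
  show "i = j"
  proof (rule ccontr)
    assume ne: "i \<noteq> j"
    note [simp] = subfield_closed[OF M]
    have gC: "g i \<in> carrier R" if "i \<in> I" for i using g that by simp
    define f where "f l = (if l = i then \<one> else if l = j then \<ominus> \<one> else \<zero>)" for l
    have "(\<Oplus>l\<in>I. f l \<otimes> g l) = (\<Oplus>l\<in>I. (if i = l then g l else \<zero>) \<oplus> (if j = l then \<ominus> g l else \<zero>))"
      by (rule finsum_cong') (use gC ne in \<open>auto simp: f_def l_minus\<close>)
    also have "\<dots> = (\<Oplus>l\<in>I. if i = l then g l else \<zero>) \<oplus> (\<Oplus>l\<in>I. if j = l then \<ominus> g l else \<zero>)"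
      by (rule finsum_addf) (use gC in simp_all)
    also have "\<dots> = g i \<oplus> (\<ominus> g j)"
      using finsum_singleton[OF ij(1) I, of g] finsum_singleton[OF ij(2) I, of "\<lambda>l. \<ominus> g l"] gC by simp
    also have "\<dots> = \<zero>" using gC ij by (simp add: r_neg)
    finally have eq: "(\<Oplus>l\<in>I. f l \<otimes> g l) = \<zero>" .
    have "f \<in> I \<rightarrow> M" by (simp add: f_def)
    from fam_indepD[OF M ind this eq ij(1)] show False by (simp add: f_def)
  qed
qed

lemma finsum_image_family:
  assumes "inj_on g I" "g \<in> I \<rightarrow> carrier R" "\<And>x. x \<in> g ` I \<Longrightarrow> f x \<in> carrier R"
  shows "(\<Oplus>x\<in>g ` I. f x \<otimes> x) = (\<Oplus>i\<in>I. f (g i) \<otimes> g i)"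
  by (rule add.finprod_reindex) (use assms in auto)

lemma fam_indep_image:
  assumes M: "subfield M R" and I: "finite I" and g: "g \<in> I \<rightarrow> carrier R" and ind: "fam_indep M I g"
  shows "fam_indep M (g ` I) (\<lambda>x. x)"
  unfolding fam_indep_def
proof (intro ballI impI)
  fix f x assume f: "f \<in> g ` I \<rightarrow> M" "(\<Oplus>x\<in>g ` I. f x \<otimes> x) = \<zero>" "x \<in> g ` I"
  have "f x \<in> carrier R" if x: "x \<in> g ` I" for x
  proof -
    obtain i where "i \<in> I" "x = g i" using x by auto
    then have "f x \<in> M" using f(1) by simp
    then show ?thesis by (rule subfield_closed(8)[OF M])
  qed
  from finsum_image_family[of g I f, OF fam_indep_inj[OF assms] g this]
  have eq: "(\<Oplus>i\<in>I. f (g i) \<otimes> g i) = \<zero>" unfolding f(2) by simp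
  obtain i where i: "i \<in> I" "x = g i" using f(3) by auto
  have "(\<lambda>i. f (g i)) \<in> I \<rightarrow> M" using f(1) by simp
  from fam_indepD[OF M ind this eq i(1)] show "f x = \<zero>" unfolding i(2) .
qed

lemma fam_span_image:
  assumes M: "subfield M R" and I: "finite I" and g: "g \<in> I \<rightarrow> carrier R"
  shows "fam_span M (g ` I) (\<lambda>x. x) = fam_span M I g"
proof
  show "fam_span M (g ` I) (\<lambda>x. x) \<subseteq> fam_span M I g"
    using I g by (intro fam_span_subset[OF M]) (auto intro: fam_span_mem[OF M I g])
  have "g i \<in> fam_span M (g ` I) (\<lambda>x. x)" if "i \<in> I" for i
    using fam_span_mem[OF M, of "g ` I" "\<lambda>x. x" "g i"] I g that by auto
  then show "fam_span M I g \<subseteq> fam_span M (g ` I) (\<lambda>x. x)"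
    using I g by (intro fam_span_subset[OF M]) auto
qed

lemma fam_span_subfield_mono:
  assumes "N' \<subseteq> N"
  shows "fam_span N' I g \<subseteq> fam_span N I g"
proof
  fix x assume "x \<in> fam_span N' I g"
  then obtain f where "f \<in> I \<rightarrow> N'" "x = (\<Oplus>i\<in>I. f i \<otimes> g i)" unfolding fam_span_def by auto
  moreover have "f \<in> I \<rightarrow> N" using calculation(1) assms by auto
  ultimately show "x \<in> fam_span N I g" unfolding fam_span_def by auto
qed

end

section \<open>Adjoining p-th roots of elements of a subfield\<close>

context char_field
begin

lemma adjoin_pth_root:
  assumes G: "subfield G R" and c: "c \<in> carrier R" "c [^] p \<in> G" "c \<notin> G"
  shows "subfield (fam_span G {..<p} (\<lambda>i. c [^] i)) R"
proof -
  note mp = minimal_polynomial_of_pth_root[OF assms]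
  have len: "length (exp_base c p) = p" by (simp add: exp_base_def)
  have set: "set (exp_base c p) \<subseteq> carrier R" by (rule exp_base_closed[OF c(1)])
  have "fam_span G {..<p} (\<lambda>i. c [^] i) = Span G (exp_base c p)"
  proof
    show "fam_span G {..<p} (\<lambda>i. c [^] i) \<subseteq> Span G (exp_base c p)"
    proof
      fix x assume "x \<in> fam_span G {..<p} (\<lambda>i. c [^] i)"
      then obtain f where f: "f \<in> {..<p} \<rightarrow> G" "x = (\<Oplus>i\<in>{..<p}. f i \<otimes> c [^] i)"
        unfolding fam_span_def by auto
      have "x = combine (map f (rev [0..<p])) (exp_base c p)"
        using combine_exp_base[OF c(1), of f p] f subfield_closed(8)[OF G] by simp
      moreover have "set (map f (rev [0..<p])) \<subseteq> G" using f(1) by auto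
      ultimately show "x \<in> Span G (exp_base c p)"
        unfolding Span_eq_combine_set_length_version[OF G set] len
        by (intro CollectI exI[of _ "map f (rev [0..<p])"]) simp
    qed
    show "Span G (exp_base c p) \<subseteq> fam_span G {..<p} (\<lambda>i. c [^] i)"
    proof
      fix x assume "x \<in> Span G (exp_base c p)"
      then obtain Ks where Ks: "x = combine Ks (exp_base c p)" "length Ks = p" "set Ks \<subseteq> G"
        unfolding Span_eq_combine_set_length_version[OF G set] len by auto
      define f where "f i = Ks ! (p - Suc i)" for i
      have "Ks = map f (rev [0..<p])"
        using Ks(2) by (intro nth_equalityI) (auto simp: f_def rev_nth)
      moreover have fG: "f \<in> {..<p} \<rightarrow> G" using Ks(2,3) by (auto simp: f_def subset_iff)
      ultimately have "x = (\<Oplus>i\<in>{..<p}. f i \<otimes> c [^] i)"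
        using combine_exp_base[OF c(1), of f p] Ks(1) subfield_closed(8)[OF G] by simp
      then show "x \<in> fam_span G {..<p} (\<lambda>i. c [^] i)" using fG by (intro fam_spanI[OF G, of f])
    qed
  qed
  also have "\<dots> = simple_extension G c" using Span_exp_base[OF G c(1) mp(1)] mp(2) by simp
  finally show ?thesis using simple_extension_is_subfield[OF G c(1)] mp(1) by simp
qed

text \<open>One step of degree \<open>p\<close>, described by bases over a smaller field
  \<open>M\<close>: the old basis is multiplied by the powers of \<open>c\<close> below
  \<open>p\<close>. The explicit shape of \<open>D'\<close> is part of the result because it decides
  in which other fields and spans \<open>D'\<close> lies.\<close>

lemma adjoin_basis:
  assumes M: "subfield M R" and G: "subfield G R" and MG: "M \<subseteq> G"
    and c: "c \<in> carrier R" "c [^] p \<in> G" "c \<notin> G"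
    and D: "finite D" "D \<subseteq> G" "fam_indep M D (\<lambda>x. x)" "G \<subseteq> fam_span M D (\<lambda>x. x)"
  obtains G' D' where "subfield G' R" "G \<subseteq> G'" "c \<in> G'" "finite D'" "D' \<subseteq> G'" "card D' = card D * p"
    "fam_indep M D' (\<lambda>x. x)" "G' \<subseteq> fam_span M D' (\<lambda>x. x)"
    "D' = (\<lambda>k. fst k \<otimes> c [^] (snd k)) ` (D \<times> {..<p})"
proof -
  define G' where "G' = fam_span G {..<p} (\<lambda>i. c [^] i)"
  define w where "w k = fst k \<otimes> c [^] (snd k)" for k :: "'a \<times> nat"
  define D' where "D' = w ` (D \<times> {..<p})"
  have G': "subfield G' R" unfolding G'_def by (rule adjoin_pth_root[OF G c])
  have cC: "(\<lambda>i. c [^] i) \<in> {..<p} \<rightarrow> carrier R" using c by simp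
  have DC: "D \<subseteq> carrier R" using D(2) subfield_closed(1)[OF G] by auto
  have p1: "1 < p" using p_prime by (rule prime_gt_1_nat)
  have one: "\<one> \<in> G'" "c \<in> G'"
    using fam_span_mem[OF G _ cC, of 0] fam_span_mem[OF G _ cC, of 1] p1 c(1) unfolding G'_def by auto
  have GG': "G \<subseteq> G'"
  proof
    fix x assume x: "x \<in> G"
    then have "x \<otimes> \<one> \<in> G'" using one(1) cC unfolding G'_def by (intro fam_span_smult[OF G]) auto
    then show "x \<in> G'" using subfield_closed(8)[OF G x] by simp
  qed
  have wfin: "finite (D \<times> {..<p})" using D(1) by simp
  have wC: "w \<in> D \<times> {..<p} \<rightarrow> carrier R" using DC c(1) by (auto simp: w_def)
  have wind: "fam_indep M (D \<times> {..<p}) w"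
    unfolding w_def using D(1,2,3) cC pth_root_independent[OF G c]
    by (intro fam_indep_product[OF M G MG]) auto
  have "card D' = card D * p"
    unfolding D'_def using card_image[OF fam_indep_inj[OF M wfin wC wind]] by (simp add: card_cartesian_product)
  moreover have "fam_indep M D' (\<lambda>x. x)" unfolding D'_def by (rule fam_indep_image[OF M wfin wC wind])
  moreover have "G' \<subseteq> fam_span M D' (\<lambda>x. x)"
    unfolding D'_def fam_span_image[OF M wfin wC] G'_def w_def
    using D(1,4) DC cC by (intro fam_span_product[OF M G MG]) auto
  moreover have "D' \<subseteq> G'"
    unfolding D'_def w_def using D(2) GG' one(2) subfield_closed(5)[OF G'] subfield_pow_closed[OF G'] by auto
  ultimately show ?thesis using that[OF G' GG' one(2), of D'] D(1) unfolding D'_def w_def by auto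
qed

text \<open>\<open>Gk\<close> is k(A) and \<open>GN\<close> its compositum with \<open>N\<close>,
  built by adjoining the elements of \<open>A\<close> one after the other. An element that is new
  for \<open>GN\<close> is also new for \<open>Gk\<close>, and each new element multiplies the
  degree by \<open>p\<close>; hence \<open>e \<le> h\<close>. The last clause keeps track that the
  basis \<open>D\<close> over \<open>k\<close> still spans \<open>GN\<close> over \<open>N\<close>,
  so that \<open>e = h\<close> means that it stays independent.\<close>

lemma compositum_tower:
  assumes k: "subfield k R" and N: "subfield N R" and kN: "k \<subseteq> N" and F: "subfield F R" and kF: "k \<subseteq> F"
    and A: "finite A" "A \<subseteq> F" "\<And>x. x \<in> A \<Longrightarrow> x [^] p \<in> k"
  shows "\<exists>Gk GN D E h e. subfield Gk R \<and> subfield GN R \<and> k \<subseteq> Gk \<and> Gk \<subseteq> F \<and> Gk \<subseteq> GN \<and> N \<subseteq> GN \<and> A \<subseteq> Gk \<and>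
    finite D \<and> D \<subseteq> Gk \<and> fam_indep k D (\<lambda>x. x) \<and> Gk \<subseteq> fam_span k D (\<lambda>x. x) \<and> card D = p ^ h \<and>
    finite E \<and> E \<subseteq> GN \<and> fam_indep N E (\<lambda>x. x) \<and> GN \<subseteq> fam_span N E (\<lambda>x. x) \<and> card E = p ^ e \<and>
    e \<le> h \<and> GN \<subseteq> fam_span N D (\<lambda>x. x)"
  using A
proof (induction A)
  case empty
  have one: "subfield K R \<Longrightarrow> fam_indep K {\<one>} (\<lambda>x. x) \<and> K \<subseteq> fam_span K {\<one>} (\<lambda>x. x)" for K
  proof
    assume K: "subfield K R"
    note [simp] = subfield_closed[OF K]
    show "fam_indep K {\<one>} (\<lambda>x. x)" unfolding fam_indep_def by simp
    show "K \<subseteq> fam_span K {\<one>} (\<lambda>x. x)"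
    proof
      fix x assume "x \<in> K"
      then show "x \<in> fam_span K {\<one>} (\<lambda>x. x)" by (intro fam_spanI[OF K, of "\<lambda>_. x"]) simp_all
    qed
  qed
  show ?case
    by (rule exI[of _ k], rule exI[of _ N], rule exI[of _ "{\<one>}"], rule exI[of _ "{\<one>}"],
        rule exI[of _ 0], rule exI[of _ 0])
      (use one[OF k] one[OF N] k N kN kF subfield_closed(3)[OF k] subfield_closed(3)[OF N] in simp)
next
  case (insert c A)
  have "A \<subseteq> F" "\<And>x. x \<in> A \<Longrightarrow> x [^] p \<in> k" using insert.prems by auto
  from insert.IH[OF this] obtain Gk GN D E h e where
    Gk: "subfield Gk R" "k \<subseteq> Gk" "Gk \<subseteq> F" "A \<subseteq> Gk" and
    GN: "subfield GN R" "Gk \<subseteq> GN" "N \<subseteq> GN" and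
    D: "finite D" "D \<subseteq> Gk" "fam_indep k D (\<lambda>x. x)" "Gk \<subseteq> fam_span k D (\<lambda>x. x)" "card D = p ^ h" and
    E: "finite E" "E \<subseteq> GN" "fam_indep N E (\<lambda>x. x)" "GN \<subseteq> fam_span N E (\<lambda>x. x)" "card E = p ^ e" and
    eh: "e \<le> h" and GND: "GN \<subseteq> fam_span N D (\<lambda>x. x)" by blast
  have c: "c \<in> carrier R" "c [^] p \<in> k" "c \<in> F" using insert.prems subfield_closed(8)[OF F] by auto
  have cGk: "c [^] p \<in> Gk" and cGN: "c [^] p \<in> GN" using c Gk(2) GN(2) by auto
  show ?case
  proof (cases "c \<in> Gk")
    case True
    show ?thesis
      by (rule exI[of _ Gk], rule exI[of _ GN], rule exI[of _ D], rule exI[of _ E],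
          rule exI[of _ h], rule exI[of _ e])
        (use Gk GN D E eh GND True in simp)
  next
    case False
    obtain Gk' D' where Gk': "subfield Gk' R" "Gk \<subseteq> Gk'" "c \<in> Gk'" and D': "finite D'" "D' \<subseteq> Gk'"
        "card D' = card D * p" "fam_indep k D' (\<lambda>x. x)" "Gk' \<subseteq> fam_span k D' (\<lambda>x. x)"
        "D' = (\<lambda>k. fst k \<otimes> c [^] (snd k)) ` (D \<times> {..<p})"
      by (rule adjoin_basis[OF k Gk(1,2) c(1) cGk False D(1-4)])
    have D'F: "D' \<subseteq> F" unfolding D'(6)
      using D(2) Gk(3) c(3) subfield_closed(5)[OF F] subfield_pow_closed[OF F] by auto
    have FC: "F \<subseteq> carrier R" by (rule subfield_closed(1)[OF F])
    have D'C: "D' \<subseteq> carrier R" using D'F FC by (rule subset_trans)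
    have Gk'F: "Gk' \<subseteq> F"
    proof -
      have "fam_span k D' (\<lambda>x. x) \<subseteq> F"
        by (rule fam_span_minimal[OF k D'(1)])
          (use D'F kF subfield_closed(2,4,5)[OF F] FC in auto)
      then show ?thesis using D'(5) by (rule subset_trans[rotated])
    qed
    have cardD': "card D' = p ^ Suc h" using D'(3) D(5) by simp
    have AGk': "insert c A \<subseteq> Gk'" using Gk(4) Gk'(2,3) by auto
    have kGk': "k \<subseteq> Gk'" using Gk(2) Gk'(2) by auto
    have DC: "D \<subseteq> carrier R" using D(2) Gk(3) FC by auto
    show ?thesis
    \<comment> \<open>The element is new over \<open>k\<close>. If it is already present over
      \<open>N\<close>, only the left exponent grows, and this is where the two degrees drift
      apart.\<close>
    proof (cases "c \<in> GN")
      case True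
      have "D' \<subseteq> GN" unfolding D'(6)
        using D(2) GN(2) True subfield_closed(5)[OF GN(1)] subfield_pow_closed[OF GN(1)] by auto
      then have "fam_span k D' (\<lambda>x. x) \<subseteq> GN"
        using Gk(2) GN(2) subfield_closed[OF GN(1)] by (intro fam_span_minimal[OF k D'(1)]) auto
      then have Gk'GN: "Gk' \<subseteq> GN" using D'(5) by auto
      have sub: "D \<subseteq> D'"
      proof
        fix x assume x: "x \<in> D"
        then have "x = fst (x, 0::nat) \<otimes> c [^] snd (x, 0::nat)" using DC c(1) by auto
        then show "x \<in> D'" unfolding D'(6) using x p_pos by (intro image_eqI[of _ _ "(x, 0)"]) auto
      qed
      have GND': "GN \<subseteq> fam_span N D' (\<lambda>x. x)"
        using GND fam_span_mono[OF N D'(1) sub, of "\<lambda>x. x"] D'C by auto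
      show ?thesis
        by (rule exI[of _ Gk'], rule exI[of _ GN], rule exI[of _ D'], rule exI[of _ E],
            rule exI[of _ "Suc h"], rule exI[of _ e])
          (use GND' Gk'(1) GN(1,3) kGk' Gk'F Gk'GN AGk' D'(1,2,4,5) cardD' E eh in simp)
    next
      case cN: False
      obtain GN' E' where GN': "subfield GN' R" "GN \<subseteq> GN'" "c \<in> GN'" and E': "finite E'" "E' \<subseteq> GN'"
          "card E' = card E * p" "fam_indep N E' (\<lambda>x. x)" "GN' \<subseteq> fam_span N E' (\<lambda>x. x)"
          "E' = (\<lambda>k. fst k \<otimes> c [^] (snd k)) ` (E \<times> {..<p})"
        by (rule adjoin_basis[OF N GN(1,3) c(1) cGN cN E(1-4)])
      have DGN': "D \<subseteq> GN'" and kGN': "k \<subseteq> GN'" using D(2) Gk(2) GN(2) GN'(2) by auto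
      have "D' \<subseteq> GN'" unfolding D'(6)
        using DGN' GN'(3) subfield_closed(5)[OF GN'(1)] subfield_pow_closed[OF GN'(1)] by auto
      then have "fam_span k D' (\<lambda>x. x) \<subseteq> GN'"
        using kGN' subfield_closed(1,2,4,5)[OF GN'(1)] by (intro fam_span_minimal[OF k D'(1)]) auto
      then have Gk'GN: "Gk' \<subseteq> GN'" using D'(5) by auto
      have ED: "E' \<subseteq> fam_span N D' (\<lambda>x. x)"
      proof
        fix x assume "x \<in> E'"
        then obtain y i where yi: "y \<in> E" "i < p" "x = y \<otimes> c [^] (i::nat)" unfolding E'(6) by auto
        have "y \<in> fam_span N D (\<lambda>x. x)" using yi(1) E(2) GND by auto
        then obtain f where f: "f \<in> D \<rightarrow> N" "y = (\<Oplus>d\<in>D. f d \<otimes> d)" unfolding fam_span_def by auto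
        have fC: "f d \<in> carrier R" "d \<in> carrier R" if "d \<in> D" for d
          using f(1) DC that subfield_closed(8)[OF N] by auto
        have "x = (\<Oplus>d\<in>D. (f d \<otimes> d) \<otimes> c [^] i)"
          unfolding yi(3) f(2) by (rule finsum_ldistr) (use D(1) c(1) fC in simp_all)
        also have "\<dots> = (\<Oplus>d\<in>D. f d \<otimes> (d \<otimes> c [^] i))"
          by (rule finsum_cong') (use c(1) fC in \<open>simp_all add: m_assoc\<close>)
        finally have x: "x \<in> fam_span N D (\<lambda>d. d \<otimes> c [^] i)" using f(1) by (intro fam_spanI[OF N, of f])
        have "d \<otimes> c [^] i \<in> fam_span N D' (\<lambda>x. x)" if "d \<in> D" for d
        proof -
          have "d \<otimes> c [^] i \<in> D'" unfolding D'(6)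
            using that yi(2) by (intro image_eqI[of _ _ "(d, i)"]) auto
          then show ?thesis
            using D'C by (intro fam_span_mem[OF N D'(1), of "\<lambda>x. x"]) auto
        qed
        then have "fam_span N D (\<lambda>d. d \<otimes> c [^] i) \<subseteq> fam_span N D' (\<lambda>x. x)"
          using D(1) D'(1) D'C by (intro fam_span_subset[OF N]) auto
        then show "x \<in> fam_span N D' (\<lambda>x. x)" using x by auto
      qed
      have "fam_span N E' (\<lambda>x. x) \<subseteq> fam_span N D' (\<lambda>x. x)"
        using ED E'(1) D'(1) D'C by (intro fam_span_subset[OF N]) auto
      then have GND': "GN' \<subseteq> fam_span N D' (\<lambda>x. x)" using E'(5) by auto
      have cardE': "card E' = p ^ Suc e" using E'(3) E(5) by simp
      have NGN': "N \<subseteq> GN'" using GN(3) GN'(2) by auto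
      show ?thesis
        by (rule exI[of _ Gk'], rule exI[of _ GN'], rule exI[of _ D'], rule exI[of _ E'],
            rule exI[of _ "Suc h"], rule exI[of _ "Suc e"])
          (use GND' cardE' NGN' Gk'(1) GN'(1) kGk' Gk'F Gk'GN AGk' D'(1,2,4,5) cardD' E'(1,2,4,5) eh in simp)
    qed
  qed
qed

text \<open>The compositum \<open>k(A) N\<^sub>1\<close> has degree a power of \<open>p\<close> over \<open>N\<^sub>1\<close>, which is a proper divisor of the
  degree of \<open>k(A)\<close> over \<open>k\<close> because \<open>A\<close> becomes dependent.  The hypothesis \<open>deg\<close> says that passing
  from \<open>k\<close> to \<open>N\<close> loses at most one factor \<open>p\<close>, so nothing is lost from \<open>N\<^sub>1\<close> to \<open>N\<close>.\<close>

lemma indep_descends: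
  assumes k: "subfield k R" and N1: "subfield N1 R" and N: "subfield N R" and kN: "k \<subseteq> N1" "N1 \<subseteq> N"
    and F: "subfield F R" and kF: "k \<subseteq> F"
    and A: "finite A" "A \<subseteq> F" "\<And>x. x \<in> A \<Longrightarrow> x [^] p \<in> k"
    and Ak: "fam_indep k A (\<lambda>x. x)" and W: "W \<subseteq> A" "\<not> fam_indep N1 W (\<lambda>x. x)"
    and deg: "\<And>D T. finite D \<Longrightarrow> D \<subseteq> F \<Longrightarrow> fam_indep k D (\<lambda>x. x) \<Longrightarrow> finite T \<Longrightarrow> T \<subseteq> carrier R
      \<Longrightarrow> D \<subseteq> fam_span N T (\<lambda>x. x) \<Longrightarrow> card D \<le> p * card T"
    and S: "S \<subseteq> A" "fam_indep N1 S (\<lambda>x. x)"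
  shows "fam_indep N S (\<lambda>x. x)"
proof -
  obtain Gk GN D E h e where
    Gk: "subfield Gk R" "k \<subseteq> Gk" "Gk \<subseteq> F" "A \<subseteq> Gk" and
    GN: "subfield GN R" "Gk \<subseteq> GN" "N1 \<subseteq> GN" and
    D: "finite D" "D \<subseteq> Gk" "fam_indep k D (\<lambda>x. x)" "Gk \<subseteq> fam_span k D (\<lambda>x. x)" "card D = p ^ h" and
    E: "finite E" "E \<subseteq> GN" "fam_indep N1 E (\<lambda>x. x)" "GN \<subseteq> fam_span N1 E (\<lambda>x. x)" "card E = p ^ e" and
    eh: "e \<le> h" and GND: "GN \<subseteq> fam_span N1 D (\<lambda>x. x)"
    using compositum_tower[OF k N1 kN(1) F kF A] by blast
  have C: "Gk \<subseteq> carrier R" "GN \<subseteq> carrier R" by (rule subfield_closed(1)[OF Gk(1)], rule subfield_closed(1)[OF GN(1)])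
  have DC: "D \<subseteq> carrier R" and EC: "E \<subseteq> carrier R" and AC: "A \<subseteq> carrier R" using D(2) E(2) Gk(4) C by auto
  have idC: "(\<lambda>x. x) \<in> Y \<rightarrow> carrier R" if "Y \<subseteq> carrier R" for Y using that by auto
  \<comment> \<open>With equal degrees \<open>D\<close> would be independent over \<open>N1\<close>.
    A basis \<open>T\<close> of \<open>Gk\<close> over \<open>k\<close> that contains
    \<open>A\<close> is no larger than \<open>D\<close> and spans it, so \<open>T\<close> would be
    independent over \<open>N1\<close> as well, against the dependence of \<open>W\<close>.\<close>
  have "e \<noteq> h"
  proof
    assume "e = h"
    then have "card D = card E" using D(5) E(5) by simp
    then have DE: "card D \<le> card E" by simp
    have "(\<lambda>x. x) \<in> E \<rightarrow> fam_span N1 D (\<lambda>x. x)"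
      using subset_trans[OF E(2) GND] by (simp add: subset_iff)
    then have DN1: "fam_indep N1 D (\<lambda>x. x)"
      by (rule fam_span_card_imp_indep[OF N1 D(1) E(1) idC[OF DC] _ E(3) DE])
    have finU: "finite (A \<union> D)" using A(1) D(1) by simp
    have UC: "A \<union> D \<subseteq> carrier R" using AC DC by simp
    obtain T where T: "A \<subseteq> T" "T \<subseteq> A \<union> D" "fam_indep k T (\<lambda>x. x)" "(\<lambda>x. x) \<in> A \<union> D \<rightarrow> fam_span k T (\<lambda>x. x)"
      by (rule fam_basis_extend[OF k finU idC[OF UC] Un_upper1 Ak])
    have finT: "finite T" by (rule finite_subset[OF T(2) finU])
    have TC: "T \<subseteq> carrier R" using T(2) AC DC by blast
    have TGk: "T \<subseteq> Gk" using T(2) Gk(4) D(2) by blast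
    have TD: "(\<lambda>x. x) \<in> T \<rightarrow> fam_span k D (\<lambda>x. x)"
      using subset_trans[OF TGk D(4)] by (simp add: subset_iff)
    have TD': "card T \<le> card D" by (rule fam_indep_card_le[OF k D(1) finT idC[OF DC] TD T(3)])
    have DT: "(\<lambda>x. x) \<in> D \<rightarrow> fam_span N1 T (\<lambda>x. x)"
    proof
      fix x assume "x \<in> D"
      then have "x \<in> fam_span k T (\<lambda>x. x)" using funcset_mem[OF T(4), of x] by blast
      then show "x \<in> fam_span N1 T (\<lambda>x. x)" by (rule subsetD[OF fam_span_subfield_mono[OF kN(1)]])
    qed
    have "fam_indep N1 T (\<lambda>x. x)"
      by (rule fam_span_card_imp_indep[OF N1 finT D(1) idC[OF TC] DT DN1 TD'])
    then have "fam_indep N1 W (\<lambda>x. x)"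
      by (rule fam_indep_subset[OF N1 _ subset_trans[OF W(1) T(1)] finT idC[OF TC]])
    then show False using W(2) by simp
  qed
  \<comment> \<open>Both degrees are powers of \<open>p\<close>, so a strict drop is a drop by a
    whole factor \<open>p\<close>.\<close>
  then have "Suc e \<le> h" using eh by simp
  then have "p ^ Suc e \<le> p ^ h" using p_pos by (intro power_increasing) auto
  then have ED: "p * card E \<le> card D" using D(5) E(5) by simp
  have finU: "finite (S \<union> D)" using finite_subset[OF S(1) A(1)] D(1) by simp
  have UC: "S \<union> D \<subseteq> carrier R" using S(1) AC DC by blast
  \<comment> \<open>\<open>T\<close> completes \<open>S\<close> to a family that spans
    \<open>D\<close> over \<open>N1\<close> and is no larger than \<open>E\<close>. Its subfamily
    \<open>T'\<close>, independent over \<open>N\<close>, will turn out to be all of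
    \<open>T\<close>.\<close>
  obtain T where T: "S \<subseteq> T" "T \<subseteq> S \<union> D" "fam_indep N1 T (\<lambda>x. x)" "(\<lambda>x. x) \<in> S \<union> D \<rightarrow> fam_span N1 T (\<lambda>x. x)"
    by (rule fam_basis_extend[OF N1 finU idC[OF UC] Un_upper1 S(2)])
  have finT: "finite T" by (rule finite_subset[OF T(2) finU])
  have TC: "T \<subseteq> carrier R" using T(2) AC DC S(1) by blast
  have TGN: "T \<subseteq> GN" using T(2) Gk(4) D(2) S(1) GN(2) by blast
  have "(\<lambda>x. x) \<in> T \<rightarrow> fam_span N1 E (\<lambda>x. x)"
    using subset_trans[OF TGN E(4)] by (simp add: subset_iff)
  then have cTE: "card T \<le> card E"
    by (rule fam_indep_card_le[OF N1 E(1) finT idC[OF EC] _ T(3)])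
  obtain T' where "{} \<subseteq> T'" and T': "T' \<subseteq> T" "fam_indep N T' (\<lambda>x. x)" "(\<lambda>x. x) \<in> T \<rightarrow> fam_span N T' (\<lambda>x. x)"
    by (rule fam_basis_extend[OF N finT idC[OF TC] empty_subsetI fam_indep_empty[OF N]])
  have finT': "finite T'" by (rule finite_subset[OF T'(1) finT])
  have T'C: "T' \<subseteq> carrier R" by (rule subset_trans[OF T'(1) TC])
  have DT: "D \<subseteq> fam_span N1 T (\<lambda>x. x)"
  proof
    fix x assume "x \<in> D"
    then show "x \<in> fam_span N1 T (\<lambda>x. x)" using funcset_mem[OF T(4), of x] by blast
  qed
  have TT': "fam_span N T (\<lambda>x. x) \<subseteq> fam_span N T' (\<lambda>x. x)"
    by (rule fam_span_subset[OF N finT' finT idC[OF T'C] T'(3)])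
  have DT': "D \<subseteq> fam_span N T' (\<lambda>x. x)"
    by (rule subset_trans[OF subset_trans[OF DT fam_span_subfield_mono[OF kN(2)]] TT'])
  have DF: "D \<subseteq> F" by (rule subset_trans[OF D(2) Gk(3)])
  have "card D \<le> p * card T'" by (rule deg[OF D(1) DF D(3) finT' T'C DT'])
  \<comment> \<open>The chain is p card T, at most p card E, at most card D, at most p card T',
    where the last step is \<open>deg\<close>.\<close>
  then have "p * card T \<le> p * card T'" by (rule le_trans[OF le_trans[OF mult_le_mono2[OF cTE] ED]])
  then have "card T \<le> card T'" using p_pos by (simp only: mult_le_cancel1 simp_thms)
  then have "T' = T" by (rule card_seteq[OF finT T'(1)])
  then have "fam_indep N T (\<lambda>x. x)" using T'(2) by simp
  then show ?thesis by (rule fam_indep_subset[OF N _ T(1) finT idC[OF TC]])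
qed

end

section \<open>Polynomials in a set of variables\<close>

text \<open>The product in \<open>mpoly_ring\<close> sums over submultisets; finiteness keeps this
  sum away from the default value zero of sums over infinite sets.\<close>

lemma finite_submultisets: "finite {k. k \<subseteq># (m :: 'c multiset)}"
proof (induction m)
  case empty
  have "{k. k \<subseteq># ({#} :: 'c multiset)} = {{#}}" by auto
  then show ?case by simp
next
  case (add x m)
  have "{k. k \<subseteq># add_mset x m} \<subseteq> {k. k \<subseteq># m} \<union> add_mset x ` {k. k \<subseteq># m}"
  proof
    fix k assume "k \<in> {k. k \<subseteq># add_mset x m}"
    then have k: "k \<subseteq># add_mset x m" by simp
    show "k \<in> {k. k \<subseteq># m} \<union> add_mset x ` {k. k \<subseteq># m}"
    proof (cases "x \<in># k")
      case True
      then have e: "k = add_mset x (k - {#x#})" by simp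
      then have "k - {#x#} \<subseteq># m" using k by (metis mset_subset_eq_add_mset_cancel)
      then show ?thesis using e by blast
    next
      case False
      have "count k y \<le> count m y" for y
        using mset_subset_eq_count[OF k, of y] False by (cases "y = x") (auto simp: not_in_iff)
      then have "k \<subseteq># m" by (rule mset_subset_eqI)
      then show ?thesis by simp
    qed
  qed
  moreover have "finite ({k. k \<subseteq># m} \<union> add_mset x ` {k. k \<subseteq># m})" using add by simp
  ultimately show ?case by (rule finite_subset)
qed

section \<open>Terms, supports and the ring structure on polynomials\<close>

definition mterm :: "('a, 'm) ring_scheme \<Rightarrow> 'a \<Rightarrow> 'c multiset \<Rightarrow> 'c multiset \<Rightarrow> 'a" where
  "mterm R c m = (\<lambda>l. if l = m then c else \<zero>\<^bsub>R\<^esub>)"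

definition msupp :: "('a, 'm) ring_scheme \<Rightarrow> ('c multiset \<Rightarrow> 'a) \<Rightarrow> 'c multiset set" where
  "msupp R f = {m. f m \<noteq> \<zero>\<^bsub>R\<^esub>}"

context ring
begin

lemma mterm_simps [simp]:
  "carrier (mpoly_ring R I) = indexed_pset I (carrier R)"
  "\<one>\<^bsub>mpoly_ring R I\<^esub> = mterm R \<one> {#}" "\<zero>\<^bsub>mpoly_ring R I\<^esub> = (\<lambda>_. \<zero>)"
  "f \<oplus>\<^bsub>mpoly_ring R I\<^esub> g = (\<lambda>m. f m \<oplus> g m)"
  by (simp_all add: mpoly_ring_def mterm_def indexed_const_def indexed_padd_def)

lemma indexed_const_mterm: "indexed_const c = mterm R c {#}"
  by (simp add: mterm_def indexed_const_def)

lemma mpoly_mult: "(f \<otimes>\<^bsub>mpoly_ring R I\<^esub> g) m = (\<Oplus>k \<in> {k. k \<subseteq># m}. f k \<otimes> g (m - k))"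
  by (simp add: mpoly_ring_def)

lemma mterm_pmult: "indexed_pmult (mterm R c m) i = mterm R c (add_mset i m)"
proof
  fix l
  have "i \<in># l \<and> l - {#i#} = m \<longleftrightarrow> l = add_mset i m" by auto
  then show "indexed_pmult (mterm R c m) i l = mterm R c (add_mset i m) l"
    by (auto simp: indexed_pmult_def mterm_def)
qed

lemma indexed_var_mterm: "indexed_var i = mterm R \<one> {#i#}"
  by (simp add: indexed_var_def indexed_const_mterm mterm_pmult)

lemma mterm_in_pset: "c \<in> carrier R \<Longrightarrow> set_mset m \<subseteq> I \<Longrightarrow> mterm R c m \<in> indexed_pset I (carrier R)"
proof (induction m)
  case empty
  then show ?case unfolding indexed_const_mterm[symmetric] by (intro indexed_pset.indexed_const)
next
  case (add x m)
  then show ?case unfolding mterm_pmult[symmetric] by (intro indexed_pset.indexed_pmult) auto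
qed

text \<open>Replaces the inductive construction of polynomials by finitely supported coefficient
  functions; conversely such a function is rebuilt by adding its terms one at a time.\<close>

lemma pset_iff:
  "f \<in> indexed_pset I (carrier R) \<longleftrightarrow>
    (\<forall>m. f m \<in> carrier R) \<and> finite (msupp R f) \<and> (\<forall>m\<in>msupp R f. set_mset m \<subseteq> I)"
proof
  assume "f \<in> indexed_pset I (carrier R)"
  then show "(\<forall>m. f m \<in> carrier R) \<and> finite (msupp R f) \<and> (\<forall>m\<in>msupp R f. set_mset m \<subseteq> I)"
  proof (induction f)
    case (indexed_const c)
    have "msupp R (indexed_const c) \<subseteq> {{#}}" by (auto simp: msupp_def indexed_const_def)
    then have "finite (msupp R (indexed_const c))" "\<forall>m\<in>msupp R (indexed_const c). set_mset m \<subseteq> I"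
      by (auto intro: finite_subset)
    then show ?case using indexed_const by (simp add: indexed_const_def)
  next
    case (indexed_padd P Q)
    have "msupp R (indexed_padd P Q) \<subseteq> msupp R P \<union> msupp R Q"
      using indexed_padd by (auto simp: msupp_def indexed_padd_def)
    moreover have "finite (msupp R P \<union> msupp R Q)" using indexed_padd by simp
    ultimately have "finite (msupp R (indexed_padd P Q))" "\<forall>m\<in>msupp R (indexed_padd P Q). set_mset m \<subseteq> I"
      using indexed_padd finite_subset by (blast, blast)
    then show ?case using indexed_padd by (simp add: indexed_padd_def)
  next
    case (indexed_pmult P i)
    have "msupp R (indexed_pmult P i) \<subseteq> add_mset i ` msupp R P"
    proof
      fix m assume "m \<in> msupp R (indexed_pmult P i)"
      then have m: "i \<in># m" "m - {#i#} \<in> msupp R P"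
        by (auto simp: msupp_def indexed_pmult_def split: if_splits)
      then have "m = add_mset i (m - {#i#})" by simp
      then show "m \<in> add_mset i ` msupp R P" using m(2) by (rule image_eqI)
    qed
    moreover have "finite (add_mset i ` msupp R P)" using indexed_pmult by simp
    moreover have "\<forall>m\<in>add_mset i ` msupp R P. set_mset m \<subseteq> I" using indexed_pmult by auto
    ultimately have "finite (msupp R (indexed_pmult P i))" "\<forall>m\<in>msupp R (indexed_pmult P i). set_mset m \<subseteq> I"
      using finite_subset by (blast, blast)
    then show ?case using indexed_pmult by (simp add: indexed_pmult_def)
  qed
next
  assume f: "(\<forall>m. f m \<in> carrier R) \<and> finite (msupp R f) \<and> (\<forall>m\<in>msupp R f. set_mset m \<subseteq> I)"
  have "finite A \<Longrightarrow> \<forall>m. f m \<in> carrier R \<Longrightarrow> \<forall>m\<in>A. set_mset m \<subseteq> I \<Longrightarrow> msupp R f \<subseteq> A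
      \<Longrightarrow> f \<in> indexed_pset I (carrier R)" for A f
  proof (induction A arbitrary: f rule: finite_induct)
    case empty
    then have "f = mterm R \<zero> {#}" by (auto simp: msupp_def mterm_def)
    then show ?case by (simp add: mterm_in_pset)
  next
    case (insert a A)
    define f' where "f' m = (if m = a then \<zero> else f m)" for m
    have "f' \<in> indexed_pset I (carrier R)"
      using insert.prems by (intro insert.IH) (auto simp: f'_def msupp_def)
    moreover have "mterm R (f a) a \<in> indexed_pset I (carrier R)" using insert.prems by (intro mterm_in_pset) auto
    moreover have "f = indexed_padd f' (mterm R (f a) a)"
      using insert.prems by (auto simp: indexed_padd_def f'_def mterm_def)
    ultimately show ?case by (metis indexed_pset.indexed_padd)
  qed
  then show "f \<in> indexed_pset I (carrier R)" using f by blast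
qed

lemma pset_closed: "f \<in> indexed_pset I (carrier R) \<Longrightarrow> f m \<in> carrier R"
  by (simp add: pset_iff)

lemma submset_sum_closed:
  "f \<in> indexed_pset I (carrier R) \<Longrightarrow> g \<in> indexed_pset I (carrier R)
    \<Longrightarrow> (f \<otimes>\<^bsub>mpoly_ring R I\<^esub> g) m \<in> carrier R"
  unfolding mpoly_mult by (intro finsum_closed) (simp add: pset_closed)

lemma msupp_mult:
  assumes "f \<in> indexed_pset I (carrier R)" "g \<in> indexed_pset I (carrier R)"
  shows "msupp R (f \<otimes>\<^bsub>mpoly_ring R I\<^esub> g) \<subseteq> (\<lambda>(a, b). a + b) ` (msupp R f \<times> msupp R g)"
proof
  fix m assume m: "m \<in> msupp R (f \<otimes>\<^bsub>mpoly_ring R I\<^esub> g)"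
  have "\<exists>k. k \<subseteq># m \<and> f k \<otimes> g (m - k) \<noteq> \<zero>"
  proof (rule ccontr)
    assume "\<not> ?thesis"
    then have "(\<Oplus>k \<in> {k. k \<subseteq># m}. f k \<otimes> g (m - k)) = \<zero>" by (intro add.finprod_one_eqI) auto
    then show False using m by (simp add: msupp_def mpoly_mult)
  qed
  then obtain k where k: "k \<subseteq># m" "f k \<otimes> g (m - k) \<noteq> \<zero>" by blast
  then have "f k \<noteq> \<zero>" "g (m - k) \<noteq> \<zero>" using assms by (auto simp: pset_closed)
  then show "m \<in> (\<lambda>(a, b). a + b) ` (msupp R f \<times> msupp R g)"
    using k(1) by (intro image_eqI[of _ _ "(k, m - k)"]) (auto simp: msupp_def)
qed

lemma mpoly_mult_closed:
  assumes "f \<in> indexed_pset I (carrier R)" "g \<in> indexed_pset I (carrier R)"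
  shows "f \<otimes>\<^bsub>mpoly_ring R I\<^esub> g \<in> indexed_pset I (carrier R)"
  unfolding pset_iff
proof (intro conjI allI ballI)
  show "(f \<otimes>\<^bsub>mpoly_ring R I\<^esub> g) m \<in> carrier R" for m by (rule submset_sum_closed[OF assms])
  have "finite ((\<lambda>(a, b). a + b) ` (msupp R f \<times> msupp R g))" using assms by (simp add: pset_iff)
  then show "finite (msupp R (f \<otimes>\<^bsub>mpoly_ring R I\<^esub> g))" by (rule finite_subset[OF msupp_mult[OF assms]])
  fix m assume "m \<in> msupp R (f \<otimes>\<^bsub>mpoly_ring R I\<^esub> g)"
  then obtain a b where "a \<in> msupp R f" "b \<in> msupp R g" "m = a + b" using msupp_mult[OF assms] by auto
  then show "set_mset m \<subseteq> I" using assms by (simp add: pset_iff)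
qed

lemma mterm_mult_left:
  assumes "c \<in> carrier R" "\<And>m. g m \<in> carrier R"
  shows "(mterm R c l \<otimes>\<^bsub>mpoly_ring R I\<^esub> g) m = (if l \<subseteq># m then c \<otimes> g (m - l) else \<zero>)"
proof (cases "l \<subseteq># m")
  case True
  have "(\<Oplus>k \<in> {k. k \<subseteq># m}. mterm R c l k \<otimes> g (m - k)) = (\<Oplus>k \<in> {k. k \<subseteq># m}. if l = k then c \<otimes> g (m - k) else \<zero>)"
    using assms by (intro finsum_cong') (auto simp: mterm_def)
  also have "\<dots> = c \<otimes> g (m - l)"
    by (rule finsum_singleton) (use True finite_submultisets assms in simp_all)
  finally show ?thesis using True by (simp add: mpoly_mult)
next
  case False
  have "(\<Oplus>k \<in> {k. k \<subseteq># m}. mterm R c l k \<otimes> g (m - k)) = \<zero>"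
    using False assms by (intro add.finprod_one_eqI) (auto simp: mterm_def)
  then show ?thesis using False by (simp add: mpoly_mult)
qed

end

context cring
begin

lemma mpoly_mult_comm:
  assumes "f \<in> indexed_pset I (carrier R)" "g \<in> indexed_pset I (carrier R)"
  shows "f \<otimes>\<^bsub>mpoly_ring R I\<^esub> g = g \<otimes>\<^bsub>mpoly_ring R I\<^esub> f"
proof
  fix m :: "'c multiset"
  have im: "(\<lambda>k. m - k) ` {k. k \<subseteq># m} = {k. k \<subseteq># m}"
  proof (intro equalityI subsetI)
    fix k assume "k \<in> {k. k \<subseteq># m}"
    then show "k \<in> (\<lambda>k. m - k) ` {k. k \<subseteq># m}"
      by (intro image_eqI[of _ _ "m - k"]) (auto simp: subset_mset.diff_diff_right)
  qed auto
  have inj: "inj_on (\<lambda>k. m - k) {k. k \<subseteq># m}"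
    by (intro inj_onI) (metis mem_Collect_eq subset_mset.diff_diff_right add_diff_cancel_left' subset_mset.add_diff_inverse)
  have "(f \<otimes>\<^bsub>mpoly_ring R I\<^esub> g) m = (\<Oplus>k \<in> (\<lambda>k. m - k) ` {k. k \<subseteq># m}. f k \<otimes> g (m - k))"
    unfolding im mpoly_mult ..
  also have "\<dots> = (\<Oplus>k \<in> {k. k \<subseteq># m}. f (m - k) \<otimes> g (m - (m - k)))"
    by (rule add.finprod_reindex[OF _ inj]) (use assms in \<open>simp add: pset_closed\<close>)
  also have "\<dots> = (\<Oplus>k \<in> {k. k \<subseteq># m}. g k \<otimes> f (m - k))"
    using assms by (intro finsum_cong') (auto simp: pset_closed m_comm subset_mset.diff_diff_right)
  finally show "(f \<otimes>\<^bsub>mpoly_ring R I\<^esub> g) m = (g \<otimes>\<^bsub>mpoly_ring R I\<^esub> f) m" by (simp add: mpoly_mult)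
qed

text \<open>Both sides sum over chains \<open>l \<subseteq># k\<close> of submultisets of
  \<open>m\<close>. The inner ranges are padded with zeros to the common range \<open>M\<close>, so
  that the two sums can be exchanged.\<close>

lemma mpoly_mult_assoc:
  assumes "f \<in> indexed_pset I (carrier R)" "g \<in> indexed_pset I (carrier R)" "h \<in> indexed_pset I (carrier R)"
  shows "(f \<otimes>\<^bsub>mpoly_ring R I\<^esub> g) \<otimes>\<^bsub>mpoly_ring R I\<^esub> h = f \<otimes>\<^bsub>mpoly_ring R I\<^esub> (g \<otimes>\<^bsub>mpoly_ring R I\<^esub> h)"
proof
  fix m :: "'c multiset"
  note C = pset_closed[OF assms(1)] pset_closed[OF assms(2)] pset_closed[OF assms(3)]
  define M where "M = {k. k \<subseteq># m}"
  have finM: "finite M" unfolding M_def by (rule finite_submultisets)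
  define t where "t l k = f l \<otimes> g (k - l) \<otimes> h (m - k)" for l k
  have tC: "t l k \<in> carrier R" for l k using C by (simp add: t_def)
  have "((f \<otimes>\<^bsub>mpoly_ring R I\<^esub> g) \<otimes>\<^bsub>mpoly_ring R I\<^esub> h) m
      = (\<Oplus>k\<in>M. \<Oplus>l\<in>M. if l \<subseteq># k then t l k else \<zero>)"
    unfolding mpoly_mult[of I "f \<otimes>\<^bsub>mpoly_ring R I\<^esub> g"] M_def[symmetric]
  proof (rule finsum_cong')
    fix k assume k: "k \<in> M"
    have "(\<Oplus>l\<in>{l. l \<subseteq># k}. f l \<otimes> g (k - l)) \<otimes> h (m - k) = (\<Oplus>l\<in>{l. l \<subseteq># k}. t l k)"
      unfolding t_def by (rule finsum_ldistr) (use C finite_submultisets in auto)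
    also have "\<dots> = (\<Oplus>l\<in>M. if l \<subseteq># k then t l k else \<zero>)"
      by (rule add.finprod_mono_neutral_cong_left)
        (use finM k tC in \<open>auto simp: M_def intro: subset_mset.trans\<close>)
    finally show "(f \<otimes>\<^bsub>mpoly_ring R I\<^esub> g) k \<otimes> h (m - k) = (\<Oplus>l\<in>M. if l \<subseteq># k then t l k else \<zero>)"
      unfolding mpoly_mult .
  qed (use tC in \<open>auto intro!: finsum_closed\<close>)
  also have "\<dots> = (\<Oplus>l\<in>M. \<Oplus>k\<in>M. if l \<subseteq># k then t l k else \<zero>)"
    by (rule finsum_finsum_swap) (use finM tC in simp_all)
  also have "\<dots> = (f \<otimes>\<^bsub>mpoly_ring R I\<^esub> (g \<otimes>\<^bsub>mpoly_ring R I\<^esub> h)) m"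
    unfolding mpoly_mult[of I f] M_def[symmetric]
  proof (rule finsum_cong')
    fix l assume l: "l \<in> M"
    have im: "(\<lambda>j. l + j) ` {j. j \<subseteq># m - l} = {k \<in> M. l \<subseteq># k}"
    proof (intro equalityI subsetI)
      fix k assume "k \<in> (\<lambda>j. l + j) ` {j. j \<subseteq># m - l}"
      then show "k \<in> {k \<in> M. l \<subseteq># k}" using l
        by (auto simp: M_def subset_mset.le_diff_conv2 add.commute)
    next
      fix k assume "k \<in> {k \<in> M. l \<subseteq># k}"
      then show "k \<in> (\<lambda>j. l + j) ` {j. j \<subseteq># m - l}" using l
        by (intro image_eqI[of _ _ "k - l"]) (auto simp: M_def subset_mset.le_diff_conv2 add.commute)
    qed
    have "(\<Oplus>k\<in>M. if l \<subseteq># k then t l k else \<zero>) = (\<Oplus>k\<in>{k \<in> M. l \<subseteq># k}. t l k)"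
      by (rule add.finprod_mono_neutral_cong_right) (use finM tC in auto)
    also have "\<dots> = (\<Oplus>j\<in>{j. j \<subseteq># m - l}. t l (l + j))"
      unfolding im[symmetric] by (rule add.finprod_reindex) (use tC in \<open>auto simp: inj_on_def\<close>)
    also have "\<dots> = (\<Oplus>j\<in>{j. j \<subseteq># m - l}. f l \<otimes> (g j \<otimes> h (m - l - j)))"
      by (rule finsum_cong') (use C in \<open>auto simp: t_def m_assoc\<close>)
    also have "\<dots> = f l \<otimes> (\<Oplus>j\<in>{j. j \<subseteq># m - l}. g j \<otimes> h (m - l - j))"
      by (rule finsum_rdistr[symmetric]) (use C finite_submultisets in auto)
    finally show "(\<Oplus>k\<in>M. if l \<subseteq># k then t l k else \<zero>) = f l \<otimes> (g \<otimes>\<^bsub>mpoly_ring R I\<^esub> h) (m - l)"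
      unfolding mpoly_mult .
  qed (use C submset_sum_closed[OF assms(2,3)] in auto)
  finally show "((f \<otimes>\<^bsub>mpoly_ring R I\<^esub> g) \<otimes>\<^bsub>mpoly_ring R I\<^esub> h) m = (f \<otimes>\<^bsub>mpoly_ring R I\<^esub> (g \<otimes>\<^bsub>mpoly_ring R I\<^esub> h)) m" .
qed

lemma pset_add:
  "f \<in> indexed_pset I (carrier R) \<Longrightarrow> g \<in> indexed_pset I (carrier R)
    \<Longrightarrow> (\<lambda>m. f m \<oplus> g m) \<in> indexed_pset I (carrier R)"
  using indexed_pset.indexed_padd[of f I "carrier R" g] unfolding indexed_padd_def .

lemma mpoly_cring: "cring (mpoly_ring R I)"
proof (rule cringI)
  show "abelian_group (mpoly_ring R I)"
  proof (rule abelian_groupI)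
    fix f assume f: "f \<in> carrier (mpoly_ring R I)"
    have "msupp R (\<lambda>m. \<ominus> f m) = msupp R f" using f by (auto simp: msupp_def pset_iff)
    then have "(\<lambda>m. \<ominus> f m) \<in> carrier (mpoly_ring R I)" using f by (simp add: pset_iff)
    moreover have "(\<lambda>m. \<ominus> f m) \<oplus>\<^bsub>mpoly_ring R I\<^esub> f = \<zero>\<^bsub>mpoly_ring R I\<^esub>"
      using f by (simp add: pset_closed l_neg)
    ultimately show "\<exists>g\<in>carrier (mpoly_ring R I). g \<oplus>\<^bsub>mpoly_ring R I\<^esub> f = \<zero>\<^bsub>mpoly_ring R I\<^esub>" by blast
  qed (use mterm_in_pset[of \<zero> "{#}" I] in \<open>simp_all add: pset_add pset_closed a_ac mterm_def\<close>)
  show "Group.comm_monoid (mpoly_ring R I)"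
  proof (rule comm_monoidI)
    fix f assume f: "f \<in> carrier (mpoly_ring R I)"
    show "\<one>\<^bsub>mpoly_ring R I\<^esub> \<otimes>\<^bsub>mpoly_ring R I\<^esub> f = f"
    proof
      show "(\<one>\<^bsub>mpoly_ring R I\<^esub> \<otimes>\<^bsub>mpoly_ring R I\<^esub> f) m = f m" for m
        using f mterm_mult_left[where c = \<one> and g = f and l = "{#}" and m = m] by (simp add: pset_closed)
    qed
  next
    fix f g assume "f \<in> carrier (mpoly_ring R I)" "g \<in> carrier (mpoly_ring R I)"
    then show "f \<otimes>\<^bsub>mpoly_ring R I\<^esub> g = g \<otimes>\<^bsub>mpoly_ring R I\<^esub> f"
      by (intro mpoly_mult_comm) simp_all
  qed (simp_all add: mpoly_mult_closed mpoly_mult_assoc mterm_in_pset)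
next
  fix f g h assume *: "f \<in> carrier (mpoly_ring R I)" "g \<in> carrier (mpoly_ring R I)" "h \<in> carrier (mpoly_ring R I)"
  show "(f \<oplus>\<^bsub>mpoly_ring R I\<^esub> g) \<otimes>\<^bsub>mpoly_ring R I\<^esub> h
      = f \<otimes>\<^bsub>mpoly_ring R I\<^esub> h \<oplus>\<^bsub>mpoly_ring R I\<^esub> g \<otimes>\<^bsub>mpoly_ring R I\<^esub> h"
  proof
    fix m :: "'c multiset"
    have C: "f k \<in> carrier R" "g k \<in> carrier R" "h k \<in> carrier R" for k using * by (simp_all add: pset_closed)
    have "(\<Oplus>k \<in> {k. k \<subseteq># m}. (f k \<oplus> g k) \<otimes> h (m - k))
        = (\<Oplus>k \<in> {k. k \<subseteq># m}. f k \<otimes> h (m - k) \<oplus> g k \<otimes> h (m - k))"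
      using C by (intro finsum_cong') (simp_all add: l_distr)
    also have "\<dots> = (\<Oplus>k \<in> {k. k \<subseteq># m}. f k \<otimes> h (m - k)) \<oplus> (\<Oplus>k \<in> {k. k \<subseteq># m}. g k \<otimes> h (m - k))"
      using C by (intro finsum_addf) simp_all
    finally show "((f \<oplus>\<^bsub>mpoly_ring R I\<^esub> g) \<otimes>\<^bsub>mpoly_ring R I\<^esub> h) m
      = (f \<otimes>\<^bsub>mpoly_ring R I\<^esub> h \<oplus>\<^bsub>mpoly_ring R I\<^esub> g \<otimes>\<^bsub>mpoly_ring R I\<^esub> h) m"
      by (simp add: mpoly_mult)
  qed
qed

end

section \<open>Weights of monomials and the absence of zero divisors\<close>

definition mweight :: "('c \<Rightarrow> nat) \<Rightarrow> 'c multiset \<Rightarrow> nat" where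
  "mweight w m = sum_mset (image_mset w m)"

lemma mweight_add: "mweight w (a + b) = mweight w a + mweight w b"
  by (simp add: mweight_def)

text \<open>A substitute for a monomial order on finitely many monomials. The variable
  \<open>b\<close> gets weight 1 and all other weights are multiplied by a number \<open>C\<close>
  above every exponent of \<open>b\<close>; quotient and remainder modulo \<open>C\<close> then
  recover both parts of the monomial.\<close>

lemma separating_weight:
  assumes "finite I" "finite A" "\<And>m. m \<in> A \<Longrightarrow> set_mset m \<subseteq> I"
  shows "\<exists>w. inj_on (mweight w) A"
  using assms
proof (induction I arbitrary: A rule: finite_induct)
  case empty
  then have "\<And>m. m \<in> A \<Longrightarrow> m = {#}" by force
  then have "inj_on (mweight (\<lambda>_. 0)) A" by (intro inj_onI) metis
  then show ?case by blast
next
  case (insert b I)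
  define r where "r m = filter_mset (\<lambda>x. x \<noteq> b) m" for m
  have "\<exists>w. inj_on (mweight w) (r ` A)"
  proof (rule insert.IH)
    fix l assume "l \<in> r ` A"
    then obtain m where m: "m \<in> A" "l = r m" by blast
    show "set_mset l \<subseteq> I" using insert.prems(2)[OF m(1)] unfolding m(2) r_def by auto
  qed (use insert.prems(1) in simp)
  then obtain w' where w': "inj_on (mweight w') (r ` A)" by blast
  define C where "C = Suc (\<Sum>m\<in>A. count m b)"
  define w where "w i = (if i = b then 1 else C * w' i)" for i
  have cnt: "count m b < C" if "m \<in> A" for m
    unfolding C_def using member_le_sum[OF that, of "\<lambda>m. count m b"] insert.prems(1) by simp
  have eq: "mweight w m = count m b + C * mweight w' (r m)" for m
    by (induction m) (auto simp: mweight_def w_def r_def algebra_simps)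
  have "inj_on (mweight w) A"
  proof (rule inj_onI)
    fix m l assume ml: "m \<in> A" "l \<in> A" "mweight w m = mweight w l"
    have mm: "mweight w m mod C = count m b" "mweight w m div C = mweight w' (r m)"
      unfolding eq using cnt[OF ml(1)] by auto
    have ll: "mweight w l mod C = count l b" "mweight w l div C = mweight w' (r l)"
      unfolding eq using cnt[OF ml(2)] by auto
    have c: "count m b = count l b" and "mweight w' (r m) = mweight w' (r l)"
      using mm ll ml(3) by simp_all
    then have rr: "r m = r l" using w' ml(1,2) by (auto dest: inj_onD)
    show "m = l"
    proof (rule multiset_eqI)
      fix x
      show "count m x = count l x"
      proof (cases "x = b")
        case False
        then have "count m x = count (r m) x" "count l x = count (r l) x" by (simp_all add: r_def)
        then show ?thesis using rr by simp
      qed (use c in simp)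
    qed
  qed
  then show ?case by blast
qed

lemma finite_arg_max:
  fixes h :: "'i \<Rightarrow> nat"
  assumes "finite S" "S \<noteq> {}"
  shows "\<exists>a\<in>S. \<forall>k\<in>S. h k \<le> h a"
proof -
  have "Max (h ` S) \<in> h ` S" using assms by simp
  then obtain a where "a \<in> S" "Max (h ` S) = h a" by blast
  then show ?thesis using Max_ge[of "h ` S"] assms by force
qed

text \<open>The monomials of largest weight in the two factors multiply to a monomial of the product
  that no other pair reaches, so its coefficient is a product of two nonzero elements.\<close>

lemma (in domain) mpoly_domain:
  assumes I: "finite I"
  shows "domain (mpoly_ring R I)"
proof -
  interpret S: cring "mpoly_ring R I" by (rule mpoly_cring)
  have no_zd: "f = \<zero>\<^bsub>mpoly_ring R I\<^esub> \<or> g = \<zero>\<^bsub>mpoly_ring R I\<^esub>"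
    if fg: "f \<in> carrier (mpoly_ring R I)" "g \<in> carrier (mpoly_ring R I)"
      and z: "f \<otimes>\<^bsub>mpoly_ring R I\<^esub> g = \<zero>\<^bsub>mpoly_ring R I\<^esub>" for f g
  proof (rule ccontr)
    assume nz: "\<not> ?thesis"
    have ne: "msupp R f \<noteq> {}" "msupp R g \<noteq> {}" using nz by (auto simp: msupp_def)
    have fin: "finite (msupp R f)" "finite (msupp R g)" using fg by (simp_all add: pset_iff)
    have "\<exists>w. inj_on (mweight w) (msupp R f \<union> msupp R g)"
      by (rule separating_weight[OF I]) (use fin fg in \<open>auto simp: pset_iff\<close>)
    then obtain w where w: "inj_on (mweight w) (msupp R f \<union> msupp R g)" by blast
    obtain a where a: "a \<in> msupp R f" "\<And>k. k \<in> msupp R f \<Longrightarrow> mweight w k \<le> mweight w a"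
      using finite_arg_max[OF fin(1) ne(1), of "mweight w"] by blast
    obtain b where b: "b \<in> msupp R g" "\<And>k. k \<in> msupp R g \<Longrightarrow> mweight w k \<le> mweight w b"
      using finite_arg_max[OF fin(2) ne(2), of "mweight w"] by blast
    have C: "f k \<in> carrier R" "g k \<in> carrier R" for k using fg by (simp_all add: pset_closed)
    have key: "f k \<otimes> g (a + b - k) = (if a = k then f k \<otimes> g (a + b - k) else \<zero>)" if k: "k \<subseteq># a + b" for k
    proof (cases "f k = \<zero> \<or> g (a + b - k) = \<zero>")
      case False
      then have s: "k \<in> msupp R f" "a + b - k \<in> msupp R g" by (auto simp: msupp_def)
      have "mweight w k + mweight w (a + b - k) = mweight w a + mweight w b"
        using k by (simp add: mweight_add[symmetric])
      then have "mweight w k = mweight w a" using a(2)[OF s(1)] b(2)[OF s(2)] by simp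
      then have "k = a" using w s(1) a(1) by (auto dest: inj_onD)
      then show ?thesis by simp
    qed (use C in auto)
    have "(f \<otimes>\<^bsub>mpoly_ring R I\<^esub> g) (a + b)
        = (\<Oplus>k \<in> {k. k \<subseteq># a + b}. if a = k then f k \<otimes> g (a + b - k) else \<zero>)"
      unfolding mpoly_mult by (rule finsum_cong') (use key C in auto)
    also have "\<dots> = f a \<otimes> g (a + b - a)"
      by (rule finsum_singleton) (use finite_submultisets C in auto)
    finally have "f a \<otimes> g b = \<zero>" using z by simp
    then show False using integral[OF _ C] a(1) b(1) C by (auto simp: msupp_def integral_iff)
  qed
  have "\<one>\<^bsub>mpoly_ring R I\<^esub> \<noteq> \<zero>\<^bsub>mpoly_ring R I\<^esub>"
    using one_not_zero by (auto simp: mterm_def fun_eq_iff)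
  then show ?thesis by (intro domain.intro domain_axioms.intro S.is_cring no_zd) auto
qed

text \<open>The map \<open>h\<close> on coefficients is a parameter because two evaluations into
  \<open>L\<close> occur: the plain one through the embedding \<open>hh\<close>, and the one that
  also raises coefficients to the p-th power.\<close>

locale mpoly_eval = R?: cring R + L?: cring L for R :: "('a, 'm) ring_scheme" (structure) and L :: "('l, 'k) ring_scheme" (structure) +
  fixes I :: "'c set" and h :: "'a \<Rightarrow> 'l" and z :: "'c \<Rightarrow> 'l"
  assumes fin: "finite I" and hom: "h \<in> ring_hom R L" and z: "\<And>i. i \<in> I \<Longrightarrow> z i \<in> carrier L"
begin

definition mon :: "'c multiset \<Rightarrow> 'l" where
  "mon m = (\<Otimes>\<^bsub>L\<^esub>i\<in>I. z i [^]\<^bsub>L\<^esub> count m i)"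

definition ev :: "('c multiset \<Rightarrow> 'a) \<Rightarrow> 'l" where
  "ev f = (\<Oplus>\<^bsub>L\<^esub>m\<in>msupp R f. h (f m) \<otimes>\<^bsub>L\<^esub> mon m)"

abbreviation P where "P \<equiv> mpoly_ring R I"

lemma h_simps [simp]:
  "x \<in> carrier R \<Longrightarrow> h x \<in> carrier L" "h \<zero> = \<zero>\<^bsub>L\<^esub>" "h \<one> = \<one>\<^bsub>L\<^esub>"
  "x \<in> carrier R \<Longrightarrow> y \<in> carrier R \<Longrightarrow> h (x \<oplus> y) = h x \<oplus>\<^bsub>L\<^esub> h y"
  "x \<in> carrier R \<Longrightarrow> y \<in> carrier R \<Longrightarrow> h (x \<otimes> y) = h x \<otimes>\<^bsub>L\<^esub> h y"
  using ring_hom_closed[OF hom] ring_hom_one[OF hom] ring_hom_add[OF hom] ring_hom_mult[OF hom]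
    ring_hom_zero[OF hom R.ring_axioms L.ring_axioms] by simp_all

lemma mon_closed [simp]: "mon m \<in> carrier L"
  unfolding mon_def by (intro L.finprod_closed) (simp add: z)

lemma mon_empty: "mon {#} = \<one>\<^bsub>L\<^esub>"
  unfolding mon_def by simp

lemma mon_add: "mon (a + b) = mon a \<otimes>\<^bsub>L\<^esub> mon b"
proof -
  have "mon (a + b) = (\<Otimes>\<^bsub>L\<^esub>i\<in>I. z i [^]\<^bsub>L\<^esub> count a i \<otimes>\<^bsub>L\<^esub> z i [^]\<^bsub>L\<^esub> count b i)"
    unfolding mon_def by (intro L.finprod_cong') (simp_all add: z L.nat_pow_mult)
  also have "\<dots> = mon a \<otimes>\<^bsub>L\<^esub> mon b"
    unfolding mon_def by (intro L.finprod_multf) (simp_all add: z)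
  finally show ?thesis .
qed

lemma mon_single:
  assumes "i \<in> I"
  shows "mon {#i#} = z i"
proof -
  have "mon {#i#} = (\<Otimes>\<^bsub>L\<^esub>j\<in>I. if i = j then z j else \<one>\<^bsub>L\<^esub>)"
    unfolding mon_def by (intro L.finprod_cong') (auto simp: z)
  also have "\<dots> = z i" by (rule L.finprod_singleton) (use assms fin z in auto)
  finally show ?thesis .
qed

lemma mon_replicate: "i \<in> I \<Longrightarrow> mon (replicate_mset n i) = z i [^]\<^bsub>L\<^esub> n"
proof (induction n)
  case (Suc n)
  have "mon (replicate_mset (Suc n) i) = mon (replicate_mset n i + {#i#})" by simp
  also have "\<dots> = z i [^]\<^bsub>L\<^esub> Suc n" using Suc by (simp only: mon_add mon_single L.nat_pow_Suc)
  finally show ?case .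
qed (simp add: mon_empty)

lemma ev_superset:
  assumes "finite A" "msupp R f \<subseteq> A" "\<And>m. f m \<in> carrier R"
  shows "ev f = (\<Oplus>\<^bsub>L\<^esub>m\<in>A. h (f m) \<otimes>\<^bsub>L\<^esub> mon m)"
  unfolding ev_def
  by (rule L.add.finprod_mono_neutral_cong_left) (use assms in \<open>auto simp: msupp_def\<close>)

lemma ev_closed [simp]: "f \<in> carrier P \<Longrightarrow> ev f \<in> carrier L"
  unfolding ev_def by (intro L.finsum_closed) (simp add: R.pset_closed)

lemma ev_add:
  assumes "f \<in> carrier P" "g \<in> carrier P"
  shows "ev (f \<oplus>\<^bsub>P\<^esub> g) = ev f \<oplus>\<^bsub>L\<^esub> ev g"
proof -
  define A where "A = msupp R f \<union> msupp R g"
  have A: "finite A" using assms by (simp add: A_def R.pset_iff)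
  have C: "f m \<in> carrier R" "g m \<in> carrier R" for m using assms by (simp_all add: R.pset_closed)
  have "ev (f \<oplus>\<^bsub>P\<^esub> g) = (\<Oplus>\<^bsub>L\<^esub>m\<in>A. h ((f \<oplus>\<^bsub>P\<^esub> g) m) \<otimes>\<^bsub>L\<^esub> mon m)"
    by (rule ev_superset[OF A]) (use C in \<open>auto simp: A_def msupp_def\<close>)
  also have "\<dots> = (\<Oplus>\<^bsub>L\<^esub>m\<in>A. h (f m) \<otimes>\<^bsub>L\<^esub> mon m \<oplus>\<^bsub>L\<^esub> h (g m) \<otimes>\<^bsub>L\<^esub> mon m)"
    by (rule L.finsum_cong') (use C in \<open>simp_all add: L.l_distr\<close>)
  also have "\<dots> = (\<Oplus>\<^bsub>L\<^esub>m\<in>A. h (f m) \<otimes>\<^bsub>L\<^esub> mon m) \<oplus>\<^bsub>L\<^esub> (\<Oplus>\<^bsub>L\<^esub>m\<in>A. h (g m) \<otimes>\<^bsub>L\<^esub> mon m)"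
    by (rule L.finsum_addf) (use C in simp_all)
  also have "\<dots> = ev f \<oplus>\<^bsub>L\<^esub> ev g"
    using ev_superset[OF A, of f] ev_superset[OF A, of g] C by (simp add: A_def)
  finally show ?thesis .
qed

lemma ev_mterm:
  assumes "c \<in> carrier R"
  shows "ev (mterm R c m) = h c \<otimes>\<^bsub>L\<^esub> mon m"
proof -
  have "ev (mterm R c m) = (\<Oplus>\<^bsub>L\<^esub>l\<in>{m}. h (mterm R c m l) \<otimes>\<^bsub>L\<^esub> mon l)"
    by (rule ev_superset) (use assms in \<open>auto simp: mterm_def msupp_def split: if_splits\<close>)
  also have "\<dots> = h c \<otimes>\<^bsub>L\<^esub> mon m" using assms by (simp add: mterm_def)
  finally show ?thesis .
qed

text \<open>Multiplication by a single term merely shifts the support. The general product is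
  reduced to this case by induction over the construction of the left factor.\<close>

lemma ev_mterm_mult:
  assumes c: "c \<in> carrier R" and g: "g \<in> carrier P"
  shows "ev (mterm R c l \<otimes>\<^bsub>P\<^esub> g) = h c \<otimes>\<^bsub>L\<^esub> mon l \<otimes>\<^bsub>L\<^esub> ev g"
proof -
  have C: "g m \<in> carrier R" for m using g by (simp add: R.pset_closed)
  note mm = R.mterm_mult_left[where c = c and g = g and l = l, OF c C]
  define A where "A = msupp R g"
  have A: "finite A" using g by (simp add: A_def R.pset_iff)
  have "msupp R (mterm R c l \<otimes>\<^bsub>P\<^esub> g) \<subseteq> (\<lambda>m. l + m) ` A"
  proof
    fix m assume "m \<in> msupp R (mterm R c l \<otimes>\<^bsub>P\<^esub> g)"
    then have m: "l \<subseteq># m" "g (m - l) \<noteq> \<zero>" using c by (auto simp: msupp_def mm split: if_splits)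
    then have "m = l + (m - l)" by simp
    then show "m \<in> (\<lambda>m. l + m) ` A" using m(2) by (intro image_eqI[of _ _ "m - l"]) (simp_all add: A_def msupp_def)
  qed
  then have "ev (mterm R c l \<otimes>\<^bsub>P\<^esub> g)
      = (\<Oplus>\<^bsub>L\<^esub>m\<in>(\<lambda>m. l + m) ` A. h ((mterm R c l \<otimes>\<^bsub>P\<^esub> g) m) \<otimes>\<^bsub>L\<^esub> mon m)"
    by (intro ev_superset) (use A c C in \<open>simp_all add: mm\<close>)
  also have "\<dots> = (\<Oplus>\<^bsub>L\<^esub>m\<in>A. h ((mterm R c l \<otimes>\<^bsub>P\<^esub> g) (l + m)) \<otimes>\<^bsub>L\<^esub> mon (l + m))"
    by (rule L.add.finprod_reindex) (use c C in \<open>auto simp: mm inj_on_def\<close>)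
  also have "\<dots> = (\<Oplus>\<^bsub>L\<^esub>m\<in>A. (h c \<otimes>\<^bsub>L\<^esub> mon l) \<otimes>\<^bsub>L\<^esub> (h (g m) \<otimes>\<^bsub>L\<^esub> mon m))"
    by (rule L.finsum_cong') (use c C in \<open>simp_all add: mm mon_add L.m_ac\<close>)
  also have "\<dots> = (h c \<otimes>\<^bsub>L\<^esub> mon l) \<otimes>\<^bsub>L\<^esub> ev g"
    unfolding ev_def A_def[symmetric] by (rule L.finsum_rdistr[symmetric]) (use A c C in simp_all)
  finally show ?thesis .
qed

lemma pmult_eq: "f \<in> carrier P \<Longrightarrow> R.indexed_pmult f i = mterm R \<one> {#i#} \<otimes>\<^bsub>P\<^esub> f"
proof
  fix m assume f: "f \<in> carrier P"
  then have C: "f m \<in> carrier R" for m by (simp add: R.pset_closed)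
  show "R.indexed_pmult f i m = (mterm R \<one> {#i#} \<otimes>\<^bsub>P\<^esub> f) m"
    using C R.mterm_mult_left[where c = \<one> and g = f and l = "{#i#}" and m = m and I = I]
    by (simp add: R.indexed_pmult_def)
qed

lemma ev_mult:
  assumes "f \<in> carrier P" "g \<in> carrier P"
  shows "ev (f \<otimes>\<^bsub>P\<^esub> g) = ev f \<otimes>\<^bsub>L\<^esub> ev g"
proof -
  interpret P: cring P by (rule R.mpoly_cring)
  have "f \<in> R.indexed_pset I (carrier R)" using assms(1) by simp
  then show ?thesis using assms(2)
  proof (induction f)
    case (indexed_const c)
    then show ?case unfolding R.indexed_const_mterm
      using ev_mterm_mult[of c g "{#}"] ev_mterm[of c "{#}"] by (simp add: mon_empty)
  next
    case (indexed_padd f1 f2)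
    have f: "f1 \<in> carrier P" "f2 \<in> carrier P" using indexed_padd by simp_all
    have "R.indexed_padd f1 f2 = f1 \<oplus>\<^bsub>P\<^esub> f2" by (simp add: R.indexed_padd_def)
    then show ?case using f indexed_padd P.l_distr[OF f indexed_padd.prems]
      by (simp only: ev_add P.m_closed P.a_closed ev_closed L.l_distr)
  next
    case (indexed_pmult f i)
    have f: "f \<in> carrier P" using indexed_pmult by simp
    have v: "mterm R \<one> {#i#} \<in> carrier P" using indexed_pmult(2) by (simp add: R.mterm_in_pset)
    show ?case unfolding pmult_eq[OF f]
      using indexed_pmult f by (simp only: P.m_assoc[OF v f indexed_pmult.prems] ev_mterm_mult
          R.one_closed P.m_closed L.m_assoc[OF _ ev_closed[OF f] ev_closed[OF indexed_pmult.prems]]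
          L.m_closed h_simps mon_closed L.one_closed)
  qed
qed

lemma ev_hom: "ring_hom_cring P L ev"
proof -
  interpret P: cring P by (rule R.mpoly_cring)
  have "ev \<one>\<^bsub>P\<^esub> = \<one>\<^bsub>L\<^esub>" using ev_mterm[of \<one> "{#}"] by (simp add: mon_empty)
  then have "ev \<in> ring_hom P L"
    by (intro ring_hom_memI ev_closed ev_mult ev_add) 
  then show ?thesis by unfold_locales
qed

lemma ev_const: "c \<in> carrier R \<Longrightarrow> ev (R.indexed_const c) = h c"
  unfolding R.indexed_const_mterm by (simp add: ev_mterm mon_empty)

lemma ev_var: "i \<in> I \<Longrightarrow> ev (R.indexed_var i) = z i"
  unfolding R.indexed_var_mterm by (simp add: ev_mterm mon_single z)

end

section \<open>Homogeneous fractions\<close>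

text \<open>Only products of homogeneous elements have to be nonzero. This suffices for homogeneous
  fractions, and it is what can be read off from a map that is injective on each graded piece.
  Taking the whole ring as every piece gives the ordinary field of fractions of a domain.\<close>

locale hfrac_domain = cring S for S :: "('s, 'k) ring_scheme" (structure) +
  fixes G :: "nat \<Rightarrow> 's set"
  assumes G_carrier: "G d \<subseteq> carrier S" and G_one: "\<one> \<in> G 0" and G_zero: "\<zero> \<in> G d"
    and G_mult: "s \<in> G d \<Longrightarrow> t \<in> G e \<Longrightarrow> s \<otimes> t \<in> G (d + e)"
    and G_add: "s \<in> G d \<Longrightarrow> t \<in> G d \<Longrightarrow> s \<oplus> t \<in> G d"
    and G_neg: "s \<in> G d \<Longrightarrow> \<ominus> s \<in> G d"
    and G_integral: "s \<in> G d \<Longrightarrow> t \<in> G e \<Longrightarrow> s \<otimes> t = \<zero> \<Longrightarrow> s = \<zero> \<or> t = \<zero>"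
    and S_one: "\<one> \<noteq> \<zero>"
begin

abbreviation Pr where "Pr \<equiv> hfrac_pairs S G"
abbreviation K where "K \<equiv> hfrac_field S G"

lemma pairD:
  assumes "(s, t) \<in> Pr"
  shows "s \<in> carrier S" "t \<in> carrier S" "t \<noteq> \<zero>" "\<exists>d. s \<in> G d \<and> t \<in> G d"
  using assms G_carrier unfolding hfrac_pairs_def by auto

lemma pairI: "s \<in> G d \<Longrightarrow> t \<in> G d \<Longrightarrow> t \<noteq> \<zero> \<Longrightarrow> (s, t) \<in> Pr"
  unfolding hfrac_pairs_def by auto

lemma rel_iff: "((s, t), (s', t')) \<in> hfrac_rel S G \<longleftrightarrow> (s, t) \<in> Pr \<and> (s', t') \<in> Pr \<and> s \<otimes> t' = s' \<otimes> t"
  unfolding hfrac_rel_def by auto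

text \<open>The factor \<open>t1\<close> has to be cancelled; the difference of the two remaining
  products is homogeneous, so \<open>G_integral\<close> applies to it.\<close>

lemma rel_trans:
  assumes "(s, t) \<in> Pr" "(s1, t1) \<in> Pr" "(s2, t2) \<in> Pr" "s \<otimes> t1 = s1 \<otimes> t" "s1 \<otimes> t2 = s2 \<otimes> t1"
  shows "s \<otimes> t2 = s2 \<otimes> t"
proof -
  note C = pairD(1,2)[OF assms(1)] pairD(1,2)[OF assms(2)] pairD(1,2)[OF assms(3)]
  obtain d where d: "s \<in> G d" "t \<in> G d" using pairD(4)[OF assms(1)] by blast
  obtain d1 where d1: "s1 \<in> G d1" "t1 \<in> G d1" using pairD(4)[OF assms(2)] by blast
  obtain d2 where d2: "s2 \<in> G d2" "t2 \<in> G d2" using pairD(4)[OF assms(3)] by blast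
  have "t1 \<otimes> (s \<otimes> t2) = (s \<otimes> t1) \<otimes> t2" using C by (simp add: m_ac)
  also have "\<dots> = (s1 \<otimes> t2) \<otimes> t" unfolding assms(4) using C by (simp add: m_ac)
  also have "\<dots> = t1 \<otimes> (s2 \<otimes> t)" unfolding assms(5) using C by (simp add: m_ac)
  finally have e: "t1 \<otimes> (s \<otimes> t2) = t1 \<otimes> (s2 \<otimes> t)" .
  have "t1 \<otimes> (s \<otimes> t2 \<oplus> \<ominus> (s2 \<otimes> t)) = t1 \<otimes> (s \<otimes> t2) \<oplus> \<ominus> (t1 \<otimes> (s2 \<otimes> t))"
    using C by (simp add: r_distr r_minus)
  then have "t1 \<otimes> (s \<otimes> t2 \<oplus> \<ominus> (s2 \<otimes> t)) = \<zero>" using e C by (simp add: r_neg)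
  moreover have "s \<otimes> t2 \<oplus> \<ominus> (s2 \<otimes> t) \<in> G (d + d2)"
    using G_mult[OF d(1) d2(2)] G_mult[OF d2(1) d(2)] by (intro G_add G_neg) (simp_all add: add.commute)
  ultimately have "s \<otimes> t2 \<oplus> \<ominus> (s2 \<otimes> t) = \<zero>" using G_integral[OF d1(2)] pairD(3)[OF assms(2)] by blast
  then have "\<ominus> (\<ominus> (s2 \<otimes> t)) = s \<otimes> t2" using C by (intro minus_equality) auto
  then show ?thesis using C by simp
qed

lemma hfrac_eq_iff:
  assumes "(s, t) \<in> Pr" "(s', t') \<in> Pr"
  shows "hfrac S G s t = hfrac S G s' t' \<longleftrightarrow> s \<otimes> t' = s' \<otimes> t"
proof
  assume e: "hfrac S G s t = hfrac S G s' t'"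
  have "(s', t') \<in> hfrac S G s' t'" using assms by (simp add: hfrac_def rel_iff)
  then show "s \<otimes> t' = s' \<otimes> t" unfolding e[symmetric] by (simp add: hfrac_def rel_iff)
next
  assume e: "s \<otimes> t' = s' \<otimes> t"
  have "(x, y) \<in> hfrac S G s t \<longleftrightarrow> (x, y) \<in> hfrac S G s' t'" for x y
  proof (cases "(x, y) \<in> Pr")
    case True
    then show ?thesis
      using rel_trans[OF assms(2,1) True e[symmetric]] rel_trans[OF assms True e] assms
      by (auto simp: hfrac_def rel_iff)
  qed (simp add: hfrac_def rel_iff)
  then show "hfrac S G s t = hfrac S G s' t'" by auto
qed

lemma hfrac_carrier [simp]: "(s, t) \<in> Pr \<Longrightarrow> hfrac S G s t \<in> carrier K"
  unfolding hfrac_field_def hfrac_def by (simp add: quotientI)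

lemma hfrac_cases:
  assumes "A \<in> carrier K"
  obtains s t where "(s, t) \<in> Pr" "A = hfrac S G s t"
  using assms unfolding hfrac_field_def hfrac_def by (auto elim!: quotientE)

lemma hfrac_mem: "(s, t) \<in> Pr \<Longrightarrow> (x, y) \<in> hfrac S G s t \<longleftrightarrow> (x, y) \<in> Pr \<and> hfrac S G x y = hfrac S G s t"
proof -
  assume st: "(s, t) \<in> Pr"
  have "(x, y) \<in> hfrac S G s t \<longleftrightarrow> (x, y) \<in> Pr \<and> s \<otimes> y = x \<otimes> t" using st by (simp add: hfrac_def rel_iff)
  then show ?thesis using hfrac_eq_iff[OF _ st, of x y] by metis
qed

lemma pair_mult: "(s, t) \<in> Pr \<Longrightarrow> (s', t') \<in> Pr \<Longrightarrow> (s \<otimes> s', t \<otimes> t') \<in> Pr"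
proof -
  assume a: "(s, t) \<in> Pr" "(s', t') \<in> Pr"
  obtain d d' where d: "s \<in> G d" "t \<in> G d" "s' \<in> G d'" "t' \<in> G d'"
    using pairD(4)[OF a(1)] pairD(4)[OF a(2)] by blast
  have "t \<otimes> t' \<noteq> \<zero>" using G_integral[OF d(2,4)] pairD(3)[OF a(1)] pairD(3)[OF a(2)] by blast
  then show ?thesis using G_mult[OF d(1,3)] G_mult[OF d(2,4)] by (rule pairI[rotated 2])
qed

lemma pair_add: "(s, t) \<in> Pr \<Longrightarrow> (s', t') \<in> Pr \<Longrightarrow> (s \<otimes> t' \<oplus> s' \<otimes> t, t \<otimes> t') \<in> Pr"
proof -
  assume a: "(s, t) \<in> Pr" "(s', t') \<in> Pr"
  obtain d d' where d: "s \<in> G d" "t \<in> G d" "s' \<in> G d'" "t' \<in> G d'"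
    using pairD(4)[OF a(1)] pairD(4)[OF a(2)] by blast
  have "t \<otimes> t' \<noteq> \<zero>" using G_integral[OF d(2,4)] pairD(3)[OF a(1)] pairD(3)[OF a(2)] by blast
  moreover have "s \<otimes> t' \<oplus> s' \<otimes> t \<in> G (d + d')"
    using G_add[OF G_mult[OF d(1,4)], of "s' \<otimes> t"] G_mult[OF d(3,2)] by (simp add: add.commute)
  ultimately show ?thesis using G_mult[OF d(2,4)] pairI by blast
qed

text \<open>The operations of \<open>hfrac_field\<close> are unions over all representatives. When
  the result does not depend on them, all members of the union coincide.\<close>

lemma Union_const:
  assumes "\<And>x y x' y'. (x, y) \<in> A \<Longrightarrow> (x', y') \<in> C \<Longrightarrow> f x y x' y' = v" "(s, t) \<in> A" "(s', t') \<in> C"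
  shows "(\<Union>(s, t) \<in> A. \<Union>(s', t') \<in> C. f s t s' t') = v"
proof -
  have "(\<Union>(s, t) \<in> A. \<Union>(s', t') \<in> C. f s t s' t') = (\<Union>a \<in> A. \<Union>c \<in> C. v)"
    using assms(1) by (intro SUP_cong refl) (auto split: prod.splits)
  also have "\<dots> = v" using assms(2,3) by auto
  finally show ?thesis .
qed

lemma hfrac_mult:
  assumes "(s, t) \<in> Pr" "(s', t') \<in> Pr"
  shows "hfrac S G s t \<otimes>\<^bsub>K\<^esub> hfrac S G s' t' = hfrac S G (s \<otimes> s') (t \<otimes> t')"
proof -
  have "hfrac S G (x \<otimes> x') (y \<otimes> y') = hfrac S G (s \<otimes> s') (t \<otimes> t')"
    if "(x, y) \<in> hfrac S G s t" "(x', y') \<in> hfrac S G s' t'" for x y x' y'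
  proof -
    have p: "(x, y) \<in> Pr" "(x', y') \<in> Pr" and e: "x \<otimes> t = s \<otimes> y" "x' \<otimes> t' = s' \<otimes> y'"
      using that assms hfrac_eq_iff by (auto simp: hfrac_mem)
    note C = pairD(1,2)[OF p(1)] pairD(1,2)[OF p(2)] pairD(1,2)[OF assms(1)] pairD(1,2)[OF assms(2)]
    have "(x \<otimes> x') \<otimes> (t \<otimes> t') = (x \<otimes> t) \<otimes> (x' \<otimes> t')" using C by (simp add: m_ac)
    also have "\<dots> = (s \<otimes> s') \<otimes> (y \<otimes> y')" unfolding e using C by (simp add: m_ac)
    finally show ?thesis using hfrac_eq_iff[OF pair_mult[OF p] pair_mult[OF assms]] by simp
  qed
  moreover have "(s, t) \<in> hfrac S G s t" "(s', t') \<in> hfrac S G s' t'" using assms by (simp_all add: hfrac_mem)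
  ultimately have "(\<Union>(s, t) \<in> hfrac S G s t. \<Union>(s', t') \<in> hfrac S G s' t'. hfrac S G (s \<otimes> s') (t \<otimes> t'))
      = hfrac S G (s \<otimes> s') (t \<otimes> t')"
    by (rule Union_const)
  then show ?thesis by (simp add: hfrac_field_def)
qed

lemma hfrac_add:
  assumes "(s, t) \<in> Pr" "(s', t') \<in> Pr"
  shows "hfrac S G s t \<oplus>\<^bsub>K\<^esub> hfrac S G s' t' = hfrac S G (s \<otimes> t' \<oplus> s' \<otimes> t) (t \<otimes> t')"
proof -
  have "hfrac S G (x \<otimes> y' \<oplus> x' \<otimes> y) (y \<otimes> y') = hfrac S G (s \<otimes> t' \<oplus> s' \<otimes> t) (t \<otimes> t')"
    if "(x, y) \<in> hfrac S G s t" "(x', y') \<in> hfrac S G s' t'" for x y x' y'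
  proof -
    have p: "(x, y) \<in> Pr" "(x', y') \<in> Pr" and e: "x \<otimes> t = s \<otimes> y" "x' \<otimes> t' = s' \<otimes> y'"
      using that assms hfrac_eq_iff by (auto simp: hfrac_mem)
    note C = pairD(1,2)[OF p(1)] pairD(1,2)[OF p(2)] pairD(1,2)[OF assms(1)] pairD(1,2)[OF assms(2)]
    have "(x \<otimes> y' \<oplus> x' \<otimes> y) \<otimes> (t \<otimes> t') = (x \<otimes> t) \<otimes> (y' \<otimes> t') \<oplus> (x' \<otimes> t') \<otimes> (y \<otimes> t)"
      using C by (simp add: l_distr r_distr m_ac)
    also have "\<dots> = (s \<otimes> t' \<oplus> s' \<otimes> t) \<otimes> (y \<otimes> y')" unfolding e using C by (simp add: l_distr r_distr m_ac)
    finally show ?thesis using hfrac_eq_iff[OF pair_add[OF p] pair_add[OF assms]] by simp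
  qed
  moreover have "(s, t) \<in> hfrac S G s t" "(s', t') \<in> hfrac S G s' t'" using assms by (simp_all add: hfrac_mem)
  ultimately have "(\<Union>(s, t) \<in> hfrac S G s t. \<Union>(s', t') \<in> hfrac S G s' t'.
      hfrac S G (s \<otimes> t' \<oplus> s' \<otimes> t) (t \<otimes> t')) = hfrac S G (s \<otimes> t' \<oplus> s' \<otimes> t) (t \<otimes> t')"
    by (rule Union_const)
  then show ?thesis by (simp add: hfrac_field_def)
qed

lemma one_pair: "(\<one>, \<one>) \<in> Pr" "(\<zero>, \<one>) \<in> Pr"
  using pairI[OF G_one G_one S_one] pairI[OF G_zero G_one S_one] by auto

lemma K_one: "\<one>\<^bsub>K\<^esub> = hfrac S G \<one> \<one>" and K_zero: "\<zero>\<^bsub>K\<^esub> = hfrac S G \<zero> \<one>"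
  by (simp_all add: hfrac_field_def)

lemma hfrac_zero_iff: "(s, t) \<in> Pr \<Longrightarrow> hfrac S G s t = \<zero>\<^bsub>K\<^esub> \<longleftrightarrow> s = \<zero>"
  unfolding K_zero using hfrac_eq_iff[OF _ one_pair(2)] pairD(1,2) by simp

lemma hfrac_field: "field K"
proof -
  have cr: "cring K"
  proof (rule cringI)
    show "abelian_group K"
    proof (rule abelian_groupI)
      fix A B C assume ABC: "A \<in> carrier K" "B \<in> carrier K" "C \<in> carrier K"
      obtain a a' where A: "(a, a') \<in> Pr" "A = hfrac S G a a'" by (rule hfrac_cases[OF ABC(1)])
      obtain b b' where B: "(b, b') \<in> Pr" "B = hfrac S G b b'" by (rule hfrac_cases[OF ABC(2)])
      obtain c c' where C: "(c, c') \<in> Pr" "C = hfrac S G c c'" by (rule hfrac_cases[OF ABC(3)])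
      note S = pairD(1,2)[OF A(1)] pairD(1,2)[OF B(1)] pairD(1,2)[OF C(1)]
      show "A \<oplus>\<^bsub>K\<^esub> B \<oplus>\<^bsub>K\<^esub> C = A \<oplus>\<^bsub>K\<^esub> (B \<oplus>\<^bsub>K\<^esub> C)"
        unfolding A(2) B(2) C(2) hfrac_add[OF A(1) B(1)] hfrac_add[OF B(1) C(1)]
          hfrac_add[OF pair_add[OF A(1) B(1)] C(1)] hfrac_add[OF A(1) pair_add[OF B(1) C(1)]]
        using S by (simp add: l_distr r_distr m_ac a_ac)
      show "A \<oplus>\<^bsub>K\<^esub> B = B \<oplus>\<^bsub>K\<^esub> A"
        unfolding A(2) B(2) hfrac_add[OF A(1) B(1)] hfrac_add[OF B(1) A(1)] using S by (simp add: m_ac a_ac)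
      show "A \<oplus>\<^bsub>K\<^esub> B \<in> carrier K"
        unfolding A(2) B(2) hfrac_add[OF A(1) B(1)] by (rule hfrac_carrier[OF pair_add[OF A(1) B(1)]])
      show "\<zero>\<^bsub>K\<^esub> \<oplus>\<^bsub>K\<^esub> A = A"
        unfolding A(2) K_zero hfrac_add[OF one_pair(2) A(1)] using S by simp
      obtain d where d: "a \<in> G d" "a' \<in> G d" using pairD(4)[OF A(1)] by blast
      have n: "(\<ominus> a, a') \<in> Pr" using G_neg[OF d(1)] d(2) pairD(3)[OF A(1)] by (rule pairI)
      have "hfrac S G (\<ominus> a) a' \<oplus>\<^bsub>K\<^esub> A = \<zero>\<^bsub>K\<^esub>"
        unfolding A(2) hfrac_add[OF n A(1)] hfrac_zero_iff[OF pair_add[OF n A(1)]]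
        using S by (simp add: l_minus l_neg)
      then show "\<exists>B\<in>carrier K. B \<oplus>\<^bsub>K\<^esub> A = \<zero>\<^bsub>K\<^esub>" using hfrac_carrier[OF n] by blast
    qed (use one_pair(2) in \<open>simp add: K_zero\<close>)
    show "Group.comm_monoid K"
    proof (rule comm_monoidI)
      fix A B C assume ABC: "A \<in> carrier K" "B \<in> carrier K" "C \<in> carrier K"
      obtain a a' where A: "(a, a') \<in> Pr" "A = hfrac S G a a'" by (rule hfrac_cases[OF ABC(1)])
      obtain b b' where B: "(b, b') \<in> Pr" "B = hfrac S G b b'" by (rule hfrac_cases[OF ABC(2)])
      obtain c c' where C: "(c, c') \<in> Pr" "C = hfrac S G c c'" by (rule hfrac_cases[OF ABC(3)])
      note S = pairD(1,2)[OF A(1)] pairD(1,2)[OF B(1)] pairD(1,2)[OF C(1)]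
      show "A \<otimes>\<^bsub>K\<^esub> B \<otimes>\<^bsub>K\<^esub> C = A \<otimes>\<^bsub>K\<^esub> (B \<otimes>\<^bsub>K\<^esub> C)"
        unfolding A(2) B(2) C(2) hfrac_mult[OF A(1) B(1)] hfrac_mult[OF B(1) C(1)]
          hfrac_mult[OF pair_mult[OF A(1) B(1)] C(1)] hfrac_mult[OF A(1) pair_mult[OF B(1) C(1)]]
        using S by (simp add: m_ac)
      show "A \<otimes>\<^bsub>K\<^esub> B = B \<otimes>\<^bsub>K\<^esub> A"
        unfolding A(2) B(2) hfrac_mult[OF A(1) B(1)] hfrac_mult[OF B(1) A(1)] using S by (simp add: m_ac)
      show "A \<otimes>\<^bsub>K\<^esub> B \<in> carrier K"
        unfolding A(2) B(2) hfrac_mult[OF A(1) B(1)] by (rule hfrac_carrier[OF pair_mult[OF A(1) B(1)]])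
      show "\<one>\<^bsub>K\<^esub> \<otimes>\<^bsub>K\<^esub> A = A"
        unfolding A(2) K_one hfrac_mult[OF one_pair(1) A(1)] using S by simp
    qed (use one_pair(1) in \<open>simp add: K_one\<close>)
    fix A B C assume ABC: "A \<in> carrier K" "B \<in> carrier K" "C \<in> carrier K"
    obtain a a' where A: "(a, a') \<in> Pr" "A = hfrac S G a a'" by (rule hfrac_cases[OF ABC(1)])
    obtain b b' where B: "(b, b') \<in> Pr" "B = hfrac S G b b'" by (rule hfrac_cases[OF ABC(2)])
    obtain c c' where C: "(c, c') \<in> Pr" "C = hfrac S G c c'" by (rule hfrac_cases[OF ABC(3)])
    note S = pairD(1,2)[OF A(1)] pairD(1,2)[OF B(1)] pairD(1,2)[OF C(1)]
    show "(A \<oplus>\<^bsub>K\<^esub> B) \<otimes>\<^bsub>K\<^esub> C = A \<otimes>\<^bsub>K\<^esub> C \<oplus>\<^bsub>K\<^esub> B \<otimes>\<^bsub>K\<^esub> C"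
      unfolding A(2) B(2) C(2) hfrac_add[OF A(1) B(1)] hfrac_mult[OF pair_add[OF A(1) B(1)] C(1)]
        hfrac_mult[OF A(1) C(1)] hfrac_mult[OF B(1) C(1)] hfrac_add[OF pair_mult[OF A(1) C(1)] pair_mult[OF B(1) C(1)]]
        hfrac_eq_iff[OF pair_mult[OF pair_add[OF A(1) B(1)] C(1)] pair_add[OF pair_mult[OF A(1) C(1)] pair_mult[OF B(1) C(1)]]]
      using S by (simp add: l_distr r_distr m_ac)
  qed
  have ne: "\<zero>\<^bsub>K\<^esub> \<noteq> \<one>\<^bsub>K\<^esub>" using hfrac_zero_iff[OF one_pair(1)] S_one K_one by auto
  show ?thesis
  proof (rule cring.cring_fieldI2[OF cr ne])
    fix A assume AK: "A \<in> carrier K" "A \<noteq> \<zero>\<^bsub>K\<^esub>"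
    obtain a a' where A: "(a, a') \<in> Pr" "A = hfrac S G a a'" by (rule hfrac_cases[OF AK(1)])
    obtain d where d: "a \<in> G d" "a' \<in> G d" using pairD(4)[OF A(1)] by blast
    have "a \<noteq> \<zero>" using AK(2) hfrac_zero_iff[OF A(1)] A(2) by auto
    then have i: "(a', a) \<in> Pr" using d by (intro pairI)
    have "A \<otimes>\<^bsub>K\<^esub> hfrac S G a' a = \<one>\<^bsub>K\<^esub>"
      unfolding A(2) hfrac_mult[OF A(1) i] K_one hfrac_eq_iff[OF pair_mult[OF A(1) i] one_pair(1)]
      using pairD(1,2)[OF A(1)] by (simp add: m_comm)
    then show "\<exists>B\<in>carrier K. A \<otimes>\<^bsub>K\<^esub> B = \<one>\<^bsub>K\<^esub>" using hfrac_carrier[OF i] by blast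
  qed
qed

text \<open>\<open>e\<close> has to respect the operations only on graded pieces and to be nonzero
  on nonzero homogeneous elements. The quotient of the two values is then independent of the
  representative, by cross multiplication.\<close>

lemma hfrac_embedding:
  assumes L: "field L" and e: "\<And>d s. s \<in> G d \<Longrightarrow> e s \<in> carrier L" "e \<one> = \<one>\<^bsub>L\<^esub>"
    "\<And>d s t. s \<in> G d \<Longrightarrow> t \<in> G d \<Longrightarrow> e (s \<oplus> t) = e s \<oplus>\<^bsub>L\<^esub> e t"
    "\<And>d d' s t. s \<in> G d \<Longrightarrow> t \<in> G d' \<Longrightarrow> e (s \<otimes> t) = e s \<otimes>\<^bsub>L\<^esub> e t"
    "\<And>d s. s \<in> G d \<Longrightarrow> s \<noteq> \<zero> \<Longrightarrow> e s \<noteq> \<zero>\<^bsub>L\<^esub>"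
  obtains \<theta> where "\<theta> \<in> ring_hom K L" "\<And>s t. (s, t) \<in> Pr \<Longrightarrow> \<theta> (hfrac S G s t) = e s \<otimes>\<^bsub>L\<^esub> inv\<^bsub>L\<^esub> (e t)"
proof -
  interpret L: field L by (rule L)
  have eC: "e s \<in> carrier L" "e t \<in> carrier L" "e t \<in> Units L" if pr: "(s, t) \<in> Pr" for s t
  proof -
    obtain d where d: "s \<in> G d" "t \<in> G d" using pairD(4)[OF pr] by blast
    show "e s \<in> carrier L" "e t \<in> carrier L" using d e(1) by blast+
    then show "e t \<in> Units L" using e(5)[OF d(2) pairD(3)[OF pr]] by (simp add: L.field_Units)
  qed
  have wd: "e s \<otimes>\<^bsub>L\<^esub> inv\<^bsub>L\<^esub> (e t) = e s' \<otimes>\<^bsub>L\<^esub> inv\<^bsub>L\<^esub> (e t')"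
    if p: "(s, t) \<in> Pr" "(s', t') \<in> Pr" and eq: "hfrac S G s t = hfrac S G s' t'" for s t s' t'
  proof -
    obtain d d' where d: "s \<in> G d" "t \<in> G d" "s' \<in> G d'" "t' \<in> G d'"
      using pairD(4)[OF p(1)] pairD(4)[OF p(2)] by blast
    note C = eC[OF p(1)] eC[OF p(2)]
    have "s \<otimes> t' = s' \<otimes> t" using eq hfrac_eq_iff[OF p] by simp
    then have x: "e s \<otimes>\<^bsub>L\<^esub> e t' = e s' \<otimes>\<^bsub>L\<^esub> e t" using e(4)[OF d(1,4)] e(4)[OF d(3,2)] by simp
    have r: "e t' \<otimes>\<^bsub>L\<^esub> (inv\<^bsub>L\<^esub> (e t') \<otimes>\<^bsub>L\<^esub> inv\<^bsub>L\<^esub> (e t)) = inv\<^bsub>L\<^esub> (e t)"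
      "e t \<otimes>\<^bsub>L\<^esub> (inv\<^bsub>L\<^esub> (e t) \<otimes>\<^bsub>L\<^esub> inv\<^bsub>L\<^esub> (e t')) = inv\<^bsub>L\<^esub> (e t')"
      using C by (simp_all add: L.m_assoc[symmetric])
    have "e s \<otimes>\<^bsub>L\<^esub> inv\<^bsub>L\<^esub> (e t) = (e s \<otimes>\<^bsub>L\<^esub> e t') \<otimes>\<^bsub>L\<^esub> (inv\<^bsub>L\<^esub> (e t') \<otimes>\<^bsub>L\<^esub> inv\<^bsub>L\<^esub> (e t))"
      using C r(1) by (simp add: L.m_assoc)
    also have "\<dots> = e s' \<otimes>\<^bsub>L\<^esub> (e t \<otimes>\<^bsub>L\<^esub> (inv\<^bsub>L\<^esub> (e t) \<otimes>\<^bsub>L\<^esub> inv\<^bsub>L\<^esub> (e t')))"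
      unfolding x using C L.m_comm[of "inv\<^bsub>L\<^esub> (e t')" "inv\<^bsub>L\<^esub> (e t)"] by (simp add: L.m_assoc)
    also have "\<dots> = e s' \<otimes>\<^bsub>L\<^esub> inv\<^bsub>L\<^esub> (e t')" unfolding r(2) ..
    finally show ?thesis .
  qed
  define \<theta> where "\<theta> A = (THE v. \<exists>s t. (s, t) \<in> Pr \<and> A = hfrac S G s t \<and> v = e s \<otimes>\<^bsub>L\<^esub> inv\<^bsub>L\<^esub> (e t))" for A
  have th: "\<theta> (hfrac S G s t) = e s \<otimes>\<^bsub>L\<^esub> inv\<^bsub>L\<^esub> (e t)" if "(s, t) \<in> Pr" for s t
    unfolding \<theta>_def using that wd by (intro the_equality) blast+
  have "\<theta> \<in> ring_hom K L"
  proof (rule ring_hom_memI)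
    show "\<theta> \<one>\<^bsub>K\<^esub> = \<one>\<^bsub>L\<^esub>" unfolding K_one th[OF one_pair(1)] e(2) by simp
    fix A assume A0: "A \<in> carrier K"
    obtain a a' where A: "(a, a') \<in> Pr" "A = hfrac S G a a'" by (rule hfrac_cases[OF A0])
    note CA = eC[OF A(1)]
    obtain d where d: "a \<in> G d" "a' \<in> G d" using pairD(4)[OF A(1)] by blast
    show "\<theta> A \<in> carrier L" unfolding A(2) th[OF A(1)] using CA by simp
    fix B assume B0: "B \<in> carrier K"
    obtain b b' where B: "(b, b') \<in> Pr" "B = hfrac S G b b'" by (rule hfrac_cases[OF B0])
    note CB = eC[OF B(1)]
    obtain d' where d': "b \<in> G d'" "b' \<in> G d'" using pairD(4)[OF B(1)] by blast
    have inv: "inv\<^bsub>L\<^esub> (e a' \<otimes>\<^bsub>L\<^esub> e b') = inv\<^bsub>L\<^esub> (e a') \<otimes>\<^bsub>L\<^esub> inv\<^bsub>L\<^esub> (e b')"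
    proof (rule L.comm_inv_char)
      have "(e a' \<otimes>\<^bsub>L\<^esub> e b') \<otimes>\<^bsub>L\<^esub> (inv\<^bsub>L\<^esub> (e a') \<otimes>\<^bsub>L\<^esub> inv\<^bsub>L\<^esub> (e b'))
          = (e a' \<otimes>\<^bsub>L\<^esub> inv\<^bsub>L\<^esub> (e a')) \<otimes>\<^bsub>L\<^esub> (e b' \<otimes>\<^bsub>L\<^esub> inv\<^bsub>L\<^esub> (e b'))"
        using CA CB by (simp add: L.m_ac del: L.Units_r_inv L.Units_l_inv)
      then show "e a' \<otimes>\<^bsub>L\<^esub> e b' \<otimes>\<^bsub>L\<^esub> (inv\<^bsub>L\<^esub> (e a') \<otimes>\<^bsub>L\<^esub> inv\<^bsub>L\<^esub> (e b')) = \<one>\<^bsub>L\<^esub>"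
        using CA CB by simp
    qed (use CA CB in simp_all)
    show "\<theta> (A \<otimes>\<^bsub>K\<^esub> B) = \<theta> A \<otimes>\<^bsub>L\<^esub> \<theta> B"
      unfolding A(2) B(2) hfrac_mult[OF A(1) B(1)] th[OF A(1)] th[OF B(1)] th[OF pair_mult[OF A(1) B(1)]]
        e(4)[OF d(1) d'(1)] e(4)[OF d(2) d'(2)] inv using CA CB by (simp add: L.m_ac)
    have m2: "b \<otimes> a' \<in> G (d + d')" using G_mult[OF d'(1) d(2)] by (simp add: add.commute)
    have cancel: "(x \<otimes>\<^bsub>L\<^esub> y) \<otimes>\<^bsub>L\<^esub> (v \<otimes>\<^bsub>L\<^esub> inv\<^bsub>L\<^esub> y) = x \<otimes>\<^bsub>L\<^esub> v"
      if "x \<in> carrier L" "y \<in> Units L" "v \<in> carrier L" for x y v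
    proof -
      have "(x \<otimes>\<^bsub>L\<^esub> y) \<otimes>\<^bsub>L\<^esub> (v \<otimes>\<^bsub>L\<^esub> inv\<^bsub>L\<^esub> y) = (x \<otimes>\<^bsub>L\<^esub> v) \<otimes>\<^bsub>L\<^esub> (y \<otimes>\<^bsub>L\<^esub> inv\<^bsub>L\<^esub> y)"
        using that by (simp add: L.m_ac L.Units_closed del: L.Units_r_inv L.Units_l_inv)
      then show ?thesis using that by simp
    qed
    have "(e a \<otimes>\<^bsub>L\<^esub> e b' \<oplus>\<^bsub>L\<^esub> e b \<otimes>\<^bsub>L\<^esub> e a') \<otimes>\<^bsub>L\<^esub> (inv\<^bsub>L\<^esub> (e a') \<otimes>\<^bsub>L\<^esub> inv\<^bsub>L\<^esub> (e b'))
        = (e a \<otimes>\<^bsub>L\<^esub> e b') \<otimes>\<^bsub>L\<^esub> (inv\<^bsub>L\<^esub> (e a') \<otimes>\<^bsub>L\<^esub> inv\<^bsub>L\<^esub> (e b'))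
          \<oplus>\<^bsub>L\<^esub> (e b \<otimes>\<^bsub>L\<^esub> e a') \<otimes>\<^bsub>L\<^esub> (inv\<^bsub>L\<^esub> (e b') \<otimes>\<^bsub>L\<^esub> inv\<^bsub>L\<^esub> (e a'))"
      using CA CB L.m_comm[of "inv\<^bsub>L\<^esub> (e b')" "inv\<^bsub>L\<^esub> (e a')"] by (simp add: L.l_distr)
    also have "\<dots> = e a \<otimes>\<^bsub>L\<^esub> inv\<^bsub>L\<^esub> (e a') \<oplus>\<^bsub>L\<^esub> e b \<otimes>\<^bsub>L\<^esub> inv\<^bsub>L\<^esub> (e b')"
      using CA CB by (simp add: cancel)
    finally have sum: "(e a \<otimes>\<^bsub>L\<^esub> e b' \<oplus>\<^bsub>L\<^esub> e b \<otimes>\<^bsub>L\<^esub> e a') \<otimes>\<^bsub>L\<^esub> (inv\<^bsub>L\<^esub> (e a') \<otimes>\<^bsub>L\<^esub> inv\<^bsub>L\<^esub> (e b'))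
        = e a \<otimes>\<^bsub>L\<^esub> inv\<^bsub>L\<^esub> (e a') \<oplus>\<^bsub>L\<^esub> e b \<otimes>\<^bsub>L\<^esub> inv\<^bsub>L\<^esub> (e b')" .
    show "\<theta> (A \<oplus>\<^bsub>K\<^esub> B) = \<theta> A \<oplus>\<^bsub>L\<^esub> \<theta> B"
      unfolding A(2) B(2) hfrac_add[OF A(1) B(1)] th[OF A(1)] th[OF B(1)] th[OF pair_add[OF A(1) B(1)]]
        e(3)[OF G_mult[OF d(1) d'(2)] m2] e(4)[OF d(1) d'(2)] e(4)[OF d'(1) d(2)] e(4)[OF d(2) d'(2)] inv
      by (rule sum)
  qed
  then show ?thesis using that th by blast
qed

end

section \<open>The function field at a generic point\<close>

context cring
begin

lemma mterm_mterm_mult: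
  assumes "c \<in> carrier R" "c' \<in> carrier R"
  shows "mterm R c m \<otimes>\<^bsub>mpoly_ring R I\<^esub> mterm R c' m' = mterm R (c \<otimes> c') (m + m')"
proof
  fix l
  have C: "mterm R c' m' k \<in> carrier R" for k using assms by (simp add: mterm_def)
  show "(mterm R c m \<otimes>\<^bsub>mpoly_ring R I\<^esub> mterm R c' m') l = mterm R (c \<otimes> c') (m + m') l"
    unfolding mterm_mult_left[OF assms(1) C] using assms by (auto simp: mterm_def)
qed

lemma indexed_var_pow:
  "indexed_var i [^]\<^bsub>mpoly_ring R I\<^esub> (n::nat) = mterm R \<one> (replicate_mset n i)"
  by (induction n) (simp_all add: indexed_var_mterm mterm_mterm_mult)

lemma mpoly_finsum_apply:
  assumes "finite A" "\<And>i. i \<in> A \<Longrightarrow> f i \<in> carrier (mpoly_ring R I)"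
  shows "(\<Oplus>\<^bsub>mpoly_ring R I\<^esub>i\<in>A. f i) m = (\<Oplus>i\<in>A. f i m)"
  using assms
proof (induction A rule: finite_induct)
  case empty
  interpret P: cring "mpoly_ring R I" by (rule mpoly_cring)
  show ?case by simp
next
  case (insert a A)
  interpret P: cring "mpoly_ring R I" by (rule mpoly_cring)
  have C: "f i \<in> carrier (mpoly_ring R I)" if "i \<in> insert a A" for i using insert.prems that by blast
  have eq: "(\<Oplus>\<^bsub>mpoly_ring R I\<^esub>i\<in>insert a A. f i) = f a \<oplus>\<^bsub>mpoly_ring R I\<^esub> (\<Oplus>\<^bsub>mpoly_ring R I\<^esub>i\<in>A. f i)"
    using insert.hyps C by (intro P.finsum_insert) auto
  have Cm: "f i m \<in> carrier R" if "i \<in> insert a A" for i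
    using C[OF that] pset_closed[of "f i" I] by simp
  have sum: "(\<Oplus>i\<in>insert a A. f i m) = f a m \<oplus> (\<Oplus>i\<in>A. f i m)"
    using insert.hyps Cm by (intro finsum_insert) auto
  show ?case using insert.IH C unfolding sum eq by simp
qed

lemma mpoly_term_expansion:
  assumes "f \<in> carrier (mpoly_ring R I)"
  shows "f = (\<Oplus>\<^bsub>mpoly_ring R I\<^esub>m\<in>msupp R f. mterm R (f m) m)"
proof
  fix l
  have fin: "finite (msupp R f)" and C: "\<And>m. f m \<in> carrier R" using assms by (simp_all add: pset_iff)
  have "(\<Oplus>\<^bsub>mpoly_ring R I\<^esub>m\<in>msupp R f. mterm R (f m) m) l = (\<Oplus>m\<in>msupp R f. mterm R (f m) m l)"
  proof (rule mpoly_finsum_apply[OF fin])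
    fix m assume "m \<in> msupp R f"
    then have "set_mset m \<subseteq> I" using assms by (simp add: pset_iff)
    then show "mterm R (f m) m \<in> carrier (mpoly_ring R I)" using C by (simp add: mterm_in_pset)
  qed
  also have "\<dots> = (\<Oplus>m\<in>msupp R f. if l = m then f m else \<zero>)"
    using C by (intro finsum_cong') (auto simp: mterm_def)
  also have "\<dots> = f l"
  proof (cases "l \<in> msupp R f")
    case True
    then show ?thesis by (rule finsum_singleton) (use fin C in auto)
  next
    case False
    have "(\<Oplus>m\<in>msupp R f. if l = m then f m else \<zero>) = \<zero>" using False by (intro add.finprod_one_eqI) auto
    then show ?thesis using False by (simp add: msupp_def)
  qed
  finally show "f l = (\<Oplus>\<^bsub>mpoly_ring R I\<^esub>m\<in>msupp R f. mterm R (f m) m) l" by simp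
qed

lemma homogeneous_iff:
  "f \<in> homogeneous_mpolys R I d \<longleftrightarrow> f \<in> carrier (mpoly_ring R I) \<and> (\<forall>m\<in>msupp R f. size m = d)"
  by (auto simp: homogeneous_mpolys_def msupp_def)

lemma homogeneous_mult:
  assumes "f \<in> homogeneous_mpolys R I d" "g \<in> homogeneous_mpolys R I e"
  shows "f \<otimes>\<^bsub>mpoly_ring R I\<^esub> g \<in> homogeneous_mpolys R I (d + e)"
proof -
  have C: "f \<in> indexed_pset I (carrier R)" "g \<in> indexed_pset I (carrier R)"
    using assms by (simp_all add: homogeneous_iff)
  have "size m = d + e" if m: "m \<in> msupp R (f \<otimes>\<^bsub>mpoly_ring R I\<^esub> g)" for m
  proof -
    obtain a b where "a \<in> msupp R f" "b \<in> msupp R g" "m = a + b" using msupp_mult[OF C] m by auto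
    then show ?thesis using assms by (simp add: homogeneous_iff)
  qed
  then show ?thesis using C by (simp add: homogeneous_iff mpoly_mult_closed)
qed

lemma homogeneous_add:
  assumes "f \<in> homogeneous_mpolys R I d" "g \<in> homogeneous_mpolys R I d"
  shows "f \<oplus>\<^bsub>mpoly_ring R I\<^esub> g \<in> homogeneous_mpolys R I d"
proof -
  have "msupp R (f \<oplus>\<^bsub>mpoly_ring R I\<^esub> g) \<subseteq> msupp R f \<union> msupp R g"
    using assms by (auto simp: msupp_def)
  then show ?thesis using assms by (auto simp: homogeneous_iff pset_add)
qed

lemma mpoly_neg:
  assumes "f \<in> carrier (mpoly_ring R I)"
  shows "\<ominus>\<^bsub>mpoly_ring R I\<^esub> f = (\<lambda>m. \<ominus> f m)"
proof -
  interpret P: cring "mpoly_ring R I" by (rule mpoly_cring)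
  have s: "msupp R (\<lambda>m. \<ominus> f m) = msupp R f" using assms by (auto simp: msupp_def pset_iff)
  have "(\<lambda>m. \<ominus> f m) \<in> carrier (mpoly_ring R I)" using assms s by (simp add: pset_iff)
  moreover have "(\<lambda>m. \<ominus> f m) \<oplus>\<^bsub>mpoly_ring R I\<^esub> f = \<zero>\<^bsub>mpoly_ring R I\<^esub>"
    using assms by (simp add: pset_closed l_neg)
  ultimately show ?thesis using P.minus_equality assms by blast
qed

lemma homogeneous_neg:
  assumes "f \<in> homogeneous_mpolys R I d"
  shows "\<ominus>\<^bsub>mpoly_ring R I\<^esub> f \<in> homogeneous_mpolys R I d"
proof -
  interpret P: cring "mpoly_ring R I" by (rule mpoly_cring)
  have f: "f \<in> carrier (mpoly_ring R I)" using assms by (simp only: homogeneous_iff)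
  have s: "msupp R (\<lambda>m. \<ominus> f m) = msupp R f" using f by (auto simp: msupp_def pset_iff)
  show ?thesis using P.a_inv_closed[OF f] assms unfolding homogeneous_iff mpoly_neg[OF f] s by simp
qed

lemma homogeneous_zero: "\<zero>\<^bsub>mpoly_ring R I\<^esub> \<in> homogeneous_mpolys R I d"
proof -
  interpret P: cring "mpoly_ring R I" by (rule mpoly_cring)
  show ?thesis using P.zero_closed by (simp add: homogeneous_iff msupp_def)
qed

lemma homogeneous_mterm:
  "c \<in> carrier R \<Longrightarrow> set_mset m \<subseteq> I \<Longrightarrow> size m = d \<Longrightarrow> mterm R c m \<in> homogeneous_mpolys R I d"
proof -
  assume "c \<in> carrier R" "set_mset m \<subseteq> I" "size m = d"
  moreover have "msupp R (mterm R c m) \<subseteq> {m}" by (auto simp: msupp_def mterm_def)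
  ultimately show ?thesis by (auto simp: homogeneous_iff mterm_in_pset)
qed

end

text \<open>The point \<open>z\<close> is a Frobenius twist: a polynomial over \<open>F\<close> is evaluated at \<open>z\<close> after raising its
  coefficients to the \<open>p\<close>-th power, so the form itself evaluates to the \<open>p\<close>-th power of the linear relation.
  Genericity is only required for polynomials of degree less than \<open>p\<close> in \<open>b1\<close>, the normal forms modulo the form.\<close>

locale generic_point = F?: char_field F p + L?: char_field L p
  for F :: "('a, 'm) ring_scheme" (structure) and L :: "('l, 'k) ring_scheme" (structure) and p +
  fixes V :: "('a, 'v, 'n) module_scheme" and \<phi> :: "'v \<Rightarrow> 'a" and hh :: "'a \<Rightarrow> 'l" and z :: "'v \<Rightarrow> 'l"
    and B :: "'v set" and b0 b1 :: 'v
  assumes B: "B = coord_basis F V" "finite B" and \<phi>: "\<And>b. b \<in> B \<Longrightarrow> \<phi> b \<in> carrier F"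
    and hh: "hh \<in> ring_hom F L" and zC: "\<And>b. b \<in> B \<Longrightarrow> z b \<in> carrier L"
    and b01: "b0 \<in> B" "b1 \<in> B" "b0 \<noteq> b1" "\<phi> b1 \<noteq> \<zero>" and z0: "z b0 = \<one>\<^bsub>L\<^esub>"
    and rel: "(\<Oplus>\<^bsub>L\<^esub>b\<in>B. hh (\<phi> b) \<otimes>\<^bsub>L\<^esub> z b) = \<zero>\<^bsub>L\<^esub>"
    and generic: "\<And>d f. f \<in> homogeneous_mpolys F B d \<Longrightarrow> (\<forall>m\<in>msupp F f. count m b1 < p)
      \<Longrightarrow> mpoly_eval.ev F L B (\<lambda>c. hh c [^]\<^bsub>L\<^esub> p) z f = \<zero>\<^bsub>L\<^esub> \<Longrightarrow> f = \<zero>\<^bsub>mpoly_ring F B\<^esub>"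
begin

lemma hh_simps [simp]:
  "x \<in> carrier F \<Longrightarrow> hh x \<in> carrier L" "hh \<zero> = \<zero>\<^bsub>L\<^esub>" "hh \<one> = \<one>\<^bsub>L\<^esub>"
  "x \<in> carrier F \<Longrightarrow> y \<in> carrier F \<Longrightarrow> hh (x \<oplus> y) = hh x \<oplus>\<^bsub>L\<^esub> hh y"
  "x \<in> carrier F \<Longrightarrow> y \<in> carrier F \<Longrightarrow> hh (x \<otimes> y) = hh x \<otimes>\<^bsub>L\<^esub> hh y"
  using ring_hom_closed[OF hh] ring_hom_one[OF hh] ring_hom_add[OF hh] ring_hom_mult[OF hh]
    ring_hom_zero[OF hh F.ring_axioms L.ring_axioms] by simp_all

lemma frob: "(\<lambda>c. hh c [^]\<^bsub>L\<^esub> p) \<in> ring_hom F L"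
  by (rule ring_hom_memI) (simp_all add: L.nat_pow_distrib L.frobenius_add)

sublocale E: mpoly_eval F L B "\<lambda>c. hh c [^]\<^bsub>L\<^esub> p" z
  by unfold_locales (use B(2) frob zC in auto)

abbreviation Q where "Q \<equiv> mpoly_ring F B"

sublocale Q: cring Q by (rule F.mpoly_cring)

sublocale ev: ring_hom_cring Q L E.ev by (rule E.ev_hom)

definition q where "q = form_mpoly p F V \<phi>"

lemma q_eq: "q = (\<Oplus>\<^bsub>Q\<^esub>b\<in>B. mterm F (\<phi> b) (replicate_mset p b))"
proof -
  have "q = (\<Oplus>\<^bsub>Q\<^esub>b\<in>B. F.indexed_const (\<phi> b) \<otimes>\<^bsub>Q\<^esub> F.indexed_var b [^]\<^bsub>Q\<^esub> p)"
    unfolding q_def form_mpoly_def Let_def B(1) ..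
  also have "\<dots> = (\<Oplus>\<^bsub>Q\<^esub>b\<in>B. mterm F (\<phi> b) (replicate_mset p b))"
    by (rule Q.finsum_cong')
      (use \<phi> in \<open>simp_all add: F.indexed_var_pow F.indexed_const_mterm F.mterm_mterm_mult F.mterm_in_pset\<close>)
  finally show ?thesis .
qed

lemma q_closed: "q \<in> carrier Q"
  unfolding q_eq by (rule Q.finsum_closed) (use \<phi> in \<open>simp add: F.mterm_in_pset\<close>)

lemma ev_q: "E.ev q = \<zero>\<^bsub>L\<^esub>"
proof -
  have "E.ev q = (\<Oplus>\<^bsub>L\<^esub>b\<in>B. E.ev (mterm F (\<phi> b) (replicate_mset p b)))"
    unfolding q_eq using \<phi> by (subst ev.hom_finsum) (auto simp: F.mterm_in_pset comp_def)
  also have "\<dots> = (\<Oplus>\<^bsub>L\<^esub>b\<in>B. (hh (\<phi> b) \<otimes>\<^bsub>L\<^esub> z b) [^]\<^bsub>L\<^esub> p)"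
    by (rule L.finsum_cong') (use \<phi> zC in \<open>simp_all add: E.ev_mterm E.mon_replicate L.nat_pow_distrib\<close>)
  also have "\<dots> = (\<Oplus>\<^bsub>L\<^esub>b\<in>B. hh (\<phi> b) \<otimes>\<^bsub>L\<^esub> z b) [^]\<^bsub>L\<^esub> p"
    using L.frobenius_finsum[of "\<lambda>b. hh (\<phi> b) \<otimes>\<^bsub>L\<^esub> z b" B 1] \<phi> zC by simp
  also have "\<dots> = \<zero>\<^bsub>L\<^esub>" unfolding rel using L.p_pos by (simp add: L.nat_pow_zero)
  finally show ?thesis .
qed

definition J where "J = PIdl\<^bsub>Q\<^esub> q"

lemma J_form: "J = form_ideal p F V \<phi>" by (simp add: J_def q_def form_ideal_def B(1)[symmetric])

sublocale J: ideal J Q unfolding J_def by (rule Q.cgenideal_ideal[OF q_closed])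

lemma J_iff: "x \<in> J \<longleftrightarrow> (\<exists>y\<in>carrier Q. x = y \<otimes>\<^bsub>Q\<^esub> q)"
  unfolding J_def cgenideal_def by auto

lemma ev_J: "x \<in> J \<Longrightarrow> E.ev x = \<zero>\<^bsub>L\<^esub>"
  unfolding J_iff using q_closed ev_q by (auto simp del: F.mterm_simps)

definition reduced where
  "reduced d = {g \<in> homogeneous_mpolys F B d. \<forall>m\<in>msupp F g. count m b1 < p}"

lemma reduced_add:
  assumes "f \<in> reduced d" "g \<in> reduced d"
  shows "f \<oplus>\<^bsub>Q\<^esub> g \<in> reduced d"
proof -
  have "msupp F (f \<oplus>\<^bsub>Q\<^esub> g) \<subseteq> msupp F f \<union> msupp F g"
    using assms by (auto simp: msupp_def)
  then show ?thesis using assms F.homogeneous_add[of f B d g] unfolding reduced_def by blast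
qed

lemma reduced_carrier: "g \<in> reduced d \<Longrightarrow> g \<in> carrier Q"
  unfolding reduced_def homogeneous_mpolys_def by blast

lemma reduced_neg:
  assumes "f \<in> reduced d"
  shows "\<ominus>\<^bsub>Q\<^esub> f \<in> reduced d"
proof -
  have f: "f \<in> carrier Q" by (rule reduced_carrier[OF assms])
  have s: "msupp F (\<ominus>\<^bsub>Q\<^esub> f) = msupp F f"
    unfolding F.mpoly_neg[OF f] using f by (auto simp: msupp_def F.pset_iff)
  have "\<ominus>\<^bsub>Q\<^esub> f \<in> homogeneous_mpolys F B d" using assms unfolding reduced_def by (intro F.homogeneous_neg) simp
  then show ?thesis using assms by (simp add: reduced_def s del: F.mterm_simps)
qed

definition Red where "Red d = {f. \<exists>x\<in>J. \<exists>g\<in>reduced d. f = x \<oplus>\<^bsub>Q\<^esub> g}"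

lemma reduced_zero: "\<zero>\<^bsub>Q\<^esub> \<in> reduced d"
  unfolding reduced_def using F.homogeneous_zero[of B d] by (auto simp: msupp_def)

lemma J_carrier: "x \<in> J \<Longrightarrow> x \<in> carrier Q" using J.a_subset by blast

lemma Red_J: "x \<in> J \<Longrightarrow> x \<in> Red d"
  unfolding Red_def using reduced_zero[of d] Q.r_zero[OF J_carrier[of x]]
  by (metis (mono_tags, lifting) mem_Collect_eq)

lemma Red_reduced: "g \<in> reduced d \<Longrightarrow> g \<in> Red d"
  unfolding Red_def using J.zero_closed Q.l_zero[OF reduced_carrier[of g d]]
  by (metis (mono_tags, lifting) mem_Collect_eq)

lemma Red_add:
  assumes "f \<in> Red d" "g \<in> Red d"
  shows "f \<oplus>\<^bsub>Q\<^esub> g \<in> Red d"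
proof -
  obtain x x' y y' where *: "x \<in> J" "x' \<in> reduced d" "f = x \<oplus>\<^bsub>Q\<^esub> x'" "y \<in> J" "y' \<in> reduced d" "g = y \<oplus>\<^bsub>Q\<^esub> y'"
    using assms unfolding Red_def by blast
  note C = J_carrier[OF *(1)] reduced_carrier[OF *(2)] J_carrier[OF *(4)] reduced_carrier[OF *(5)]
  have "f \<oplus>\<^bsub>Q\<^esub> g = (x \<oplus>\<^bsub>Q\<^esub> y) \<oplus>\<^bsub>Q\<^esub> (x' \<oplus>\<^bsub>Q\<^esub> y')"
    unfolding *(3,6) using C by (simp only: Q.a_ac Q.a_closed)
  then show ?thesis unfolding Red_def using J.a_closed[OF *(1,4)] reduced_add[OF *(2,5)] by blast
qed

lemma Red_neg:
  assumes "f \<in> Red d"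
  shows "\<ominus>\<^bsub>Q\<^esub> f \<in> Red d"
proof -
  obtain x x' where *: "x \<in> J" "x' \<in> reduced d" "f = x \<oplus>\<^bsub>Q\<^esub> x'" using assms unfolding Red_def by blast
  have "\<ominus>\<^bsub>Q\<^esub> f = \<ominus>\<^bsub>Q\<^esub> x \<oplus>\<^bsub>Q\<^esub> \<ominus>\<^bsub>Q\<^esub> x'"
    unfolding *(3) by (rule Q.minus_add[OF J_carrier[OF *(1)] reduced_carrier[OF *(2)]])
  then show ?thesis unfolding Red_def using J.a_inv_closed[OF *(1)] reduced_neg[OF *(2)] by blast
qed

lemma Red_carrier: "f \<in> Red d \<Longrightarrow> f \<in> carrier Q"
  unfolding Red_def using J_carrier reduced_carrier Q.a_closed by blast

lemma Red_finsum:
  assumes "finite A" "\<And>i. i \<in> A \<Longrightarrow> f i \<in> Red d"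
  shows "(\<Oplus>\<^bsub>Q\<^esub>i\<in>A. f i) \<in> Red d"
  using assms
proof (induction A rule: finite_induct)
  case empty
  then show ?case using Red_reduced[OF reduced_zero] by (simp del: F.mterm_simps)
next
  case (insert a A)
  have "(\<Oplus>\<^bsub>Q\<^esub>i\<in>insert a A. f i) = f a \<oplus>\<^bsub>Q\<^esub> (\<Oplus>\<^bsub>Q\<^esub>i\<in>A. f i)"
    using insert.hyps insert.prems Red_carrier by (intro Q.finsum_insert) (auto simp del: F.mterm_simps)
  then show ?case using insert Red_add by (simp del: F.mterm_simps)
qed

text \<open>Division by the form: \<open>\<phi> b1\<close> is invertible, so modulo the form the
  p-th power of the variable \<open>b1\<close> is a combination of p-th powers of the other
  variables. The replacement lowers the exponent of \<open>b1\<close> and keeps the total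
  degree.\<close>

lemma Red_mterm:
  "c \<in> carrier F \<Longrightarrow> set_mset m \<subseteq> B \<Longrightarrow> size m = d \<Longrightarrow> mterm F c m \<in> Red d"
proof (induction "count m b1" arbitrary: m c rule: less_induct)
  case less
  show ?case
  proof (cases "count m b1 < p")
    case True
    have "msupp F (mterm F c m) \<subseteq> {m}" by (auto simp: msupp_def mterm_def)
    then have "mterm F c m \<in> reduced d"
      unfolding reduced_def using True F.homogeneous_mterm[OF less.prems] by blast
    then show ?thesis by (rule Red_reduced)
  next
    case False
    define m' where "m' = m - replicate_mset p b1"
    have m: "m = m' + replicate_mset p b1"
      unfolding m'_def using False by (simp add: count_le_replicate_mset_subset_eq[symmetric])
    define c' where "c' = c \<otimes> inv (\<phi> b1)"
    have u: "\<phi> b1 \<in> Units F" using b01 \<phi> by (simp add: F.field_Units)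
    have c': "c' \<in> carrier F" "c' \<otimes> \<phi> b1 = c" unfolding c'_def using less.prems(1) u by (simp_all add: F.m_assoc F.Units_closed)
    have m'B: "set_mset m' \<subseteq> B" using less.prems(2) unfolding m by auto
    define T where "T b = mterm F (c' \<otimes> \<phi> b) (m' + replicate_mset p b)" for b
    have mC: "mterm F c' m' \<in> carrier Q" using c' m'B by (simp add: F.mterm_in_pset)
    have TC: "T b \<in> carrier Q" if "b \<in> B" for b
    proof -
      have "set_mset (m' + replicate_mset p b) \<subseteq> B" using m'B that by auto
      then show ?thesis unfolding T_def using that \<phi> c' by (simp add: F.mterm_in_pset)
    qed
    have "mterm F c' m' \<otimes>\<^bsub>Q\<^esub> q = (\<Oplus>\<^bsub>Q\<^esub>b\<in>B. mterm F c' m' \<otimes>\<^bsub>Q\<^esub> mterm F (\<phi> b) (replicate_mset p b))"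
      unfolding q_eq by (rule Q.finsum_rdistr) (use B(2) mC \<phi> in \<open>auto simp: F.mterm_in_pset\<close>)
    also have "\<dots> = (\<Oplus>\<^bsub>Q\<^esub>b\<in>B. T b)"
      by (rule Q.finsum_cong') (use TC c' \<phi> in \<open>simp_all add: T_def F.mterm_mterm_mult del: F.mterm_simps\<close>)
    also have "\<dots> = (\<Oplus>\<^bsub>Q\<^esub>b\<in>insert b1 (B - {b1}). T b)" using b01(2) by (simp add: insert_absorb del: F.mterm_simps)
    also have "\<dots> = T b1 \<oplus>\<^bsub>Q\<^esub> (\<Oplus>\<^bsub>Q\<^esub>b\<in>B - {b1}. T b)"
      by (rule Q.finsum_insert) (use B(2) TC b01 in \<open>auto simp del: F.mterm_simps\<close>)
    also have "T b1 = mterm F c m" unfolding T_def c'(2) m ..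
    finally have eq: "mterm F c' m' \<otimes>\<^bsub>Q\<^esub> q = mterm F c m \<oplus>\<^bsub>Q\<^esub> (\<Oplus>\<^bsub>Q\<^esub>b\<in>B - {b1}. T b)" .
    have TR: "T b \<in> Red d" if b: "b \<in> B - {b1}" for b
      unfolding T_def
    proof (rule less.hyps)
      show "count (m' + replicate_mset p b) b1 < count m b1" unfolding m using b F.p_pos by auto
      show "set_mset (m' + replicate_mset p b) \<subseteq> B" using m'B b by auto
      show "size (m' + replicate_mset p b) = d" using less.prems(3) unfolding m by simp
      show "c' \<otimes> \<phi> b \<in> carrier F" using c' \<phi> b by simp
    qed
    have S: "(\<Oplus>\<^bsub>Q\<^esub>b\<in>B - {b1}. T b) \<in> Red d" using B(2) TR by (intro Red_finsum) auto
    have "mterm F c' m' \<otimes>\<^bsub>Q\<^esub> q \<in> J" using J_iff mC by blast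
    then have X: "mterm F c' m' \<otimes>\<^bsub>Q\<^esub> q \<in> Red d" by (rule Red_J)
    have tC: "mterm F c m \<in> carrier Q" using less.prems by (simp add: F.mterm_in_pset)
    have "mterm F c m = mterm F c' m' \<otimes>\<^bsub>Q\<^esub> q \<oplus>\<^bsub>Q\<^esub> \<ominus>\<^bsub>Q\<^esub> (\<Oplus>\<^bsub>Q\<^esub>b\<in>B - {b1}. T b)"
      unfolding eq using tC Red_carrier[OF S] by (simp add: Q.a_assoc Q.r_neg del: F.mterm_simps)
    then show ?thesis using Red_add[OF X Red_neg[OF S]] by simp
  qed
qed

lemma homogeneous_Red:
  assumes "f \<in> homogeneous_mpolys F B d"
  shows "f \<in> Red d"
proof -
  have f: "f \<in> carrier Q" "\<And>m. m \<in> msupp F f \<Longrightarrow> size m = d" using assms F.homogeneous_iff[of f B d] by auto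
  have "(\<Oplus>\<^bsub>Q\<^esub>m\<in>msupp F f. mterm F (f m) m) \<in> Red d"
    using f by (intro Red_finsum Red_mterm) (auto simp: F.pset_iff)
  then show ?thesis using F.mpoly_term_expansion[OF f(1)] by simp
qed

text \<open>Together with \<open>ev_J\<close> this identifies the homogeneous part of the ideal with
  the homogeneous kernel of the evaluation. It takes the place of an irreducibility proof: zero
  divisors are excluded because the values lie in a field.\<close>

lemma kernel:
  assumes "f \<in> homogeneous_mpolys F B d" "E.ev f = \<zero>\<^bsub>L\<^esub>"
  shows "f \<in> J"
proof -
  obtain x g where xg: "x \<in> J" "g \<in> reduced d" "f = x \<oplus>\<^bsub>Q\<^esub> g"
    using homogeneous_Red[OF assms(1)] unfolding Red_def by blast
  have "E.ev g = \<zero>\<^bsub>L\<^esub>"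
    using assms(2) ev_J[OF xg(1)] J_carrier[OF xg(1)] reduced_carrier[OF xg(2)]
    unfolding xg(3) by (simp del: F.mterm_simps)
  then have "g = \<zero>\<^bsub>Q\<^esub>" using generic xg(2) unfolding reduced_def by blast
  then show ?thesis using xg(1,3) J_carrier[OF xg(1)] by (simp del: F.mterm_simps)
qed

end

text \<open>One equation over \<open>L\<close> whose coefficients have rank \<open>card T\<close>
  over the image of \<open>K\<close> acts like \<open>card T\<close> independent equations over
  \<open>K\<close>. Coordinates outside \<open>T\<close> are free and determine those in
  \<open>T\<close>; the basis vector \<open>v e\<close> has 1 at \<open>e\<close>, 0 elsewhere
  outside \<open>T\<close>, and in \<open>T\<close> the negated coordinates of
  \<open>w e\<close>.\<close>

lemma solution_space_dim:
  fixes K :: "('s, 'm) ring_scheme" and L :: "('l, 'k) ring_scheme" and w :: "'v \<Rightarrow> 'l"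
  assumes K: "field K" and L: "field L" and \<theta>: "\<theta> \<in> ring_hom K L" and B: "finite B"
    and w: "\<And>b. b \<in> B \<Longrightarrow> w b \<in> carrier L" and T: "T \<subseteq> B"
    and ind: "ring.fam_indep L (\<theta> ` carrier K) T w"
    and span: "\<And>b. b \<in> B \<Longrightarrow> w b \<in> ring.fam_span L (\<theta> ` carrier K) T w"
  shows "vectorspace.dim K (ring.func_space K B\<lparr>carrier := {x \<in> carrier (ring.func_space K B).
    (\<Oplus>\<^bsub>L\<^esub>b\<in>B. w b \<otimes>\<^bsub>L\<^esub> \<theta> (x b)) = \<zero>\<^bsub>L\<^esub>}\<rparr>) = card B - card T"
proof -
  interpret K: field K by (rule K)
  interpret L: field L by (rule L)
  interpret h: ring_hom_cring K L \<theta> by unfold_locales (rule \<theta>)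
  define FS where "FS = K.func_space B"
  have FS: "carrier FS = B \<rightarrow>\<^sub>E carrier K" "zero FS = restrict (\<lambda>v. \<zero>\<^bsub>K\<^esub>) B"
    "add FS = (\<lambda>f g. restrict (\<lambda>v. f v \<oplus>\<^bsub>K\<^esub> g v) B)" "smult FS = (\<lambda>c f. restrict (\<lambda>v. c \<otimes>\<^bsub>K\<^esub> f v) B)"
    unfolding FS_def K.func_space_def by simp_all
  have "module K FS" unfolding FS_def by (rule K.func_space_is_module)
  then have vsFS: "vectorspace K FS" using K by (simp add: vectorspace_def)
  interpret FSv: vectorspace K FS by (rule vsFS)
  define tx where "tx x = (\<Oplus>\<^bsub>L\<^esub>b\<in>B. w b \<otimes>\<^bsub>L\<^esub> \<theta> (x b))" for x
  define W where "W = {x \<in> carrier FS. tx x = \<zero>\<^bsub>L\<^esub>}"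
  have xC: "x b \<in> carrier K" if "x \<in> carrier FS" "b \<in> B" for x b using that unfolding FS by auto
  have WF: "x \<in> carrier FS" "tx x = \<zero>\<^bsub>L\<^esub>" if "x \<in> W" for x using that unfolding W_def by auto
  have tx_cong: "tx x = (\<Oplus>\<^bsub>L\<^esub>b\<in>B. w b \<otimes>\<^bsub>L\<^esub> \<theta> (g b))" if "\<And>b. b \<in> B \<Longrightarrow> x b = g b" "\<And>b. b \<in> B \<Longrightarrow> g b \<in> carrier K" for x g
    unfolding tx_def by (rule L.finsum_cong') (use that w in auto)
  have tx_add: "tx (x \<oplus>\<^bsub>FS\<^esub> y) = tx x \<oplus>\<^bsub>L\<^esub> tx y" if xy: "x \<in> carrier FS" "y \<in> carrier FS" for x y
  proof -
    have "tx (x \<oplus>\<^bsub>FS\<^esub> y) = (\<Oplus>\<^bsub>L\<^esub>b\<in>B. w b \<otimes>\<^bsub>L\<^esub> \<theta> (x b \<oplus>\<^bsub>K\<^esub> y b))"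
      by (rule tx_cong) (use xy xC in \<open>auto simp: FS(3)\<close>)
    also have "\<dots> = (\<Oplus>\<^bsub>L\<^esub>b\<in>B. w b \<otimes>\<^bsub>L\<^esub> \<theta> (x b) \<oplus>\<^bsub>L\<^esub> w b \<otimes>\<^bsub>L\<^esub> \<theta> (y b))"
      by (rule L.finsum_cong') (use xC[OF xy(1)] xC[OF xy(2)] w in \<open>auto simp: L.r_distr\<close>)
    also have "\<dots> = tx x \<oplus>\<^bsub>L\<^esub> tx y"
      unfolding tx_def by (rule L.finsum_addf) (use xC[OF xy(1)] xC[OF xy(2)] w in auto)
    finally show ?thesis .
  qed
  have tx_smult: "tx (c \<odot>\<^bsub>FS\<^esub> x) = \<theta> c \<otimes>\<^bsub>L\<^esub> tx x" if c: "c \<in> carrier K" and x: "x \<in> carrier FS" for c x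
  proof -
    have "tx (c \<odot>\<^bsub>FS\<^esub> x) = (\<Oplus>\<^bsub>L\<^esub>b\<in>B. w b \<otimes>\<^bsub>L\<^esub> \<theta> (c \<otimes>\<^bsub>K\<^esub> x b))"
      by (rule tx_cong) (use c x xC in \<open>auto simp: FS(4)\<close>)
    also have "\<dots> = (\<Oplus>\<^bsub>L\<^esub>b\<in>B. \<theta> c \<otimes>\<^bsub>L\<^esub> (w b \<otimes>\<^bsub>L\<^esub> \<theta> (x b)))"
      by (rule L.finsum_cong') (use xC[OF x] c w in \<open>auto simp: L.m_ac\<close>)
    also have "\<dots> = \<theta> c \<otimes>\<^bsub>L\<^esub> tx x"
      unfolding tx_def by (rule L.finsum_rdistr[symmetric]) (use B xC[OF x] c w in auto)
    finally show ?thesis .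
  qed
  have tx_zero: "tx (zero FS) = \<zero>\<^bsub>L\<^esub>"
  proof -
    have "tx (zero FS) = (\<Oplus>\<^bsub>L\<^esub>b\<in>B. w b \<otimes>\<^bsub>L\<^esub> \<theta> \<zero>\<^bsub>K\<^esub>)" by (rule tx_cong) (auto simp: FS(2))
    also have "\<dots> = \<zero>\<^bsub>L\<^esub>" using w by (intro L.add.finprod_one_eqI) auto
    finally show ?thesis .
  qed
  have "submodule K W FS"
  proof (rule submodule.intro)
    show "module K FS" by fact
    show "W \<subseteq> carrier FS" unfolding W_def by auto
    show "\<And>v u. v \<in> W \<Longrightarrow> u \<in> W \<Longrightarrow> v \<oplus>\<^bsub>FS\<^esub> u \<in> W" unfolding W_def using tx_add by simp
    show "\<zero>\<^bsub>FS\<^esub> \<in> W" unfolding W_def using tx_zero by simp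
    show "\<And>c v. c \<in> carrier K \<Longrightarrow> v \<in> W \<Longrightarrow> c \<odot>\<^bsub>FS\<^esub> v \<in> W" unfolding W_def using tx_smult by simp
  qed
  then have "VectorSpace.subspace K W FS" using vsFS by (simp add: VectorSpace.subspace_def)
  then have vsM: "vectorspace K (FS\<lparr>carrier := W\<rparr>)" by (rule FSv.subspace_is_vs)
  define M where "M = FS\<lparr>carrier := W\<rparr>"
  interpret M: vectorspace K M unfolding M_def by (rule vsM)
  have M: "carrier M = W" "zero M = restrict (\<lambda>v. \<zero>\<^bsub>K\<^esub>) B"
    "add M = (\<lambda>f g. restrict (\<lambda>v. f v \<oplus>\<^bsub>K\<^esub> g v) B)" "smult M = (\<lambda>c f. restrict (\<lambda>v. c \<otimes>\<^bsub>K\<^esub> f v) B)"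
    unfolding M_def using FS by simp_all
  have pointwise: "(\<Oplus>\<^bsub>M\<^esub>i\<in>A. f i) b = (\<Oplus>\<^bsub>K\<^esub>i\<in>A. f i b)"
    if "finite A" "\<And>i. i \<in> A \<Longrightarrow> f i \<in> W" "b \<in> B" for A b and f :: "('v \<Rightarrow> 's) \<Rightarrow> _"
    using that
  proof (induction A rule: finite_induct)
    case empty
    then show ?case by (simp add: M(2))
  next
    case (insert a A)
    have fW: "f i \<in> carrier M" "f i b \<in> carrier K" if "i \<in> insert a A" for i
      using insert.prems that M(1) xC[OF WF(1)] by auto
    have "(\<Oplus>\<^bsub>M\<^esub>i\<in>insert a A. f i) = f a \<oplus>\<^bsub>M\<^esub> (\<Oplus>\<^bsub>M\<^esub>i\<in>A. f i)"
      using insert.hyps fW(1) by (intro M.M.finsum_insert) auto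
    moreover have "(\<Oplus>\<^bsub>K\<^esub>i\<in>insert a A. f i b) = f a b \<oplus>\<^bsub>K\<^esub> (\<Oplus>\<^bsub>K\<^esub>i\<in>A. f i b)"
      using insert.hyps fW(2) by (intro K.finsum_insert) auto
    ultimately show ?case using insert.IH insert.prems by (simp add: M(3))
  qed
  have finT: "finite T" using T B finite_subset by blast
  have wT: "w t \<in> carrier L" if "t \<in> T" for t using w T that by blast
  have uniq: "x = y" if x: "x \<in> W" and y: "y \<in> W" and eq: "\<And>e. e \<in> B - T \<Longrightarrow> x e = y e" for x y
  proof -
    note C = xC[OF WF(1)[OF x]] xC[OF WF(1)[OF y]]
    define D where "D b = x b \<ominus>\<^bsub>K\<^esub> y b" for b
    have DC: "D b \<in> carrier K" if "b \<in> B" for b unfolding D_def using C that by simp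
    have "(\<Oplus>\<^bsub>L\<^esub>b\<in>B. w b \<otimes>\<^bsub>L\<^esub> \<theta> (x b)) = (\<Oplus>\<^bsub>L\<^esub>b\<in>B. w b \<otimes>\<^bsub>L\<^esub> \<theta> (D b) \<oplus>\<^bsub>L\<^esub> w b \<otimes>\<^bsub>L\<^esub> \<theta> (y b))"
    proof (rule L.finsum_cong')
      fix b assume b: "b \<in> B"
      have "x b = D b \<oplus>\<^bsub>K\<^esub> y b" unfolding D_def a_minus_def using C b by (simp add: K.a_assoc K.l_neg)
      then show "w b \<otimes>\<^bsub>L\<^esub> \<theta> (x b) = w b \<otimes>\<^bsub>L\<^esub> \<theta> (D b) \<oplus>\<^bsub>L\<^esub> w b \<otimes>\<^bsub>L\<^esub> \<theta> (y b)"
        using DC C w b by (simp add: L.r_distr)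
    qed (use w DC C in auto)
    also have "\<dots> = (\<Oplus>\<^bsub>L\<^esub>b\<in>B. w b \<otimes>\<^bsub>L\<^esub> \<theta> (D b)) \<oplus>\<^bsub>L\<^esub> (\<Oplus>\<^bsub>L\<^esub>b\<in>B. w b \<otimes>\<^bsub>L\<^esub> \<theta> (y b))"
      by (rule L.finsum_addf) (use w DC C in auto)
    finally have "tx x = (\<Oplus>\<^bsub>L\<^esub>b\<in>B. w b \<otimes>\<^bsub>L\<^esub> \<theta> (D b)) \<oplus>\<^bsub>L\<^esub> tx y" unfolding tx_def .
    moreover have "(\<Oplus>\<^bsub>L\<^esub>b\<in>B. w b \<otimes>\<^bsub>L\<^esub> \<theta> (D b)) \<in> carrier L" using w DC by (intro L.finsum_closed) auto
    ultimately have z: "(\<Oplus>\<^bsub>L\<^esub>b\<in>B. w b \<otimes>\<^bsub>L\<^esub> \<theta> (D b)) = \<zero>\<^bsub>L\<^esub>" using WF(2)[OF x] WF(2)[OF y] by simp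
    have "(\<Oplus>\<^bsub>L\<^esub>b\<in>B. w b \<otimes>\<^bsub>L\<^esub> \<theta> (D b)) = (\<Oplus>\<^bsub>L\<^esub>t\<in>T. \<theta> (D t) \<otimes>\<^bsub>L\<^esub> w t)"
    proof (rule L.add.finprod_mono_neutral_cong_right)
      show "w b \<otimes>\<^bsub>L\<^esub> \<theta> (D b) = \<zero>\<^bsub>L\<^esub>" if "b \<in> B - T" for b
        using that eq[OF that] C(2) w unfolding D_def by (simp add: a_minus_def K.r_neg)
      show "w t \<otimes>\<^bsub>L\<^esub> \<theta> (D t) = \<theta> (D t) \<otimes>\<^bsub>L\<^esub> w t" if "t \<in> T" for t
        using that T DC[of t] wT by (intro L.m_comm) auto
    qed (use B T w DC in auto)
    then have z': "(\<Oplus>\<^bsub>L\<^esub>t\<in>T. \<theta> (D t) \<otimes>\<^bsub>L\<^esub> w t) = \<zero>\<^bsub>L\<^esub>" using z by simp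
    have "(\<lambda>t. \<theta> (D t)) \<in> T \<rightarrow> \<theta> ` carrier K" using DC T by auto
    with z' have "\<theta> (D t) = \<zero>\<^bsub>L\<^esub>" if "t \<in> T" for t
      using bspec[OF ind[unfolded L.fam_indep_def], of "\<lambda>t. \<theta> (D t)"] that by blast
    moreover have "inj_on \<theta> (carrier K)" by (rule non_trivial_field_hom_is_inj[OF \<theta> K L])
    ultimately have "D t = \<zero>\<^bsub>K\<^esub>" if "t \<in> T" for t
      using that DC[of t] T inj_onD[of \<theta> "carrier K" "D t" "\<zero>\<^bsub>K\<^esub>"] by auto
    then have "x t = y t" if "t \<in> T" for t
      using that C[of t] T unfolding D_def by (metis K.minus_other_side K.r_zero K.l_zero K.zero_closed subsetD)
    then have "x b = y b" if "b \<in> B" for b using eq that by blast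
    then show "x = y" using WF(1)[OF x] WF(1)[OF y] unfolding FS(1) by (intro PiE_ext) auto
  qed
  have "\<forall>e\<in>B. \<exists>\<kappa>. (\<forall>t\<in>T. \<kappa> t \<in> carrier K) \<and> w e = (\<Oplus>\<^bsub>L\<^esub>t\<in>T. \<theta> (\<kappa> t) \<otimes>\<^bsub>L\<^esub> w t)"
  proof
    fix e assume "e \<in> B"
    then obtain f where f: "f \<in> T \<rightarrow> \<theta> ` carrier K" "w e = (\<Oplus>\<^bsub>L\<^esub>t\<in>T. f t \<otimes>\<^bsub>L\<^esub> w t)"
      using span unfolding L.fam_span_def by blast
    have "\<forall>t\<in>T. \<exists>k. k \<in> carrier K \<and> f t = \<theta> k" using f(1) by auto
    from bchoice[OF this] obtain \<kappa> where k: "\<forall>t\<in>T. \<kappa> t \<in> carrier K \<and> f t = \<theta> (\<kappa> t)" by blast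
    have "w e = (\<Oplus>\<^bsub>L\<^esub>t\<in>T. \<theta> (\<kappa> t) \<otimes>\<^bsub>L\<^esub> w t)"
      unfolding f(2) by (rule L.finsum_cong') (use k wT in auto)
    then show "\<exists>\<kappa>. (\<forall>t\<in>T. \<kappa> t \<in> carrier K) \<and> w e = (\<Oplus>\<^bsub>L\<^esub>t\<in>T. \<theta> (\<kappa> t) \<otimes>\<^bsub>L\<^esub> w t)" using k by blast
  qed
  from bchoice[OF this] obtain \<kappa> where
    kC: "\<And>e t. e \<in> B \<Longrightarrow> t \<in> T \<Longrightarrow> \<kappa> e t \<in> carrier K" and
    ksum: "\<And>e. e \<in> B \<Longrightarrow> w e = (\<Oplus>\<^bsub>L\<^esub>t\<in>T. \<theta> (\<kappa> e t) \<otimes>\<^bsub>L\<^esub> w t)" by blast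
  define v where "v e = restrict (\<lambda>b. if b = e then \<one>\<^bsub>K\<^esub> else if b \<in> T then \<ominus>\<^bsub>K\<^esub> \<kappa> e b else \<zero>\<^bsub>K\<^esub>) B" for e
  have vW: "v e \<in> W" if e: "e \<in> B - T" for e
  proof -
    have vC: "v e \<in> carrier FS" unfolding FS(1) v_def using kC e by auto
    have vK: "v e b \<in> carrier K" if "b \<in> B" for b by (rule xC[OF vC that])
    have "tx (v e) = (\<Oplus>\<^bsub>L\<^esub>b\<in>insert e T. w b \<otimes>\<^bsub>L\<^esub> \<theta> (v e b))"
      unfolding tx_def
      by (rule L.add.finprod_mono_neutral_cong_right) (use B T e w vK in \<open>auto simp: v_def\<close>)
    also have "\<dots> = w e \<otimes>\<^bsub>L\<^esub> \<theta> (v e e) \<oplus>\<^bsub>L\<^esub> (\<Oplus>\<^bsub>L\<^esub>b\<in>T. w b \<otimes>\<^bsub>L\<^esub> \<theta> (v e b))"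
      by (rule L.finsum_insert) (use finT T e w vK in auto)
    also have "w e \<otimes>\<^bsub>L\<^esub> \<theta> (v e e) = w e" using e w by (simp add: v_def)
    also have "(\<Oplus>\<^bsub>L\<^esub>b\<in>T. w b \<otimes>\<^bsub>L\<^esub> \<theta> (v e b)) = (\<Oplus>\<^bsub>L\<^esub>b\<in>T. \<ominus>\<^bsub>L\<^esub> \<one>\<^bsub>L\<^esub> \<otimes>\<^bsub>L\<^esub> (\<theta> (\<kappa> e b) \<otimes>\<^bsub>L\<^esub> w b))"
    proof (rule L.finsum_cong')
      fix b assume b: "b \<in> T"
      then have "v e b = \<ominus>\<^bsub>K\<^esub> \<kappa> e b" using e T by (auto simp: v_def)
      then show "w b \<otimes>\<^bsub>L\<^esub> \<theta> (v e b) = \<ominus>\<^bsub>L\<^esub> \<one>\<^bsub>L\<^esub> \<otimes>\<^bsub>L\<^esub> (\<theta> (\<kappa> e b) \<otimes>\<^bsub>L\<^esub> w b)"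
        using kC[of e b] e b wT[OF b] by (simp add: L.l_minus L.r_minus L.m_comm)
    qed (use kC e wT in auto)
    also have "\<dots> = \<ominus>\<^bsub>L\<^esub> \<one>\<^bsub>L\<^esub> \<otimes>\<^bsub>L\<^esub> (\<Oplus>\<^bsub>L\<^esub>b\<in>T. \<theta> (\<kappa> e b) \<otimes>\<^bsub>L\<^esub> w b)"
      by (rule L.finsum_rdistr[symmetric]) (use finT kC e wT in auto)
    also have "(\<Oplus>\<^bsub>L\<^esub>b\<in>T. \<theta> (\<kappa> e b) \<otimes>\<^bsub>L\<^esub> w b) = w e" using ksum e by simp
    also have "\<ominus>\<^bsub>L\<^esub> \<one>\<^bsub>L\<^esub> \<otimes>\<^bsub>L\<^esub> w e = \<ominus>\<^bsub>L\<^esub> w e" using e w by (simp add: L.l_minus)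
    finally have "tx (v e) = \<zero>\<^bsub>L\<^esub>" using w e by (simp add: L.r_neg)
    then show ?thesis using vC unfolding W_def by simp
  qed
  have vv: "v e e' = (if e' = e then \<one>\<^bsub>K\<^esub> else \<zero>\<^bsub>K\<^esub>)" if "e' \<in> B - T" for e e'
    using that by (auto simp: v_def)
  have vinj: "inj_on v (B - T)"
  proof (rule inj_onI)
    fix e e' assume "e \<in> B - T" "e' \<in> B - T" "v e = v e'"
    then show "e = e'" using vv[of e e] vv[of e e'] K.one_not_zero by (metis (full_types))
  qed
  define A where "A = v ` (B - T)"
  have finA: "finite A" and AC: "A \<subseteq> carrier M" unfolding A_def M(1) using B vW by auto
  \<comment> \<open>Evaluation at the indices outside \<open>T\<close> recovers the coefficients of
    a linear combination. This gives independence at once, and spanning together with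
    \<open>uniq\<close>.\<close>
  have lc: "M.lincomb a A e = a (v e)" if a: "a \<in> A \<rightarrow> carrier K" and e: "e \<in> B - T" for a e
  proof -
    have uW: "a u \<odot>\<^bsub>M\<^esub> u \<in> W" if "u \<in> A" for u using a that AC M(1) M.smult_closed by blast
    have "M.lincomb a A e = (\<Oplus>\<^bsub>K\<^esub>u\<in>A. (a u \<odot>\<^bsub>M\<^esub> u) e)"
      unfolding M.lincomb_def using pointwise[OF finA uW, of "\<lambda>u. u"] finA uW e
      by (subst pointwise) auto
    also have "\<dots> = (\<Oplus>\<^bsub>K\<^esub>u\<in>A. if v e = u then a u else \<zero>\<^bsub>K\<^esub>)"
    proof (rule K.finsum_cong')
      fix u assume u: "u \<in> A"
      then obtain e' where e': "e' \<in> B - T" "u = v e'" unfolding A_def by blast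
      have "v e = u \<longleftrightarrow> e = e'" using vinj e e' by (auto dest: inj_onD)
      then show "(a u \<odot>\<^bsub>M\<^esub> u) e = (if v e = u then a u else \<zero>\<^bsub>K\<^esub>)"
        using vv[OF e, of e'] e e' a u unfolding M(4) by auto
    qed (use a in auto)
    also have "\<dots> = a (v e)" by (rule K.finsum_singleton) (use finA a e A_def in auto)
    finally show ?thesis .
  qed
  have "M.basis A"
    unfolding M.basis_def
  proof (intro conjI)
    show "M.lin_indpt A"
    proof (rule M.finite_lin_indpt2[OF finA AC])
      fix a assume a: "a \<in> A \<rightarrow> carrier K" "M.lincomb a A = \<zero>\<^bsub>M\<^esub>"
      show "\<forall>u\<in>A. a u = \<zero>\<^bsub>K\<^esub>"
      proof
        fix u assume "u \<in> A"
        then obtain e where e: "e \<in> B - T" "u = v e" unfolding A_def by blast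
        show "a u = \<zero>\<^bsub>K\<^esub>" using lc[OF a(1) e(1)] e unfolding a(2) M(2) by simp
      qed
    qed
    show "M.gen_set A"
    proof
      show "M.span A \<subseteq> carrier M" using AC M.span_closed by blast
      show "carrier M \<subseteq> M.span A"
      proof
        fix x assume x: "x \<in> carrier M"
        define a where "a u = x (inv_into (B - T) v u)" for u
        have a: "a \<in> A \<rightarrow> carrier K"
          unfolding A_def a_def using xC[OF WF(1)] x M(1) vinj by (auto simp: inv_into_f_f)
        have "M.lincomb a A \<in> carrier M" using AC a by (rule M.lincomb_closed)
        moreover have "x e = M.lincomb a A e" if "e \<in> B - T" for e
          unfolding lc[OF a that] a_def using vinj that by (simp add: inv_into_f_f)
        ultimately have "x = M.lincomb a A" using uniq x unfolding M(1) by blast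
        then show "x \<in> M.span A" unfolding M.finite_span[OF finA AC] using a by blast
      qed
    qed
  qed (rule AC)
  then have "M.dim = card A" by (rule M.dim_basis[OF finA])
  also have "card A = card B - card T" unfolding A_def using card_image[OF vinj] card_Diff_subset[OF finT T] by simp
  finally show ?thesis unfolding M_def W_def tx_def FS_def .
qed

lemma (in mpoly_eval) ev_in_subfield:
  assumes L: "field L" and N: "subfield N L" and h: "\<And>c. c \<in> carrier R \<Longrightarrow> h c \<in> N" and z: "\<And>i. i \<in> I \<Longrightarrow> z i \<in> N"
    and f: "f \<in> carrier P"
  shows "ev f \<in> N"
proof -
  interpret L: field L by (rule L)
  have fC: "f m \<in> carrier R" for m using R.pset_closed f by simp
  have "mon m \<in> N" for m
    unfolding mon_def by (rule L.subfield_finprod_closed[OF N]) (use z L.subfield_pow_closed[OF N] in auto)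
  from L.subfield_closed(5)[OF N h[OF fC] this] have "h (f m) \<otimes>\<^bsub>L\<^esub> mon m \<in> N" for m .
  then show ?thesis unfolding ev_def by (intro L.subfield_finsum_closed[OF N]) auto
qed

section \<open>The embedding of the function field and the defect index as a rank\<close>

context generic_point
begin

abbreviation S where "S \<equiv> Q Quot J"

definition cl where "cl f = J +>\<^bsub>Q\<^esub> f"

sublocale cl: ring_hom_cring Q S cl
proof -
  have "ring_hom_cring Q S ((+>\<^bsub>Q\<^esub>) J)" by (rule J.rcos_ring_hom_cring[OF Q.is_cring])
  moreover have "cl = (+>\<^bsub>Q\<^esub>) J" by (rule ext) (simp add: cl_def)
  ultimately show "ring_hom_cring Q S cl" by simp
qed

lemma cl_zero_iff:
  assumes "f \<in> carrier Q"
  shows "cl f = \<zero>\<^bsub>S\<^esub> \<longleftrightarrow> f \<in> J"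
proof -
  have z: "\<zero>\<^bsub>S\<^esub> = J" by (simp add: FactRing_def)
  show ?thesis
    using J.rcos_const_imp_mem[OF assms] J.a_rcos_const[of f] unfolding z cl_def by blast
qed

text \<open>Evaluation of a residue class at an arbitrary representative; as the evaluation vanishes
  on \<open>J\<close>, the choice is immaterial (\<open>ec_cl\<close>).\<close>

definition ec where "ec A = E.ev (SOME f. f \<in> A)"

lemma ec_cl:
  assumes f: "f \<in> carrier Q"
  shows "ec (cl f) = E.ev f"
proof -
  have "f \<in> cl f" unfolding cl_def by (rule J.a_rcos_self[OF f])
  then have "(SOME g. g \<in> cl f) \<in> cl f" by (rule someI[of "\<lambda>g. g \<in> cl f"])
  then obtain h where h: "h \<in> J" "(SOME g. g \<in> cl f) = h \<oplus>\<^bsub>Q\<^esub> f"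
    unfolding cl_def a_r_coset_def' by blast
  show ?thesis
    unfolding ec_def h(2) using ev_J[OF h(1)] J_carrier[OF h(1)] f by (simp del: F.mterm_simps)
qed

definition Gp where "Gp d = cl ` homogeneous_mpolys F B d"

lemma hom_carrier: "f \<in> homogeneous_mpolys F B d \<Longrightarrow> f \<in> carrier Q"
  unfolding homogeneous_mpolys_def by blast

lemma one_homogeneous: "\<one>\<^bsub>Q\<^esub> \<in> homogeneous_mpolys F B 0"
  using F.homogeneous_mterm[of \<one> "{#}" B 0] by (simp add: F.indexed_const_mterm mpoly_ring_def)

text \<open>If a product of homogeneous classes vanishes, then so does the product of their values
  in \<open>L\<close>, hence one of the values, and \<open>kernel\<close> carries this back to the
  classes.\<close>

sublocale H: hfrac_domain S Gp
proof (unfold_locales)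
  fix d e s t
  show "Gp d \<subseteq> carrier S" unfolding Gp_def using hom_carrier cl.hom_closed by blast
  show "\<one>\<^bsub>S\<^esub> \<in> Gp 0" unfolding Gp_def using one_homogeneous cl.hom_one by (metis imageI)
  show "\<zero>\<^bsub>S\<^esub> \<in> Gp d" unfolding Gp_def using F.homogeneous_zero cl.hom_zero by (metis imageI)
  { assume "s \<in> Gp d"
    then obtain f where f: "f \<in> homogeneous_mpolys F B d" "s = cl f" unfolding Gp_def by blast
    note fC = hom_carrier[OF f(1)]
    have "\<ominus>\<^bsub>S\<^esub> s = cl (\<ominus>\<^bsub>Q\<^esub> f)" unfolding f(2) using cl.hom_a_inv[OF fC] by simp
    then show "\<ominus>\<^bsub>S\<^esub> s \<in> Gp d" unfolding Gp_def using F.homogeneous_neg[OF f(1)] by blast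
    { assume "t \<in> Gp d"
      then obtain g where g: "g \<in> homogeneous_mpolys F B d" "t = cl g" unfolding Gp_def by blast
      have "s \<oplus>\<^bsub>S\<^esub> t = cl (f \<oplus>\<^bsub>Q\<^esub> g)" unfolding f(2) g(2) using cl.hom_add[OF fC hom_carrier[OF g(1)]] by simp
      then show "s \<oplus>\<^bsub>S\<^esub> t \<in> Gp d" unfolding Gp_def using F.homogeneous_add[OF f(1) g(1)] by blast }
    { assume "t \<in> Gp e"
      then obtain g where g: "g \<in> homogeneous_mpolys F B e" "t = cl g" unfolding Gp_def by blast
      note gC = hom_carrier[OF g(1)]
      have eq: "s \<otimes>\<^bsub>S\<^esub> t = cl (f \<otimes>\<^bsub>Q\<^esub> g)" unfolding f(2) g(2) using cl.hom_mult[OF fC gC] by simp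
      then show "s \<otimes>\<^bsub>S\<^esub> t \<in> Gp (d + e)" unfolding Gp_def using F.homogeneous_mult[OF f(1) g(1)] by blast
      assume "s \<otimes>\<^bsub>S\<^esub> t = \<zero>\<^bsub>S\<^esub>"
      then have "f \<otimes>\<^bsub>Q\<^esub> g \<in> J" using eq cl_zero_iff[OF Q.m_closed[OF fC gC]] by simp
      then have "E.ev f \<otimes>\<^bsub>L\<^esub> E.ev g = \<zero>\<^bsub>L\<^esub>" using ev_J ev.hom_mult[OF fC gC] by simp
      then have "E.ev f = \<zero>\<^bsub>L\<^esub> \<or> E.ev g = \<zero>\<^bsub>L\<^esub>" using L.integral ev.hom_closed[OF fC] ev.hom_closed[OF gC] by blast
      then have "f \<in> J \<or> g \<in> J" using kernel[OF f(1)] kernel[OF g(1)] by blast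
      then show "s = \<zero>\<^bsub>S\<^esub> \<or> t = \<zero>\<^bsub>S\<^esub>" unfolding f(2) g(2) using cl_zero_iff[OF fC] cl_zero_iff[OF gC] by blast }
  }
  have "\<one>\<^bsub>Q\<^esub> \<notin> J" using ev_J[of "\<one>\<^bsub>Q\<^esub>"] ev.hom_one by auto
  then show "\<one>\<^bsub>S\<^esub> \<noteq> \<zero>\<^bsub>S\<^esub>" using cl_zero_iff[OF Q.one_closed] cl.hom_one by simp
qed

lemma function_field_eq:
  "function_field p F V \<phi> = hfrac_field S Gp"
  "function_field_emb p F V \<phi> a = hfrac S Gp (cl (F.indexed_const a)) \<one>\<^bsub>S\<^esub>"
proof -
  have 1: "coord_ring p F V \<phi> = S" by (simp add: coord_ring_def J_form B(1)[symmetric])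
  have 2: "coord_class p F V \<phi> f = cl f" for f by (simp add: coord_class_def cl_def J_form B(1)[symmetric])
  have 3: "coord_piece p F V \<phi> = Gp"
    by (rule ext) (simp add: coord_piece_def Gp_def 2 B(1)[symmetric])
  show "function_field p F V \<phi> = hfrac_field S Gp"
    "function_field_emb p F V \<phi> a = hfrac S Gp (cl (F.indexed_const a)) \<one>\<^bsub>S\<^esub>"
    unfolding function_field_def function_field_emb_def 1 2 3 by simp_all
qed

text \<open>The image of the function field in \<open>L\<close>, as
  \<open>function_field_embedding\<close> shows. Because \<open>z b0\<close> is 1, each
  \<open>z b\<close> is the value of a ratio of two homogeneous coordinates.\<close>

definition N where "N = generate_field L ((\<lambda>c. hh c [^]\<^bsub>L\<^esub> p) ` carrier F \<union> z ` B)"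

lemma generators_carrier: "(\<lambda>c. hh c [^]\<^bsub>L\<^esub> p) ` carrier F \<union> z ` B \<subseteq> carrier L"
  using zC by auto

lemma function_field_embedding:
  obtains \<theta> where "\<theta> \<in> ring_hom (function_field p F V \<phi>) L"
    "\<And>c. c \<in> carrier F \<Longrightarrow> \<theta> (function_field_emb p F V \<phi> c) = hh c [^]\<^bsub>L\<^esub> p"
    "\<theta> ` carrier (function_field p F V \<phi>) = N"
proof -
  obtain \<theta> where th: "\<theta> \<in> ring_hom H.K L"
    "\<And>s t. (s, t) \<in> H.Pr \<Longrightarrow> \<theta> (hfrac S Gp s t) = ec s \<otimes>\<^bsub>L\<^esub> inv\<^bsub>L\<^esub> (ec t)"
  proof (rule H.hfrac_embedding[of L ec])
    show "field L" by (rule L.field_axioms)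
    show "ec \<one>\<^bsub>S\<^esub> = \<one>\<^bsub>L\<^esub>" using ec_cl[OF Q.one_closed] cl.hom_one ev.hom_one by simp
    fix d s assume "s \<in> Gp d"
    then obtain f where f: "f \<in> homogeneous_mpolys F B d" "s = cl f" unfolding Gp_def by blast
    note fC = hom_carrier[OF f(1)]
    show "ec s \<in> carrier L" unfolding f(2) ec_cl[OF fC] by (rule ev.hom_closed[OF fC])
    show "ec s \<noteq> \<zero>\<^bsub>L\<^esub>" if "s \<noteq> \<zero>\<^bsub>S\<^esub>"
      using that kernel[OF f(1)] cl_zero_iff[OF fC] unfolding f(2) ec_cl[OF fC] by blast
    fix t
    { assume "t \<in> Gp d"
      then obtain g where g: "g \<in> homogeneous_mpolys F B d" "t = cl g" unfolding Gp_def by blast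
      note gC = hom_carrier[OF g(1)]
      show "ec (s \<oplus>\<^bsub>S\<^esub> t) = ec s \<oplus>\<^bsub>L\<^esub> ec t"
        unfolding f(2) g(2) cl.hom_add[OF fC gC, symmetric] ec_cl[OF fC] ec_cl[OF gC] ec_cl[OF Q.a_closed[OF fC gC]]
        by (rule ev.hom_add[OF fC gC]) }
    { fix d' assume "t \<in> Gp d'"
      then obtain g where g: "g \<in> homogeneous_mpolys F B d'" "t = cl g" unfolding Gp_def by blast
      note gC = hom_carrier[OF g(1)]
      show "ec (s \<otimes>\<^bsub>S\<^esub> t) = ec s \<otimes>\<^bsub>L\<^esub> ec t"
        unfolding f(2) g(2) cl.hom_mult[OF fC gC, symmetric] ec_cl[OF fC] ec_cl[OF gC] ec_cl[OF Q.m_closed[OF fC gC]]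
        by (rule ev.hom_mult[OF fC gC]) }
  qed blast
  have const: "(cl (F.indexed_const c), \<one>\<^bsub>S\<^esub>) \<in> H.Pr" "F.indexed_const c \<in> carrier Q" if "c \<in> carrier F" for c
  proof -
    have h: "F.indexed_const c \<in> homogeneous_mpolys F B 0"
      unfolding F.indexed_const_mterm using that by (intro F.homogeneous_mterm) auto
    show "(cl (F.indexed_const c), \<one>\<^bsub>S\<^esub>) \<in> H.Pr"
      by (rule H.pairI[OF _ H.G_one H.S_one]) (use h in \<open>simp add: Gp_def\<close>)
    show "F.indexed_const c \<in> carrier Q" by (rule hom_carrier[OF h])
  qed
  have ec1: "ec \<one>\<^bsub>S\<^esub> = \<one>\<^bsub>L\<^esub>" using ec_cl[OF Q.one_closed] cl.hom_one ev.hom_one by simp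
  have emb: "\<theta> (function_field_emb p F V \<phi> c) = hh c [^]\<^bsub>L\<^esub> p" if c: "c \<in> carrier F" for c
    unfolding function_field_eq(2) th(2)[OF const(1)[OF c]] ec1 ec_cl[OF const(2)[OF c]]
    using c E.ev_const[OF c] by simp
  interpret K: field H.K by (rule H.hfrac_field)
  interpret th: ring_hom_ring H.K L \<theta> by (rule ring_hom_ringI2[OF K.ring_axioms L.ring_axioms th(1)])
  have sub: "subfield (\<theta> ` carrier H.K) L"
    by (rule th.img_is_subfield(2)[OF K.carrier_is_subfield]) simp
  have NS: "subfield N L" unfolding N_def by (rule L.generate_field_is_subfield[OF generators_carrier])
  have gen: "hh c [^]\<^bsub>L\<^esub> p \<in> N" if "c \<in> carrier F" for c unfolding N_def using that by (auto intro: generate_field.incl)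
  have genz: "z b \<in> N" if "b \<in> B" for b unfolding N_def using that by (auto intro: generate_field.incl)
  have "\<theta> ` carrier H.K = N"
  proof
    show "\<theta> ` carrier H.K \<subseteq> N"
    proof
      fix y assume "y \<in> \<theta> ` carrier H.K"
      then obtain a where a: "a \<in> carrier H.K" "y = \<theta> a" by blast
      obtain s t where st: "(s, t) \<in> H.Pr" "a = hfrac S Gp s t" by (rule H.hfrac_cases[OF a(1)])
      obtain d where d: "s \<in> Gp d" "t \<in> Gp d" "t \<noteq> \<zero>\<^bsub>S\<^esub>" using H.pairD(3,4)[OF st(1)] by blast
      obtain f where f: "f \<in> homogeneous_mpolys F B d" "s = cl f" using d(1) unfolding Gp_def by blast
      obtain g where g: "g \<in> homogeneous_mpolys F B d" "t = cl g" using d(2) unfolding Gp_def by blast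
      note C = hom_carrier[OF f(1)] hom_carrier[OF g(1)]
      have y: "y = E.ev f \<otimes>\<^bsub>L\<^esub> inv\<^bsub>L\<^esub> (E.ev g)"
        using th(2)[OF st(1)] unfolding a(2) st(2) f(2) g(2) ec_cl[OF C(1)] ec_cl[OF C(2)] .
      have nz: "E.ev g \<noteq> \<zero>\<^bsub>L\<^esub>" using d(3) kernel[OF g(1)] cl_zero_iff[OF C(2)] unfolding g(2) by blast
      have evN: "E.ev h \<in> N" if "h \<in> carrier Q" for h
        by (rule E.ev_in_subfield[OF L.field_axioms NS gen genz that])
      have "inv\<^bsub>L\<^esub> (E.ev g) \<in> N" by (rule L.subfield_closed(7)[OF NS evN[OF C(2)] nz])
      then show "y \<in> N" unfolding y by (rule L.subfield_closed(5)[OF NS evN[OF C(1)]])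
    qed
    show "N \<subseteq> \<theta> ` carrier H.K"
      unfolding N_def
    proof (rule L.generate_field_min_subfield1[OF generators_carrier sub], rule subsetI)
      fix y assume "y \<in> (\<lambda>c. hh c [^]\<^bsub>L\<^esub> p) ` carrier F \<union> z ` B"
      then show "y \<in> \<theta> ` carrier H.K"
      proof
        assume "y \<in> (\<lambda>c. hh c [^]\<^bsub>L\<^esub> p) ` carrier F"
        then obtain c where c: "c \<in> carrier F" "y = hh c [^]\<^bsub>L\<^esub> p" by blast
        have "y = \<theta> (hfrac S Gp (cl (F.indexed_const c)) \<one>\<^bsub>S\<^esub>)" using emb[OF c(1)] c(2) unfolding function_field_eq(2) by simp
        then show ?thesis using H.hfrac_carrier[OF const(1)[OF c(1)]] by blast
      next
        assume "y \<in> z ` B"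
        then obtain b where b: "b \<in> B" "y = z b" by blast
        have v: "F.indexed_var i \<in> homogeneous_mpolys F B 1" if "i \<in> B" for i
          unfolding F.indexed_var_mterm using that by (intro F.homogeneous_mterm) auto
        note C = hom_carrier[OF v[OF b(1)]] hom_carrier[OF v[OF b01(1)]]
        \<comment> \<open>The normalisation at \<open>b0\<close> exhibits \<open>z b\<close> as the
          value of the fraction of the variable \<open>b\<close> by the variable \<open>b0\<close>,
          which is homogeneous of degree zero.\<close>
        have e0: "E.ev (F.indexed_var b0) = \<one>\<^bsub>L\<^esub>" using E.ev_var[OF b01(1)] z0 by simp
        then have "cl (F.indexed_var b0) \<noteq> \<zero>\<^bsub>S\<^esub>" using cl_zero_iff[OF C(2)] ev_J[of "F.indexed_var b0"] by auto
        then have pr: "(cl (F.indexed_var b), cl (F.indexed_var b0)) \<in> H.Pr"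
          using v[OF b(1)] v[OF b01(1)] by (intro H.pairI[where d = 1]) (simp_all add: Gp_def)
        have "\<theta> (hfrac S Gp (cl (F.indexed_var b)) (cl (F.indexed_var b0))) = y"
          unfolding th(2)[OF pr] ec_cl[OF C(1)] ec_cl[OF C(2)] e0 b(2) using E.ev_var[OF b(1)] zC[OF b(1)] by simp
        then show ?thesis using H.hfrac_carrier[OF pr] by blast
      qed
    qed
  qed
  then show ?thesis using that[of \<theta>] th(1) emb unfolding function_field_eq(1) by blast
qed

text \<open>The embedding sends a scalar \<open>c\<close> of \<open>F\<close> to the p-th power of
  \<open>hh c\<close>, and the coordinates enter the form as p-th powers too. So Frobenius can be
  pulled out of the whole sum, and isotropic vectors are the solutions of a linear equation.\<close>

lemma first_defect_index_eq:
  assumes T: "T \<subseteq> B" and ind: "L.fam_indep N T (\<lambda>b. hh (\<phi> b))"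
    and span: "\<And>b. b \<in> B \<Longrightarrow> hh (\<phi> b) \<in> L.fam_span N T (\<lambda>b. hh (\<phi> b))"
  shows "first_defect_index p F V \<phi> = card B - card T"
proof -
  let ?K = "function_field p F V \<phi>" and ?\<iota> = "function_field_emb p F V \<phi>"
  obtain \<theta> where th: "\<theta> \<in> ring_hom ?K L"
    "\<And>c. c \<in> carrier F \<Longrightarrow> \<theta> (?\<iota> c) = hh c [^]\<^bsub>L\<^esub> p" "\<theta> ` carrier ?K = N"
    by (rule function_field_embedding) blast
  have fK: "field ?K" unfolding function_field_eq(1) by (rule H.hfrac_field)
  interpret K: field ?K by (rule fK)
  interpret th: ring_hom_cring ?K L \<theta> by unfold_locales (rule th(1))
  have inj: "inj_on \<theta> (carrier ?K)" by (rule non_trivial_field_hom_is_inj[OF th(1) fK L.field_axioms])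
  have io: "?\<iota> c \<in> carrier ?K" if c: "c \<in> carrier F" for c
  proof -
    have h: "F.indexed_const c \<in> homogeneous_mpolys F B 0"
      unfolding F.indexed_const_mterm using c by (intro F.homogeneous_mterm) auto
    have "(cl (F.indexed_const c), \<one>\<^bsub>S\<^esub>) \<in> H.Pr"
      by (rule H.pairI[OF _ H.G_one H.S_one]) (use h in \<open>simp add: Gp_def\<close>)
    then show ?thesis unfolding function_field_eq by (rule H.hfrac_carrier)
  qed
  have zero_iff: "ext_form p F V \<phi> ?K ?\<iota> x = \<zero>\<^bsub>?K\<^esub> \<longleftrightarrow> (\<Oplus>\<^bsub>L\<^esub>b\<in>B. hh (\<phi> b) \<otimes>\<^bsub>L\<^esub> \<theta> (x b)) = \<zero>\<^bsub>L\<^esub>"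
    if x: "x \<in> carrier (K.func_space B)" for x
  proof -
    have xC: "x b \<in> carrier ?K" if "b \<in> B" for b using x that by (auto simp: K.func_space_def)
    have eK: "(\<Oplus>\<^bsub>?K\<^esub>b\<in>B. ?\<iota> (\<phi> b) \<otimes>\<^bsub>?K\<^esub> x b [^]\<^bsub>?K\<^esub> p) \<in> carrier ?K"
      using io \<phi> xC by (intro K.finsum_closed) auto
    have "\<theta> (ext_form p F V \<phi> ?K ?\<iota> x) = \<theta> (\<Oplus>\<^bsub>?K\<^esub>b\<in>B. ?\<iota> (\<phi> b) \<otimes>\<^bsub>?K\<^esub> x b [^]\<^bsub>?K\<^esub> p)"
      by (simp add: ext_form_def B(1)[symmetric])
    also have "\<dots> = (\<Oplus>\<^bsub>L\<^esub>b\<in>B. \<theta> (?\<iota> (\<phi> b) \<otimes>\<^bsub>?K\<^esub> x b [^]\<^bsub>?K\<^esub> p))"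
      using io \<phi> xC by (subst th.hom_finsum) (auto simp: comp_def)
    also have "\<dots> = (\<Oplus>\<^bsub>L\<^esub>b\<in>B. (hh (\<phi> b) \<otimes>\<^bsub>L\<^esub> \<theta> (x b)) [^]\<^bsub>L\<^esub> p)"
      by (rule L.finsum_cong') (use io \<phi> xC th(2) th.hom_pow in \<open>auto simp: L.nat_pow_distrib\<close>)
    also have "\<dots> = (\<Oplus>\<^bsub>L\<^esub>b\<in>B. hh (\<phi> b) \<otimes>\<^bsub>L\<^esub> \<theta> (x b)) [^]\<^bsub>L\<^esub> p"
      using L.frobenius_finsum[of "\<lambda>b. hh (\<phi> b) \<otimes>\<^bsub>L\<^esub> \<theta> (x b)" B 1] \<phi> xC by simp
    finally have e: "\<theta> (ext_form p F V \<phi> ?K ?\<iota> x) = (\<Oplus>\<^bsub>L\<^esub>b\<in>B. hh (\<phi> b) \<otimes>\<^bsub>L\<^esub> \<theta> (x b)) [^]\<^bsub>L\<^esub> p" .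
    have C: "(\<Oplus>\<^bsub>L\<^esub>b\<in>B. hh (\<phi> b) \<otimes>\<^bsub>L\<^esub> \<theta> (x b)) \<in> carrier L" using \<phi> xC by (intro L.finsum_closed) auto
    have "ext_form p F V \<phi> ?K ?\<iota> x \<in> carrier ?K" using eK by (simp add: ext_form_def B(1)[symmetric])
    then have "ext_form p F V \<phi> ?K ?\<iota> x = \<zero>\<^bsub>?K\<^esub> \<longleftrightarrow> \<theta> (ext_form p F V \<phi> ?K ?\<iota> x) = \<zero>\<^bsub>L\<^esub>"
      using inj_onD[OF inj, of _ "\<zero>\<^bsub>?K\<^esub>"] th.hom_zero by auto
    also have "\<dots> \<longleftrightarrow> (\<Oplus>\<^bsub>L\<^esub>b\<in>B. hh (\<phi> b) \<otimes>\<^bsub>L\<^esub> \<theta> (x b)) = \<zero>\<^bsub>L\<^esub>"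
      unfolding e by (rule L.pow_eq_zero_iff[OF C L.p_pos])
    finally show ?thesis .
  qed
  have "first_defect_index p F V \<phi> = vectorspace.dim ?K (K.func_space B\<lparr>carrier :=
      {x \<in> carrier (K.func_space B). (\<Oplus>\<^bsub>L\<^esub>b\<in>B. hh (\<phi> b) \<otimes>\<^bsub>L\<^esub> \<theta> (x b)) = \<zero>\<^bsub>L\<^esub>}\<rparr>)"
  proof -
    have "{x \<in> carrier (K.func_space B). ext_form p F V \<phi> ?K ?\<iota> x = \<zero>\<^bsub>?K\<^esub>} =
        {x \<in> carrier (K.func_space B). (\<Oplus>\<^bsub>L\<^esub>b\<in>B. hh (\<phi> b) \<otimes>\<^bsub>L\<^esub> \<theta> (x b)) = \<zero>\<^bsub>L\<^esub>}"
      using zero_iff by blast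
    then show ?thesis
      unfolding first_defect_index_def Let_def defect_index_def ext_space_def B(1)[symmetric] by simp
  qed
  also have "\<dots> = card B - card T"
    by (rule solution_space_dim[OF fK L.field_axioms th(1) B(2) _ T]) (use ind span \<phi> th(3) in auto)
  finally show ?thesis .
qed

end

section \<open>Generic solutions of the linear equation\<close>

text \<open>Fractions are formed inside the given field, so that the fraction fields belonging to
  different exponents can be compared by inclusion.\<close>

definition (in ring) fractions :: "'a set \<Rightarrow> 'a set" where
  "fractions A = {x. \<exists>a\<in>A. \<exists>b\<in>A. b \<noteq> \<zero> \<and> x = a \<otimes> inv b}"

context field
begin

lemma
  assumes A: "subring A R"
  shows fractions_subfield: "subfield (fractions A) R" and fractions_incl: "A \<subseteq> fractions A"
proof -
  note AC = subringE(1)[OF A]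
  have inv: "inv b \<in> carrier R" "b \<otimes> inv b = \<one>" if "b \<in> A" "b \<noteq> \<zero>" for b
    using that AC field_Units by auto
  have mk: "x \<in> fractions A" if "a \<in> A" "b \<in> A" "b \<noteq> \<zero>" "x \<in> carrier R" "x \<otimes> b = a" for x a b
  proof -
    have "x = a \<otimes> inv b" using that inv[OF that(2,3)] AC by (auto simp: m_assoc)
    then show ?thesis unfolding fractions_def using that by blast
  qed
  have br: "\<exists>a\<in>A. \<exists>b\<in>A. b \<noteq> \<zero> \<and> x \<otimes> b = a \<and> x \<in> carrier R" if x: "x \<in> fractions A" for x
  proof -
    obtain a b where ab: "a \<in> A" "b \<in> A" "b \<noteq> \<zero>" "x = a \<otimes> inv b" using x unfolding fractions_def by blast
    have C: "a \<in> carrier R" "b \<in> carrier R" using ab AC by auto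
    have "x \<otimes> b = a" unfolding ab(4) using inv[OF ab(2,3)] C by (simp add: m_assoc m_comm[of "inv b"])
    moreover have "x \<in> carrier R" unfolding ab(4) using inv[OF ab(2,3)] C by simp
    ultimately show ?thesis using ab by blast
  qed
  show incl: "A \<subseteq> fractions A"
  proof
    fix x assume "x \<in> A"
    then show "x \<in> fractions A" using AC by (intro mk[of x \<one>] subringE(3)[OF A]) auto
  qed
  have nz: "b \<otimes> b' \<noteq> \<zero>" if "b \<in> A" "b' \<in> A" "b \<noteq> \<zero>" "b' \<noteq> \<zero>" for b b' using that AC integral by blast
  show "subfield (fractions A) R"
  proof (rule subfieldI')
    show "subring (fractions A) R"
    proof (rule subringI)
      show "fractions A \<subseteq> carrier R" using br by blast
      show "\<one> \<in> fractions A" using incl subringE(3)[OF A] by blast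
      fix x assume x: "x \<in> fractions A"
      obtain a b where ab: "a \<in> A" "b \<in> A" "b \<noteq> \<zero>" "x \<otimes> b = a" "x \<in> carrier R" using br[OF x] by blast
      have C: "a \<in> carrier R" "b \<in> carrier R" using ab AC by auto
      show "\<ominus> x \<in> fractions A"
      proof (rule mk[of "\<ominus> a" b])
        show "\<ominus> x \<otimes> b = \<ominus> a" using ab C by (simp add: l_minus)
      qed (use ab subringE(5)[OF A] in auto)
      fix y assume y: "y \<in> fractions A"
      obtain a' b' where ab': "a' \<in> A" "b' \<in> A" "b' \<noteq> \<zero>" "y \<otimes> b' = a'" "y \<in> carrier R" using br[OF y] by blast
      have C': "a' \<in> carrier R" "b' \<in> carrier R" using ab' AC by auto
      note bb = subringE(6)[OF A ab(2) ab'(2)]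
      show "x \<otimes> y \<in> fractions A"
      proof (rule mk[of "a \<otimes> a'" "b \<otimes> b'"])
        have "(x \<otimes> y) \<otimes> (b \<otimes> b') = (x \<otimes> b) \<otimes> (y \<otimes> b')" using ab(5) ab'(5) C C' by (simp add: m_ac)
        then show "(x \<otimes> y) \<otimes> (b \<otimes> b') = a \<otimes> a'" unfolding ab(4) ab'(4) .
      qed (use ab ab' bb nz subringE(6)[OF A ab(1) ab'(1)] in auto)
      show "x \<oplus> y \<in> fractions A"
      proof (rule mk[of "a \<otimes> b' \<oplus> a' \<otimes> b" "b \<otimes> b'"])
        have "(x \<oplus> y) \<otimes> (b \<otimes> b') = (x \<otimes> b) \<otimes> b' \<oplus> (y \<otimes> b') \<otimes> b"
          using ab(5) ab'(5) C C' by (simp add: l_distr r_distr m_ac)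
        then show "(x \<oplus> y) \<otimes> (b \<otimes> b') = a \<otimes> b' \<oplus> a' \<otimes> b" unfolding ab(4) ab'(4) .
        show "a \<otimes> b' \<oplus> a' \<otimes> b \<in> A"
          by (rule subringE(7)[OF A subringE(6)[OF A ab(1) ab'(2)] subringE(6)[OF A ab'(1) ab(2)]])
      qed (use ab ab' bb nz in auto)
    qed
    fix x assume x: "x \<in> fractions A - {\<zero>}"
    obtain a b where ab: "a \<in> A" "b \<in> A" "b \<noteq> \<zero>" "x \<otimes> b = a" "x \<in> carrier R" using br[of x] x by blast
    have C: "a \<in> carrier R" "b \<in> carrier R" using ab AC by auto
    have ix: "inv x \<in> carrier R" "inv x \<otimes> x = \<one>" using ab(5) x field_Units by auto
    have an: "a \<noteq> \<zero>" using ab(3,4,5) x C integral by blast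
    have "inv x \<otimes> a = b" unfolding ab(4)[symmetric] using ix C ab(5) by (simp add: m_assoc[symmetric])
    then show "inv x \<in> fractions A" using ab an ix by (intro mk[of b a]) auto
  qed
qed

lemma common_denominator:
  assumes A: "subring A R"
  shows "finite J \<Longrightarrow> f \<in> J \<rightarrow> fractions A \<Longrightarrow> \<exists>d\<in>A. d \<noteq> \<zero> \<and> (\<forall>j\<in>J. d \<otimes> f j \<in> A)"
proof (induction J rule: finite_induct)
  case empty
  then show ?case using subringE(3)[OF A] by (intro bexI[of _ \<one>]) auto
next
  case (insert i J)
  note AC = subringE(1)[OF A]
  have fC: "f j \<in> carrier R" if "j \<in> insert i J" for j
    using insert.prems that subfield_closed(1)[OF fractions_subfield[OF A]] by blast
  obtain d where d: "d \<in> A" "d \<noteq> \<zero>" "\<forall>j\<in>J. d \<otimes> f j \<in> A" using insert by auto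
  obtain a b where ab: "a \<in> A" "b \<in> A" "b \<noteq> \<zero>" "f i = a \<otimes> inv b" using insert.prems unfolding fractions_def by blast
  have C: "a \<in> carrier R" "b \<in> carrier R" "d \<in> carrier R" using ab d AC by auto
  have ib: "inv b \<in> carrier R" "b \<otimes> inv b = \<one>" using C(2) ab(3) field_Units by auto
  have "(d \<otimes> b) \<otimes> f j \<in> A" if j: "j \<in> insert i J" for j
  proof (cases "j = i")
    case True
    have "(d \<otimes> b) \<otimes> (a \<otimes> inv b) = (d \<otimes> a) \<otimes> (b \<otimes> inv b)" using C ib(1) by (simp add: m_ac)
    then show ?thesis unfolding True ab(4) using ib C subringE(6)[OF A d(1) ab(1)] by simp
  next
    case False
    then have "b \<otimes> (d \<otimes> f j) \<in> A" using j d(3) subringE(6)[OF A ab(2)] by blast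
    then show ?thesis using C fC[OF j] by (simp add: m_ac)
  qed
  moreover have "d \<otimes> b \<noteq> \<zero>" using C d(2) ab(3) integral by blast
  ultimately show ?case using subringE(6)[OF A d(1) ab(2)] by blast
qed

text \<open>A relation with fractional coefficients is multiplied by a common denominator.\<close>

lemma fam_indep_fractions:
  assumes A: "subring A R" and J: "finite J" and g: "g \<in> J \<rightarrow> carrier R" and ind: "fam_indep A J g"
  shows "fam_indep (fractions A) J g"
  unfolding fam_indep_def
proof (intro ballI impI)
  fix f i assume f: "f \<in> J \<rightarrow> fractions A" and z: "(\<Oplus>j\<in>J. f j \<otimes> g j) = \<zero>" and i: "i \<in> J"
  note AC = subringE(1)[OF A]
  obtain d where d: "d \<in> A" "d \<noteq> \<zero>" "\<forall>j\<in>J. d \<otimes> f j \<in> A" using common_denominator[OF A J f] by blast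
  have fC: "f j \<in> carrier R" if "j \<in> J" for j
    using f that subfield_closed(1)[OF fractions_subfield[OF A]] by blast
  have gC: "g j \<in> carrier R" if "j \<in> J" for j using g that by blast
  have dC: "d \<in> carrier R" using d AC by blast
  have "(\<Oplus>j\<in>J. (d \<otimes> f j) \<otimes> g j) = (\<Oplus>j\<in>J. d \<otimes> (f j \<otimes> g j))"
    by (rule finsum_cong') (use fC gC dC in \<open>auto simp: m_assoc\<close>)
  also have "\<dots> = d \<otimes> (\<Oplus>j\<in>J. f j \<otimes> g j)" by (rule finsum_rdistr[symmetric]) (use J fC gC dC in auto)
  also have "\<dots> = \<zero>" unfolding z using dC by simp
  finally have "(\<Oplus>j\<in>J. (d \<otimes> f j) \<otimes> g j) = \<zero>" .
  moreover have "(\<lambda>j. d \<otimes> f j) \<in> J \<rightarrow> A" using d(3) by auto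
  ultimately have "d \<otimes> f i = \<zero>" using bspec[OF ind[unfolded fam_indep_def], of "\<lambda>j. d \<otimes> f j"] i by blast
  then show "f i = \<zero>" using integral[OF _ dC fC[OF i]] d(2) by blast
qed

end

text \<open>Algebraic independence of the variables \<open>Y\<close> over the copy of
  \<open>F\<close>, stated as injectivity of evaluation. Here coefficients enter through
  \<open>hh\<close> itself, in contrast to the evaluation of \<open>generic_point\<close>.\<close>

locale rational_functions = F?: char_field F p + L?: char_field L p + E?: mpoly_eval F L I hh Y
  for F :: "('a, 'm) ring_scheme" (structure) and L :: "('l, 'k) ring_scheme" (structure) and p
    and I :: "'v set" and hh :: "'a \<Rightarrow> 'l" and Y :: "'v \<Rightarrow> 'l" +
  assumes ev_inj: "\<And>f. f \<in> carrier (mpoly_ring F I) \<Longrightarrow> E.ev f = \<zero>\<^bsub>L\<^esub> \<Longrightarrow> f = \<zero>\<^bsub>mpoly_ring F I\<^esub>"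
begin

sublocale PR: cring E.P by (rule F.mpoly_cring)
sublocale evr: ring_hom_cring E.P L E.ev by (rule E.ev_hom)

definition k where "k = (\<lambda>c. hh c [^]\<^bsub>L\<^esub> p) ` carrier F"

lemma frob: "(\<lambda>c. hh c [^]\<^bsub>L\<^esub> p) \<in> ring_hom F L"
  by (rule ring_hom_memI) (simp_all add: L.nat_pow_distrib L.frobenius_add)

lemma k_subfield: "subfield k L"
proof -
  interpret h: ring_hom_ring F L "\<lambda>c. hh c [^]\<^bsub>L\<^esub> p"
    by (rule ring_hom_ringI2[OF F.ring_axioms L.ring_axioms frob])
  show ?thesis unfolding k_def by (rule h.img_is_subfield(2)[OF F.carrier_is_subfield]) simp
qed

lemma hh_zero: "x \<in> carrier F \<Longrightarrow> hh x = \<zero>\<^bsub>L\<^esub> \<longleftrightarrow> x = \<zero>"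
  using inj_onD[OF non_trivial_field_hom_is_inj[OF E.hom F.field_axioms L.field_axioms], of x \<zero>] by auto

text \<open>The polynomials in the \<open>q\<close>-th powers of the variables with coefficients in \<open>k\<close>.\<close>

definition TP where
  "TP q = {E.ev f |f. f \<in> carrier E.P \<and> (\<forall>m. hh (f m) \<in> k) \<and> (\<forall>m\<in>msupp F f. \<forall>i. q dvd count m i)}"

lemma pC: "f \<in> carrier E.P \<Longrightarrow> f m \<in> carrier F" using F.pset_closed by simp

lemma TP_subring: "subring (TP q) L"
proof (rule L.subringI)
  show "TP q \<subseteq> carrier L" unfolding TP_def by auto
  have k: "\<one>\<^bsub>L\<^esub> \<in> k" "\<zero>\<^bsub>L\<^esub> \<in> k" using L.subfield_closed(2,3)[OF k_subfield] by auto
  have "\<one>\<^bsub>L\<^esub> = E.ev (mterm F \<one> {#})" by (simp add: E.ev_mterm E.mon_empty)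
  moreover have "mterm F \<one> {#} \<in> carrier E.P" by (simp add: F.mterm_in_pset)
  moreover have "hh (mterm F \<one> {#} m) \<in> k" for m using k by (simp add: mterm_def)
  moreover have "msupp F (mterm F \<one> {#}) \<subseteq> {{#}}" by (auto simp: mterm_def msupp_def)
  ultimately show "\<one>\<^bsub>L\<^esub> \<in> TP q" unfolding TP_def by fastforce
  fix x assume "x \<in> TP q"
  then obtain f where f: "f \<in> carrier E.P" "x = E.ev f" "\<forall>m. hh (f m) \<in> k" "\<forall>m\<in>msupp F f. \<forall>i. q dvd count m i"
    unfolding TP_def by blast
  have neg: "hh ((\<ominus>\<^bsub>E.P\<^esub> f) m) = \<ominus>\<^bsub>L\<^esub> hh (f m)" for m
    unfolding F.mpoly_neg[OF f(1)] using pC[OF f(1)] ring_hom_cring.hom_a_inv[of F L hh "f m"] E.hom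
    by (simp add: ring_hom_cring_def ring_hom_cring_axioms_def F.is_cring L.is_cring)
  have "msupp F (\<ominus>\<^bsub>E.P\<^esub> f) = msupp F f"
    unfolding F.mpoly_neg[OF f(1)] using pC[OF f(1)] by (auto simp: msupp_def)
  moreover have "hh ((\<ominus>\<^bsub>E.P\<^esub> f) m) \<in> k" for m unfolding neg using f(3) L.subfield_closed(6)[OF k_subfield] by blast
  moreover have "\<ominus>\<^bsub>L\<^esub> x = E.ev (\<ominus>\<^bsub>E.P\<^esub> f)" unfolding f(2) using evr.hom_a_inv[OF f(1)] by simp
  ultimately show "\<ominus>\<^bsub>L\<^esub> x \<in> TP q" unfolding TP_def using f(4) PR.a_inv_closed[OF f(1)] by auto
  fix y assume "y \<in> TP q"
  then obtain g where g: "g \<in> carrier E.P" "y = E.ev g" "\<forall>m. hh (g m) \<in> k" "\<forall>m\<in>msupp F g. \<forall>i. q dvd count m i"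
    unfolding TP_def by blast
  have "hh ((f \<oplus>\<^bsub>E.P\<^esub> g) m) = hh (f m) \<oplus>\<^bsub>L\<^esub> hh (g m)" for m using pC[OF f(1)] pC[OF g(1)] by simp
  then have "hh ((f \<oplus>\<^bsub>E.P\<^esub> g) m) \<in> k" for m using f(3) g(3) L.subfield_closed(4)[OF k_subfield] by simp
  moreover have "msupp F (f \<oplus>\<^bsub>E.P\<^esub> g) \<subseteq> msupp F f \<union> msupp F g" using pC[OF f(1)] pC[OF g(1)] by (auto simp: msupp_def)
  moreover have "x \<oplus>\<^bsub>L\<^esub> y = E.ev (f \<oplus>\<^bsub>E.P\<^esub> g)" unfolding f(2) g(2) by (rule evr.hom_add[OF f(1) g(1), symmetric])
  ultimately show "x \<oplus>\<^bsub>L\<^esub> y \<in> TP q" unfolding TP_def using f(4) g(4) PR.a_closed[OF f(1) g(1)] by blast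
  have "hh ((f \<otimes>\<^bsub>E.P\<^esub> g) m) \<in> k" for m
  proof -
    interpret h: ring_hom_cring F L hh using E.hom by (simp add: ring_hom_cring_def ring_hom_cring_axioms_def F.is_cring L.is_cring)
    have "hh ((f \<otimes>\<^bsub>E.P\<^esub> g) m) = (\<Oplus>\<^bsub>L\<^esub>l \<in> {l. l \<subseteq># m}. hh (f l \<otimes> g (m - l)))"
      unfolding F.mpoly_mult using pC[OF f(1)] pC[OF g(1)] by (subst h.hom_finsum) (auto simp: comp_def)
    also have "\<dots> \<in> k"
    proof (rule L.subfield_finsum_closed[OF k_subfield], rule funcsetI)
      fix l
      show "hh (f l \<otimes> g (m - l)) \<in> k"
        using L.subfield_closed(5)[OF k_subfield, of "hh (f l)" "hh (g (m - l))"] f(3) g(3) pC[OF f(1)] pC[OF g(1)] by simp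
    qed
    finally show ?thesis .
  qed
  moreover have "\<forall>i. q dvd count m i" if "m \<in> msupp F (f \<otimes>\<^bsub>E.P\<^esub> g)" for m
  proof -
    have "m \<in> (\<lambda>(a, b). a + b) ` (msupp F f \<times> msupp F g)"
      using F.msupp_mult[of f I g] f(1) g(1) that by auto
    then obtain a b where ab: "a \<in> msupp F f" "b \<in> msupp F g" "m = a + b" by auto
    have "\<forall>i. q dvd count a i" "\<forall>i. q dvd count b i" using f(4) g(4) ab(1,2) by blast+
    then show ?thesis unfolding ab(3) by simp
  qed
  moreover have "x \<otimes>\<^bsub>L\<^esub> y = E.ev (f \<otimes>\<^bsub>E.P\<^esub> g)" unfolding f(2) g(2) by (rule evr.hom_mult[OF f(1) g(1), symmetric])
  ultimately show "x \<otimes>\<^bsub>L\<^esub> y \<in> TP q" unfolding TP_def using PR.m_closed[OF f(1) g(1)] by blast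
qed

text \<open>The coefficients contain only exponents divisible by \<open>q\<close>, and the monomials
  of \<open>Ms\<close> only exponents below \<open>q\<close>. Residues modulo \<open>q\<close>
  therefore separate the members of \<open>Ms\<close>, and what remains at \<open>m0 + e0\<close> is
  a relation over \<open>k\<close> among the elements indexed by \<open>D\<close>.\<close>

lemma TP_indep:
  assumes Ms: "finite Ms" "\<And>e i. e \<in> Ms \<Longrightarrow> count e i < q" "\<And>e. e \<in> Ms \<Longrightarrow> set_mset e \<subseteq> I"
    and D: "finite D" "a \<in> D \<rightarrow> carrier F" "L.fam_indep k D (\<lambda>d. hh (a d))"
  shows "L.fam_indep (TP q) (Ms \<times> D) (\<lambda>u. E.mon (fst u) \<otimes>\<^bsub>L\<^esub> hh (a (snd u)))"
  unfolding L.fam_indep_def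
proof (intro ballI impI)
  fix f u0 assume f: "f \<in> Ms \<times> D \<rightarrow> TP q" and u0: "u0 \<in> Ms \<times> D"
    and z: "(\<Oplus>\<^bsub>L\<^esub>u\<in>Ms \<times> D. f u \<otimes>\<^bsub>L\<^esub> (E.mon (fst u) \<otimes>\<^bsub>L\<^esub> hh (a (snd u)))) = \<zero>\<^bsub>L\<^esub>"
  have "\<forall>u\<in>Ms \<times> D. \<exists>g. g \<in> carrier E.P \<and> f u = E.ev g \<and> (\<forall>m. hh (g m) \<in> k) \<and> (\<forall>m\<in>msupp F g. \<forall>i. q dvd count m i)"
    using f unfolding TP_def by blast
  from bchoice[OF this] obtain g where
    "\<forall>u\<in>Ms \<times> D. g u \<in> carrier E.P \<and> f u = E.ev (g u) \<and> (\<forall>m. hh (g u m) \<in> k) \<and> (\<forall>m\<in>msupp F (g u). \<forall>i. q dvd count m i)" by blast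
  then have g: "\<And>u. u \<in> Ms \<times> D \<Longrightarrow> g u \<in> carrier E.P" "\<And>u. u \<in> Ms \<times> D \<Longrightarrow> f u = E.ev (g u)"
    "\<And>u m. u \<in> Ms \<times> D \<Longrightarrow> hh (g u m) \<in> k" "\<And>u m i. u \<in> Ms \<times> D \<Longrightarrow> g u m \<noteq> \<zero> \<Longrightarrow> q dvd count m i"
    by (auto simp: msupp_def)
  have gC: "g u m \<in> carrier F" if "u \<in> Ms \<times> D" for u m by (rule pC[OF g(1)[OF that]])
  have aC: "a (snd u) \<in> carrier F" if "u \<in> Ms \<times> D" for u using D(2) that by auto
  define t where "t u = mterm F (a (snd u)) (fst u) \<otimes>\<^bsub>E.P\<^esub> g u" for u
  have mC: "mterm F (a (snd u)) (fst u) \<in> carrier E.P" if "u \<in> Ms \<times> D" for u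
    using aC[OF that] Ms(3)[of "fst u"] that by (simp add: F.mterm_in_pset mem_Times_iff)
  have tC: "t u \<in> carrier E.P" if "u \<in> Ms \<times> D" for u
    unfolding t_def by (rule PR.m_closed[OF mC[OF that] g(1)[OF that]])
  have fin: "finite (Ms \<times> D)" using Ms(1) D(1) by simp
  have "E.ev (\<Oplus>\<^bsub>E.P\<^esub>u\<in>Ms \<times> D. t u) = (\<Oplus>\<^bsub>L\<^esub>u\<in>Ms \<times> D. E.ev (t u))"
    using tC by (subst evr.hom_finsum) (auto simp: comp_def)
  also have "\<dots> = (\<Oplus>\<^bsub>L\<^esub>u\<in>Ms \<times> D. f u \<otimes>\<^bsub>L\<^esub> (E.mon (fst u) \<otimes>\<^bsub>L\<^esub> hh (a (snd u))))"
  proof (rule L.finsum_cong')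
    fix u assume u: "u \<in> Ms \<times> D"
    have "E.ev (t u) = hh (a (snd u)) \<otimes>\<^bsub>L\<^esub> E.mon (fst u) \<otimes>\<^bsub>L\<^esub> E.ev (g u)"
      unfolding t_def by (rule E.ev_mterm_mult[OF aC[OF u] g(1)[OF u]])
    then show "E.ev (t u) = f u \<otimes>\<^bsub>L\<^esub> (E.mon (fst u) \<otimes>\<^bsub>L\<^esub> hh (a (snd u)))"
      unfolding g(2)[OF u] using aC[OF u] E.ev_closed[OF g(1)[OF u]] by (simp add: L.m_ac)
  qed (use g aC in auto)
  finally have "E.ev (\<Oplus>\<^bsub>E.P\<^esub>u\<in>Ms \<times> D. t u) = \<zero>\<^bsub>L\<^esub>" unfolding z .
  moreover have "(\<Oplus>\<^bsub>E.P\<^esub>u\<in>Ms \<times> D. t u) \<in> carrier E.P" using tC by (intro PR.finsum_closed) blast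
  ultimately have t0: "(\<Oplus>\<^bsub>E.P\<^esub>u\<in>Ms \<times> D. t u) = \<zero>\<^bsub>E.P\<^esub>" by (intro ev_inj)
  have "g u0 m0 = \<zero>" for m0
  proof (rule ccontr)
    assume nz: "g u0 m0 \<noteq> \<zero>"
    obtain e0 d0 where ed: "u0 = (e0, d0)" "e0 \<in> Ms" "d0 \<in> D" using u0 by blast
    have tv: "t u (m0 + e0) = (if fst u = e0 then a (snd u) \<otimes> g u m0 else \<zero>)" if u: "u \<in> Ms \<times> D" for u
    proof -
      have c: "t u (m0 + e0) = (if fst u \<subseteq># m0 + e0 then a (snd u) \<otimes> g u (m0 + e0 - fst u) else \<zero>)"
        unfolding t_def by (rule F.mterm_mult_left[OF aC[OF u] gC[OF u]])
      show ?thesis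
      proof (cases "fst u = e0")
        case False
        have "g u (m0 + e0 - fst u) = \<zero>" if sub: "fst u \<subseteq># m0 + e0"
        proof (rule ccontr)
          assume n: "g u (m0 + e0 - fst u) \<noteq> \<zero>"
          have "count e0 i = count (fst u) i" for i
          proof -
            have d1: "q dvd count (m0 + e0 - fst u) i" by (rule g(4)[OF u n])
            have d2: "q dvd count m0 i" by (rule g(4)[OF u0 nz])
            have le: "count (fst u) i \<le> count m0 i + count e0 i" using mset_subset_eq_count[OF sub, of i] by simp
            have "q dvd count m0 i + count e0 i - count (fst u) i" using d1 by simp
            then have "(count m0 i + count e0 i) mod q = count (fst u) i mod q"
              using le by (metis mod_eq_dvd_iff_nat)
            moreover have "(count m0 i + count e0 i) mod q = count e0 i mod q"
              using d2 by (metis add_0 dvd_eq_mod_eq_0 mod_add_left_eq)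
            ultimately show ?thesis using Ms(2)[OF ed(2), of i] Ms(2)[of "fst u" i] u by auto
          qed
          then show False using False multiset_eqI by metis
        qed
        then show ?thesis unfolding c using False aC[OF u] by auto
      qed (simp add: c)
    qed
    have "\<zero> = (\<Oplus>\<^bsub>E.P\<^esub>u\<in>Ms \<times> D. t u) (m0 + e0)" unfolding t0 by simp
    also have "\<dots> = (\<Oplus>u\<in>Ms \<times> D. t u (m0 + e0))" by (rule F.mpoly_finsum_apply[OF fin tC])
    also have "\<dots> = (\<Oplus>u\<in>Pair e0 ` D. a (snd u) \<otimes> g u m0)"
      by (rule F.add.finprod_mono_neutral_cong_right) (use fin ed tv aC gC in \<open>auto\<close>)
    also have "\<dots> = (\<Oplus>d\<in>D. a d \<otimes> g (e0, d) m0)"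
      using aC gC ed by (subst F.add.finprod_reindex) (auto simp: inj_on_def)
    finally have s: "(\<Oplus>d\<in>D. a d \<otimes> g (e0, d) m0) = \<zero>" by simp
    interpret h: ring_hom_cring F L hh using E.hom by (simp add: ring_hom_cring_def ring_hom_cring_axioms_def F.is_cring L.is_cring)
    have C: "a d \<in> carrier F" "g (e0, d) m0 \<in> carrier F" if "d \<in> D" for d using aC[of "(e0, d)"] gC ed that by auto
    have "\<zero>\<^bsub>L\<^esub> = hh (\<Oplus>d\<in>D. a d \<otimes> g (e0, d) m0)" unfolding s by simp
    also have "\<dots> = (\<Oplus>\<^bsub>L\<^esub>d\<in>D. hh (a d \<otimes> g (e0, d) m0))" using C by (subst h.hom_finsum) (auto simp: comp_def)
    also have "\<dots> = (\<Oplus>\<^bsub>L\<^esub>d\<in>D. hh (g (e0, d) m0) \<otimes>\<^bsub>L\<^esub> hh (a d))"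
      by (rule L.finsum_cong') (use C in \<open>auto simp: L.m_comm\<close>)
    finally have "(\<Oplus>\<^bsub>L\<^esub>d\<in>D. hh (g (e0, d) m0) \<otimes>\<^bsub>L\<^esub> hh (a d)) = \<zero>\<^bsub>L\<^esub>" by simp
    moreover have "(\<lambda>d. hh (g (e0, d) m0)) \<in> D \<rightarrow> k" using g(3) ed by auto
    ultimately have "hh (g (e0, d0) m0) = \<zero>\<^bsub>L\<^esub>"
      using bspec[OF D(3)[unfolded L.fam_indep_def], of "\<lambda>d. hh (g (e0, d) m0)"] ed(3) by blast
    then show False using hh_zero[OF gC[OF u0]] nz ed(1) by simp
  qed
  then have "E.ev (g u0) = \<zero>\<^bsub>L\<^esub>" unfolding E.ev_def msupp_def by simp
  then show "f u0 = \<zero>\<^bsub>L\<^esub>" using g(2)[OF u0] by simp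
qed

text \<open>Serves to show that the coordinate eliminated from the generic solution lies outside
  k(Y). After clearing the denominator, one coefficient of lowest degree would make
  \<open>hh c0\<close> a quotient of two elements of \<open>k\<close>.\<close>

lemma linear_form_not_fraction:
  assumes c0: "c0 \<in> carrier F" "hh c0 \<notin> k" and c: "c \<in> I \<rightarrow> carrier F"
  shows "hh c0 \<oplus>\<^bsub>L\<^esub> (\<Oplus>\<^bsub>L\<^esub>i\<in>I. hh (c i) \<otimes>\<^bsub>L\<^esub> Y i) \<notin> L.fractions (TP 1)"
proof
  let ?al = "hh c0 \<oplus>\<^bsub>L\<^esub> (\<Oplus>\<^bsub>L\<^esub>i\<in>I. hh (c i) \<otimes>\<^bsub>L\<^esub> Y i)"
  assume "?al \<in> L.fractions (TP 1)"
  then obtain a b where ab: "a \<in> TP 1" "b \<in> TP 1" "b \<noteq> \<zero>\<^bsub>L\<^esub>" "?al = a \<otimes>\<^bsub>L\<^esub> inv\<^bsub>L\<^esub> b"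
    unfolding L.fractions_def by blast
  obtain f where f: "f \<in> carrier E.P" "a = E.ev f" "\<forall>m. hh (f m) \<in> k" using ab(1) unfolding TP_def by blast
  obtain g where g: "g \<in> carrier E.P" "b = E.ev g" "\<forall>m. hh (g m) \<in> k" using ab(2) unfolding TP_def by blast
  have cC: "c i \<in> carrier F" if "i \<in> I" for i using c that by blast
  have bC: "b \<in> carrier L" "a \<in> carrier L" unfolding g(2) f(2) by (rule E.ev_closed[OF g(1)], rule E.ev_closed[OF f(1)])
  have "inv\<^bsub>L\<^esub> b \<in> carrier L" "inv\<^bsub>L\<^esub> b \<otimes>\<^bsub>L\<^esub> b = \<one>\<^bsub>L\<^esub>" using bC ab(3) L.field_Units by auto
  then have eq: "?al \<otimes>\<^bsub>L\<^esub> b = a" unfolding ab(4) using bC by (simp add: L.m_assoc)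
  define t where "t i = mterm F (c i) {#i#} \<otimes>\<^bsub>E.P\<^esub> g" for i
  define t0 where "t0 = mterm F c0 {#} \<otimes>\<^bsub>E.P\<^esub> g"
  have mC: "mterm F c0 {#} \<in> carrier E.P" "\<And>i. i \<in> I \<Longrightarrow> mterm F (c i) {#i#} \<in> carrier E.P"
    using c0 cC by (simp_all add: F.mterm_in_pset)
  have tC: "t0 \<in> carrier E.P" "\<And>i. i \<in> I \<Longrightarrow> t i \<in> carrier E.P"
    unfolding t_def t0_def using mC g(1) PR.m_closed by blast+
  have sC: "(\<Oplus>\<^bsub>E.P\<^esub>i\<in>I. t i) \<in> carrier E.P" using tC by (intro PR.finsum_closed) blast
  have "E.ev (t0 \<oplus>\<^bsub>E.P\<^esub> (\<Oplus>\<^bsub>E.P\<^esub>i\<in>I. t i)) = E.ev t0 \<oplus>\<^bsub>L\<^esub> (\<Oplus>\<^bsub>L\<^esub>i\<in>I. E.ev (t i))"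
    unfolding evr.hom_add[OF tC(1) sC] using tC(2) by (subst evr.hom_finsum) (auto simp: comp_def)
  also have "E.ev t0 = hh c0 \<otimes>\<^bsub>L\<^esub> b"
    unfolding t0_def E.ev_mterm_mult[OF c0(1) g(1)] g(2) using c0 by (simp add: E.mon_empty)
  also have "(\<Oplus>\<^bsub>L\<^esub>i\<in>I. E.ev (t i)) = (\<Oplus>\<^bsub>L\<^esub>i\<in>I. hh (c i) \<otimes>\<^bsub>L\<^esub> Y i \<otimes>\<^bsub>L\<^esub> b)"
  proof (rule L.finsum_cong')
    show "E.ev (t i) = hh (c i) \<otimes>\<^bsub>L\<^esub> Y i \<otimes>\<^bsub>L\<^esub> b" if "i \<in> I" for i
      unfolding t_def E.ev_mterm_mult[OF cC[OF that] g(1)] g(2) E.mon_single[OF that] ..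
  qed (use cC E.z bC in auto)
  also have "\<dots> = (\<Oplus>\<^bsub>L\<^esub>i\<in>I. hh (c i) \<otimes>\<^bsub>L\<^esub> Y i) \<otimes>\<^bsub>L\<^esub> b"
    by (rule L.finsum_ldistr[symmetric]) (use E.fin cC E.z bC in auto)
  also have "hh c0 \<otimes>\<^bsub>L\<^esub> b \<oplus>\<^bsub>L\<^esub> \<dots> = E.ev f"
    unfolding f(2)[symmetric] eq[symmetric] using c0 cC E.z bC by (subst L.l_distr) (auto intro!: L.finsum_closed)
  finally have e: "E.ev (t0 \<oplus>\<^bsub>E.P\<^esub> (\<Oplus>\<^bsub>E.P\<^esub>i\<in>I. t i)) = E.ev f" .
  define h where "h = t0 \<oplus>\<^bsub>E.P\<^esub> (\<Oplus>\<^bsub>E.P\<^esub>i\<in>I. t i)"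
  have hC: "h \<in> carrier E.P" unfolding h_def by (rule PR.a_closed[OF tC(1) sC])
  have "E.ev (h \<ominus>\<^bsub>E.P\<^esub> f) = \<zero>\<^bsub>L\<^esub>"
    unfolding PR.minus_eq evr.hom_add[OF hC PR.a_inv_closed[OF f(1)]] evr.hom_a_inv[OF f(1)] e[folded h_def]
    by (rule L.r_neg[OF E.ev_closed[OF f(1)]])
  then have "h \<ominus>\<^bsub>E.P\<^esub> f = \<zero>\<^bsub>E.P\<^esub>" by (intro ev_inj PR.minus_closed hC f(1))
  then have hf: "h = f" using PR.r_right_minus_eq[OF hC f(1)] by blast
  have "msupp F g \<noteq> {}"
  proof
    assume "msupp F g = {}"
    then have "E.ev g = \<zero>\<^bsub>L\<^esub>" unfolding E.ev_def by simp
    then show False using ab(3) g(2) by simp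
  qed
  \<comment> \<open>A monomial of least degree in the denominator. A variable times the denominator
    cannot produce it, so only the constant term \<open>c0\<close> of the linear form contributes to
    its coefficient.\<close>
  then obtain m where m: "g m \<noteq> \<zero>" "\<And>m'. g m' \<noteq> \<zero> \<Longrightarrow> size m \<le> size m'"
    using ex_has_least_nat[of "\<lambda>m. m \<in> msupp F g" _ size] unfolding msupp_def by auto
  have gC: "g l \<in> carrier F" for l by (rule pC[OF g(1)])
  have ti: "t i m = \<zero>" if i: "i \<in> I" for i
  proof -
    have c1: "t i m = (if {#i#} \<subseteq># m then c i \<otimes> g (m - {#i#}) else \<zero>)"
      unfolding t_def by (rule F.mterm_mult_left[OF cC[OF i] gC])
    have "g (m - {#i#}) = \<zero>" if s: "{#i#} \<subseteq># m"
    proof (rule ccontr)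
      assume "g (m - {#i#}) \<noteq> \<zero>"
      then have "size m \<le> size (m - {#i#})" by (rule m(2))
      moreover have "size (m - {#i#}) < size m" using s by (simp add: size_Diff1_less)
      ultimately show False by simp
    qed
    then show ?thesis unfolding c1 using cC[OF i] by simp
  qed
  have "f m = t0 m \<oplus> (\<Oplus>\<^bsub>E.P\<^esub>i\<in>I. t i) m" unfolding hf[symmetric] h_def by simp
  also have "(\<Oplus>\<^bsub>E.P\<^esub>i\<in>I. t i) m = (\<Oplus>i\<in>I. t i m)" by (rule F.mpoly_finsum_apply[OF E.fin tC(2)])
  also have "\<dots> = \<zero>" using ti by (intro F.add.finprod_one_eqI) auto
  also have "t0 m = c0 \<otimes> g m" unfolding t0_def F.mterm_mult_left[OF c0(1) gC] by simp
  finally have "f m = c0 \<otimes> g m" using c0 gC by simp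
  then have fm: "hh (f m) = hh c0 \<otimes>\<^bsub>L\<^esub> hh (g m)" using c0 gC by simp
  have gm: "hh (g m) \<in> k" "hh (g m) \<noteq> \<zero>\<^bsub>L\<^esub>" using g(3) m(1) hh_zero[OF gC] by auto
  have u: "hh (g m) \<in> Units L" using gm gC L.field_Units by simp
  have "hh c0 = hh (f m) \<otimes>\<^bsub>L\<^esub> inv\<^bsub>L\<^esub> (hh (g m))" unfolding fm using c0 u by (simp add: L.m_assoc L.Units_closed)
  also have "\<dots> \<in> k" using f(3) L.subfield_closed(5,7)[OF k_subfield] gm by blast
  finally show False using c0(2) by contradiction
qed

end

text \<open>The type of \<open>L\<close> is spelled out because it depends only on the types of
  \<open>F\<close> and of the variables; the main theorem can therefore obtain such a field inside
  its own proof.\<close>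

lemma (in char_field) rational_functions_exist:
  assumes I: "finite (I :: 'v set)"
  shows "\<exists>(L :: (('v multiset \<Rightarrow> 'a) \<times> ('v multiset \<Rightarrow> 'a)) set ring) hh Y. rational_functions R L p I hh Y"
proof -
  define D where "D = mpoly_ring R I"
  interpret D: domain D unfolding D_def by (rule mpoly_domain[OF I])
  \<comment> \<open>Every graded piece is the whole ring, so homogeneous fractions are all
    fractions.\<close>
  interpret H: hfrac_domain D "\<lambda>_. carrier D"
    by unfold_locales (use D.integral in auto)
  define ka where "ka f = hfrac D (\<lambda>_. carrier D) f \<one>\<^bsub>D\<^esub>" for f
  interpret L: field H.K by (rule H.hfrac_field)
  have pr: "(f, \<one>\<^bsub>D\<^esub>) \<in> H.Pr" if "f \<in> carrier D" for f
    by (rule H.pairI) (use that in auto)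
  have ka_hom: "ka \<in> ring_hom D H.K"
  proof (rule ring_hom_memI)
    show "ka \<one>\<^bsub>D\<^esub> = \<one>\<^bsub>H.K\<^esub>" unfolding ka_def H.K_one ..
    fix f assume f: "f \<in> carrier D"
    show "ka f \<in> carrier H.K" unfolding ka_def by (rule H.hfrac_carrier[OF pr[OF f]])
    fix g assume g: "g \<in> carrier D"
    show "ka (f \<otimes>\<^bsub>D\<^esub> g) = ka f \<otimes>\<^bsub>H.K\<^esub> ka g"
      unfolding ka_def H.hfrac_mult[OF pr[OF f] pr[OF g]] by simp
    show "ka (f \<oplus>\<^bsub>D\<^esub> g) = ka f \<oplus>\<^bsub>H.K\<^esub> ka g"
      unfolding ka_def H.hfrac_add[OF pr[OF f] pr[OF g]] using f g by simp
  qed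
  have ka_zero: "f = \<zero>\<^bsub>D\<^esub>" if "f \<in> carrier D" "ka f = \<zero>\<^bsub>H.K\<^esub>" for f
    using that(2) unfolding ka_def H.hfrac_zero_iff[OF pr[OF that(1)]] .
  define hh where "hh c = ka (mterm R c {#})" for c
  define Y where "Y i = ka (mterm R \<one> {#i#})" for i
  have mD: "mterm R c m \<in> carrier D" if "c \<in> carrier R" "set_mset m \<subseteq> I" for c m
    unfolding D_def using that by (simp add: mterm_in_pset)
  have hh_hom: "hh \<in> ring_hom R H.K"
  proof (rule ring_hom_memI)
    have "mterm R \<one> {#} = \<one>\<^bsub>D\<^esub>" by (simp add: D_def mpoly_ring_def indexed_const_mterm)
    then show "hh \<one> = \<one>\<^bsub>H.K\<^esub>" unfolding hh_def using ring_hom_one[OF ka_hom] by simp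
    fix c assume c: "c \<in> carrier R"
    show "hh c \<in> carrier H.K" unfolding hh_def using ring_hom_closed[OF ka_hom] mD c by simp
    fix c' assume c': "c' \<in> carrier R"
    have "mterm R (c \<otimes> c') {#} = mterm R c {#} \<otimes>\<^bsub>D\<^esub> mterm R c' {#}"
      unfolding D_def using mterm_mterm_mult[OF c c', where I = I and m = "{#}" and m' = "{#}"] by simp
    then show "hh (c \<otimes> c') = hh c \<otimes>\<^bsub>H.K\<^esub> hh c'" unfolding hh_def using ring_hom_mult[OF ka_hom] mD c c' by simp
    have "mterm R (c \<oplus> c') {#} = mterm R c {#} \<oplus>\<^bsub>D\<^esub> mterm R c' {#}"
      unfolding D_def using c c' by (auto simp: mterm_def)
    then show "hh (c \<oplus> c') = hh c \<oplus>\<^bsub>H.K\<^esub> hh c'" unfolding hh_def using ring_hom_add[OF ka_hom] mD c c' by simp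
  qed
  have YC: "Y i \<in> carrier H.K" if "i \<in> I" for i unfolding Y_def using ring_hom_closed[OF ka_hom] mD that by simp
  interpret h: ring_hom_cring R H.K hh
    using hh_hom by (simp add: ring_hom_cring_def ring_hom_cring_axioms_def is_cring L.is_cring)
  have "hh ([n] \<cdot> \<one>) = [n] \<cdot>\<^bsub>H.K\<^esub> \<one>\<^bsub>H.K\<^esub>" for n :: nat
    by (induction n) (simp_all add: add.nat_pow_Suc L.add.nat_pow_Suc)
  from this[of p] have "[p] \<cdot>\<^bsub>H.K\<^esub> \<one>\<^bsub>H.K\<^esub> = \<zero>\<^bsub>H.K\<^esub>" unfolding p_zero by simp
  then interpret Lp: char_field H.K p by unfold_locales (use p_prime in auto)
  interpret E: mpoly_eval R H.K I hh Y by unfold_locales (use I hh_hom YC in auto)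
  have ev: "E.ev f = ka f" if f: "f \<in> indexed_pset I (carrier R)" for f
    using f
  proof (induction f rule: indexed_pset.induct)
    case (indexed_const c)
    show ?case unfolding E.ev_const[OF indexed_const] unfolding hh_def indexed_const_mterm ..
  next
    case (indexed_padd P Q)
    have C: "P \<in> carrier D" "Q \<in> carrier D" using indexed_padd.hyps by (simp_all add: D_def)
    have e: "indexed_padd P Q = P \<oplus>\<^bsub>D\<^esub> Q" by (simp add: D_def mpoly_ring_def)
    show ?case
      unfolding e ring_hom_add[OF ka_hom C] E.ev_add[folded D_def, OF C] indexed_padd.IH ..
  next
    case (indexed_pmult P i)
    have C: "P \<in> carrier D" "mterm R \<one> {#i#} \<in> carrier D" using indexed_pmult.hyps by (simp_all add: D_def mterm_in_pset)
    have e: "indexed_pmult P i = mterm R \<one> {#i#} \<otimes>\<^bsub>D\<^esub> P" using E.pmult_eq[folded D_def, OF C(1)] .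
    have "E.ev (mterm R \<one> {#i#} \<otimes>\<^bsub>D\<^esub> P) = Y i \<otimes>\<^bsub>H.K\<^esub> E.ev P"
      unfolding E.ev_mterm_mult[folded D_def, OF one_closed C(1)] E.mon_single[OF indexed_pmult.hyps(2)]
      using YC[OF indexed_pmult.hyps(2)] E.ev_closed[folded D_def, OF C(1)] h.hom_one by simp
    then show ?case unfolding e ring_hom_mult[OF ka_hom C(2,1)] indexed_pmult.IH Y_def .
  qed
  have "rational_functions R H.K p I hh Y"
  proof unfold_locales
    fix f assume f: "f \<in> carrier (mpoly_ring R I)" "E.ev f = \<zero>\<^bsub>H.K\<^esub>"
    have "f \<in> indexed_pset I (carrier R)" using f(1) by simp
    from ev[OF this] have "ka f = \<zero>\<^bsub>H.K\<^esub>" using f(2) by simp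
    then show "f = \<zero>\<^bsub>mpoly_ring R I\<^esub>" using ka_zero[of f] f(1) unfolding D_def by blast
  qed
  then show ?thesis by blast
qed

section \<open>Monomials and powers in the rational function field\<close>

context rational_functions
begin

lemma TP_mono:
  assumes "q' dvd q"
  shows "TP q \<subseteq> TP q'"
proof
  fix x assume "x \<in> TP q"
  then obtain f where f: "x = E.ev f" "f \<in> carrier E.P" "\<forall>m. hh (f m) \<in> k" "\<forall>m\<in>msupp F f. \<forall>i. q dvd count m i"
    unfolding TP_def by blast
  have "\<forall>m\<in>msupp F f. \<forall>i. q' dvd count m i" using f(4) dvd_trans[OF assms] by blast
  then show "x \<in> TP q'" unfolding TP_def using f(1,2,3) by blast
qed

lemma TP_mterm:
  assumes "c \<in> carrier F" "hh c \<in> k" "set_mset m \<subseteq> I" "\<And>i. q dvd count m i"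
  shows "hh c \<otimes>\<^bsub>L\<^esub> E.mon m \<in> TP q"
proof -
  have k: "\<zero>\<^bsub>L\<^esub> \<in> k" using L.subfield_closed(2)[OF k_subfield] .
  have 1: "mterm F c m \<in> carrier E.P" using assms by (simp add: F.mterm_in_pset)
  have 2: "hh (mterm F c m l) \<in> k" for l using assms(2) k by (simp add: mterm_def)
  have 3: "msupp F (mterm F c m) \<subseteq> {m}" by (auto simp: mterm_def msupp_def)
  have 4: "hh c \<otimes>\<^bsub>L\<^esub> E.mon m = E.ev (mterm F c m)" by (rule E.ev_mterm[OF assms(1), symmetric])
  show ?thesis unfolding TP_def using 1 2 3 4 assms(4) by blast
qed

lemma k_in_TP: "k \<subseteq> TP q"
proof
  fix x assume x: "x \<in> k"
  then obtain c where c: "c \<in> carrier F" "x = hh c [^]\<^bsub>L\<^esub> p" unfolding k_def by blast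
  interpret h: ring_hom_cring F L hh using E.hom by (simp add: ring_hom_cring_def ring_hom_cring_axioms_def F.is_cring L.is_cring)
  have "x = hh (c [^] p)" using c h.hom_pow by simp
  then show "x \<in> TP q" using TP_mterm[of "c [^] p" "{#}" q] c x by (simp add: E.mon_empty)
qed

lemma hh_one_k: "hh \<one> \<in> k" using L.subfield_closed(3)[OF k_subfield] by simp

lemma mon_in_TP1: "set_mset m \<subseteq> I \<Longrightarrow> E.mon m \<in> TP 1"
  using TP_mterm[of \<one> m 1] hh_one_k by simp

lemma Y_in_TP1: "i \<in> I \<Longrightarrow> Y i \<in> TP 1"
  using mon_in_TP1[of "{#i#}"] E.mon_single[of i] by simp

lemma Y_pow_in_TP: "i \<in> I \<Longrightarrow> Y i [^]\<^bsub>L\<^esub> q \<in> TP q"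
  using TP_mterm[of \<one> "replicate_mset q i" q] hh_one_k E.z by (simp add: E.mon_replicate)

lemma Y_nonzero: "i \<in> I \<Longrightarrow> Y i \<noteq> \<zero>\<^bsub>L\<^esub>"
proof
  assume i: "i \<in> I" "Y i = \<zero>\<^bsub>L\<^esub>"
  have C: "mterm F \<one> {#i#} \<in> carrier E.P" using i by (simp add: F.mterm_in_pset)
  have "E.ev (mterm F \<one> {#i#}) = \<zero>\<^bsub>L\<^esub>" using i by (simp add: E.ev_mterm E.mon_single)
  from ev_inj[OF C this] have "mterm F \<one> {#i#} {#i#} = \<zero>" by simp
  then show False by (simp add: mterm_def)
qed

lemma pow_in_k:
  assumes "c \<in> carrier F" "0 < t"
  shows "hh c [^]\<^bsub>L\<^esub> (p ^ t) \<in> k"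
proof -
  interpret h: ring_hom_cring F L hh using E.hom by (simp add: ring_hom_cring_def ring_hom_cring_axioms_def F.is_cring L.is_cring)
  obtain s where t: "t = Suc s" using assms(2) gr0_implies_Suc by blast
  have "hh c [^]\<^bsub>L\<^esub> (p ^ t) = hh (c [^] (p ^ s)) [^]\<^bsub>L\<^esub> p"
    unfolding t using assms(1) h.hom_pow by (simp add: L.nat_pow_pow mult.commute)
  then show ?thesis unfolding k_def using assms(1) by blast
qed

text \<open>The guard \<open>0 < q\<close> takes care of the case without variables, where the empty
  monomial is counted even for \<open>q = 0\<close>.\<close>

lemma box_card:
  "\<exists>Ms. finite Ms \<and> card Ms = q ^ card I \<and> (\<forall>m\<in>Ms. set_mset m \<subseteq> I \<and> (\<forall>i. 0 < q \<longrightarrow> count m i < q))"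
proof -
  define b where "b f = (\<Sum>i\<in>I. replicate_mset (f i) i)" for f :: "'v \<Rightarrow> nat"
  have cnt: "count (b f) j = (if j \<in> I then f j else 0)" for f j
    unfolding b_def using E.fin by (simp add: count_sum sum.delta)
  define Ms where "Ms = b ` (I \<rightarrow>\<^sub>E {..<q})"
  have inj: "inj_on b (I \<rightarrow>\<^sub>E {..<q})"
  proof (rule inj_onI)
    fix f g assume f: "f \<in> I \<rightarrow>\<^sub>E {..<q}" and g: "g \<in> I \<rightarrow>\<^sub>E {..<q}" and e: "b f = b g"
    show "f = g" by (rule PiE_ext[OF f g]) (use cnt[of f] cnt[of g] e in metis)
  qed
  have "finite Ms" unfolding Ms_def using E.fin by (intro finite_imageI finite_PiE) auto
  moreover have "card Ms = q ^ card I"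
    unfolding Ms_def card_image[OF inj] using E.fin by (simp add: card_PiE)
  moreover have "set_mset m \<subseteq> I \<and> (\<forall>i. 0 < q \<longrightarrow> count m i < q)" if m: "m \<in> Ms" for m
  proof -
    obtain f where f: "f \<in> I \<rightarrow>\<^sub>E {..<q}" "m = b f" using m unfolding Ms_def by blast
    have "i \<in> I" if "i \<in># m" for i using that cnt[of f i] unfolding f(2) by (metis count_eq_zero_iff)
    moreover have "count m i < q" if "0 < q" for i unfolding f(2) cnt using f(1) that by auto
    ultimately show ?thesis by blast
  qed
  ultimately show ?thesis by blast
qed

end

text \<open>The generic point of the hypersurface \<open>\<Sum> \<phi>(v) x\<^sub>v = 0\<close> with \<open>x\<^sub>e\<^sub>0 = 1\<close>, solved for \<open>x\<^sub>e\<^sub>1\<close>.\<close>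

locale generic_solution = rational_functions F L p I hh Y
  for F :: "('a, 'm) ring_scheme" (structure) and L :: "('l, 'k) ring_scheme" (structure) and p
    and I :: "'v set" and hh :: "'a \<Rightarrow> 'l" and Y :: "'v \<Rightarrow> 'l" +
  fixes A :: "'v set" and e0 e1 :: 'v and \<phi> :: "'v \<Rightarrow> 'a"
  assumes finA: "finite A" and e01: "e0 \<in> A" "e1 \<in> A" "e0 \<noteq> e1" and I: "I = A - {e0, e1}"
    and \<phi>: "\<And>v. v \<in> A \<Longrightarrow> \<phi> v \<in> carrier F" and \<phi>_indep: "L.fam_indep k A (\<lambda>v. hh (\<phi> v))"
begin

sublocale h: ring_hom_cring F L hh
  using E.hom by (simp add: ring_hom_cring_def ring_hom_cring_axioms_def F.is_cring L.is_cring)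

lemma \<phi>_nonzero:
  assumes v: "v \<in> A"
  shows "\<phi> v \<noteq> \<zero>"
proof
  assume z: "\<phi> v = \<zero>"
  have i: "L.fam_indep k {v} (\<lambda>v. hh (\<phi> v))"
    by (rule L.fam_indep_subset[OF k_subfield \<phi>_indep]) (use v finA \<phi> in auto)
  have "(\<Oplus>\<^bsub>L\<^esub>v\<in>{v}. \<one>\<^bsub>L\<^esub> \<otimes>\<^bsub>L\<^esub> hh (\<phi> v)) = \<zero>\<^bsub>L\<^esub>" using z by (intro L.add.finprod_one_eqI) auto
  then have "\<one>\<^bsub>L\<^esub> = \<zero>\<^bsub>L\<^esub>"
    using L.fam_indepD[OF k_subfield i, of "\<lambda>_. \<one>\<^bsub>L\<^esub>" v] L.subfield_closed(3)[OF k_subfield] by auto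
  then show False by simp
qed

definition cf where "cf v = \<ominus> (\<phi> v \<otimes> inv (\<phi> e1))"

definition \<alpha> where "\<alpha> = hh (cf e0) \<oplus>\<^bsub>L\<^esub> (\<Oplus>\<^bsub>L\<^esub>i\<in>I. hh (cf i) \<otimes>\<^bsub>L\<^esub> Y i)"

definition x where "x v = (if v = e0 then \<one>\<^bsub>L\<^esub> else if v = e1 then \<alpha> else Y v)"

definition N where "N = generate_field L (k \<union> x ` A)"

lemma \<phi>1: "\<phi> e1 \<in> Units F" "inv (\<phi> e1) \<in> carrier F"
  using \<phi>[OF e01(2)] \<phi>_nonzero[OF e01(2)] F.field_Units by auto

lemma cf_closed: "v \<in> A \<Longrightarrow> cf v \<in> carrier F"
  unfolding cf_def using \<phi> \<phi>1 by simp

lemma cf_mult: "v \<in> A \<Longrightarrow> \<phi> e1 \<otimes> cf v = \<ominus> \<phi> v"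
proof -
  assume v: "v \<in> A"
  have "\<phi> e1 \<otimes> (\<phi> v \<otimes> inv (\<phi> e1)) = \<phi> v \<otimes> (\<phi> e1 \<otimes> inv (\<phi> e1))"
    using \<phi>[OF v] \<phi>[OF e01(2)] \<phi>1 by (simp add: F.m_ac del: F.Units_r_inv)
  then show ?thesis unfolding cf_def using \<phi>[OF v] \<phi>[OF e01(2)] \<phi>1 by (simp add: F.r_minus)
qed

lemma I_A: "I \<subseteq> A" unfolding I by blast

lemma \<alpha>_closed: "\<alpha> \<in> carrier L"
  unfolding \<alpha>_def using cf_closed[OF e01(1)] cf_closed I_A E.z by (intro L.a_closed L.finsum_closed) auto

lemma x_closed: "v \<in> A \<Longrightarrow> x v \<in> carrier L"
  unfolding x_def using \<alpha>_closed E.z I by auto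

text \<open>Otherwise the values at \<open>e0\<close> and \<open>e1\<close> would be proportional
  over \<open>k\<close>. That this ratio is outside \<open>k\<close> is what makes
  \<open>\<alpha>\<close> a p-th root of degree exactly \<open>p\<close> over k(Y).\<close>

lemma cf_not_k: "hh (cf e0) \<notin> k"
proof
  assume k: "hh (cf e0) \<in> k"
  have i: "L.fam_indep k {e0, e1} (\<lambda>v. hh (\<phi> v))"
    by (rule L.fam_indep_subset[OF k_subfield \<phi>_indep]) (use e01 finA \<phi> in auto)
  define f where "f v = (if v = e0 then \<one>\<^bsub>L\<^esub> else hh (cf e0))" for v
  have f: "f \<in> {e0, e1} \<rightarrow> k" unfolding f_def using k L.subfield_closed(3)[OF k_subfield] by auto
  note C = \<phi>[OF e01(1)] \<phi>[OF e01(2)] cf_closed[OF e01(1)]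
  have "(\<Oplus>\<^bsub>L\<^esub>v\<in>{e0, e1}. f v \<otimes>\<^bsub>L\<^esub> hh (\<phi> v)) = hh (\<phi> e0) \<oplus>\<^bsub>L\<^esub> hh (cf e0) \<otimes>\<^bsub>L\<^esub> hh (\<phi> e1)"
    using e01(3) C by (simp add: f_def)
  also have "hh (cf e0) \<otimes>\<^bsub>L\<^esub> hh (\<phi> e1) = hh (\<phi> e1 \<otimes> cf e0)" using C by (simp add: L.m_comm)
  also have "hh (\<phi> e0) \<oplus>\<^bsub>L\<^esub> hh (\<phi> e1 \<otimes> cf e0) = \<zero>\<^bsub>L\<^esub>"
    unfolding cf_mult[OF e01(1)] using C by (simp add: L.r_neg)
  finally have "(\<Oplus>\<^bsub>L\<^esub>v\<in>{e0, e1}. f v \<otimes>\<^bsub>L\<^esub> hh (\<phi> v)) = \<zero>\<^bsub>L\<^esub>" .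
  then have "f e0 = \<zero>\<^bsub>L\<^esub>" using L.fam_indepD[OF k_subfield i f, of e0] by simp
  then show False by (simp add: f_def)
qed

lemma relation: "(\<Oplus>\<^bsub>L\<^esub>v\<in>A. hh (\<phi> v) \<otimes>\<^bsub>L\<^esub> x v) = \<zero>\<^bsub>L\<^esub>"
proof -
  define u where "u v = hh (\<phi> v) \<otimes>\<^bsub>L\<^esub> x v" for v
  have uC: "u v \<in> carrier L" if "v \<in> A" for v unfolding u_def using \<phi> x_closed that by simp
  have A: "A = insert e0 (insert e1 I)" unfolding I using e01 by blast
  have fin: "finite I" using E.fin .
  have hC: "hh (cf i) \<otimes>\<^bsub>L\<^esub> Y i \<in> carrier L" if "i \<in> I" for i using that cf_closed I_A E.z by auto
  have uI: "u v \<in> carrier L" if "v \<in> I" for v using uC I_A that by blast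
  have s1: "(\<Oplus>\<^bsub>L\<^esub>v\<in>insert e1 I. u v) = u e1 \<oplus>\<^bsub>L\<^esub> (\<Oplus>\<^bsub>L\<^esub>v\<in>I. u v)"
    by (rule L.finsum_insert) (use fin uI uC[OF e01(2)] in \<open>auto simp: I\<close>)
  have s2: "(\<Oplus>\<^bsub>L\<^esub>v\<in>A. u v) = u e0 \<oplus>\<^bsub>L\<^esub> (\<Oplus>\<^bsub>L\<^esub>v\<in>insert e1 I. u v)"
    unfolding A by (rule L.finsum_insert) (use fin uI uC[OF e01(1)] uC[OF e01(2)] e01(3) in \<open>auto simp: I\<close>)
  have sC: "(\<Oplus>\<^bsub>L\<^esub>v\<in>I. u v) \<in> carrier L" using uC I_A by (intro L.finsum_closed) auto
  note C = \<phi>[OF e01(1)] \<phi>[OF e01(2)] cf_closed[OF e01(1)]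
  have "u e1 = hh (\<phi> e1) \<otimes>\<^bsub>L\<^esub> \<alpha>" unfolding u_def x_def using e01(3) by simp
  also have "\<dots> = hh (\<phi> e1) \<otimes>\<^bsub>L\<^esub> hh (cf e0) \<oplus>\<^bsub>L\<^esub> hh (\<phi> e1) \<otimes>\<^bsub>L\<^esub> (\<Oplus>\<^bsub>L\<^esub>i\<in>I. hh (cf i) \<otimes>\<^bsub>L\<^esub> Y i)"
    unfolding \<alpha>_def using C hC by (intro L.r_distr L.finsum_closed) auto
  also have "hh (\<phi> e1) \<otimes>\<^bsub>L\<^esub> hh (cf e0) = \<ominus>\<^bsub>L\<^esub> hh (\<phi> e0)"
  proof -
    have "hh (\<phi> e1) \<otimes>\<^bsub>L\<^esub> hh (cf e0) = hh (\<phi> e1 \<otimes> cf e0)" using C by simp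
    also have "\<dots> = \<ominus>\<^bsub>L\<^esub> hh (\<phi> e0)" unfolding cf_mult[OF e01(1)] using C by (rule_tac h.hom_a_inv)
    finally show ?thesis .
  qed
  also have "hh (\<phi> e1) \<otimes>\<^bsub>L\<^esub> (\<Oplus>\<^bsub>L\<^esub>i\<in>I. hh (cf i) \<otimes>\<^bsub>L\<^esub> Y i) = (\<Oplus>\<^bsub>L\<^esub>i\<in>I. hh (\<phi> e1) \<otimes>\<^bsub>L\<^esub> (hh (cf i) \<otimes>\<^bsub>L\<^esub> Y i))"
    by (rule L.finsum_rdistr) (use fin C hC in auto)
  also have "\<dots> = (\<Oplus>\<^bsub>L\<^esub>i\<in>I. \<ominus>\<^bsub>L\<^esub> \<one>\<^bsub>L\<^esub> \<otimes>\<^bsub>L\<^esub> u i)"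
  proof (rule L.finsum_cong')
    fix i assume i: "i \<in> I"
    then have iA: "i \<in> A" using I_A by blast
    have "hh (\<phi> e1) \<otimes>\<^bsub>L\<^esub> (hh (cf i) \<otimes>\<^bsub>L\<^esub> Y i) = hh (\<phi> e1 \<otimes> cf i) \<otimes>\<^bsub>L\<^esub> Y i"
      using C cf_closed[OF iA] E.z[OF i] by (simp add: L.m_assoc)
    also have "hh (\<phi> e1 \<otimes> cf i) = \<ominus>\<^bsub>L\<^esub> hh (\<phi> i)" unfolding cf_mult[OF iA] by (rule h.hom_a_inv[OF \<phi>[OF iA]])
    finally show "hh (\<phi> e1) \<otimes>\<^bsub>L\<^esub> (hh (cf i) \<otimes>\<^bsub>L\<^esub> Y i) = \<ominus>\<^bsub>L\<^esub> \<one>\<^bsub>L\<^esub> \<otimes>\<^bsub>L\<^esub> u i"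
      unfolding u_def x_def using i I \<phi>[OF iA] E.z[OF i] by (auto simp: L.l_minus)
  qed (use uC I_A in auto)
  also have "\<dots> = \<ominus>\<^bsub>L\<^esub> \<one>\<^bsub>L\<^esub> \<otimes>\<^bsub>L\<^esub> (\<Oplus>\<^bsub>L\<^esub>v\<in>I. u v)"
    by (rule L.finsum_rdistr[symmetric]) (use fin uC I_A in auto)
  also have "\<dots> = \<ominus>\<^bsub>L\<^esub> (\<Oplus>\<^bsub>L\<^esub>v\<in>I. u v)" using sC by (simp add: L.l_minus)
  finally have u1: "u e1 = \<ominus>\<^bsub>L\<^esub> hh (\<phi> e0) \<oplus>\<^bsub>L\<^esub> \<ominus>\<^bsub>L\<^esub> (\<Oplus>\<^bsub>L\<^esub>v\<in>I. u v)" .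
  have u0: "u e0 = hh (\<phi> e0)" unfolding u_def x_def using C by simp
  have "(\<Oplus>\<^bsub>L\<^esub>v\<in>A. u v) = \<zero>\<^bsub>L\<^esub>"
    unfolding s2 s1 u0 u1 using sC C by (simp add: L.a_assoc L.l_neg L.r_neg)
  then show ?thesis unfolding u_def .
qed

abbreviation G where "G \<equiv> L.fractions (TP 1)"

lemma G_subfield: "subfield G L" by (rule L.fractions_subfield[OF TP_subring])

lemma \<alpha>_not_G: "\<alpha> \<notin> G"
  unfolding \<alpha>_def using cf_closed[OF e01(1)] cf_not_k cf_closed I_A by (intro linear_form_not_fraction) auto

lemma x_nonzero:
  assumes "v \<in> A"
  shows "x v \<noteq> \<zero>\<^bsub>L\<^esub>"
proof -
  have "\<alpha> \<noteq> \<zero>\<^bsub>L\<^esub>" using \<alpha>_not_G L.subfield_closed(2)[OF G_subfield] by auto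
  then show ?thesis unfolding x_def using assms Y_nonzero[of v] I by auto
qed

text \<open>Frobenius turns the linear form into one in the q-th powers of the variables. Its
  coefficients are q-th powers of elements of \<open>F\<close>, hence in \<open>k\<close> because
  the exponent \<open>t\<close> is positive.\<close>

lemma \<alpha>_pow:
  assumes t: "0 < t"
  shows "\<alpha> [^]\<^bsub>L\<^esub> (p ^ t) \<in> L.fractions (TP (p ^ t))"
proof -
  note M = L.fractions_subfield[OF TP_subring, of "p ^ t"]
  note incl = subsetD[OF L.fractions_incl[OF TP_subring, of "p ^ t"]]
  have cY: "hh (cf i) \<otimes>\<^bsub>L\<^esub> Y i \<in> carrier L" if "i \<in> I" for i using that cf_closed I_A E.z by auto
  have "\<alpha> [^]\<^bsub>L\<^esub> (p ^ t) = hh (cf e0) [^]\<^bsub>L\<^esub> (p ^ t) \<oplus>\<^bsub>L\<^esub> (\<Oplus>\<^bsub>L\<^esub>i\<in>I. hh (cf i) \<otimes>\<^bsub>L\<^esub> Y i) [^]\<^bsub>L\<^esub> (p ^ t)"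
    unfolding \<alpha>_def by (rule L.frobenius_pow_add) (use cf_closed[OF e01(1)] cY in \<open>auto intro!: L.finsum_closed\<close>)
  also have "(\<Oplus>\<^bsub>L\<^esub>i\<in>I. hh (cf i) \<otimes>\<^bsub>L\<^esub> Y i) [^]\<^bsub>L\<^esub> (p ^ t) = (\<Oplus>\<^bsub>L\<^esub>i\<in>I. (hh (cf i) \<otimes>\<^bsub>L\<^esub> Y i) [^]\<^bsub>L\<^esub> (p ^ t))"
    by (rule L.frobenius_finsum) (use cY in auto)
  finally have e: "\<alpha> [^]\<^bsub>L\<^esub> (p ^ t) = hh (cf e0) [^]\<^bsub>L\<^esub> (p ^ t) \<oplus>\<^bsub>L\<^esub> (\<Oplus>\<^bsub>L\<^esub>i\<in>I. (hh (cf i) \<otimes>\<^bsub>L\<^esub> Y i) [^]\<^bsub>L\<^esub> (p ^ t))" .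
  have 1: "hh (cf v) [^]\<^bsub>L\<^esub> (p ^ t) \<in> L.fractions (TP (p ^ t))" if "v \<in> A" for v
    using pow_in_k[OF cf_closed[OF that] t] k_in_TP incl by blast
  have "(hh (cf i) \<otimes>\<^bsub>L\<^esub> Y i) [^]\<^bsub>L\<^esub> (p ^ t) \<in> L.fractions (TP (p ^ t))" if i: "i \<in> I" for i
  proof -
    have iA: "i \<in> A" using i I_A by blast
    have "(hh (cf i) \<otimes>\<^bsub>L\<^esub> Y i) [^]\<^bsub>L\<^esub> (p ^ t) = hh (cf i) [^]\<^bsub>L\<^esub> (p ^ t) \<otimes>\<^bsub>L\<^esub> Y i [^]\<^bsub>L\<^esub> (p ^ t)"
      using cf_closed[OF iA] E.z[OF i] by (intro L.nat_pow_distrib) auto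
    then show ?thesis using L.subfield_closed(5)[OF M 1[OF iA] incl[OF Y_pow_in_TP[OF i]]] by simp
  qed
  then have "(\<Oplus>\<^bsub>L\<^esub>i\<in>I. (hh (cf i) \<otimes>\<^bsub>L\<^esub> Y i) [^]\<^bsub>L\<^esub> (p ^ t)) \<in> L.fractions (TP (p ^ t))"
    by (intro L.subfield_finsum_closed[OF M]) blast
  then show ?thesis unfolding e by (rule L.subfield_closed(4)[OF M 1[OF e01(1)]])
qed

lemma \<alpha>_p: "\<alpha> [^]\<^bsub>L\<^esub> p \<in> G"
proof -
  have "L.fractions (TP p) \<subseteq> G" unfolding L.fractions_def using TP_mono[of 1 p] by auto
  then show ?thesis using \<alpha>_pow[of 1] by auto
qed

lemma k_carrier: "k \<subseteq> carrier L" by (rule L.subfield_closed(1)[OF k_subfield])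

lemma generators: "k \<union> x ` A \<subseteq> carrier L" using k_carrier x_closed by blast

lemma N_subfield: "subfield N L" unfolding N_def by (rule L.generate_field_is_subfield[OF generators])

lemma N_minimal: "subfield M L \<Longrightarrow> k \<subseteq> M \<Longrightarrow> (\<And>v. v \<in> A \<Longrightarrow> x v \<in> M) \<Longrightarrow> N \<subseteq> M"
  unfolding N_def by (rule L.generate_field_min_subfield1[OF generators]) auto

lemma k_N: "k \<subseteq> N" and x_N: "v \<in> A \<Longrightarrow> x v \<in> N"
  unfolding N_def by (auto intro: generate_field.incl)

text \<open>The lower bound of the count. \<open>M\<close> is generated as a field of fractions by
  \<open>k\<close> and the q-th powers of the variables. Over it the monomials in \<open>Y\<close>
  with exponents below q are independent, and over k(Y), which contains them, so are the
  \<open>p\<close> powers of \<open>\<alpha>\<close>; the tower law multiplies the two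
  numbers.\<close>

lemma many_independent:
  assumes t: "0 < t"
  shows "\<exists>M (J :: (('v multiset \<times> unit) \<times> nat) set) g. subfield M L \<and> k \<subseteq> M \<and> (\<forall>w\<in>N. w [^]\<^bsub>L\<^esub> (p ^ t) \<in> M) \<and> finite J \<and>
    card J = p * (p ^ t) ^ (card A - 2) \<and> g \<in> J \<rightarrow> N \<and> L.fam_indep M J g"
proof -
  define M where "M = L.fractions (TP (p ^ t))"
  have M: "subfield M L" unfolding M_def by (rule L.fractions_subfield[OF TP_subring])
  have incl: "TP (p ^ t) \<subseteq> M" unfolding M_def by (rule L.fractions_incl[OF TP_subring])
  have MG: "M \<subseteq> G" unfolding M_def L.fractions_def using TP_mono[of 1 "p ^ t"] by auto
  have kM: "k \<subseteq> M" using k_in_TP incl by blast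
  have "N \<subseteq> {w \<in> carrier L. w [^]\<^bsub>L\<^esub> (p ^ t) \<in> M}"
  proof (rule N_minimal[OF L.frobenius_preimage_subfield[OF M]])
    show "k \<subseteq> {w \<in> carrier L. w [^]\<^bsub>L\<^esub> (p ^ t) \<in> M}"
      using kM k_carrier L.subfield_pow_closed[OF M] by blast
    fix v assume v: "v \<in> A"
    have "x v [^]\<^bsub>L\<^esub> (p ^ t) \<in> M"
    proof (cases "v = e0 \<or> v = e1")
      case True
      then show ?thesis using \<alpha>_pow[OF t] L.subfield_closed(3)[OF M] unfolding x_def M_def by auto
    next
      case False
      then have "v \<in> I" using v I by blast
      then show ?thesis using Y_pow_in_TP[of v "p ^ t"] incl False unfolding x_def by auto
    qed
    then show "x v \<in> {w \<in> carrier L. w [^]\<^bsub>L\<^esub> (p ^ t) \<in> M}" using x_closed[OF v] by blast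
  qed
  then have wM: "\<forall>w\<in>N. w [^]\<^bsub>L\<^esub> (p ^ t) \<in> M" by blast
  obtain Ms where Ms: "finite Ms" "card Ms = (p ^ t) ^ card I"
    "\<And>m. m \<in> Ms \<Longrightarrow> set_mset m \<subseteq> I" "\<And>m i. m \<in> Ms \<Longrightarrow> count m i < p ^ t"
    using box_card[of "p ^ t"] F.p_pos by fastforce
  \<comment> \<open>The trivial second component makes the bare monomials an instance of
    \<open>TP_indep\<close>, with a single scalar equal to one.\<close>
  define g1 where "g1 u = E.mon (fst u) \<otimes>\<^bsub>L\<^esub> hh \<one>" for u :: "'v multiset \<times> unit"
  have one: "L.fam_indep k {()} (\<lambda>_. hh \<one>)"
    unfolding L.fam_indep_def using k_carrier by (auto simp: subset_iff)
  have "L.fam_indep (TP (p ^ t)) (Ms \<times> {()}) g1"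
    unfolding g1_def using TP_indep[of Ms "p ^ t" "{()}" "\<lambda>_. \<one>"] Ms(1,3,4) one by simp
  then have ind1: "L.fam_indep M (Ms \<times> {()}) g1"
    unfolding M_def by (intro L.fam_indep_fractions[OF TP_subring]) (use Ms(1) in \<open>auto simp: g1_def\<close>)
  have g1: "g1 u \<in> G" "g1 u \<in> N" if u: "u \<in> Ms \<times> {()}" for u
  proof -
    have s: "set_mset (fst u) \<subseteq> I" using Ms(3)[of "fst u"] u by auto
    have e: "g1 u = E.mon (fst u)" unfolding g1_def by simp
    show "g1 u \<in> G" unfolding e using mon_in_TP1[OF s] L.fractions_incl[OF TP_subring] by blast
    have "Y i \<in> N" if "i \<in> I" for i using x_N[of i] that I unfolding x_def by auto
    then show "g1 u \<in> N"
      unfolding e E.mon_def using L.subfield_pow_closed[OF N_subfield] by (intro L.subfield_finprod_closed[OF N_subfield]) auto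
  qed
  have ind2: "L.fam_indep G {..<p} (\<lambda>i. \<alpha> [^]\<^bsub>L\<^esub> i)"
    by (rule L.pth_root_independent[OF G_subfield \<alpha>_closed \<alpha>_p \<alpha>_not_G])
  define J where "J = (Ms \<times> {()}) \<times> {..<p}"
  define g where "g u = g1 (fst u) \<otimes>\<^bsub>L\<^esub> \<alpha> [^]\<^bsub>L\<^esub> snd u" for u :: "('v multiset \<times> unit) \<times> nat"
  have "L.fam_indep M J g"
    unfolding J_def g_def
    by (rule L.fam_indep_product[OF M G_subfield MG _ _ _ _ ind1 ind2]) (use Ms(1) g1 \<alpha>_closed in auto)
  moreover have "finite J" "card J = p * (p ^ t) ^ (card A - 2)"
  proof -
    have "card I = card A - 2" unfolding I using e01 finA by (simp add: card_Diff_subset)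
    then show "finite J" "card J = p * (p ^ t) ^ (card A - 2)" unfolding J_def using Ms(1,2) by (simp_all add: card_cartesian_product)
  qed
  moreover have "g \<in> J \<rightarrow> N"
  proof
    fix u assume u: "u \<in> J"
    have "\<alpha> \<in> N" using x_N[OF e01(2)] e01(3) unfolding x_def by simp
    then have "\<alpha> [^]\<^bsub>L\<^esub> snd u \<in> N" by (rule L.subfield_pow_closed[OF N_subfield])
    moreover have "g1 (fst u) \<in> N" using g1(2)[of "fst u"] u unfolding J_def by auto
    ultimately show "g u \<in> N" unfolding g_def using L.subfield_closed(5)[OF N_subfield] by blast
  qed
  ultimately show ?thesis using M kM wM by blast
qed

text \<open>Elements of \<open>F\<close> independent over \<open>k\<close> stay independent over
  k(Y), and \<open>N\<close> lies in an extension of k(Y) spanned by \<open>p\<close> powers of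
  \<open>\<alpha>\<close>. So a span of \<open>T\<close> over \<open>N\<close> lies in the span over
  k(Y) of p card T elements. This supplies the hypothesis \<open>deg\<close> of
  \<open>indep_descends\<close>.\<close>

lemma scalar_rank:
  assumes D: "finite D" "D \<subseteq> hh ` carrier F" "L.fam_indep k D (\<lambda>x. x)"
    and T: "finite T" "T \<subseteq> carrier L" "D \<subseteq> L.fam_span N T (\<lambda>x. x)"
  shows "card D \<le> p * card T"
proof -
  define N' where "N' = L.fam_span G {..<p} (\<lambda>i. \<alpha> [^]\<^bsub>L\<^esub> i)"
  have N': "subfield N' L" unfolding N'_def by (rule L.adjoin_pth_root[OF G_subfield \<alpha>_closed \<alpha>_p \<alpha>_not_G])
  have p1: "1 < p" using F.p_prime prime_gt_1_nat by blast
  have aC: "(\<lambda>i. \<alpha> [^]\<^bsub>L\<^esub> i) \<in> {..<p} \<rightarrow> carrier L" using \<alpha>_closed by auto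
  have mem: "\<alpha> [^]\<^bsub>L\<^esub> i \<in> N'" if "i < p" for i :: nat
    unfolding N'_def using L.fam_span_mem[OF G_subfield _ aC, of i] that by simp
  have GN': "G \<subseteq> N'"
  proof
    fix y assume y: "y \<in> G"
    have "y \<otimes>\<^bsub>L\<^esub> \<alpha> [^]\<^bsub>L\<^esub> (0::nat) \<in> N'"
      unfolding N'_def by (rule L.fam_span_smult[OF G_subfield aC _ _ y]) (use mem[of 0] p1 N'_def in auto)
    then show "y \<in> N'" using y L.subfield_closed(1)[OF G_subfield] by auto
  qed
  have "N \<subseteq> N'"
  proof (rule N_minimal[OF N'])
    show "k \<subseteq> N'" using k_in_TP L.fractions_incl[OF TP_subring] GN' by blast
    fix v assume v: "v \<in> A"
    show "x v \<in> N'"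
    proof (cases "v = e0 \<or> v = e1")
      case True
      then show ?thesis using mem[of 1] p1 \<alpha>_closed L.subfield_closed(3)[OF N'] unfolding x_def by auto
    next
      case False
      then have "v \<in> I" using v I by blast
      then have "Y v \<in> N'" using Y_in_TP1[of v] L.fractions_incl[OF TP_subring] GN' by blast
      then show ?thesis using False unfolding x_def by simp
    qed
  qed
  then have "L.fam_span N T (\<lambda>x. x) \<subseteq> L.fam_span N' T (\<lambda>x. x)" by (rule L.fam_span_subfield_mono)
  moreover have "L.fam_span N' T (\<lambda>x. x) \<subseteq> L.fam_span G ({..<p} \<times> T) (\<lambda>u. \<alpha> [^]\<^bsub>L\<^esub> fst u \<otimes>\<^bsub>L\<^esub> snd u)"
    by (rule L.fam_span_product[OF G_subfield N' GN' _ T(1) aC]) (use T(2) N'_def in auto)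
  ultimately have sp: "(\<lambda>x. x) \<in> D \<rightarrow> L.fam_span G ({..<p} \<times> T) (\<lambda>u. \<alpha> [^]\<^bsub>L\<^esub> fst u \<otimes>\<^bsub>L\<^esub> snd u)" using T(3) by blast
  define a where "a d = inv_into (carrier F) hh d" for d
  have a: "a d \<in> carrier F" "hh (a d) = d" if "d \<in> D" for d
    unfolding a_def using D(2) that by (auto simp: inv_into_into f_inv_into_f subset_iff)
  have dC: "d \<in> carrier L" if "d \<in> D" for d using D(2) that by auto
  have "L.fam_indep k D (\<lambda>d. hh (a d))"
    unfolding L.fam_indep_def
  proof (intro ballI impI)
    fix f i assume f: "f \<in> D \<rightarrow> k" and z: "(\<Oplus>\<^bsub>L\<^esub>d\<in>D. f d \<otimes>\<^bsub>L\<^esub> hh (a d)) = \<zero>\<^bsub>L\<^esub>" and i: "i \<in> D"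
    have "(\<Oplus>\<^bsub>L\<^esub>d\<in>D. f d \<otimes>\<^bsub>L\<^esub> d) = (\<Oplus>\<^bsub>L\<^esub>d\<in>D. f d \<otimes>\<^bsub>L\<^esub> hh (a d))"
      by (rule L.finsum_cong') (use a dC f k_carrier in auto)
    then show "f i = \<zero>\<^bsub>L\<^esub>" using L.fam_indepD[OF k_subfield D(3) f _ i] z by simp
  qed
  \<comment> \<open>For \<open>q = 1\<close> only the empty monomial has all exponents below
    \<open>q\<close>, and \<open>TP_indep\<close> reduces to the passage of scalars from
    \<open>k\<close> to k[Y].\<close>
  then have "L.fam_indep (TP 1) ({{#}} \<times> D) (\<lambda>u. E.mon (fst u) \<otimes>\<^bsub>L\<^esub> hh (a (snd u)))"
    by (intro TP_indep) (use D(1) a in auto)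
  then have i2: "L.fam_indep G ({{#}} \<times> D) (\<lambda>u. E.mon (fst u) \<otimes>\<^bsub>L\<^esub> hh (a (snd u)))"
    by (intro L.fam_indep_fractions[OF TP_subring]) (use D(1) a dC in auto)
  have "L.fam_indep G ((\<lambda>u. E.mon (fst u) \<otimes>\<^bsub>L\<^esub> hh (a (snd u))) ` ({{#}} \<times> D)) (\<lambda>x. x)"
    by (rule L.fam_indep_image[OF G_subfield _ _ i2]) (use D(1) a dC in auto)
  moreover have "(\<lambda>u. E.mon (fst u) \<otimes>\<^bsub>L\<^esub> hh (a (snd u))) ` ({{#}} \<times> D) = D"
  proof -
    have "E.mon (fst u) \<otimes>\<^bsub>L\<^esub> hh (a (snd u)) = snd u" if "u \<in> {{#}} \<times> D" for u :: "'v multiset \<times> 'l"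
      using that a dC by (auto simp: E.mon_empty)
    then have "(\<lambda>u. E.mon (fst u) \<otimes>\<^bsub>L\<^esub> hh (a (snd u))) ` ({{#}} \<times> D) = snd ` ({({#} :: 'v multiset)} \<times> D)"
      by (intro image_cong refl)
    then show ?thesis by simp
  qed
  ultimately have i3: "L.fam_indep G D (\<lambda>x. x)" by simp
  have "card D \<le> card ({..<p} \<times> T)"
    by (rule L.fam_indep_card_le[OF G_subfield _ D(1) _ sp i3]) (use T \<alpha>_closed in auto)
  then show ?thesis by (simp add: card_cartesian_product)
qed

end

section \<open>Counting monomials\<close>

context char_field
begin

text \<open>Here the powers of \<open>x\<close> may be dependent, so the degree argument behind
  \<open>adjoin_pth_root\<close> is replaced by a direct one: products are reduced by the q-th power
  of \<open>x\<close>, which lies in \<open>G\<close>, and inverses come from Frobenius.\<close>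

lemma adjoin_root_subfield:
  assumes G: "subfield G R" and x: "x \<in> carrier R" "x [^] (p ^ t) \<in> G"
  shows "subfield (fam_span G {..<p ^ t} (\<lambda>i. x [^] i)) R"
proof -
  let ?q = "p ^ t"
  define S where "S = fam_span G {..<?q} (\<lambda>i. x [^] i)"
  have q: "0 < ?q" using p_pos by simp
  have xC: "(\<lambda>i. x [^] i) \<in> {..<?q} \<rightarrow> carrier R" using x(1) by simp
  note GC = subfield_closed(1)[OF G]
  have SC: "S \<subseteq> carrier R" unfolding S_def by (rule fam_span_carrier[OF G xC])
  have add: "y \<oplus> y' \<in> S" if "y \<in> S" "y' \<in> S" for y y' using fam_span_add[OF G xC] that unfolding S_def by blast
  have sm: "c \<otimes> y \<in> S" if "c \<in> G" "y \<in> S" for c y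
    using fam_span_smult[OF G xC _ _ that(1)] that(2) unfolding S_def by simp
  have zero: "\<zero> \<in> S" unfolding S_def by (rule fam_span_zero[OF G xC])
  have pw: "x [^] i \<in> S" if "i < ?q" for i
    unfolding S_def using fam_span_mem[OF G _ xC, of i] that by simp
  have one: "\<one> \<in> S" using pw[OF q] by simp
  have pm: "x [^] i \<otimes> x [^] j \<in> S" if ij: "i < ?q" "j < ?q" for i j
  proof (cases "i + j < ?q")
    case True
    then show ?thesis using pw x(1) by (simp add: nat_pow_mult)
  next
    case False
    then have "x [^] i \<otimes> x [^] j = x [^] ?q \<otimes> x [^] (i + j - ?q)"
      using x(1) by (simp add: nat_pow_mult)
    then show ?thesis using sm[OF x(2) pw[of "i + j - ?q"]] ij by simp
  qed
  have sp: "s \<otimes> x [^] j \<in> S" if s: "s \<in> S" and j: "j < ?q" for s j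
  proof -
    have "S \<subseteq> {s \<in> carrier R. s \<otimes> x [^] j \<in> S}"
      unfolding S_def
    proof (rule fam_span_minimal[OF G], unfold S_def[symmetric])
      show "(\<lambda>i. x [^] i) \<in> {..<?q} \<rightarrow> {s \<in> carrier R. s \<otimes> x [^] j \<in> S}" using pm[OF _ j] x(1) by auto
      fix c s assume c: "c \<in> G" and s: "s \<in> {s \<in> carrier R. s \<otimes> x [^] j \<in> S}"
      have "c \<in> carrier R" using c GC by blast
      then show "c \<otimes> s \<in> {s \<in> carrier R. s \<otimes> x [^] j \<in> S}"
        using sm[OF c, of "s \<otimes> x [^] j"] x(1) s by (simp add: m_assoc)
    qed (use zero add x(1) in \<open>auto simp: l_distr\<close>)
    then show ?thesis using s by blast
  qed
  have mult: "s \<otimes> y \<in> S" if s: "s \<in> S" and y: "y \<in> S" for s y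
  proof -
    have sC: "s \<in> carrier R" using s SC by blast
    have "S \<subseteq> {y \<in> carrier R. s \<otimes> y \<in> S}"
      unfolding S_def
    proof (rule fam_span_minimal[OF G], unfold S_def[symmetric])
      show "(\<lambda>i. x [^] i) \<in> {..<?q} \<rightarrow> {y \<in> carrier R. s \<otimes> y \<in> S}" using sp[OF s] x(1) by auto
      fix c y assume c: "c \<in> G" and y: "y \<in> {y \<in> carrier R. s \<otimes> y \<in> S}"
      have "c \<in> carrier R" using c GC by blast
      then have "s \<otimes> (c \<otimes> y) = c \<otimes> (s \<otimes> y)" using sC y by (simp add: m_lcomm)
      then show "c \<otimes> y \<in> {y \<in> carrier R. s \<otimes> y \<in> S}"
        using sm[OF c, of "s \<otimes> y"] y \<open>c \<in> carrier R\<close> by simp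
    qed (use zero add sC in \<open>auto simp: r_distr\<close>)
    then show ?thesis using y by blast
  qed
  have pow: "s [^] (n::nat) \<in> S" if "s \<in> S" for s n by (induction n) (use one mult that in auto)
  note P = frobenius_preimage_subfield[OF G, of t]
  \<comment> \<open>Every \<open>s\<close> in the span has its q-th power in \<open>G\<close>, so a
    nonzero \<open>s\<close> has the inverse s^(q-1) divided by s^q, again in the span.\<close>
  have SP: "S \<subseteq> {w \<in> carrier R. w [^] ?q \<in> G}"
    unfolding S_def
  proof (rule fam_span_minimal[OF G])
    show "(\<lambda>i. x [^] i) \<in> {..<?q} \<rightarrow> {w \<in> carrier R. w [^] ?q \<in> G}"
      using subfield_pow_closed[OF P, of x] x by blast
    fix c w assume "c \<in> G" and w: "w \<in> {w \<in> carrier R. w [^] ?q \<in> G}"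
    then have "c \<in> {w \<in> carrier R. w [^] ?q \<in> G}" using subfield_pow_closed[OF G] GC by blast
    then show "c \<otimes> w \<in> {w \<in> carrier R. w [^] ?q \<in> G}" using w by (rule subfield_closed(5)[OF P])
  qed (use subfield_closed(2,4)[OF P] in auto)
  have neg: "\<ominus> s \<in> S" if "s \<in> S" for s
    using sm[of "\<ominus> \<one>" s] subfield_closed(3,6)[OF G] that SC by (auto simp: l_minus)
  have inv: "inv s \<in> S" if s: "s \<in> S - {\<zero>}" for s
  proof -
    have sC: "s \<in> carrier R" "s \<in> Units R" using s SC field_Units by auto
    have u: "s [^] ?q \<in> G" "s [^] ?q \<noteq> \<zero>" using SP s sC pow_eq_zero_iff[OF sC(1) q] by auto
    then have i: "inv (s [^] ?q) \<in> G" by (rule subfield_closed(7)[OF G])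
    have sq: "s [^] ?q = s \<otimes> s [^] (?q - 1)" using nat_pow_Suc2[OF sC(1), of "?q - 1"] unfolding Suc_diff_1[OF q] .
    have U: "s [^] ?q \<in> Units R" using u(2) sC field_Units by simp
    have "s \<otimes> (inv (s [^] ?q) \<otimes> s [^] (?q - 1)) = inv (s [^] ?q) \<otimes> (s \<otimes> s [^] (?q - 1))"
      by (rule m_lcomm) (use sC U in auto)
    then have "s \<otimes> (inv (s [^] ?q) \<otimes> s [^] (?q - 1)) = \<one>" unfolding sq[symmetric] using U by simp
    then have "inv s = inv (s [^] ?q) \<otimes> s [^] (?q - 1)" using sC U by (intro comm_inv_char) auto
    then show ?thesis using sm[OF i pow[of s "?q - 1"]] s by simp
  qed
  have "subfield S R"
    by (rule subfieldI'[OF subringI[OF SC one neg mult add] inv])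
  then show ?thesis unfolding S_def .
qed

end

text \<open>The bound is imposed at all indices. Outside \<open>Vs\<close> it only says that
  \<open>cap i\<close> is positive, which is why the lemmas that need members of a box assume
  positive caps everywhere.\<close>

definition box :: "'c set \<Rightarrow> ('c \<Rightarrow> nat) \<Rightarrow> 'c multiset set" where
  "box Vs cap = {m. set_mset m \<subseteq> Vs \<and> (\<forall>i. count m i < cap i)}"

lemma box_insert:
  "box (insert a Vs) cap \<subseteq> (\<lambda>u. fst u + replicate_mset (snd u) a) ` (box Vs cap \<times> {..<cap a})"
proof
  fix m assume m: "m \<in> box (insert a Vs) cap"
  define m' where "m' = filter_mset (\<lambda>i. i \<noteq> a) m"
  have "m = m' + replicate_mset (count m a) a"
    unfolding m'_def by (rule multiset_eqI) auto
  moreover have "count m' i < cap i" for i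
    using m le_less_trans[of "count m' i" "count m i" "cap i"] unfolding m'_def box_def by auto
  moreover have "set_mset m' \<subseteq> Vs" using m unfolding m'_def box_def by auto
  ultimately show "m \<in> (\<lambda>u. fst u + replicate_mset (snd u) a) ` (box Vs cap \<times> {..<cap a})"
    using m unfolding box_def by (intro image_eqI[of _ _ "(m', count m a)"]) auto
qed

lemma box_empty: "box {} cap \<subseteq> {{#}}" unfolding box_def by auto

lemma box_finite_card:
  assumes "finite Vs"
  shows "finite (box Vs cap)" "card (box Vs cap) \<le> (\<Prod>i\<in>Vs. cap i)"
proof -
  have "finite (box Vs cap) \<and> card (box Vs cap) \<le> (\<Prod>i\<in>Vs. cap i)"
    using assms
  proof (induction Vs rule: finite_induct)
    case empty
    have "card (box {} cap) \<le> card {{#} :: 'a multiset}" by (rule card_mono[OF _ box_empty]) simp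
    then show ?case using finite_subset[OF box_empty] by simp
  next
    case (insert a Vs)
    let ?f = "\<lambda>u. fst u + replicate_mset (snd u) a"
    have fin: "finite (box Vs cap \<times> {..<cap a})" using insert.IH by simp
    have "card (box (insert a Vs) cap) \<le> card (?f ` (box Vs cap \<times> {..<cap a}))"
      by (rule card_mono[OF finite_imageI[OF fin] box_insert])
    also have "\<dots> \<le> card (box Vs cap \<times> {..<cap a})" by (rule card_image_le[OF fin])
    also have "\<dots> = card (box Vs cap) * cap a" by (simp add: card_cartesian_product)
    also have "\<dots> \<le> (\<Prod>i\<in>Vs. cap i) * cap a" using insert.IH by simp
    finally have "card (box (insert a Vs) cap) \<le> (\<Prod>i\<in>insert a Vs. cap i)" using insert.hyps by (simp add: mult.commute)
    then show ?case using finite_subset[OF box_insert finite_imageI[OF fin]] by blast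
  qed
  then show "finite (box Vs cap)" "card (box Vs cap) \<le> (\<Prod>i\<in>Vs. cap i)" by auto
qed

text \<open>The upper bound of the count, for a system \<open>y\<close> of coordinates normalised at
  \<open>b0\<close> and with \<open>b1\<close> to be eliminated. It is used with the map on
  coefficients that has image \<open>k\<close>.\<close>

locale monomial_span = F?: cring F + L?: char_field L p + E: mpoly_eval F L I h y
  for F :: "('a, 'm) ring_scheme" (structure) and L :: "('l, 'k) ring_scheme" (structure) and p
    and I :: "'v set" and h :: "'a \<Rightarrow> 'l" and y :: "'v \<Rightarrow> 'l" +
  fixes b0 b1 :: 'v
  assumes h_inj: "\<And>c. c \<in> carrier F \<Longrightarrow> h c = \<zero>\<^bsub>L\<^esub> \<Longrightarrow> c = \<zero>"
    and b01: "b0 \<in> I" "b1 \<in> I" "b0 \<noteq> b1" and y0: "y b0 = \<one>\<^bsub>L\<^esub>"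
begin

text \<open>Adjoins one coordinate whose power with exponent \<open>cap a\<close> is already
  present: the spanning monomials are multiplied by the lower powers of this coordinate.\<close>

lemma box_step:
  assumes M: "subfield M L" and S: "subfield S L" "M \<subseteq> S" "S \<subseteq> L.fam_span M (box Vs cap) E.mon"
    and Vs: "finite Vs" and a: "a \<in> I" "a \<notin> Vs" "y a [^]\<^bsub>L\<^esub> cap a \<in> S" and cap: "cap a = p ^ s" "0 < s" "\<And>i. 0 < cap i"
  shows "\<exists>S'. subfield S' L \<and> S \<subseteq> S' \<and> y a \<in> S' \<and> S' \<subseteq> L.fam_span M (box (insert a Vs) cap) E.mon"
proof -
  have aC: "y a \<in> carrier L" by (rule E.z[OF a(1)])
  have yC: "(\<lambda>i. y a [^]\<^bsub>L\<^esub> i) \<in> {..<cap a} \<rightarrow> carrier L" using aC by simp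
  have mC: "E.mon \<in> Z \<rightarrow> carrier L" for Z by simp
  define S' where "S' = L.fam_span S {..<cap a} (\<lambda>i. y a [^]\<^bsub>L\<^esub> i)"
  have S': "subfield S' L" unfolding S'_def cap(1) by (rule L.adjoin_root_subfield[OF S(1) aC]) (use a(3) cap(1) in simp)
  have mem: "y a [^]\<^bsub>L\<^esub> i \<in> S'" if "i < cap a" for i :: nat
    unfolding S'_def using L.fam_span_mem[OF S(1) _ yC, of i] that by simp
  have SS': "S \<subseteq> S'"
  proof
    fix c assume c: "c \<in> S"
    have "c \<otimes>\<^bsub>L\<^esub> y a [^]\<^bsub>L\<^esub> (0::nat) \<in> S'"
      unfolding S'_def by (rule L.fam_span_smult[OF S(1) yC _ _ c]) (use mem[of 0] cap(3) S'_def in auto)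
    then show "c \<in> S'" using c L.subfield_closed(1)[OF S(1)] by auto
  qed
  have "1 < cap a" unfolding cap(1) using one_less_power[of p s] cap(2) L.p_prime prime_gt_1_nat[of p] by blast
  then have ya: "y a \<in> S'" using mem[of 1] aC by simp
  have "S' \<subseteq> L.fam_span M (box Vs cap \<times> {..<cap a}) (\<lambda>u. E.mon (fst u) \<otimes>\<^bsub>L\<^esub> y a [^]\<^bsub>L\<^esub> snd u)"
    unfolding S'_def
    by (rule L.fam_span_product[OF M S(1,2) box_finite_card(1)[OF Vs] _ mC yC S(3)]) simp
  also have "L.fam_span M (box Vs cap \<times> {..<cap a}) (\<lambda>u. E.mon (fst u) \<otimes>\<^bsub>L\<^esub> y a [^]\<^bsub>L\<^esub> snd u)
      \<subseteq> L.fam_span M (box (insert a Vs) cap) E.mon"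
  proof (rule L.fam_span_subset[OF M _ _ mC])
    show "finite (box (insert a Vs) cap)" "finite (box Vs cap \<times> {..<cap a})" using box_finite_card(1)[of "insert a Vs" cap] box_finite_card(1)[OF Vs, of cap] Vs by auto
    show "(\<lambda>u. E.mon (fst u) \<otimes>\<^bsub>L\<^esub> y a [^]\<^bsub>L\<^esub> snd u) \<in> box Vs cap \<times> {..<cap a} \<rightarrow> L.fam_span M (box (insert a Vs) cap) E.mon"
    proof
      fix u assume u: "u \<in> box Vs cap \<times> {..<cap a}"
      then obtain m i where mi: "u = (m, i)" "m \<in> box Vs cap" "i < cap a" by auto
      have "count m a = 0" using mi(2) a(2) unfolding box_def by (auto simp: not_in_iff[symmetric])
      then have "m + replicate_mset i a \<in> box (insert a Vs) cap" using mi(2,3) unfolding box_def by auto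
      then have "E.mon (m + replicate_mset i a) \<in> L.fam_span M (box (insert a Vs) cap) E.mon"
        using L.fam_span_mem[OF M _ mC] box_finite_card(1)[of "insert a Vs" cap] Vs by simp
      then show "E.mon (fst u) \<otimes>\<^bsub>L\<^esub> y a [^]\<^bsub>L\<^esub> snd u \<in> L.fam_span M (box (insert a Vs) cap) E.mon"
        unfolding mi(1) E.mon_add E.mon_replicate[OF a(1)] by simp
    qed
  qed
  finally have "S' \<subseteq> L.fam_span M (box (insert a Vs) cap) E.mon" .
  then show ?thesis using S' SS' ya by blast
qed

lemma box_spanning:
  assumes M: "subfield M L" and Vs: "finite Vs" and XI: "Vs \<subseteq> I" and y: "\<And>i. i \<in> Vs \<Longrightarrow> y i [^]\<^bsub>L\<^esub> cap i \<in> M"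
    and cap: "\<And>i. i \<in> Vs \<Longrightarrow> \<exists>s. cap i = p ^ s \<and> 0 < s" "\<And>i. 0 < cap i"
  shows "\<exists>S. subfield S L \<and> M \<subseteq> S \<and> y ` Vs \<subseteq> S \<and> S \<subseteq> L.fam_span M (box Vs cap) E.mon"
  using Vs XI y cap(1)
proof (induction Vs rule: finite_induct)
  case empty
  have e: "{#} \<in> box {} cap" using cap(2) by (simp add: box_def)
  have mC: "E.mon \<in> Z \<rightarrow> carrier L" for Z by simp
  have "M \<subseteq> L.fam_span M (box {} cap) E.mon"
  proof
    fix c assume c: "c \<in> M"
    have "E.mon {#} \<in> L.fam_span M (box {} cap) E.mon"
      by (rule L.fam_span_mem[OF M _ mC e]) (rule box_finite_card(1), simp)
    then have "c \<otimes>\<^bsub>L\<^esub> E.mon {#} \<in> L.fam_span M (box {} cap) E.mon"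
      by (rule L.fam_span_smult[OF M mC _ _ c, rotated]) (rule box_finite_card(1), simp)
    then show "c \<in> L.fam_span M (box {} cap) E.mon" using c L.subfield_closed(1)[OF M] by (auto simp: E.mon_empty)
  qed
  then show ?case using M by blast
next
  case (insert a Vs)
  have "\<exists>S. subfield S L \<and> M \<subseteq> S \<and> y ` Vs \<subseteq> S \<and> S \<subseteq> L.fam_span M (box Vs cap) E.mon"
    by (rule insert.IH) (use insert.prems in auto)
  then obtain S where S: "subfield S L" "M \<subseteq> S" "y ` Vs \<subseteq> S" "S \<subseteq> L.fam_span M (box Vs cap) E.mon" by blast
  obtain s where s: "cap a = p ^ s" "0 < s" using insert.prems(3) by blast
  have "y a [^]\<^bsub>L\<^esub> cap a \<in> S" "a \<in> I" using insert.prems S(2) by auto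
  from box_step[OF M S(1,2,4) insert.hyps(1) this(2) insert.hyps(2) this(1) s cap(2)]
  obtain S' where "subfield S' L" "S \<subseteq> S'" "y a \<in> S'" "S' \<subseteq> L.fam_span M (box (insert a Vs) cap) E.mon" by blast
  then show ?case using S(2,3) by (intro exI[of _ S']) blast
qed

definition N where "N = generate_field L (h ` carrier F \<union> y ` I)"

text \<open>At \<open>b1\<close> exponents below \<open>p\<close> suffice, because the relation
  expresses the p-th power of this coordinate by the other coordinates.\<close>

definition cap where "cap t i = (if i = b1 then p else p ^ t)" for t :: nat

text \<open>\<open>N\<close> lies in the span of the box, whose size is at most \<open>p\<close>
  times the power of p^t with exponent \<open>card (I - {b0, b1})\<close>. Comparison with the
  independent family \<open>g\<close> bounds \<open>r\<close>, and in the case of equality the box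
  has no more elements than \<open>g\<close>, so its monomials are independent.\<close>

lemma monomial_basis:
  assumes M: "subfield M L" "h ` carrier F \<subseteq> M" and t: "0 < t" and wM: "\<And>w. w \<in> N \<Longrightarrow> w [^]\<^bsub>L\<^esub> (p ^ t) \<in> M"
    and B: "B \<subseteq> I" "b1 \<in> B" and a: "\<And>b. b \<in> B \<Longrightarrow> a b \<in> carrier L" "\<And>b. b \<in> B \<Longrightarrow> a b [^]\<^bsub>L\<^esub> p \<in> h ` carrier F"
    and a1: "a b1 \<noteq> \<zero>\<^bsub>L\<^esub>" and rel: "(\<Oplus>\<^bsub>L\<^esub>b\<in>B. a b \<otimes>\<^bsub>L\<^esub> y b) = \<zero>\<^bsub>L\<^esub>"
    and J: "finite J" "g \<in> J \<rightarrow> N" "L.fam_indep M J g" "card J = p * (p ^ t) ^ r"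
  shows "r \<le> card (I - {b0, b1})"
    "r = card (I - {b0, b1}) \<Longrightarrow> L.fam_indep M (box (I - {b0}) (cap t)) E.mon"
proof -
  define Vs where "Vs = I - {b0, b1}"
  have finVs: "finite Vs" unfolding Vs_def using E.fin by simp
  have p1: "1 < p" using L.p_prime prime_gt_1_nat by blast
  have cap0: "0 < cap t i" for i unfolding cap_def using L.p_pos by simp
  have gen: "h ` carrier F \<union> y ` I \<subseteq> carrier L" using E.z by auto
  have yN: "y i \<in> N" if "i \<in> I" for i unfolding N_def using that by (auto intro: generate_field.incl)
  have "\<exists>S. subfield S L \<and> M \<subseteq> S \<and> y ` Vs \<subseteq> S \<and> S \<subseteq> L.fam_span M (box Vs (cap t)) E.mon"
  proof (rule box_spanning[OF M(1) finVs])
    fix i assume i: "i \<in> Vs"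
    then show "y i [^]\<^bsub>L\<^esub> cap t i \<in> M" using wM[OF yN[of i]] unfolding Vs_def cap_def by auto
    show "\<exists>s. cap t i = p ^ s \<and> 0 < s" using i t unfolding Vs_def cap_def by auto
  qed (use cap0 in \<open>auto simp: Vs_def\<close>)
  then obtain S where S: "subfield S L" "M \<subseteq> S" "y ` Vs \<subseteq> S" "S \<subseteq> L.fam_span M (box Vs (cap t)) E.mon" by blast
  have yS: "y i \<in> S" if "i \<in> I - {b1}" for i
    using that S(3) y0 L.subfield_closed(3)[OF S(1)] unfolding Vs_def by (cases "i = b0") auto
  have finB: "finite B" using B(1) E.fin finite_subset by blast
  have BC: "y b \<in> carrier L" if "b \<in> B" for b using E.z B(1) that by blast
  have tC: "a b \<otimes>\<^bsub>L\<^esub> y b \<in> carrier L" if "b \<in> B" for b using a(1) BC that by simp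
  \<comment> \<open>The relation is raised to the p-th power: the p-th powers of its coefficients
    belong to \<open>M\<close>, and all other coordinates already belong to
    \<open>S\<close>.\<close>
  have b1S: "y b1 [^]\<^bsub>L\<^esub> p \<in> S"
  proof -
    define w where "w b = (a b \<otimes>\<^bsub>L\<^esub> y b) [^]\<^bsub>L\<^esub> p" for b
    have w: "w b = a b [^]\<^bsub>L\<^esub> p \<otimes>\<^bsub>L\<^esub> y b [^]\<^bsub>L\<^esub> p" if "b \<in> B" for b
      unfolding w_def using a(1)[OF that] BC[OF that] by (rule L.nat_pow_distrib)
    have wC: "w b \<in> carrier L" if "b \<in> B" for b unfolding w_def using tC that by simp
    have aS: "a b [^]\<^bsub>L\<^esub> p \<in> S" if "b \<in> B" for b using a(2)[OF that] M(2) S(2) by blast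
    have wS: "w b \<in> S" if "b \<in> B - {b1}" for b
    proof -
      have "y b \<in> S" using yS[of b] that B(1) by blast
      then show ?thesis using w[of b] that aS[of b] L.subfield_closed(5)[OF S(1)] L.subfield_pow_closed[OF S(1)] by auto
    qed
    have "(\<Oplus>\<^bsub>L\<^esub>b\<in>B. w b) = (\<Oplus>\<^bsub>L\<^esub>b\<in>B. a b \<otimes>\<^bsub>L\<^esub> y b) [^]\<^bsub>L\<^esub> p"
      unfolding w_def using L.frobenius_finsum[of "\<lambda>b. a b \<otimes>\<^bsub>L\<^esub> y b" B 1] tC by simp
    then have z: "(\<Oplus>\<^bsub>L\<^esub>b\<in>B. w b) = \<zero>\<^bsub>L\<^esub>" unfolding rel using L.p_pos by (simp add: L.nat_pow_zero)
    have "(\<Oplus>\<^bsub>L\<^esub>b\<in>insert b1 (B - {b1}). w b) = w b1 \<oplus>\<^bsub>L\<^esub> (\<Oplus>\<^bsub>L\<^esub>b\<in>B - {b1}. w b)"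
      by (rule L.finsum_insert) (use finB wC B(2) in auto)
    moreover have "insert b1 (B - {b1}) = B" using B(2) by blast
    ultimately have z': "w b1 \<oplus>\<^bsub>L\<^esub> (\<Oplus>\<^bsub>L\<^esub>b\<in>B - {b1}. w b) = \<zero>\<^bsub>L\<^esub>" using z by simp
    have s: "(\<Oplus>\<^bsub>L\<^esub>b\<in>B - {b1}. w b) \<in> S" by (rule L.subfield_finsum_closed[OF S(1)]) (use wS in blast)
    then have "w b1 = \<ominus>\<^bsub>L\<^esub> (\<Oplus>\<^bsub>L\<^esub>b\<in>B - {b1}. w b)"
      using L.minus_equality[OF z'] wC[OF B(2)] L.subfield_closed(1)[OF S(1)] by auto
    then have w1: "w b1 \<in> S" using L.subfield_closed(6)[OF S(1) s] by simp
    have nz: "a b1 [^]\<^bsub>L\<^esub> p \<noteq> \<zero>\<^bsub>L\<^esub>" using L.pow_eq_zero_iff[OF a(1)[OF B(2)] L.p_pos] a1 by simp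
    then have i: "inv\<^bsub>L\<^esub> (a b1 [^]\<^bsub>L\<^esub> p) \<in> S" by (rule L.subfield_closed(7)[OF S(1) aS[OF B(2)]])
    have U: "a b1 [^]\<^bsub>L\<^esub> p \<in> Units L" using nz a(1)[OF B(2)] L.field_Units by simp
    have "y b1 [^]\<^bsub>L\<^esub> p = inv\<^bsub>L\<^esub> (a b1 [^]\<^bsub>L\<^esub> p) \<otimes>\<^bsub>L\<^esub> w b1"
      unfolding w[OF B(2)] using U a(1)[OF B(2)] BC[OF B(2)] by (simp add: L.m_assoc[symmetric])
    then show ?thesis using L.subfield_closed(5)[OF S(1) i w1] by simp
  qed
  have insVs: "insert b1 Vs = I - {b0}" unfolding Vs_def using b01 by blast
  have "\<exists>S'. subfield S' L \<and> S \<subseteq> S' \<and> y b1 \<in> S' \<and> S' \<subseteq> L.fam_span M (box (insert b1 Vs) (cap t)) E.mon"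
    by (rule box_step[OF M(1) S(1,2,4) finVs b01(2), of 1]) (use b1S cap0 in \<open>auto simp: Vs_def cap_def\<close>)
  then obtain S' where S': "subfield S' L" "S \<subseteq> S'" "y b1 \<in> S'" "S' \<subseteq> L.fam_span M (box (I - {b0}) (cap t)) E.mon"
    unfolding insVs by blast
  have "N \<subseteq> S'"
    unfolding N_def
  proof (rule L.generate_field_min_subfield1[OF gen S'(1)])
    have "y i \<in> S'" if "i \<in> I" for i using yS[of i] S'(2,3) that by (cases "i = b1") auto
    then show "h ` carrier F \<union> y ` I \<subseteq> S'" using M(2) S(2) S'(2) by blast
  qed
  then have gS: "g \<in> J \<rightarrow> L.fam_span M (box (I - {b0}) (cap t)) E.mon" using J(2) S'(4) by blast
  have finE: "finite (box (I - {b0}) (cap t))" by (rule box_finite_card(1)) (use E.fin in simp)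
  have mC: "E.mon \<in> Z \<rightarrow> carrier L" for Z by simp
  have "card (box (I - {b0}) (cap t)) \<le> (\<Prod>i\<in>I - {b0}. cap t i)" by (rule box_finite_card(2)) (use E.fin in simp)
  also have "\<dots> = cap t b1 * (\<Prod>i\<in>Vs. cap t i)"
    unfolding insVs[symmetric] by (rule prod.insert) (use finVs Vs_def in auto)
  also have "(\<Prod>i\<in>Vs. cap t i) = (\<Prod>i\<in>Vs. p ^ t)" by (rule prod.cong) (auto simp: Vs_def cap_def)
  also have "cap t b1 * (\<Prod>i\<in>Vs. p ^ t) = p * (p ^ t) ^ card Vs" by (simp add: cap_def)
  finally have cE: "card (box (I - {b0}) (cap t)) \<le> p * (p ^ t) ^ card Vs" .
  have "card J \<le> card (box (I - {b0}) (cap t))"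
    by (rule L.fam_indep_card_le[OF M(1) finE J(1) mC gS J(3)])
  then have "p * (p ^ t) ^ r \<le> p * (p ^ t) ^ card Vs" using cE unfolding J(4) by (rule le_trans)
  then have "(p ^ t) ^ r \<le> (p ^ t) ^ card Vs" using L.p_pos by simp
  moreover have "1 < p ^ t" using one_less_power[OF p1 t] .
  ultimately show "r \<le> card (I - {b0, b1})" unfolding Vs_def by (rule power_le_imp_le_exp[rotated])
  assume "r = card (I - {b0, b1})"
  then have "card (box (I - {b0}) (cap t)) \<le> card J" using cE J(4) unfolding Vs_def by simp
  then show "L.fam_indep M (box (I - {b0}) (cap t)) E.mon"
    by (rule L.fam_span_card_imp_indep[OF M(1) finE J(1) mC gS J(3)])
qed

text \<open>Deleting the variable \<open>b0\<close> dehomogenises, which loses nothing in a fixed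
  degree \<open>d\<close>. The remaining exponents are at most \<open>d\<close>, hence below p^t,
  and below \<open>p\<close> at \<open>b1\<close>; so the polynomial becomes a relation among the
  independent monomials of the box.\<close>

lemma genericity:
  assumes M: "subfield M L" "h ` carrier F \<subseteq> M" and ind: "L.fam_indep M (box (I - {b0}) (cap t)) E.mon" and t: "d < p ^ t"
    and B: "B \<subseteq> I" "b0 \<in> B" and f: "f \<in> homogeneous_mpolys F B d" "\<forall>m\<in>msupp F f. count m b1 < p"
    and z: "mpoly_eval.ev F L B h y f = \<zero>\<^bsub>L\<^esub>"
  shows "f = \<zero>\<^bsub>mpoly_ring F B\<^esub>"
proof -
  have finB: "finite B" using B(1) E.fin finite_subset by blast
  interpret EB: mpoly_eval F L B h y by unfold_locales (use finB E.hom E.z B(1) in auto)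
  have fP: "f \<in> carrier (mpoly_ring F B)" using f(1) unfolding homogeneous_mpolys_def by blast
  have fin: "finite (msupp F f)" and fC: "\<And>m. f m \<in> carrier F" and sB: "\<And>m. m \<in> msupp F f \<Longrightarrow> set_mset m \<subseteq> B"
    using fP by (simp_all add: F.pset_iff)
  have size: "size m = d" if "m \<in> msupp F f" for m using f(1) that F.homogeneous_iff[of f B d] by blast
  define g where "g m = filter_mset (\<lambda>i. i \<noteq> b0) m" for m :: "'v multiset"
  have split: "m = g m + replicate_mset (count m b0) b0" for m
    unfolding g_def by (rule multiset_eqI) auto
  have inj: "inj_on g (msupp F f)"
  proof (rule inj_onI)
    fix m m' assume m: "m \<in> msupp F f" "m' \<in> msupp F f" and e: "g m = g m'"
    have "size (g m) + count m b0 = d" using arg_cong[OF split[of m], of size] size[OF m(1)] by simp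
    moreover have "size (g m') + count m' b0 = d" using arg_cong[OF split[of m'], of size] size[OF m(2)] by simp
    ultimately have "count m b0 = count m' b0" using e by simp
    then show "m = m'" using split[of m] split[of m'] e by simp
  qed
  have mon: "EB.mon m = E.mon (g m)" if m: "m \<in> msupp F f" for m
  proof -
    have "E.mon (g m) = (\<Otimes>\<^bsub>L\<^esub>i\<in>B. y i [^]\<^bsub>L\<^esub> count m i)"
      unfolding E.mon_def
    proof (rule L.finprod_mono_neutral_cong_right)
      fix i assume "i \<in> I - B"
      then have "count (g m) i = 0" using sB[OF m] unfolding g_def by (auto simp: not_in_iff[symmetric])
      then show "y i [^]\<^bsub>L\<^esub> count (g m) i = \<one>\<^bsub>L\<^esub>" by simp
    next
      fix i assume "i \<in> B"
      then show "y i [^]\<^bsub>L\<^esub> count (g m) i = y i [^]\<^bsub>L\<^esub> count m i" using y0 unfolding g_def by (cases "i = b0") auto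
    qed (use E.fin B(1) E.z in auto)
    then show ?thesis unfolding EB.mon_def by simp
  qed
  have gbox: "g ` msupp F f \<subseteq> box (I - {b0}) (cap t)"
  proof
    fix u assume "u \<in> g ` msupp F f"
    then obtain m where m: "m \<in> msupp F f" "u = g m" by blast
    have "count u i < cap t i" for i
    proof -
      have "count u i \<le> count m i" unfolding m(2) g_def by simp
      moreover have "count m i < cap t i"
        using f(2) m(1) count_le_size[of m i] size[OF m(1)] t unfolding cap_def by auto
      ultimately show ?thesis by linarith
    qed
    moreover have "set_mset u \<subseteq> I - {b0}" unfolding m(2) g_def using sB[OF m(1)] B(1) by auto
    ultimately show "u \<in> box (I - {b0}) (cap t)" unfolding box_def by blast
  qed
  have finE: "finite (box (I - {b0}) (cap t))" by (rule box_finite_card(1)) (use E.fin in simp)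
  have ind': "L.fam_indep M (g ` msupp F f) E.mon"
    by (rule L.fam_indep_subset[OF M(1) ind gbox finE]) simp
  define c where "c u = h (f (inv_into (msupp F f) g u))" for u
  have cg: "c (g m) = h (f m)" if "m \<in> msupp F f" for m unfolding c_def using inj that by simp
  have hC: "h (f m) \<in> M" "h (f m) \<in> carrier L" for m using fC M(2) by auto
  have "(\<Oplus>\<^bsub>L\<^esub>u\<in>g ` msupp F f. c u \<otimes>\<^bsub>L\<^esub> E.mon u) = (\<Oplus>\<^bsub>L\<^esub>m\<in>msupp F f. c (g m) \<otimes>\<^bsub>L\<^esub> E.mon (g m))"
    by (rule L.add.finprod_reindex[OF _ inj]) (use hC c_def in auto)
  also have "\<dots> = (\<Oplus>\<^bsub>L\<^esub>m\<in>msupp F f. h (f m) \<otimes>\<^bsub>L\<^esub> EB.mon m)"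
    by (rule L.finsum_cong') (use cg mon hC in auto)
  also have "\<dots> = \<zero>\<^bsub>L\<^esub>" using z unfolding EB.ev_def .
  finally have s: "(\<Oplus>\<^bsub>L\<^esub>u\<in>g ` msupp F f. c u \<otimes>\<^bsub>L\<^esub> E.mon u) = \<zero>\<^bsub>L\<^esub>" .
  have cM: "c \<in> g ` msupp F f \<rightarrow> M" using cg hC(1) by auto
  have "msupp F f = {}"
  proof (rule ccontr)
    assume "msupp F f \<noteq> {}"
    then obtain m where m: "m \<in> msupp F f" by blast
    have "c (g m) = \<zero>\<^bsub>L\<^esub>" by (rule L.fam_indepD[OF M(1) ind' cM s]) (use m in blast)
    then have "f m = \<zero>" using cg[OF m] h_inj[OF fC] by simp
    then show False using m by (simp add: msupp_def)
  qed
  then have "f = (\<lambda>m. \<zero>)" unfolding msupp_def by auto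
  then show ?thesis by (simp add: F.indexed_const_mterm mpoly_ring_def mterm_def)
qed

end

section \<open>Subforms\<close>

lemma (in field) fam_span_coefficients:
  assumes "\<And>v. v \<in> Vs \<Longrightarrow> a v \<in> fam_span N T b"
  obtains n where "\<And>v t. v \<in> Vs \<Longrightarrow> t \<in> T \<Longrightarrow> n v t \<in> N" "\<And>v. v \<in> Vs \<Longrightarrow> a v = (\<Oplus>t\<in>T. n v t \<otimes> b t)"
proof -
  have "\<forall>v\<in>Vs. \<exists>f. f \<in> T \<rightarrow> N \<and> a v = (\<Oplus>t\<in>T. f t \<otimes> b t)" using assms unfolding fam_span_def by blast
  from bchoice[OF this] obtain n where n: "\<forall>v\<in>Vs. n v \<in> T \<rightarrow> N \<and> a v = (\<Oplus>t\<in>T. n v t \<otimes> b t)" by blast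
  show ?thesis by (rule that[of n]) (use n in blast)+
qed

section \<open>Rescaling a solution and solving for pivot coordinates\<close>

context field
begin

text \<open>The field of ratios of the coordinates of a projective point does not depend on the
  coordinate used as denominator. By \<open>conv\<close> the old point is recovered from the new one
  homogeneously; applied at the coordinate \<open>e\<close>, where \<open>x\<close> is 1, it puts
  the scaling factor itself into the new field.\<close>

lemma generate_field_rescale:
  assumes k: "k \<subseteq> carrier R" and x: "\<And>v. v \<in> A \<Longrightarrow> x v \<in> carrier R" "e \<in> A" "x e = \<one>"
    and B: "finite B" and a: "\<And>b. b \<in> B \<Longrightarrow> a b \<in> carrier R" and z: "\<And>b. b \<in> B \<Longrightarrow> z b \<in> generate_field R (k \<union> x ` A)"
    and rel: "(\<Oplus>b\<in>B. a b \<otimes> z b) = \<zero>" and b0: "b0 \<in> B" "z b0 \<noteq> \<zero>"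
    and conv: "\<And>H c v. subfield H R \<Longrightarrow> k \<subseteq> H \<Longrightarrow> c \<in> carrier R \<Longrightarrow> (\<And>b. b \<in> B \<Longrightarrow> c \<otimes> z b \<in> H) \<Longrightarrow> v \<in> A \<Longrightarrow> c \<otimes> x v \<in> H"
  shows "\<exists>z'. z' b0 = \<one> \<and> (\<forall>b\<in>B. z' b \<in> carrier R) \<and> (\<Oplus>b\<in>B. a b \<otimes> z' b) = \<zero> \<and>
    generate_field R (k \<union> z' ` B) = generate_field R (k \<union> x ` A)"
proof -
  define N where "N = generate_field R (k \<union> x ` A)"
  have gx: "k \<union> x ` A \<subseteq> carrier R" using k x(1) by blast
  have N: "subfield N R" unfolding N_def by (rule generate_field_is_subfield[OF gx])
  have kN: "k \<subseteq> N" unfolding N_def by (auto intro: generate_field.incl)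
  have zN: "z b \<in> N" if "b \<in> B" for b using z that unfolding N_def .
  have zC: "z b \<in> carrier R" if "b \<in> B" for b using zN[OF that] subfield_closed(1)[OF N] by blast
  define c where "c = inv (z b0)"
  have cN: "c \<in> N" unfolding c_def by (rule subfield_closed(7)[OF N zN[OF b0(1)] b0(2)])
  have cC: "c \<in> carrier R" using cN subfield_closed(1)[OF N] by blast
  have U: "z b0 \<in> Units R" using zC[OF b0(1)] b0(2) field_Units by simp
  have c0: "c \<noteq> \<zero>"
  proof
    assume "c = \<zero>"
    then have "\<one> = \<zero>" using Units_l_inv[OF U] zC[OF b0(1)] unfolding c_def by simp
    then show False by simp
  qed
  define z' where "z' b = c \<otimes> z b" for b
  have z'C: "z' b \<in> carrier R" if "b \<in> B" for b unfolding z'_def using cC zC[OF that] by simp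
  have "(\<Oplus>b\<in>B. a b \<otimes> z' b) = (\<Oplus>b\<in>B. c \<otimes> (a b \<otimes> z b))"
    by (rule finsum_cong') (use a zC cC in \<open>auto simp: z'_def m_ac\<close>)
  also have "\<dots> = c \<otimes> (\<Oplus>b\<in>B. a b \<otimes> z b)" by (rule finsum_rdistr[symmetric]) (use B a zC cC in auto)
  also have "\<dots> = \<zero>" unfolding rel using cC by simp
  finally have rel': "(\<Oplus>b\<in>B. a b \<otimes> z' b) = \<zero>" .
  have gz: "k \<union> z' ` B \<subseteq> carrier R" using k z'C by blast
  define H where "H = generate_field R (k \<union> z' ` B)"
  have H: "subfield H R" unfolding H_def by (rule generate_field_is_subfield[OF gz])
  have kH: "k \<subseteq> H" and zH: "\<And>b. b \<in> B \<Longrightarrow> z' b \<in> H" unfolding H_def by (auto intro: generate_field.incl)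
  have cx: "c \<otimes> x v \<in> H" if "v \<in> A" for v
    by (rule conv[OF H kH cC _ that]) (use zH in \<open>simp add: z'_def\<close>)
  have "c \<in> H" using cx[OF x(2)] x(3) cC by simp
  then have "inv c \<in> H" by (rule subfield_closed(7)[OF H _ c0])
  then have bH: "z b0 \<in> H" unfolding c_def using U by simp
  have "x v \<in> H" if v: "v \<in> A" for v
  proof -
    have "z b0 \<otimes> (c \<otimes> x v) = x v" unfolding c_def using U x(1)[OF v] by (simp add: m_assoc[symmetric] Units_closed)
    then show ?thesis using subfield_closed(5)[OF H bH cx[OF v]] by simp
  qed
  then have "N \<subseteq> H" unfolding N_def by (intro generate_field_min_subfield1[OF gx H]) (use kH in auto)
  moreover have "H \<subseteq> N"
    unfolding H_def by (rule generate_field_min_subfield1[OF gz N]) (use kN zN subfield_closed(5)[OF N cN] z'_def in auto)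
  ultimately have "H = N" by blast
  moreover have "z' b0 = \<one>" unfolding z'_def c_def using U by simp
  ultimately show ?thesis using z'C rel' unfolding H_def N_def by blast
qed

text \<open>All \<open>a v\<close> are rewritten through the pivots in \<open>T\<close>. Making the
  brackets zero solves the equation; conversely, if the pivots are independent over a field that
  contains the brackets, every solution has zero brackets. Both directions are used.\<close>

lemma pivot_sum:
  assumes A: "finite A" and T: "T \<subseteq> A" and a: "\<And>v. v \<in> A \<Longrightarrow> a v \<in> carrier R" and x: "\<And>v. v \<in> A \<Longrightarrow> x v \<in> carrier R"
    and n: "\<And>v t. v \<in> A - T \<Longrightarrow> t \<in> T \<Longrightarrow> n v t \<in> carrier R" and av: "\<And>v. v \<in> A - T \<Longrightarrow> a v = (\<Oplus>t\<in>T. n v t \<otimes> a t)"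
  shows "(\<Oplus>v\<in>A. a v \<otimes> x v) = (\<Oplus>t\<in>T. (x t \<oplus> (\<Oplus>v\<in>A - T. n v t \<otimes> x v)) \<otimes> a t)"
proof -
  have fT: "finite T" "finite (A - T)" using A T finite_subset by auto
  have TC: "a t \<in> carrier R" "x t \<in> carrier R" if "t \<in> T" for t using a x T that by auto
  have C: "n v t \<otimes> x v \<in> carrier R" if "v \<in> A - T" "t \<in> T" for v t using n x that by auto
  have "(\<Oplus>v\<in>T \<union> (A - T). a v \<otimes> x v) = (\<Oplus>v\<in>T. a v \<otimes> x v) \<oplus> (\<Oplus>v\<in>A - T. a v \<otimes> x v)"
    by (rule finsum_Un_disjoint) (use fT a x T in auto)
  also have "T \<union> (A - T) = A" using T by blast
  also have "(\<Oplus>v\<in>A - T. a v \<otimes> x v) = (\<Oplus>v\<in>A - T. \<Oplus>t\<in>T. n v t \<otimes> x v \<otimes> a t)"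
  proof (rule finsum_cong')
    fix v assume v: "v \<in> A - T"
    have xv: "x v \<in> carrier R" using v x by blast
    have "a v \<otimes> x v = (\<Oplus>t\<in>T. n v t \<otimes> a t \<otimes> x v)"
      unfolding av[OF v] by (rule finsum_ldistr) (use fT n[OF v] TC xv in auto)
    also have "\<dots> = (\<Oplus>t\<in>T. n v t \<otimes> x v \<otimes> a t)"
      by (rule finsum_cong') (use n[OF v] TC xv in \<open>auto simp: m_ac\<close>)
    finally show "a v \<otimes> x v = (\<Oplus>t\<in>T. n v t \<otimes> x v \<otimes> a t)" .
  qed (use C TC in \<open>auto intro!: finsum_closed\<close>)
  also have "\<dots> = (\<Oplus>t\<in>T. \<Oplus>v\<in>A - T. n v t \<otimes> x v \<otimes> a t)"
    by (rule finsum_finsum_swap) (use fT C TC in auto)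
  also have "(\<Oplus>v\<in>T. a v \<otimes> x v) \<oplus> \<dots> = (\<Oplus>t\<in>T. a t \<otimes> x t \<oplus> (\<Oplus>v\<in>A - T. n v t \<otimes> x v \<otimes> a t))"
    by (rule finsum_addf[symmetric]) (use C TC in \<open>auto intro!: finsum_closed\<close>)
  also have "\<dots> = (\<Oplus>t\<in>T. (x t \<oplus> (\<Oplus>v\<in>A - T. n v t \<otimes> x v)) \<otimes> a t)"
  proof (rule finsum_cong')
    fix t assume t: "t \<in> T"
    have S: "(\<Oplus>v\<in>A - T. n v t \<otimes> x v) \<in> carrier R" using C t by (intro finsum_closed) auto
    have "(\<Oplus>v\<in>A - T. n v t \<otimes> x v \<otimes> a t) = (\<Oplus>v\<in>A - T. n v t \<otimes> x v) \<otimes> a t"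
      by (rule finsum_ldistr[symmetric]) (use fT C t TC in auto)
    then show "a t \<otimes> x t \<oplus> (\<Oplus>v\<in>A - T. n v t \<otimes> x v \<otimes> a t) = (x t \<oplus> (\<Oplus>v\<in>A - T. n v t \<otimes> x v)) \<otimes> a t"
      using TC[OF t] S by (simp add: l_distr r_distr m_comm)
  qed (use C TC in \<open>auto intro!: finsum_closed\<close>)
  finally show ?thesis .
qed

end

section \<open>The defect index of the form and of a subform\<close>

context generic_solution
begin

text \<open>The coordinates in \<open>C\<close> take part only in generating \<open>N\<close>, so
  that the count applies; the polynomials whose genericity is needed involve \<open>B\<close> alone.
  When the count is tight, \<open>y\<close> restricted to \<open>B\<close> is a generic point, and
  the rank over its own field gives the defect index.\<close>

lemma first_defect_index_formula:
  fixes V :: "('a, 'v, 'n) module_scheme" and \<psi> :: "'v \<Rightarrow> 'a"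
  assumes B: "B = coord_basis F V" "finite B" and C: "finite C" and \<psi>: "\<And>b. b \<in> B \<Longrightarrow> \<psi> b \<in> carrier F"
    and y: "\<And>v. v \<in> B \<union> C \<Longrightarrow> y v \<in> carrier L" "y b0 = \<one>\<^bsub>L\<^esub>" and b01: "b0 \<in> B" "b1 \<in> B" "b0 \<noteq> b1" "\<psi> b1 \<noteq> \<zero>"
    and rel: "(\<Oplus>\<^bsub>L\<^esub>b\<in>B. hh (\<psi> b) \<otimes>\<^bsub>L\<^esub> y b) = \<zero>\<^bsub>L\<^esub>" and gen: "generate_field L (k \<union> y ` (B \<union> C)) = N"
  shows "card A - 2 \<le> card (B \<union> C - {b0, b1})"
    "card A - 2 = card (B \<union> C - {b0, b1}) \<Longrightarrow> T \<subseteq> B \<Longrightarrow> L.fam_indep (generate_field L (k \<union> y ` B)) T (\<lambda>b. hh (\<psi> b)) \<Longrightarrow>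
      (\<And>b. b \<in> B \<Longrightarrow> hh (\<psi> b) \<in> L.fam_span (generate_field L (k \<union> y ` B)) T (\<lambda>b. hh (\<psi> b))) \<Longrightarrow>
      first_defect_index p F V \<psi> = card B - card T"
proof -
  let ?h = "\<lambda>c. hh c [^]\<^bsub>L\<^esub> p"
  interpret MS: monomial_span F L p "B \<union> C" ?h y b0 b1
  proof unfold_locales
    show "c = \<zero>" if "c \<in> carrier F" "?h c = \<zero>\<^bsub>L\<^esub>" for c
      using that L.pow_eq_zero_iff[of "hh c" p] L.p_pos hh_zero by simp
  qed (use B(2) C frob y b01 in auto)
  have kh: "?h ` carrier F = k" unfolding k_def ..
  have MSN: "MS.N = N" unfolding MS.N_def kh gen ..
  have \<psi>p: "hh (\<psi> b) [^]\<^bsub>L\<^esub> p \<in> ?h ` carrier F" if "b \<in> B" for b using \<psi>[OF that] by blast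
  have nz: "hh (\<psi> b1) \<noteq> \<zero>\<^bsub>L\<^esub>" using hh_zero[OF \<psi>[OF b01(2)]] b01(4) by simp
  have basis: "card A - 2 \<le> card (B \<union> C - {b0, b1}) \<and> (card A - 2 = card (B \<union> C - {b0, b1}) \<longrightarrow>
      (\<exists>M. subfield M L \<and> k \<subseteq> M \<and> L.fam_indep M (box (B \<union> C - {b0}) (MS.cap t)) MS.E.mon))" if t: "0 < t" for t
  proof -
    obtain M and J :: "(('v multiset \<times> unit) \<times> nat) set" and g where
      M: "subfield M L" "k \<subseteq> M" "\<forall>w\<in>N. w [^]\<^bsub>L\<^esub> (p ^ t) \<in> M" and
      J: "finite J" "card J = p * (p ^ t) ^ (card A - 2)" "g \<in> J \<rightarrow> N" "L.fam_indep M J g"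
      using many_independent[OF t] by blast
    note mb = MS.monomial_basis[OF M(1) _ t _ _ b01(2) _ \<psi>p nz rel J(1) _ J(4) J(2)]
    have 1: "?h ` carrier F \<subseteq> M" using M(2) kh by simp
    have 2: "w [^]\<^bsub>L\<^esub> (p ^ t) \<in> M" if "w \<in> MS.N" for w using M(3) that unfolding MSN by blast
    have 3: "hh (\<psi> b) \<in> carrier L" if "b \<in> B" for b using \<psi>[OF that] by simp
    have 4: "g \<in> J \<rightarrow> MS.N" unfolding MSN by (rule J(3))
    have "card A - 2 \<le> card (B \<union> C - {b0, b1})" by (rule mb(1)[OF 1 2 Un_upper1 3 _ 4])
    moreover have "L.fam_indep M (box (B \<union> C - {b0}) (MS.cap t)) MS.E.mon" if "card A - 2 = card (B \<union> C - {b0, b1})"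
      by (rule mb(2)[OF 1 2 Un_upper1 3 _ 4 that])
    ultimately show ?thesis using M(1,2) by blast
  qed
  then show "card A - 2 \<le> card (B \<union> C - {b0, b1})" using basis[of 1] by simp
  assume eq: "card A - 2 = card (B \<union> C - {b0, b1})" and T: "T \<subseteq> B"
    "L.fam_indep (generate_field L (k \<union> y ` B)) T (\<lambda>b. hh (\<psi> b))"
    "\<And>b. b \<in> B \<Longrightarrow> hh (\<psi> b) \<in> L.fam_span (generate_field L (k \<union> y ` B)) T (\<lambda>b. hh (\<psi> b))"
  have generic: "f = \<zero>\<^bsub>mpoly_ring F B\<^esub>"
    if f: "f \<in> homogeneous_mpolys F B d" "\<forall>m\<in>msupp F f. count m b1 < p" "mpoly_eval.ev F L B ?h y f = \<zero>\<^bsub>L\<^esub>" for d f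
  proof -
    obtain M where M: "subfield M L" "k \<subseteq> M" "L.fam_indep M (box (B \<union> C - {b0}) (MS.cap (Suc d))) MS.E.mon"
      using basis[of "Suc d"] eq by blast
    have "1 < p" using F.p_prime prime_gt_1_nat by blast
    \<comment> \<open>For polynomials of degree \<open>d\<close> any q above \<open>d\<close> will
      do; the exponent \<open>Suc d\<close> is one that works.\<close>
    then have d: "d < p ^ Suc d" using power_gt_expt[of p "Suc d"] by simp
    show ?thesis
      by (rule MS.genericity[OF M(1) _ M(3) d Un_upper1 b01(1) f]) (use M(2) kh in simp)
  qed
  interpret GP: generic_point F L p V \<psi> hh y B b0 b1
    by unfold_locales (use B \<psi> E.hom y b01 rel generic in auto)
  have GN: "GP.N = generate_field L (k \<union> y ` B)" unfolding GP.N_def kh ..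
  show "first_defect_index p F V \<psi> = card B - card T"
    by (rule GP.first_defect_index_eq[OF T(1)]) (use T(2,3) in \<open>auto simp: GN\<close>)
qed

lemma rescaled_solution:
  assumes e: "e \<in> A"
  shows "\<exists>x'. x' e = \<one>\<^bsub>L\<^esub> \<and> (\<forall>v\<in>A. x' v \<in> carrier L) \<and> (\<Oplus>\<^bsub>L\<^esub>v\<in>A. hh (\<phi> v) \<otimes>\<^bsub>L\<^esub> x' v) = \<zero>\<^bsub>L\<^esub> \<and>
    generate_field L (k \<union> x' ` A) = N"
  unfolding N_def
proof (rule L.generate_field_rescale[OF k_carrier x_closed e01(1) _ finA _ _ relation e x_nonzero[OF e]])
  show "x e0 = \<one>\<^bsub>L\<^esub>" by (simp add: x_def)
qed (use \<phi> x_N in \<open>auto simp: N_def\<close>)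

lemma first_defect_index_subspace:
  fixes W :: "('a, 'v, 'n) module_scheme" and \<psi> :: "'v \<Rightarrow> 'a"
  assumes B: "B = coord_basis F W" "B \<subseteq> A" and \<psi>: "\<And>b. b \<in> B \<Longrightarrow> \<psi> b = \<phi> b"
    and T0: "T0 \<subseteq> A" "L.fam_indep N T0 (\<lambda>v. hh (\<phi> v))" "\<And>v. v \<in> A \<Longrightarrow> hh (\<phi> v) \<in> L.fam_span N T0 (\<lambda>v. hh (\<phi> v))"
    and lt: "card T0 < card B"
  shows "first_defect_index p F W \<psi> = card B - card T0"
proof -
  define a where "a v = hh (\<phi> v)" for v
  have aC: "a v \<in> carrier L" if "v \<in> A" for v unfolding a_def using \<phi>[OF that] by simp
  have aA: "a \<in> A \<rightarrow> carrier L" using aC by blast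
  have ind_k: "L.fam_indep k A a" unfolding a_def by (rule \<phi>_indep)
  have inj: "inj_on a A" by (rule L.fam_indep_inj[OF k_subfield finA aA ind_k])
  note NC = L.subfield_closed(1)[OF N_subfield]
  have finB: "finite B" using B(2) finA finite_subset by blast
  have aB: "a \<in> B \<rightarrow> carrier L" using aC B(2) by blast
  obtain TW where TW0: "{} \<subseteq> TW" and TW: "TW \<subseteq> B" "L.fam_indep N TW a" "a \<in> B \<rightarrow> L.fam_span N TW a"
    by (rule L.fam_basis_extend[OF N_subfield finB aB empty_subsetI L.fam_indep_empty[OF N_subfield]])
  have TWA: "TW \<subseteq> A" using TW(1) B(2) by blast
  obtain T where T: "TW \<subseteq> T" "T \<subseteq> A" "L.fam_indep N T a" "a \<in> A \<rightarrow> L.fam_span N T a"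
    by (rule L.fam_basis_extend[OF N_subfield finA aA TWA TW(2)])
  have finT: "finite T" "finite T0" "finite TW" using T(2) T0(1) TWA finA finite_subset by blast+
  have aT: "a \<in> T \<rightarrow> carrier L" "a \<in> T0 \<rightarrow> carrier L" using aC T(2) T0(1) by blast+
  have T0s: "a \<in> T \<rightarrow> L.fam_span N T0 a" using T0(3) T(2) unfolding a_def by blast
  have Ts: "a \<in> T0 \<rightarrow> L.fam_span N T a" using T(4) T0(1) by blast
  have "card T \<le> card T0" by (rule L.fam_indep_card_le[OF N_subfield finT(2,1) aT(2) T0s T(3)])
  moreover have "card T0 \<le> card T" using L.fam_indep_card_le[OF N_subfield finT(1,2) aT(1) Ts] T0(2) unfolding a_def .
  ultimately have cT: "card T = card T0" by simp
  have "card TW \<le> card T" by (rule card_mono[OF finT(1) T(1)])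
  \<comment> \<open>Since \<open>B\<close> has more elements than the rank, an index
    \<open>e\<close> of \<open>B\<close> remains free. Its coordinate is normalised to one, which
    keeps the solution constructed on \<open>B\<close> nonzero.\<close>
  then have "\<not> B \<subseteq> TW" using lt cT card_mono[OF finT(3), of B] by linarith
  then obtain e where e: "e \<in> B" "e \<notin> TW" by blast
  have eA: "e \<in> A" using e(1) B(2) by blast
  obtain x' where x': "x' e = \<one>\<^bsub>L\<^esub>" "\<And>v. v \<in> A \<Longrightarrow> x' v \<in> carrier L"
    "(\<Oplus>\<^bsub>L\<^esub>v\<in>A. a v \<otimes>\<^bsub>L\<^esub> x' v) = \<zero>\<^bsub>L\<^esub>" "generate_field L (k \<union> x' ` A) = N"
    using rescaled_solution[OF eA] unfolding a_def by blast
  have gx: "k \<union> x' ` A \<subseteq> carrier L" using k_carrier x'(2) by blast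
  have x'N: "x' v \<in> N" if "v \<in> A" for v unfolding x'(4)[symmetric] using that by (auto intro: generate_field.incl)
  have aTW: "a v \<in> L.fam_span N TW a" if "v \<in> B" for v using TW(3) that by blast
  obtain \<kappa> where \<kappa>: "\<And>v t. v \<in> B \<Longrightarrow> t \<in> TW \<Longrightarrow> \<kappa> v t \<in> N" "\<And>v. v \<in> B \<Longrightarrow> a v = (\<Oplus>\<^bsub>L\<^esub>t\<in>TW. \<kappa> v t \<otimes>\<^bsub>L\<^esub> a t)"
    using L.fam_span_coefficients[of B a N TW a, OF aTW] by blast
  define s where "s t = (\<Oplus>\<^bsub>L\<^esub>v\<in>B - TW. \<kappa> v t \<otimes>\<^bsub>L\<^esub> x' v)" for t
  have sN: "s t \<in> N" if "t \<in> TW" for t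
    unfolding s_def
  proof (rule L.subfield_finsum_closed[OF N_subfield], rule funcsetI)
    fix v assume "v \<in> B - TW"
    then have "v \<in> B" "v \<in> A" using B(2) by auto
    then show "\<kappa> v t \<otimes>\<^bsub>L\<^esub> x' v \<in> N" using L.subfield_closed(5)[OF N_subfield \<kappa>(1)[OF _ that] x'N] by blast
  qed
  \<comment> \<open>Off \<open>TW\<close> the coordinates of the large solution are kept; those in
    \<open>TW\<close> are changed so that the brackets of \<open>pivot_sum\<close> vanish on
    \<open>B\<close> alone.\<close>
  define y where "y v = (if v \<in> TW then \<ominus>\<^bsub>L\<^esub> s v else x' v)" for v
  have yN: "y v \<in> N" if "v \<in> A" for v
    unfolding y_def using x'N[OF that] L.subfield_closed(6)[OF N_subfield sN] by auto
  have yC: "y v \<in> carrier L" if "v \<in> A" for v using yN[OF that] NC by blast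
  have ye: "y e = \<one>\<^bsub>L\<^esub>" unfolding y_def using e(2) x'(1) by simp
  have relB: "(\<Oplus>\<^bsub>L\<^esub>b\<in>B. a b \<otimes>\<^bsub>L\<^esub> y b) = \<zero>\<^bsub>L\<^esub>"
  proof -
    have "(\<Oplus>\<^bsub>L\<^esub>b\<in>B. a b \<otimes>\<^bsub>L\<^esub> y b) = (\<Oplus>\<^bsub>L\<^esub>t\<in>TW. (y t \<oplus>\<^bsub>L\<^esub> (\<Oplus>\<^bsub>L\<^esub>v\<in>B - TW. \<kappa> v t \<otimes>\<^bsub>L\<^esub> y v)) \<otimes>\<^bsub>L\<^esub> a t)"
    proof (rule L.pivot_sum[OF finB TW(1)])
      show "a v \<in> carrier L" "y v \<in> carrier L" if "v \<in> B" for v using aC yC B(2) that by blast+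
      show "\<kappa> v t \<in> carrier L" if "v \<in> B - TW" "t \<in> TW" for v t using \<kappa>(1)[of v t] that NC by blast
      show "a v = (\<Oplus>\<^bsub>L\<^esub>t\<in>TW. \<kappa> v t \<otimes>\<^bsub>L\<^esub> a t)" if "v \<in> B - TW" for v using \<kappa>(2)[of v] that by blast
    qed
    also have "\<dots> = \<zero>\<^bsub>L\<^esub>"
    proof (rule L.add.finprod_one_eqI)
      fix t assume t: "t \<in> TW"
      have xk: "\<kappa> v t \<otimes>\<^bsub>L\<^esub> x' v \<in> carrier L" if "v \<in> B - TW" for v
        using \<kappa>(1)[of v t] x'(2)[of v] that t NC B(2) by blast
      have "(\<Oplus>\<^bsub>L\<^esub>v\<in>B - TW. \<kappa> v t \<otimes>\<^bsub>L\<^esub> y v) = s t"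
        unfolding s_def by (rule L.finsum_cong') (use xk in \<open>auto simp: y_def\<close>)
      moreover have "y t = \<ominus>\<^bsub>L\<^esub> s t" unfolding y_def using t by simp
      moreover have "s t \<in> carrier L" "a t \<in> carrier L" using sN[OF t] NC aC t TWA by blast+
      ultimately show "(y t \<oplus>\<^bsub>L\<^esub> (\<Oplus>\<^bsub>L\<^esub>v\<in>B - TW. \<kappa> v t \<otimes>\<^bsub>L\<^esub> y v)) \<otimes>\<^bsub>L\<^esub> a t = \<zero>\<^bsub>L\<^esub>" by (simp add: L.l_neg)
    qed
    finally show ?thesis .
  qed
  define N1 where "N1 = generate_field L (k \<union> y ` B)"
  have gB: "k \<union> y ` B \<subseteq> carrier L" using k_carrier yC B(2) by blast
  have N1: "subfield N1 L" unfolding N1_def by (rule L.generate_field_is_subfield[OF gB])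
  have kN1: "k \<subseteq> N1" and yN1: "\<And>b. b \<in> B \<Longrightarrow> y b \<in> N1" unfolding N1_def by (auto intro: generate_field.incl)
  have N1N: "N1 \<subseteq> N"
    unfolding N1_def by (rule L.generate_field_min_subfield1[OF gB N_subfield]) (use k_N yN B(2) in blast)
  \<comment> \<open>The set that is dependent over the small field is the set of values on
    \<open>B\<close>: the solution \<open>y\<close> has its coordinates in \<open>N1\<close> and the
    coordinate 1 at \<open>e\<close>.\<close>
  have descend: "L.fam_indep N S (\<lambda>x. x)" if S: "S \<subseteq> a ` A" "L.fam_indep N1 S (\<lambda>x. x)" for S
  proof (rule L.indep_descends[OF k_subfield N1 N_subfield kN1 N1N, of "hh ` carrier F" "a ` A" "a ` B"])
    show "subfield (hh ` carrier F) L"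
      by (rule ring_hom_ring.img_is_subfield(2)[OF ring_hom_ringI2[OF F.ring_axioms L.ring_axioms E.hom] F.carrier_is_subfield]) simp
    show "k \<subseteq> hh ` carrier F"
    proof
      fix u assume "u \<in> k"
      then obtain c where c: "c \<in> carrier F" "u = hh c [^]\<^bsub>L\<^esub> p" unfolding k_def by blast
      have "u = hh (c [^] p)" using c h.hom_pow by simp
      then show "u \<in> hh ` carrier F" using c(1) by blast
    qed
    show "finite (a ` A)" using finA by simp
    show "a ` A \<subseteq> hh ` carrier F" unfolding a_def using \<phi> by blast
    show "u [^]\<^bsub>L\<^esub> p \<in> k" if "u \<in> a ` A" for u using that \<phi> unfolding a_def k_def by blast
    show "L.fam_indep k (a ` A) (\<lambda>x. x)" by (rule L.fam_indep_image[OF k_subfield finA aA ind_k])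
    show "a ` B \<subseteq> a ` A" using B(2) by blast
    show "\<not> L.fam_indep N1 (a ` B) (\<lambda>x. x)"
    proof
      assume i: "L.fam_indep N1 (a ` B) (\<lambda>x. x)"
      have injB: "inj_on a B" using inj B(2) inj_on_subset by blast
      define c where "c u = y (inv_into B a u)" for u
      have ca: "c (a v) = y v" if "v \<in> B" for v unfolding c_def using injB that by simp
      have "(\<Oplus>\<^bsub>L\<^esub>u\<in>a ` B. c u \<otimes>\<^bsub>L\<^esub> u) = (\<Oplus>\<^bsub>L\<^esub>v\<in>B. c (a v) \<otimes>\<^bsub>L\<^esub> a v)"
        by (rule L.finsum_image_family[OF injB aB]) (use ca yC B(2) in auto)
      also have "\<dots> = (\<Oplus>\<^bsub>L\<^esub>v\<in>B. a v \<otimes>\<^bsub>L\<^esub> y v)"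
        by (rule L.finsum_cong') (use ca yC aC B(2) in \<open>auto simp: L.m_comm subset_iff\<close>)
      finally have z: "(\<Oplus>\<^bsub>L\<^esub>u\<in>a ` B. c u \<otimes>\<^bsub>L\<^esub> u) = \<zero>\<^bsub>L\<^esub>" unfolding relB .
      have "c \<in> a ` B \<rightarrow> N1" using ca yN1 by auto
      from L.fam_indepD[OF N1 i this z, of "a e"] have "c (a e) = \<zero>\<^bsub>L\<^esub>" using e(1) by blast
      then show False using ca[OF e(1)] ye by simp
    qed
    show "card D \<le> p * card T'" if "finite D" "D \<subseteq> hh ` carrier F" "L.fam_indep k D (\<lambda>x. x)" "finite T'" "T' \<subseteq> carrier L"
      "D \<subseteq> L.fam_span N T' (\<lambda>x. x)" for D T'
      by (rule scalar_rank[OF that])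
  qed (use S in auto)
  have ind1: "L.fam_indep N1 T a" by (rule L.fam_indep_subfield[OF N_subfield T(3) N1N])
  \<comment> \<open>A value outside the span over \<open>N1\<close> would enlarge \<open>T\<close>
    to a family independent over \<open>N1\<close>, hence by \<open>descend\<close> over
    \<open>N\<close>, where \<open>T\<close> already has maximal size.\<close>
  have span1: "a c \<in> L.fam_span N1 T a" if c: "c \<in> A" for c
  proof (rule ccontr)
    assume n: "a c \<notin> L.fam_span N1 T a"
    have cT: "c \<notin> T" using n L.fam_span_mem[OF N1 finT(1) aT(1)] by blast
    have aI: "a \<in> insert c T \<rightarrow> carrier L" using aT(1) aC[OF c] by blast
    have "L.fam_indep N1 (insert c T) a" by (rule L.fam_indep_insert[OF N1 finT(1) cT aI ind1 n])
    then have "L.fam_indep N1 (a ` insert c T) (\<lambda>x. x)"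
      by (rule L.fam_indep_image[OF N1 _ aI, rotated]) (use finT(1) in simp)
    then have i: "L.fam_indep N (a ` insert c T) (\<lambda>x. x)" by (intro descend) (use c T(2) in blast)+
    have sp: "(\<lambda>x. x) \<in> a ` insert c T \<rightarrow> L.fam_span N T a" using T(2,4) c by blast
    have "card (a ` insert c T) \<le> card T"
      by (rule L.fam_indep_card_le[OF N_subfield finT(1) _ aT(1) sp i]) (use finT(1) in simp)
    moreover have "card (a ` insert c T) = Suc (card T)"
      using card_image[OF inj_on_subset[OF inj, of "insert c T"]] c T(2) cT finT(1) by simp
    ultimately show False by simp
  qed
  obtain \<nu> where \<nu>: "\<And>v t. v \<in> A \<Longrightarrow> t \<in> T \<Longrightarrow> \<nu> v t \<in> N1" "\<And>v. v \<in> A \<Longrightarrow> a v = (\<Oplus>\<^bsub>L\<^esub>t\<in>T. \<nu> v t \<otimes>\<^bsub>L\<^esub> a t)"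
    using L.fam_span_coefficients[of A a N1 T a, OF span1] by blast
  have pivot: "x' t = \<ominus>\<^bsub>L\<^esub> (\<Oplus>\<^bsub>L\<^esub>v\<in>A - T. \<nu> v t \<otimes>\<^bsub>L\<^esub> x' v)"
    "(\<Oplus>\<^bsub>L\<^esub>v\<in>A - T. \<nu> v t \<otimes>\<^bsub>L\<^esub> x' v) \<in> carrier L" if t: "t \<in> T" for t
  proof -
    define f where "f t = x' t \<oplus>\<^bsub>L\<^esub> (\<Oplus>\<^bsub>L\<^esub>v\<in>A - T. \<nu> v t \<otimes>\<^bsub>L\<^esub> x' v)" for t
    have sN: "(\<Oplus>\<^bsub>L\<^esub>v\<in>A - T. \<nu> v t \<otimes>\<^bsub>L\<^esub> x' v) \<in> N" if "t \<in> T" for t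
    proof (rule L.subfield_finsum_closed[OF N_subfield], rule funcsetI)
      fix v assume "v \<in> A - T"
      then have v: "v \<in> A" by blast
      have "\<nu> v t \<in> N" using \<nu>(1)[OF v that] N1N by blast
      then show "\<nu> v t \<otimes>\<^bsub>L\<^esub> x' v \<in> N" by (rule L.subfield_closed(5)[OF N_subfield _ x'N[OF v]])
    qed
    have f: "f \<in> T \<rightarrow> N"
      unfolding f_def using L.subfield_closed(4)[OF N_subfield x'N sN] T(2) by blast
    have "(\<Oplus>\<^bsub>L\<^esub>v\<in>A. a v \<otimes>\<^bsub>L\<^esub> x' v) = (\<Oplus>\<^bsub>L\<^esub>t\<in>T. f t \<otimes>\<^bsub>L\<^esub> a t)"
      unfolding f_def
    proof (rule L.pivot_sum[OF finA T(2) aC x'(2)])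
      show "\<nu> v t \<in> carrier L" if "v \<in> A - T" "t \<in> T" for v t using \<nu>(1)[of v t] that L.subfield_closed(1)[OF N1] by blast
      show "a v = (\<Oplus>\<^bsub>L\<^esub>t\<in>T. \<nu> v t \<otimes>\<^bsub>L\<^esub> a t)" if "v \<in> A - T" for v using \<nu>(2)[of v] that by blast
    qed
    then have "(\<Oplus>\<^bsub>L\<^esub>t\<in>T. f t \<otimes>\<^bsub>L\<^esub> a t) = \<zero>\<^bsub>L\<^esub>" using x'(3) by simp
    from L.fam_indepD[OF N_subfield T(3) f this t] have z: "f t = \<zero>\<^bsub>L\<^esub>" .
    show c: "(\<Oplus>\<^bsub>L\<^esub>v\<in>A - T. \<nu> v t \<otimes>\<^bsub>L\<^esub> x' v) \<in> carrier L" using sN[OF t] NC by blast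
    have "x' t \<in> carrier L" using x'(2) T(2) t by blast
    then show "x' t = \<ominus>\<^bsub>L\<^esub> (\<Oplus>\<^bsub>L\<^esub>v\<in>A - T. \<nu> v t \<otimes>\<^bsub>L\<^esub> x' v)"
      using L.minus_equality[OF z[unfolded f_def] c] by simp
  qed
  \<comment> \<open>Every element of \<open>T\<close> outside \<open>B\<close> is missing from
    \<open>B \<union> C\<close>. As the count requires at least \<open>card A\<close> coordinates,
    there can be no such element.\<close>
  define C where "C = A - B - T"
  have finC: "finite C" unfolding C_def using finA by simp
  have BC: "B \<union> C \<subseteq> A" unfolding C_def using B(2) by blast
  have gen: "generate_field L (k \<union> y ` (B \<union> C)) = N"
  proof
    have g: "k \<union> y ` (B \<union> C) \<subseteq> carrier L" using k_carrier yC BC by blast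
    let ?H = "generate_field L (k \<union> y ` (B \<union> C))"
    have H: "subfield ?H L" by (rule L.generate_field_is_subfield[OF g])
    show "?H \<subseteq> N" by (rule L.generate_field_min_subfield1[OF g N_subfield]) (use k_N yN BC in blast)
    have kH: "k \<subseteq> ?H" and yH: "\<And>v. v \<in> B \<union> C \<Longrightarrow> y v \<in> ?H" by (auto intro: generate_field.incl)
    have N1H: "N1 \<subseteq> ?H" unfolding N1_def by (rule L.generate_field_min_subfield1[OF gB H]) (use kH yH in blast)
    have xn: "x' v \<in> ?H" if "v \<in> A - T" for v
    proof -
      have "v \<in> B \<union> C" "v \<notin> TW" using that T(1) unfolding C_def by blast+
      then show ?thesis using yH[of v] unfolding y_def by simp
    qed
    have "x' v \<in> ?H" if v: "v \<in> A" for v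
    proof (cases "v \<in> T")
      case True
      have "(\<Oplus>\<^bsub>L\<^esub>w\<in>A - T. \<nu> w v \<otimes>\<^bsub>L\<^esub> x' w) \<in> ?H"
      proof (rule L.subfield_finsum_closed[OF H], rule funcsetI)
        fix w assume w: "w \<in> A - T"
        have "\<nu> w v \<in> ?H" using \<nu>(1)[of w v] w True N1H by blast
        then show "\<nu> w v \<otimes>\<^bsub>L\<^esub> x' w \<in> ?H" by (rule L.subfield_closed(5)[OF H _ xn[OF w]])
      qed
      then show ?thesis unfolding pivot(1)[OF True] by (rule L.subfield_closed(6)[OF H])
    qed (use v xn in blast)
    then show "N \<subseteq> ?H"
      unfolding x'(4)[symmetric] by (intro L.generate_field_min_subfield1[OF gx H]) (use kH in blast)
  qed
  \<comment> \<open>The rank is positive, so \<open>B\<close> has at least two elements and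
    contains, besides \<open>e\<close>, an index \<open>b1\<close> whose coordinate can be
    eliminated.\<close>
  have "card T \<noteq> 0"
  proof
    assume "card T = 0"
    then have "T = {}" using finT(1) by simp
    then have "a e = \<zero>\<^bsub>L\<^esub>" using \<nu>(2)[OF eA] by simp
    then show False unfolding a_def using hh_zero[OF \<phi>[OF eA]] \<phi>_nonzero[OF eA] by simp
  qed
  then have "card B \<noteq> card {e}" using lt cT by simp
  then obtain b1 where b1: "b1 \<in> B" "b1 \<noteq> e" using e(1) by (metis card.empty card_insert_disjoint empty_iff finite.emptyI insertI1 is_singletonI' is_singleton_def singletonD)
  have b1A: "b1 \<in> A" using b1(1) B(2) by blast
  note form = first_defect_index_formula[OF B(1) finB finC, of \<psi> y e b1]
  have psC: "\<psi> b \<in> carrier F" if "b \<in> B" for b using \<psi>[OF that] \<phi> B(2) that by auto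
  have yBC: "y v \<in> carrier L" if "v \<in> B \<union> C" for v using yC BC that by blast
  have ps1: "\<psi> b1 \<noteq> \<zero>" using \<psi>[OF b1(1)] \<phi>_nonzero[OF b1A] by simp
  have psrel: "(\<Oplus>\<^bsub>L\<^esub>b\<in>B. hh (\<psi> b) \<otimes>\<^bsub>L\<^esub> y b) = \<zero>\<^bsub>L\<^esub>"
  proof -
    have "(\<Oplus>\<^bsub>L\<^esub>b\<in>B. hh (\<psi> b) \<otimes>\<^bsub>L\<^esub> y b) = (\<Oplus>\<^bsub>L\<^esub>b\<in>B. a b \<otimes>\<^bsub>L\<^esub> y b)"
      by (rule L.finsum_cong') (use \<psi> yC aC B(2) in \<open>auto simp: a_def subset_iff\<close>)
    then show ?thesis using relB by simp
  qed
  note form = form[OF psC yBC ye e(1) b1(1) b1(2)[symmetric] ps1 psrel gen]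
  have two: "card (Z - {e, b1}) = card Z - 2" if "finite Z" "B \<subseteq> Z" for Z
    using that e(1) b1 by (subst card_Diff_subset) (auto simp: card_insert_if)
  have finBC: "finite (B \<union> C)" using finB finC by simp
  have "2 = card {e, b1}" using b1(2) by simp
  also have "\<dots> \<le> card (B \<union> C)" by (rule card_mono[OF finBC]) (use e(1) b1(1) in blast)
  finally have c2: "2 \<le> card (B \<union> C)" .
  have "card A - 2 \<le> card (B \<union> C) - 2" using form(1) two[OF finBC] by simp
  then have "card A \<le> card (B \<union> C)" using c2 by linarith
  then have BCA: "B \<union> C = A" using card_seteq[OF finA BC] by blast
  then have TB: "T \<subseteq> B" using T(2) unfolding C_def by blast
  have ext: "L.fam_indep N1 T (\<lambda>b. hh (\<psi> b))"
    unfolding L.fam_indep_def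
  proof (intro ballI impI)
    fix f i assume f: "f \<in> T \<rightarrow> N1" and z: "(\<Oplus>\<^bsub>L\<^esub>t\<in>T. f t \<otimes>\<^bsub>L\<^esub> hh (\<psi> t)) = \<zero>\<^bsub>L\<^esub>" and i: "i \<in> T"
    have "f t \<in> carrier L" if "t \<in> T" for t using f that L.subfield_closed(1)[OF N1] by blast
    then have "(\<Oplus>\<^bsub>L\<^esub>t\<in>T. f t \<otimes>\<^bsub>L\<^esub> a t) = (\<Oplus>\<^bsub>L\<^esub>t\<in>T. f t \<otimes>\<^bsub>L\<^esub> hh (\<psi> t))"
      by (intro L.finsum_cong') (use \<psi> TB psC in \<open>auto simp: a_def subset_iff\<close>)
    then show "f i = \<zero>\<^bsub>L\<^esub>" using L.fam_indepD[OF N1 ind1 f _ i] z by simp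
  qed
  have extS: "hh (\<psi> b) \<in> L.fam_span N1 T (\<lambda>b. hh (\<psi> b))" if b: "b \<in> B" for b
  proof -
    have bA: "b \<in> A" using b B(2) by blast
    have nC: "\<nu> b t \<in> carrier L" if "t \<in> T" for t using \<nu>(1)[OF bA that] L.subfield_closed(1)[OF N1] by blast
    have "hh (\<psi> b) = a b" unfolding a_def \<psi>[OF b] ..
    also have "\<dots> = (\<Oplus>\<^bsub>L\<^esub>t\<in>T. \<nu> b t \<otimes>\<^bsub>L\<^esub> a t)" by (rule \<nu>(2)[OF bA])
    also have "\<dots> = (\<Oplus>\<^bsub>L\<^esub>t\<in>T. \<nu> b t \<otimes>\<^bsub>L\<^esub> hh (\<psi> t))"
      by (rule L.finsum_cong') (use nC \<psi> TB psC in \<open>auto simp: a_def subset_iff\<close>)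
    finally show ?thesis by (rule L.fam_spanI[OF N1, rotated]) (use \<nu>(1)[OF bA] in blast)
  qed
  have eq: "card A - 2 = card (B \<union> C - {e, b1})" using two[OF finBC Un_upper1] unfolding BCA by simp
  have "first_defect_index p F W \<psi> = card B - card T"
    by (rule form(2)[OF _ _ eq TB ext[unfolded N1_def] extS[unfolded N1_def]])
  then show ?thesis unfolding cT .
qed

end

section \<open>Independence of the chosen basis\<close>

lemma (in cring) double_sum_swap:
  assumes "finite A" "finite B" and \<alpha>: "\<And>b. b \<in> B \<Longrightarrow> \<alpha> b \<in> carrier R" and \<beta>: "\<And>e. e \<in> A \<Longrightarrow> \<beta> e \<in> carrier R"
    and P: "\<And>e b. e \<in> A \<Longrightarrow> b \<in> B \<Longrightarrow> P e b \<in> carrier R"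
  shows "(\<Oplus>b\<in>B. \<alpha> b \<otimes> (\<Oplus>e\<in>A. P e b \<otimes> \<beta> e)) = (\<Oplus>e\<in>A. (\<Oplus>b\<in>B. P e b \<otimes> \<alpha> b) \<otimes> \<beta> e)"
proof -
  have "(\<Oplus>b\<in>B. \<alpha> b \<otimes> (\<Oplus>e\<in>A. P e b \<otimes> \<beta> e)) = (\<Oplus>b\<in>B. \<Oplus>e\<in>A. P e b \<otimes> \<alpha> b \<otimes> \<beta> e)"
  proof (rule finsum_cong')
    fix b assume b: "b \<in> B"
    have "\<alpha> b \<otimes> (\<Oplus>e\<in>A. P e b \<otimes> \<beta> e) = (\<Oplus>e\<in>A. \<alpha> b \<otimes> (P e b \<otimes> \<beta> e))"
      by (rule finsum_rdistr) (use assms(1) \<alpha>[OF b] \<beta> P[OF _ b] in auto)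
    also have "\<dots> = (\<Oplus>e\<in>A. P e b \<otimes> \<alpha> b \<otimes> \<beta> e)"
      by (rule finsum_cong') (use \<alpha>[OF b] \<beta> P[OF _ b] in \<open>auto simp: m_ac\<close>)
    finally show "\<alpha> b \<otimes> (\<Oplus>e\<in>A. P e b \<otimes> \<beta> e) = (\<Oplus>e\<in>A. P e b \<otimes> \<alpha> b \<otimes> \<beta> e)" .
  qed (use \<alpha> \<beta> P in \<open>auto intro!: finsum_closed\<close>)
  also have "\<dots> = (\<Oplus>e\<in>A. \<Oplus>b\<in>B. P e b \<otimes> \<alpha> b \<otimes> \<beta> e)"
    by (rule finsum_finsum_swap) (use assms(1,2) \<alpha> \<beta> P in auto)
  also have "\<dots> = (\<Oplus>e\<in>A. (\<Oplus>b\<in>B. P e b \<otimes> \<alpha> b) \<otimes> \<beta> e)"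
  proof (rule finsum_cong')
    fix e assume e: "e \<in> A"
    show "(\<Oplus>b\<in>B. P e b \<otimes> \<alpha> b \<otimes> \<beta> e) = (\<Oplus>b\<in>B. P e b \<otimes> \<alpha> b) \<otimes> \<beta> e"
      by (rule finsum_ldistr[symmetric]) (use assms(2) \<alpha> \<beta>[OF e] P[OF e] in auto)
  qed (use \<alpha> \<beta> P in \<open>auto intro!: finsum_closed\<close>)
  finally show ?thesis .
qed

text \<open>The basis chosen by \<open>coord_basis\<close> for the whole space need not be the one
  adapted to the subspace. The two families of values are related by matrices \<open>P\<close> and
  \<open>Q\<close> over \<open>k\<close>; coordinates of solutions transform by the transposed
  matrices, so after rescaling they generate the same field \<open>N\<close>.\<close>

lemma (in generic_solution) first_defect_index_change:
  fixes V :: "('a, 'v, 'n) module_scheme" and \<psi> :: "'v \<Rightarrow> 'a"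
  assumes B: "B = coord_basis F V" "finite B" "card B = card A" and \<psi>: "\<And>b. b \<in> B \<Longrightarrow> \<psi> b \<in> carrier F" "\<And>b. b \<in> B \<Longrightarrow> \<psi> b \<noteq> \<zero>"
    and AB: "\<And>e. e \<in> A \<Longrightarrow> hh (\<phi> e) \<in> L.fam_span k B (\<lambda>b. hh (\<psi> b))"
    and BA: "\<And>b. b \<in> B \<Longrightarrow> hh (\<psi> b) \<in> L.fam_span k A (\<lambda>v. hh (\<phi> v))"
    and T0: "T0 \<subseteq> A" "L.fam_indep N T0 (\<lambda>v. hh (\<phi> v))" "\<And>v. v \<in> A \<Longrightarrow> hh (\<phi> v) \<in> L.fam_span N T0 (\<lambda>v. hh (\<phi> v))"
  shows "first_defect_index p F V \<psi> = card B - card T0"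
proof -
  define a where "a v = hh (\<phi> v)" for v
  have a_eq: "a = (\<lambda>v. hh (\<phi> v))" by (rule ext) (rule a_def)
  have T0a: "L.fam_indep N T0 a" "\<And>v. v \<in> A \<Longrightarrow> a v \<in> L.fam_span N T0 a" using T0(2,3) unfolding a_eq by blast+
  define a' where "a' v = hh (\<psi> v)" for v
  have aC: "a v \<in> carrier L" if "v \<in> A" for v unfolding a_def using \<phi>[OF that] by simp
  have a'C: "a' v \<in> carrier L" if "v \<in> B" for v unfolding a'_def using \<psi>(1)[OF that] by simp
  have aA: "a \<in> A \<rightarrow> carrier L" "a' \<in> B \<rightarrow> carrier L" using aC a'C by blast+
  obtain P where P: "\<And>e b. e \<in> A \<Longrightarrow> b \<in> B \<Longrightarrow> P e b \<in> k" "\<And>e. e \<in> A \<Longrightarrow> a e = (\<Oplus>\<^bsub>L\<^esub>b\<in>B. P e b \<otimes>\<^bsub>L\<^esub> a' b)"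
    using L.fam_span_coefficients[of A "\<lambda>e. hh (\<phi> e)" k B "\<lambda>b. hh (\<psi> b)", OF AB] unfolding a_def a'_def by blast
  obtain Q where Q: "\<And>b v. b \<in> B \<Longrightarrow> v \<in> A \<Longrightarrow> Q b v \<in> k" "\<And>b. b \<in> B \<Longrightarrow> a' b = (\<Oplus>\<^bsub>L\<^esub>v\<in>A. Q b v \<otimes>\<^bsub>L\<^esub> a v)"
    using L.fam_span_coefficients[of B "\<lambda>b. hh (\<psi> b)" k A "\<lambda>e. hh (\<phi> e)", OF BA] unfolding a_def a'_def by blast
  have PC: "P e b \<in> carrier L" if "e \<in> A" "b \<in> B" for e b using P(1)[OF that] k_carrier by blast
  have QC: "Q b v \<in> carrier L" if "b \<in> B" "v \<in> A" for b v using Q(1)[OF that] k_carrier by blast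
  define d where "d e v = (\<Oplus>\<^bsub>L\<^esub>b\<in>B. P e b \<otimes>\<^bsub>L\<^esub> Q b v)" for e v
  have dk: "d e v \<in> k" if "e \<in> A" "v \<in> A" for e v
    unfolding d_def
  proof (rule L.subfield_finsum_closed[OF k_subfield], rule funcsetI)
    fix b assume "b \<in> B"
    then show "P e b \<otimes>\<^bsub>L\<^esub> Q b v \<in> k" using L.subfield_closed(5)[OF k_subfield P(1)[OF that(1)] Q(1)[OF _ that(2)]] by blast
  qed
  have dC: "d e v \<in> carrier L" if "e \<in> A" "v \<in> A" for e v using dk[OF that] k_carrier by blast
  \<comment> \<open>Inserting one expansion into the other and comparing coefficients, by
    independence over \<open>k\<close>, shows that the product of the two matrices is the
    identity.\<close>
  have delta: "d e v = (if v = e then \<one>\<^bsub>L\<^esub> else \<zero>\<^bsub>L\<^esub>)" if e: "e \<in> A" and v: "v \<in> A" for e v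
  proof -
    have "a e = (\<Oplus>\<^bsub>L\<^esub>b\<in>B. P e b \<otimes>\<^bsub>L\<^esub> (\<Oplus>\<^bsub>L\<^esub>v\<in>A. Q b v \<otimes>\<^bsub>L\<^esub> a v))"
      unfolding P(2)[OF e] by (rule L.finsum_cong') (use Q(2) PC[OF e] QC aC a'C in \<open>auto intro!: L.finsum_closed\<close>)
    also have "\<dots> = (\<Oplus>\<^bsub>L\<^esub>v\<in>A. (\<Oplus>\<^bsub>L\<^esub>b\<in>B. Q b v \<otimes>\<^bsub>L\<^esub> P e b) \<otimes>\<^bsub>L\<^esub> a v)"
      by (rule L.double_sum_swap[OF finA B(2), where P = "\<lambda>v b. Q b v"]) (use PC[OF e] QC aC in auto)
    also have "\<dots> = (\<Oplus>\<^bsub>L\<^esub>v\<in>A. d e v \<otimes>\<^bsub>L\<^esub> a v)"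
    proof (rule L.finsum_cong')
      fix v assume v: "v \<in> A"
      have "(\<Oplus>\<^bsub>L\<^esub>b\<in>B. Q b v \<otimes>\<^bsub>L\<^esub> P e b) = d e v"
        unfolding d_def by (rule L.finsum_cong') (use PC[OF e] QC[OF _ v] in \<open>auto simp: L.m_comm\<close>)
      then show "(\<Oplus>\<^bsub>L\<^esub>b\<in>B. Q b v \<otimes>\<^bsub>L\<^esub> P e b) \<otimes>\<^bsub>L\<^esub> a v = d e v \<otimes>\<^bsub>L\<^esub> a v" by simp
    qed (use dC[OF e] aC in auto)
    finally have s: "a e = (\<Oplus>\<^bsub>L\<^esub>v\<in>A. d e v \<otimes>\<^bsub>L\<^esub> a v)" .
    define f where "f v = d e v \<ominus>\<^bsub>L\<^esub> (if v = e then \<one>\<^bsub>L\<^esub> else \<zero>\<^bsub>L\<^esub>)" for v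
    have fk: "f \<in> A \<rightarrow> k"
    proof
      fix v assume v: "v \<in> A"
      have "(if v = e then \<one>\<^bsub>L\<^esub> else \<zero>\<^bsub>L\<^esub>) \<in> k" using L.subfield_closed(2,3)[OF k_subfield] by simp
      then show "f v \<in> k"
        unfolding f_def a_minus_def using L.subfield_closed(4)[OF k_subfield dk[OF e v]] L.subfield_closed(6)[OF k_subfield] by blast
    qed
    have fC: "f v \<in> carrier L" if "v \<in> A" for v using fk that k_carrier by blast
    have sing: "(\<Oplus>\<^bsub>L\<^esub>v\<in>A. (if v = e then \<one>\<^bsub>L\<^esub> else \<zero>\<^bsub>L\<^esub>) \<otimes>\<^bsub>L\<^esub> a v) = a e"
    proof -
      have "(\<Oplus>\<^bsub>L\<^esub>v\<in>A. (if v = e then \<one>\<^bsub>L\<^esub> else \<zero>\<^bsub>L\<^esub>) \<otimes>\<^bsub>L\<^esub> a v) = (\<Oplus>\<^bsub>L\<^esub>v\<in>A. if e = v then a v else \<zero>\<^bsub>L\<^esub>)"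
        by (rule L.finsum_cong') (use aC in auto)
      also have "\<dots> = a e" by (rule L.finsum_singleton[OF e finA]) (use aC in auto)
      finally show ?thesis .
    qed
    have "(\<Oplus>\<^bsub>L\<^esub>v\<in>A. f v \<otimes>\<^bsub>L\<^esub> a v) \<oplus>\<^bsub>L\<^esub> (\<Oplus>\<^bsub>L\<^esub>v\<in>A. (if v = e then \<one>\<^bsub>L\<^esub> else \<zero>\<^bsub>L\<^esub>) \<otimes>\<^bsub>L\<^esub> a v)
        = (\<Oplus>\<^bsub>L\<^esub>v\<in>A. f v \<otimes>\<^bsub>L\<^esub> a v \<oplus>\<^bsub>L\<^esub> (if v = e then \<one>\<^bsub>L\<^esub> else \<zero>\<^bsub>L\<^esub>) \<otimes>\<^bsub>L\<^esub> a v)"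
      by (rule L.finsum_addf[symmetric]) (use fC aC in auto)
    also have "\<dots> = (\<Oplus>\<^bsub>L\<^esub>v\<in>A. d e v \<otimes>\<^bsub>L\<^esub> a v)"
    proof (rule L.finsum_cong')
      fix v assume v: "v \<in> A"
      let ?u = "if v = e then \<one>\<^bsub>L\<^esub> else \<zero>\<^bsub>L\<^esub>"
      have u: "?u \<in> carrier L" by simp
      have "f v \<oplus>\<^bsub>L\<^esub> ?u = d e v" unfolding f_def a_minus_def using dC[OF e v] u by (simp only: L.a_assoc L.a_inv_closed L.l_neg L.r_zero)
      then show "f v \<otimes>\<^bsub>L\<^esub> a v \<oplus>\<^bsub>L\<^esub> ?u \<otimes>\<^bsub>L\<^esub> a v = d e v \<otimes>\<^bsub>L\<^esub> a v"
        using L.l_distr[OF fC[OF v] u aC[OF v]] by simp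
    qed (use dC[OF e] aC in auto)
    finally have "(\<Oplus>\<^bsub>L\<^esub>v\<in>A. f v \<otimes>\<^bsub>L\<^esub> a v) \<oplus>\<^bsub>L\<^esub> a e = a e" unfolding sing s[symmetric] .
    moreover have "(\<Oplus>\<^bsub>L\<^esub>v\<in>A. f v \<otimes>\<^bsub>L\<^esub> a v) \<in> carrier L" using fC aC by (intro L.finsum_closed) auto
    ultimately have "(\<Oplus>\<^bsub>L\<^esub>v\<in>A. f v \<otimes>\<^bsub>L\<^esub> a v) = \<zero>\<^bsub>L\<^esub>" using aC[OF e] L.add.r_cancel_one by simp
    from L.fam_indepD[OF k_subfield \<phi>_indep[folded a_def] fk this v]
    have "f v = \<zero>\<^bsub>L\<^esub>" .
    then show ?thesis unfolding f_def using dC[OF e v] by (simp add: L.r_right_minus_eq)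
  qed
  define z where "z b = (\<Oplus>\<^bsub>L\<^esub>e\<in>A. P e b \<otimes>\<^bsub>L\<^esub> x e)" for b
  have zN: "z b \<in> N" if b: "b \<in> B" for b
    unfolding z_def
  proof (rule L.subfield_finsum_closed[OF N_subfield], rule funcsetI)
    fix e assume e: "e \<in> A"
    have "P e b \<in> N" using P(1)[OF e b] k_N by blast
    then show "P e b \<otimes>\<^bsub>L\<^esub> x e \<in> N" by (rule L.subfield_closed(5)[OF N_subfield _ x_N[OF e]])
  qed
  have zC: "z b \<in> carrier L" if "b \<in> B" for b using zN[OF that] L.subfield_closed(1)[OF N_subfield] by blast
  have relz: "(\<Oplus>\<^bsub>L\<^esub>b\<in>B. a' b \<otimes>\<^bsub>L\<^esub> z b) = \<zero>\<^bsub>L\<^esub>"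
  proof -
    have "(\<Oplus>\<^bsub>L\<^esub>b\<in>B. a' b \<otimes>\<^bsub>L\<^esub> z b) = (\<Oplus>\<^bsub>L\<^esub>e\<in>A. (\<Oplus>\<^bsub>L\<^esub>b\<in>B. P e b \<otimes>\<^bsub>L\<^esub> a' b) \<otimes>\<^bsub>L\<^esub> x e)"
      unfolding z_def by (rule L.double_sum_swap[OF finA B(2) a'C x_closed PC])
    also have "\<dots> = (\<Oplus>\<^bsub>L\<^esub>e\<in>A. a e \<otimes>\<^bsub>L\<^esub> x e)"
      by (rule L.finsum_cong') (use P(2) x_closed aC in auto)
    also have "\<dots> = \<zero>\<^bsub>L\<^esub>" unfolding a_def by (rule relation)
    finally show ?thesis .
  qed
  have xz: "x v = (\<Oplus>\<^bsub>L\<^esub>b\<in>B. Q b v \<otimes>\<^bsub>L\<^esub> z b)" if v: "v \<in> A" for v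
  proof -
    have "(\<Oplus>\<^bsub>L\<^esub>b\<in>B. Q b v \<otimes>\<^bsub>L\<^esub> z b) = (\<Oplus>\<^bsub>L\<^esub>e\<in>A. (\<Oplus>\<^bsub>L\<^esub>b\<in>B. P e b \<otimes>\<^bsub>L\<^esub> Q b v) \<otimes>\<^bsub>L\<^esub> x e)"
      unfolding z_def by (rule L.double_sum_swap[OF finA B(2) QC[OF _ v] x_closed PC])
    also have "\<dots> = (\<Oplus>\<^bsub>L\<^esub>e\<in>A. if v = e then x e else \<zero>\<^bsub>L\<^esub>)"
      by (rule L.finsum_cong') (use delta[OF _ v] x_closed in \<open>auto simp: d_def\<close>)
    also have "\<dots> = x v" by (rule L.finsum_singleton[OF v finA]) (use x_closed in auto)
    finally show ?thesis by simp
  qed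
  have "\<exists>b0\<in>B. z b0 \<noteq> \<zero>\<^bsub>L\<^esub>"
  proof (rule ccontr)
    assume "\<not> (\<exists>b0\<in>B. z b0 \<noteq> \<zero>\<^bsub>L\<^esub>)"
    then have "x e0 = \<zero>\<^bsub>L\<^esub>" unfolding xz[OF e01(1)] using QC[OF _ e01(1)] by (intro L.add.finprod_one_eqI) auto
    then show False using x_nonzero[OF e01(1)] by simp
  qed
  then obtain b0 where b0: "b0 \<in> B" "z b0 \<noteq> \<zero>\<^bsub>L\<^esub>" by blast
  have "\<exists>z'. z' b0 = \<one>\<^bsub>L\<^esub> \<and> (\<forall>b\<in>B. z' b \<in> carrier L) \<and> (\<Oplus>\<^bsub>L\<^esub>b\<in>B. a' b \<otimes>\<^bsub>L\<^esub> z' b) = \<zero>\<^bsub>L\<^esub> \<and>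
    generate_field L (k \<union> z' ` B) = generate_field L (k \<union> x ` A)"
  proof (rule L.generate_field_rescale[OF k_carrier x_closed e01(1) _ B(2) a'C _ relz b0])
    show "x e0 = \<one>\<^bsub>L\<^esub>" by (simp add: x_def)
    show "z b \<in> generate_field L (k \<union> x ` A)" if "b \<in> B" for b using zN[OF that] unfolding N_def .
    fix H c v assume H: "subfield H L" "k \<subseteq> H" "c \<in> carrier L" "\<And>b. b \<in> B \<Longrightarrow> c \<otimes>\<^bsub>L\<^esub> z b \<in> H" and v: "v \<in> A"
    have "c \<otimes>\<^bsub>L\<^esub> x v = (\<Oplus>\<^bsub>L\<^esub>b\<in>B. c \<otimes>\<^bsub>L\<^esub> (Q b v \<otimes>\<^bsub>L\<^esub> z b))"
      unfolding xz[OF v] by (rule L.finsum_rdistr) (use B(2) H(3) QC[OF _ v] zC in auto)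
    also have "\<dots> = (\<Oplus>\<^bsub>L\<^esub>b\<in>B. Q b v \<otimes>\<^bsub>L\<^esub> (c \<otimes>\<^bsub>L\<^esub> z b))"
      by (rule L.finsum_cong') (use H(3) QC[OF _ v] zC in \<open>auto simp: L.m_lcomm\<close>)
    also have "\<dots> \<in> H"
    proof (rule L.subfield_finsum_closed[OF H(1)], rule funcsetI)
      fix b assume b: "b \<in> B"
      have "Q b v \<in> H" using Q(1)[OF b v] H(2) by blast
      then show "Q b v \<otimes>\<^bsub>L\<^esub> (c \<otimes>\<^bsub>L\<^esub> z b) \<in> H" by (rule L.subfield_closed(5)[OF H(1) _ H(4)[OF b]])
    qed
    finally show "c \<otimes>\<^bsub>L\<^esub> x v \<in> H" .
  qed
  then obtain z' where z': "z' b0 = \<one>\<^bsub>L\<^esub>" "\<And>b. b \<in> B \<Longrightarrow> z' b \<in> carrier L" "(\<Oplus>\<^bsub>L\<^esub>b\<in>B. hh (\<psi> b) \<otimes>\<^bsub>L\<^esub> z' b) = \<zero>\<^bsub>L\<^esub>"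
    "generate_field L (k \<union> z' ` B) = N"
    unfolding N_def a'_def by blast
  have "2 = card {e0, e1}" using e01(3) by simp
  also have "\<dots> \<le> card A" by (rule card_mono[OF finA]) (use e01 in blast)
  finally have "2 \<le> card B" unfolding B(3) .
  then have "\<not> B \<subseteq> {b0}" using card_mono[of "{b0}" B] by auto
  then obtain b1 where b1: "b1 \<in> B" "b0 \<noteq> b1" by blast
  obtain T where T0': "{} \<subseteq> T" and T: "T \<subseteq> B" "L.fam_indep N T a'" "a' \<in> B \<rightarrow> L.fam_span N T a'"
    by (rule L.fam_basis_extend[OF N_subfield B(2) aA(2) empty_subsetI L.fam_indep_empty[OF N_subfield]])
  have fin: "finite T" "finite T0" using T(1) T0(1) B(2) finA finite_subset by blast+
  have aT: "a' \<in> T \<rightarrow> carrier L" "a \<in> T0 \<rightarrow> carrier L" using aC a'C T(1) T0(1) by blast+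
  have sA: "L.fam_span N A a \<subseteq> L.fam_span N T0 a"
    by (rule L.fam_span_subset[OF N_subfield fin(2) finA aT(2)]) (use T0a(2) in blast)
  have sB: "L.fam_span N B a' \<subseteq> L.fam_span N T a'"
    by (rule L.fam_span_subset[OF N_subfield fin(1) B(2) aT(1) T(3)])
  have "a' b \<in> L.fam_span N T0 a" if "b \<in> B" for b
    using BA[OF that] L.fam_span_subfield_mono[OF k_N, of A a] sA unfolding a_def a'_def by blast
  then have "a' \<in> T \<rightarrow> L.fam_span N T0 a" using T(1) by blast
  then have le1: "card T \<le> card T0" by (rule L.fam_indep_card_le[OF N_subfield fin(2,1) aT(2) _ T(2)])
  have "a e \<in> L.fam_span N T a'" if "e \<in> A" for e
    using AB[OF that] L.fam_span_subfield_mono[OF k_N, of B a'] sB unfolding a_def a'_def by blast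
  then have "a \<in> T0 \<rightarrow> L.fam_span N T a'" using T0(1) by blast
  then have le2: "card T0 \<le> card T" by (rule L.fam_indep_card_le[OF N_subfield fin aT(1) _ T0a(1)])
  have eq: "card A - 2 = card (B \<union> {} - {b0, b1})"
  proof -
    have "card (B - {b0, b1}) = card B - card {b0, b1}" by (rule card_Diff_subset) (use b0 b1 in auto)
    then show ?thesis using b1(2) B(3) by simp
  qed
  have "first_defect_index p F V \<psi> = card B - card T"
  proof (rule first_defect_index_formula(2)[OF B(1,2) _ \<psi>(1) _ z'(1) b0(1) b1 \<psi>(2)[OF b1(1)] z'(3) _ eq T(1)])
    show "L.fam_indep (generate_field L (k \<union> z' ` B)) T (\<lambda>b. hh (\<psi> b))" unfolding z'(4) using T(2) unfolding a'_def .
    show "hh (\<psi> b) \<in> L.fam_span (generate_field L (k \<union> z' ` B)) T (\<lambda>b. hh (\<psi> b))" if "b \<in> B" for b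
      unfolding z'(4) using T(3) that unfolding a'_def by blast
  qed (use z' in auto)
  then show ?thesis using le1 le2 by simp
qed

section \<open>Bases adapted to a subspace and the conclusion\<close>

context vectorspace
begin

lemma subspace_finite_basis:
  assumes fd: fin_dim and W: "VectorSpace.subspace K W V"
  shows "\<exists>B. finite B \<and> vectorspace.basis K (V\<lparr>carrier := W\<rparr>) B"
proof -
  interpret W: vectorspace K "V\<lparr>carrier := W\<rparr>" by (rule subspace_is_vs[OF W])
  have sub: "submodule K W V" using W by simp
  then have WC: "W \<subseteq> carrier V" unfolding submodule_def by blast
  have "\<exists>A. finite A \<and> maximal A (\<lambda>S. S \<subseteq> carrier (V\<lparr>carrier := W\<rparr>) \<and> W.lin_indpt S)"
  proof (rule maximal_exists[where N = dim and B = "{}"])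
    fix A assume A: "A \<subseteq> carrier (V\<lparr>carrier := W\<rparr>) \<and> W.lin_indpt A"
    then have "lin_indpt A" "A \<subseteq> carrier V" using span_li_not_depend(2)[OF _ sub, of A] WC by auto
    then show "finite A \<and> card A \<le> dim" using li_le_dim[OF fd] by blast
  next
    show "{} \<subseteq> carrier (V\<lparr>carrier := W\<rparr>) \<and> W.lin_indpt {}" by (auto simp: W.lin_dep_def)
  qed
  then show ?thesis using W.max_li_is_basis by blast
qed

lemma subspace_basis_extend:
  assumes fd: fin_dim and W: "VectorSpace.subspace K W V" and B: "vectorspace.basis K (V\<lparr>carrier := W\<rparr>) B"
  shows "\<exists>A. finite A \<and> basis A \<and> B \<subseteq> A"
proof -
  interpret W: vectorspace K "V\<lparr>carrier := W\<rparr>" by (rule subspace_is_vs[OF W])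
  have sub: "submodule K W V" using W by simp
  then have WC: "W \<subseteq> carrier V" unfolding submodule_def by blast
  have BW: "B \<subseteq> W" "W.lin_indpt B" using B unfolding W.basis_def by auto
  then have Bli: "lin_indpt B" "B \<subseteq> carrier V" using span_li_not_depend(2)[OF BW(1) sub] WC by auto
  have "\<exists>A. finite A \<and> maximal A (\<lambda>S. B \<subseteq> S \<and> S \<subseteq> carrier V \<and> lin_indpt S)"
  proof (rule maximal_exists[where N = dim and B = B])
    fix A assume "B \<subseteq> A \<and> A \<subseteq> carrier V \<and> lin_indpt A"
    then show "finite A \<and> card A \<le> dim" using li_le_dim[OF fd] by blast
  next
    show "B \<subseteq> B \<and> B \<subseteq> carrier V \<and> lin_indpt B" using Bli by blast
  qed
  then obtain A where A: "finite A" "maximal A (\<lambda>S. B \<subseteq> S \<and> S \<subseteq> carrier V \<and> lin_indpt S)" by blast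
  have A1: "B \<subseteq> A" "A \<subseteq> carrier V" "lin_indpt A" using A(2) unfolding maximal_def by blast+
  have "S = A" if "A \<subseteq> S" "S \<subseteq> carrier V" "lin_indpt S" for S
    using A(2) A1(1) that unfolding maximal_def by blast
  then have "maximal A (\<lambda>S. S \<subseteq> carrier V \<and> lin_indpt S)" unfolding maximal_def using A1 by blast
  then show ?thesis using max_li_is_basis A(1) A1(1) by blast
qed

end

lemma (in quasilinear_form) form_lincomb:
  assumes "finite A" "A \<subseteq> carrier V" "c \<in> A \<rightarrow> carrier E"
  shows "\<phi> (lincomb c A) = (\<Oplus>\<^bsub>E\<^esub>v\<in>A. c v [^]\<^bsub>E\<^esub> p \<otimes>\<^bsub>E\<^esub> \<phi> v)"
  using assms
proof (induction A rule: finite_induct)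
  case empty
  \<comment> \<open>That the form vanishes at zero follows from its homogeneity with the scalar
    zero, as \<open>p\<close> is positive.\<close>
  have "\<phi> (\<zero>\<^bsub>E\<^esub> \<odot>\<^bsub>V\<^esub> \<zero>\<^bsub>V\<^esub>) = \<zero>\<^bsub>E\<^esub> [^]\<^bsub>E\<^esub> p \<otimes>\<^bsub>E\<^esub> \<phi> \<zero>\<^bsub>V\<^esub>" by (rule form_smult) auto
  moreover have "0 < p" using prime_char(1) by (simp add: prime_gt_0_nat)
  ultimately have "\<phi> \<zero>\<^bsub>V\<^esub> = \<zero>\<^bsub>E\<^esub>" using form_closed[of "\<zero>\<^bsub>V\<^esub>"] by (simp add: R.nat_pow_zero)
  then show ?case by (simp add: lincomb_def)
next
  case (insert v A)
  have C: "v \<in> carrier V" "A \<subseteq> carrier V" "c v \<in> carrier E" "c \<in> A \<rightarrow> carrier E" using insert.prems by auto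
  have "lincomb c (insert v A) = c v \<odot>\<^bsub>V\<^esub> v \<oplus>\<^bsub>V\<^esub> lincomb c A"
    unfolding lincomb_def using insert.hyps C by (intro finsum_insert) (auto simp: Pi_iff subset_iff)
  moreover have "\<phi> (c v \<odot>\<^bsub>V\<^esub> v \<oplus>\<^bsub>V\<^esub> lincomb c A) = \<phi> (c v \<odot>\<^bsub>V\<^esub> v) \<oplus>\<^bsub>E\<^esub> \<phi> (lincomb c A)"
    using C by (intro form_add) auto
  moreover have "(\<Oplus>\<^bsub>E\<^esub>v\<in>insert v A. c v [^]\<^bsub>E\<^esub> p \<otimes>\<^bsub>E\<^esub> \<phi> v) = c v [^]\<^bsub>E\<^esub> p \<otimes>\<^bsub>E\<^esub> \<phi> v \<oplus>\<^bsub>E\<^esub> (\<Oplus>\<^bsub>E\<^esub>v\<in>A. c v [^]\<^bsub>E\<^esub> p \<otimes>\<^bsub>E\<^esub> \<phi> v)"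
    using insert.hyps C form_closed by (intro R.finsum_insert) (auto simp: Pi_iff subset_iff)
  ultimately show ?case using insert.IH[OF C(2,4)] form_smult[OF C(3,1)] by simp
qed

theorem proposition6p1:
  fixes F :: "('a, 'm) ring_scheme"
    and V W :: "('a, 'v, 'n) module_scheme"
    and \<phi> \<psi> :: "'v \<Rightarrow> 'a"
    and p j :: nat
  assumes "Factorial_Ring.prime p" and "field F" and "has_characteristic F p" and "\<not> perfect_in_char F p"
    and "quasilinear_form p F V \<phi>" and "anisotropic F V \<phi>" and "vectorspace.dim F V \<ge> 2"
    and "1 \<le> j" and "j \<le> first_defect_index p F V \<phi>"
    and "is_subform F W \<psi> V \<phi>"
    and "vectorspace.dim F V - vectorspace.dim F W = first_defect_index p F V \<phi> - j"
  shows "first_defect_index p F W \<psi> = j"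
proof -
  interpret QF: quasilinear_form p F V \<phi> by (rule assms(5))
  have "[p] \<cdot>\<^bsub>F\<^esub> \<one>\<^bsub>F\<^esub> = \<zero>\<^bsub>F\<^esub>" using assms(3) unfolding has_characteristic_def by simp
  then interpret Fc: char_field F p by unfold_locales (use assms(1) in auto)
  have W: "VectorSpace.subspace F (carrier W) V" "V\<lparr>carrier := carrier W\<rparr> = W" "\<And>w. w \<in> carrier W \<Longrightarrow> \<psi> w = \<phi> w"
    using assms(10) unfolding is_subform_def by auto
  have vsW: "vectorspace F W" using QF.subspace_is_vs[OF W(1)] unfolding W(2) .
  have "\<exists>B. finite B \<and> QF.basis B" by (rule QF.finite_basis_exists[OF QF.finite_dimensional])
  then have BV: "finite (coord_basis F V)" "QF.basis (coord_basis F V)"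
    unfolding coord_basis_def by (rule someI2_ex, simp)+
  have "\<exists>B. finite B \<and> vectorspace.basis F W B"
    using QF.subspace_finite_basis[OF QF.finite_dimensional W(1)] unfolding W(2) .
  then have BW: "finite (coord_basis F W)" "vectorspace.basis F W (coord_basis F W)"
    unfolding coord_basis_def by (rule someI2_ex, simp)+
  obtain A where A: "finite A" "QF.basis A" "coord_basis F W \<subseteq> A"
    using QF.subspace_basis_extend[OF QF.finite_dimensional W(1), of "coord_basis F W"] BW(2) unfolding W(2) by blast
  have dims: "vectorspace.dim F V = card A" "vectorspace.dim F V = card (coord_basis F V)"
    "vectorspace.dim F W = card (coord_basis F W)"
    using QF.dim_basis[OF A(1,2)] QF.dim_basis[OF BV] vectorspace.dim_basis[OF vsW BW] .
  have BWW: "coord_basis F W \<subseteq> carrier W" using BW(2) unfolding vectorspace.basis_def[OF vsW] by blast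
  have sub: "A \<subseteq> carrier V" "coord_basis F V \<subseteq> carrier V" using A(2) BV(2) unfolding QF.basis_def by auto
  have "2 \<le> card A" using assms(7) dims(1) by simp
  then have "\<not> card A \<le> Suc 0" by simp
  \<comment> \<open>The dimension hypothesis provides the two special basis vectors: the coordinate
    at \<open>e0\<close> is set to one, the one at \<open>e1\<close> is eliminated, and the
    remaining ones become the variables.\<close>
  then obtain e0 e1 where e: "e0 \<in> A" "e1 \<in> A" "e0 \<noteq> e1"
    unfolding card_le_Suc0_iff_eq[OF A(1)] by blast
  have fin: "finite (A - {e0, e1})" using A(1) by simp
  obtain L :: "(('v multiset \<Rightarrow> 'a) \<times> ('v multiset \<Rightarrow> 'a)) set ring" and hh Y
    where RF: "rational_functions F L p (A - {e0, e1}) hh Y"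
    using Fc.rational_functions_exist[OF fin] by blast
  interpret RF: rational_functions F L p "A - {e0, e1}" hh Y by (rule RF)
  interpret hm: ring_hom_cring F L hh
    by unfold_locales (rule RF.E.hom)
  have form_C: "\<phi> v \<in> carrier F" if "v \<in> carrier V" for v by (rule QF.form_closed[OF that])
  have lin: "hh (\<phi> (QF.lincomb c S)) = (\<Oplus>\<^bsub>L\<^esub>v\<in>S. hh (c v) [^]\<^bsub>L\<^esub> p \<otimes>\<^bsub>L\<^esub> hh (\<phi> v))"
    if S: "finite S" "S \<subseteq> carrier V" and cS: "c \<in> S \<rightarrow> carrier F" for S c
  proof -
    have f: "\<phi> v \<in> carrier F" if "v \<in> S" for v using form_C S(2) that by blast
    have c: "c v \<in> carrier F" if "v \<in> S" for v using cS that by blast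
    have "hh (\<phi> (QF.lincomb c S)) = hh (\<Oplus>\<^bsub>F\<^esub>v\<in>S. c v [^]\<^bsub>F\<^esub> p \<otimes>\<^bsub>F\<^esub> \<phi> v)"
      using QF.form_lincomb[OF S cS] by simp
    also have "\<dots> = (\<Oplus>\<^bsub>L\<^esub>v\<in>S. hh (c v [^]\<^bsub>F\<^esub> p \<otimes>\<^bsub>F\<^esub> \<phi> v))"
      using c f by (subst hm.hom_finsum) (auto simp: comp_def)
    also have "\<dots> = (\<Oplus>\<^bsub>L\<^esub>v\<in>S. hh (c v) [^]\<^bsub>L\<^esub> p \<otimes>\<^bsub>L\<^esub> hh (\<phi> v))"
      by (rule RF.L.finsum_cong') (use c f hm.hom_pow in auto)
    finally show ?thesis .
  qed
  have span: "hh (\<phi> v) \<in> RF.L.fam_span RF.k S (\<lambda>v. hh (\<phi> v))"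
    if S: "finite S" "QF.basis S" and v: "v \<in> carrier V" for S v
  proof -
    have SC: "S \<subseteq> carrier V" "QF.span S = carrier V" using S(2) unfolding QF.basis_def by auto
    have "v \<in> QF.span S" using v SC(2) by simp
    then obtain c where c: "v = QF.lincomb c S" "c \<in> S \<rightarrow> carrier F"
      unfolding QF.finite_span[OF S(1) SC(1)] by blast
    have cC: "c v \<in> carrier F" if "v \<in> S" for v using c(2) that by blast
    show ?thesis
      unfolding c(1) lin[OF S(1) SC(1) c(2)]
      by (rule RF.L.fam_spanI[OF RF.k_subfield _ refl]) (use cC in \<open>auto simp: RF.k_def\<close>)
  qed
  \<comment> \<open>Here anisotropy is used: coefficients in \<open>k\<close> are p-th powers, so a
    relation among the values says that the form vanishes at a linear combination of basis
    vectors.\<close>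
  have indep: "RF.L.fam_indep RF.k A (\<lambda>v. hh (\<phi> v))"
    unfolding RF.L.fam_indep_def
  proof (intro ballI impI)
    fix f i assume f: "f \<in> A \<rightarrow> RF.k" and z: "(\<Oplus>\<^bsub>L\<^esub>v\<in>A. f v \<otimes>\<^bsub>L\<^esub> hh (\<phi> v)) = \<zero>\<^bsub>L\<^esub>" and i: "i \<in> A"
    have "\<forall>v\<in>A. \<exists>c. c \<in> carrier F \<and> f v = hh c [^]\<^bsub>L\<^esub> p" using f unfolding RF.k_def by auto
    from bchoice[OF this] obtain c where c: "\<forall>v\<in>A. c v \<in> carrier F \<and> f v = hh (c v) [^]\<^bsub>L\<^esub> p" by blast
    have cC: "c v \<in> carrier F" if "v \<in> A" for v using c that by blast
    then have cA: "c \<in> A \<rightarrow> carrier F" by blast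
    have C: "QF.lincomb c A \<in> carrier V" by (rule QF.lincomb_closed[OF sub(1) cA])
    have "hh (\<phi> (QF.lincomb c A)) = (\<Oplus>\<^bsub>L\<^esub>v\<in>A. f v \<otimes>\<^bsub>L\<^esub> hh (\<phi> v))"
      unfolding lin[OF A(1) sub(1) cA]
      by (rule RF.L.finsum_cong') (use c form_C sub(1) in \<open>auto simp: subset_iff\<close>)
    then have "\<phi> (QF.lincomb c A) = \<zero>\<^bsub>F\<^esub>" using z RF.hh_zero[OF form_C[OF C]] by simp
    then have l0: "QF.lincomb c A = \<zero>\<^bsub>V\<^esub>" using assms(6) C unfolding isotropic_def by blast
    have "\<not> QF.lin_dep A" using A(2) unfolding QF.basis_def by blast
    from QF.not_lindepD[OF this A(1) subset_refl cA l0] have "c i = \<zero>\<^bsub>F\<^esub>" using i by blast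
    then show "f i = \<zero>\<^bsub>L\<^esub>" using c i RF.L.p_pos by (simp add: RF.L.nat_pow_zero)
  qed
  interpret GS: generic_solution F L p "A - {e0, e1}" hh Y A e0 e1 \<phi>
    by unfold_locales (use A(1) e form_C sub(1) indep in auto)
  have aA: "(\<lambda>v. hh (\<phi> v)) \<in> A \<rightarrow> carrier L" using form_C sub(1) by auto
  obtain T where T0: "{} \<subseteq> T" and T: "T \<subseteq> A" "RF.L.fam_indep GS.N T (\<lambda>v. hh (\<phi> v))"
    "(\<lambda>v. hh (\<phi> v)) \<in> A \<rightarrow> RF.L.fam_span GS.N T (\<lambda>v. hh (\<phi> v))"
    by (rule RF.L.fam_basis_extend[OF GS.N_subfield A(1) aA empty_subsetI RF.L.fam_indep_empty[OF GS.N_subfield]])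
  have Tspan: "hh (\<phi> v) \<in> RF.L.fam_span GS.N T (\<lambda>v. hh (\<phi> v))" if "v \<in> A" for v using T(3) that by blast
  have nz: "\<phi> v \<noteq> \<zero>\<^bsub>F\<^esub>" if v: "v \<in> coord_basis F V" for v
  proof -
    have vC: "v \<in> carrier V" using v sub(2) by blast
    have "\<zero>\<^bsub>V\<^esub> \<notin> coord_basis F V"
      by (rule QF.vs_zero_lin_dep[OF sub(2)]) (use BV(2) in \<open>simp add: QF.basis_def\<close>)
    then have "v \<noteq> \<zero>\<^bsub>V\<^esub>" using v by blast
    then show ?thesis using vC assms(6) unfolding isotropic_def by blast
  qed
  have i1V: "first_defect_index p F V \<phi> = card A - card T"
  proof -
    have "first_defect_index p F V \<phi> = card (coord_basis F V) - card T"
    proof (rule GS.first_defect_index_change[OF refl BV(1) _ _ nz _ _ T(1,2) Tspan])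
      show "card (coord_basis F V) = card A" using dims by simp
      show "\<phi> b \<in> carrier F" if "b \<in> coord_basis F V" for b using form_C sub(2) that by blast
      show "hh (\<phi> e) \<in> RF.L.fam_span RF.k (coord_basis F V) (\<lambda>b. hh (\<phi> b))" if "e \<in> A" for e
        using span[OF BV] sub(1) that by blast
      show "hh (\<phi> b) \<in> RF.L.fam_span RF.k A (\<lambda>v. hh (\<phi> v))" if "b \<in> coord_basis F V" for b
        using span[OF A(1,2)] sub(2) that by blast
    qed
    then show ?thesis using dims by simp
  qed
  have "card (coord_basis F W) \<le> card A" by (rule card_mono[OF A(1,3)])
  moreover have "card T \<le> card A" by (rule card_mono[OF A(1) T(1)])
  \<comment> \<open>The codimension is a truncated difference of natural numbers; the bounds just
    collected and the bound on \<open>j\<close> make it a true one, and the dimension of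
    \<open>W\<close> exceeds the rank by \<open>j\<close>.\<close>
  ultimately have cW: "card (coord_basis F W) = card T + j" using assms(8,9,11) unfolding i1V dims(1,3) by linarith
  have "first_defect_index p F W \<psi> = card (coord_basis F W) - card T"
  proof (rule GS.first_defect_index_subspace[OF refl A(3) _ T(1,2) Tspan])
    show "\<psi> b = \<phi> b" if "b \<in> coord_basis F W" for b using W(3) BWW that by blast
    show "card T < card (coord_basis F W)" using cW assms(8) by simp
  qed
  then show ?thesis using cW by simp
qed

end
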